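(* Let $\mathbb{D}$ be a division ring with finite dimension $d$ over a central subfield $\mathbb{F}$, and assume that $\mathbb{D}$ is not of quadratic type over $\mathbb{F}$. Let $V$ be a right $\mathbb{D}$-vector space of finite dimension $n\geq 1$, with $|\mathbb{F}|\geq nd$. Let $S$ be an optimal trivial spectrum subspace of $\operatorname{End}_{\mathbb{D}}(V)$. Then the $S$-invariant $\mathbb{D}$-linear subspaces of $V$ form a complete flag $(V_0,\dots,V_n)$ of $V$, and $S=H_1\vee\cdots\vee H_n$ where, for each $i\in\{1,\dots,n\}$, $H_i$ is an $\mathbb{F}$-linear hyperplane of $\operatorname{End}_{\mathbb{D}}(V_i/V_{i-1})$ that does not contain the identity of $V_i/V_{i-1}$. Conversely, given a complete flag $(V_0,\dots,V_n)$ of $\mathbb{D}$-linear subspaces of $V$ and, for each $i\in\{1,\dots,n\}$, an $\mathbb{F}$-linear hyperplane $H_i$ of $\operatorname{End}_{\mathbb{D}}(V_i/V_{i-1})$ that does not contain the identity of $V_i/V_{i-1}$, the space $H_1\vee\cdots\vee H_n$ is an optimal trivial spectrum subspace of $\operatorname{End}_{\mathbb{D}}(V)$.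
   Context: A central subfield of $\mathbb{D}$ is a subfield contained in the center of $\mathbb{D}$. $\operatorname{End}_{\mathbb{D}}(V)$ is the $\mathbb{F}$-algebra of $\mathbb{D}$-linear endomorphisms of $V$. An $\mathbb{F}$-linear subspace $S$ of $\operatorname{End}_{\mathbb{D}}(V)$ has trivial spectrum if $\operatorname{id}_V-u$ is invertible for all $u\in S$; it is optimal if it has the greatest possible dimension over $\mathbb{F}$ among all trivial spectrum $\mathbb{F}$-linear subspaces of $\operatorname{End}_{\mathbb{D}}(V)$. A $\mathbb{D}$-linear subspace $V_0$ of $V$ is $S$-invariant if $f(V_0)\subseteq V_0$ for all $f\in S$. A flag is a chain $\{0\}=V_0\subsetneq V_1\subsetneq\cdots\subsetneq V_p=V$ of $\mathbb{D}$-linear subspaces; it is complete if $p=\dim_{\mathbb{D}}V$. Given a flag $(V_0,\dots,V_p)$ and nonempty subsets $\mathcal{S}_i\subseteq\operatorname{End}_{\mathbb{D}}(V_i/V_{i-1})$, the joint $\mathcal{S}_1\vee\cdots\vee\mathcal{S}_p$ is the set of all $u\in\operatorname{End}_{\mathbb{D}}(V)$ that leave every $V_i$ invariant and induce on $V_i/V_{i-1}$ an element of $\mathcal{S}_i$ for each $i$. $\mathbb{D}$ is of quadratic type over $\mathbb{F}$ if one of the following holds: (i) $d=1$; (ii) $d=2$ and $\mathbb{D}$ is a separable field extension of $\mathbb{F}$; (iii) $d=4$ and $\mathbb{D}$ is a quaternion algebra over $\mathbb{F}$; (iv) $d=2^m$ for some $m\geq 1$, $\operatorname{char}(\mathbb{F})=2$,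 $\mathbb{D}$ is a field and $x^2\in\mathbb{F}$ for all $x\in\mathbb{D}$. *)

theory Defs
  imports "HOL-Algebra.Algebra"
begin

locale skew_field = ring R for R (structure) +
  assumes one_not_zero: "\<one> \<noteq> \<zero>"
    and Units_eq: "Units R = carrier R - {\<zero>}"

definition ring_center :: "('a, 'm) ring_scheme \<Rightarrow> 'a set" where
  "ring_center R = {z \<in> carrier R. \<forall>x \<in> carrier R. z \<otimes>\<^bsub>R\<^esub> x = x \<otimes>\<^bsub>R\<^esub> z}"

definition central_subfield :: "'a set \<Rightarrow> ('a, 'm) ring_scheme \<Rightarrow> bool" where
  "central_subfield F R \<longleftrightarrow> subfield F R \<and> F \<subseteq> ring_center R"

text \<open>As for the library record \<open>module\<close>, only the additive part of the underlying ring
  record is meaningful; the fields \<open>mult\<close> and \<open>one\<close> are ignored.\<close>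

record ('a, 'b) rmodule = "'b ring" +
  rsmult :: "['b, 'a] \<Rightarrow> 'b"  (infixl \<open>\<bullet>\<index>\<close> 70)

locale right_vector_space = D?: skew_field D + V?: abelian_group V
  for D :: "('a, 'm) ring_scheme" (structure) and V :: "('a, 'b, 'k) rmodule_scheme" (structure) +
  assumes rsmult_closed: "\<lbrakk>x \<in> carrier V; a \<in> carrier D\<rbrakk> \<Longrightarrow> x \<bullet>\<^bsub>V\<^esub> a \<in> carrier V"
    and rsmult_add_scalar: "\<lbrakk>x \<in> carrier V; a \<in> carrier D; b \<in> carrier D\<rbrakk>
      \<Longrightarrow> x \<bullet>\<^bsub>V\<^esub> (a \<oplus>\<^bsub>D\<^esub> b) = x \<bullet>\<^bsub>V\<^esub> a \<oplus>\<^bsub>V\<^esub> x \<bullet>\<^bsub>V\<^esub> b"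
    and rsmult_add_vector: "\<lbrakk>x \<in> carrier V; y \<in> carrier V; a \<in> carrier D\<rbrakk>
      \<Longrightarrow> (x \<oplus>\<^bsub>V\<^esub> y) \<bullet>\<^bsub>V\<^esub> a = x \<bullet>\<^bsub>V\<^esub> a \<oplus>\<^bsub>V\<^esub> y \<bullet>\<^bsub>V\<^esub> a"
    and rsmult_assoc: "\<lbrakk>x \<in> carrier V; a \<in> carrier D; b \<in> carrier D\<rbrakk>
      \<Longrightarrow> x \<bullet>\<^bsub>V\<^esub> (a \<otimes>\<^bsub>D\<^esub> b) = (x \<bullet>\<^bsub>V\<^esub> a) \<bullet>\<^bsub>V\<^esub> b"
    and rsmult_one: "x \<in> carrier V \<Longrightarrow> x \<bullet>\<^bsub>V\<^esub> \<one>\<^bsub>D\<^esub> = x"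

definition right_subspace ::
  "('a, 'm) ring_scheme \<Rightarrow> ('a, 'b, 'k) rmodule_scheme \<Rightarrow> 'b set \<Rightarrow> bool" where
  "right_subspace D V W \<longleftrightarrow>
     subgroup W (add_monoid V) \<and> (\<forall>x \<in> W. \<forall>a \<in> carrier D. x \<bullet>\<^bsub>V\<^esub> a \<in> W)"

definition right_basis ::
  "('a, 'm) ring_scheme \<Rightarrow> ('a, 'b, 'k) rmodule_scheme \<Rightarrow> nat \<Rightarrow> (nat \<Rightarrow> 'b) \<Rightarrow> bool" where
  "right_basis D V n b \<longleftrightarrow>
     b \<in> {..<n} \<rightarrow> carrier V
   \<and> (\<forall>v \<in> carrier V. \<exists>a \<in> {..<n} \<rightarrow> carrier D. v = (\<Oplus>\<^bsub>V\<^esub>i\<in>{..<n}. b i \<bullet>\<^bsub>V\<^esub> a i))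
   \<and> (\<forall>a \<in> {..<n} \<rightarrow> carrier D.
        (\<Oplus>\<^bsub>V\<^esub>i\<in>{..<n}. b i \<bullet>\<^bsub>V\<^esub> a i) = \<zero>\<^bsub>V\<^esub> \<longrightarrow> (\<forall>i<n. a i = \<zero>\<^bsub>D\<^esub>))"

definition right_dim ::
  "('a, 'm) ring_scheme \<Rightarrow> ('a, 'b, 'k) rmodule_scheme \<Rightarrow> nat \<Rightarrow> bool" where
  "right_dim D V n \<longleftrightarrow> (\<exists>b. right_basis D V n b)"

text \<open>The quotient space \<open>V/U\<close>; its elements are the cosets of \<open>U\<close>. The quotient \<open>W/U\<close> of
  a subspace \<open>W\<close> of \<open>V\<close> is obtained by first restricting the carrier of \<open>V\<close> to \<open>W\<close>.\<close>

definition quotient_space ::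
  "('a, 'b, 'k) rmodule_scheme \<Rightarrow> 'b set \<Rightarrow> ('a, 'b set) rmodule" where
  "quotient_space V U =
     \<lparr>carrier = a_rcosets\<^bsub>V\<^esub> U, monoid.mult = undefined, one = undefined,
      ring.zero = U, add = set_add V,
      rsmult = (\<lambda>C a. \<Union>x\<in>C. U +>\<^bsub>V\<^esub> (x \<bullet>\<^bsub>V\<^esub> a))\<rparr>"

abbreviation subquotient ::
  "('a, 'b, 'k) rmodule_scheme \<Rightarrow> 'b set \<Rightarrow> 'b set \<Rightarrow> ('a, 'b set) rmodule" where
  "subquotient V W U \<equiv> quotient_space (V\<lparr>carrier := W\<rparr>) U"

text \<open>Endomorphisms are represented by functions that are \<open>undefined\<close> outside the carrier,
  so that equality of endomorphisms is equality on the carrier.\<close>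

definition End_ring ::
  "('a, 'm) ring_scheme \<Rightarrow> ('a, 'b, 'k) rmodule_scheme \<Rightarrow> ('b \<Rightarrow> 'b) ring" where
  "End_ring D V =
     \<lparr>carrier = {f \<in> carrier V \<rightarrow>\<^sub>E carrier V.
        (\<forall>x \<in> carrier V. \<forall>y \<in> carrier V. f (x \<oplus>\<^bsub>V\<^esub> y) = f x \<oplus>\<^bsub>V\<^esub> f y) \<and>
        (\<forall>x \<in> carrier V. \<forall>a \<in> carrier D. f (x \<bullet>\<^bsub>V\<^esub> a) = f x \<bullet>\<^bsub>V\<^esub> a)},
      monoid.mult = compose (carrier V),
      one = (\<lambda>x \<in> carrier V. x),
      ring.zero = (\<lambda>x \<in> carrier V. \<zero>\<^bsub>V\<^esub>),
      add = (\<lambda>f g. \<lambda>x \<in> carrier V. f x \<oplus>\<^bsub>V\<^esub> g x)\<rparr>"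

text \<open>The image of a central subfield \<open>F\<close> in the endomorphism ring. The \<open>F\<close>-algebra structure of
  the endomorphism ring is multiplication by these elements (\<open>(c f)(x) = f(x) c\<close>), which is
  how the library theory of embedded algebras treats scalars.\<close>

definition scalars :: "'a set \<Rightarrow> ('a, 'b, 'k) rmodule_scheme \<Rightarrow> ('b \<Rightarrow> 'b) set" where
  "scalars F V = (\<lambda>c. \<lambda>x \<in> carrier V. x \<bullet>\<^bsub>V\<^esub> c) ` F"

text \<open>The library locale \<open>subalgebra K W R\<close> only says that \<open>W\<close> is a \<open>K\<close>-linear subspace of \<open>R\<close>
  (no closure under multiplication).\<close>

abbreviation End_subspace ::
  "('a, 'm) ring_scheme \<Rightarrow> 'a set \<Rightarrow> ('a, 'b, 'k) rmodule_scheme \<Rightarrow> ('b \<Rightarrow> 'b) set \<Rightarrow> bool" where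
  "End_subspace D F V S \<equiv> subalgebra (scalars F V) S (End_ring D V)"

abbreviation End_dimension ::
  "('a, 'm) ring_scheme \<Rightarrow> 'a set \<Rightarrow> ('a, 'b, 'k) rmodule_scheme \<Rightarrow> nat \<Rightarrow> ('b \<Rightarrow> 'b) set \<Rightarrow> bool" where
  "End_dimension D F V k S \<equiv> ring.dimension (End_ring D V) k (scalars F V) S"

definition End_hyperplane ::
  "('a, 'm) ring_scheme \<Rightarrow> 'a set \<Rightarrow> ('a, 'b, 'k) rmodule_scheme \<Rightarrow> ('b \<Rightarrow> 'b) set \<Rightarrow> bool" where
  "End_hyperplane D F V H \<longleftrightarrow> End_subspace D F V H \<and>
     (\<exists>k. End_dimension D F V k H \<and> End_dimension D F V (Suc k) (carrier (End_ring D V)))"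

definition trivial_spectrum ::
  "('a, 'm) ring_scheme \<Rightarrow> 'a set \<Rightarrow> ('a, 'b, 'k) rmodule_scheme \<Rightarrow> ('b \<Rightarrow> 'b) set \<Rightarrow> bool" where
  "trivial_spectrum D F V S \<longleftrightarrow> End_subspace D F V S \<and>
     (\<forall>u \<in> S. \<one>\<^bsub>End_ring D V\<^esub> \<ominus>\<^bsub>End_ring D V\<^esub> u \<in> Units (End_ring D V))"

definition optimal_trivial_spectrum ::
  "('a, 'm) ring_scheme \<Rightarrow> 'a set \<Rightarrow> ('a, 'b, 'k) rmodule_scheme \<Rightarrow> ('b \<Rightarrow> 'b) set \<Rightarrow> bool" where
  "optimal_trivial_spectrum D F V S \<longleftrightarrow> trivial_spectrum D F V S \<and>
     (\<exists>k. End_dimension D F V k S \<and>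
       (\<forall>T m. trivial_spectrum D F V T \<and> End_dimension D F V m T \<longrightarrow> m \<le> k))"

definition invariant_subspace ::
  "('a, 'm) ring_scheme \<Rightarrow> ('a, 'b, 'k) rmodule_scheme \<Rightarrow> ('b \<Rightarrow> 'b) set \<Rightarrow> 'b set \<Rightarrow> bool" where
  "invariant_subspace D V S W \<longleftrightarrow> right_subspace D V W \<and> (\<forall>f \<in> S. f ` W \<subseteq> W)"

definition flag ::
  "('a, 'm) ring_scheme \<Rightarrow> ('a, 'b, 'k) rmodule_scheme \<Rightarrow> nat \<Rightarrow> (nat \<Rightarrow> 'b set) \<Rightarrow> bool" where
  "flag D V p W \<longleftrightarrow> W 0 = {\<zero>\<^bsub>V\<^esub>} \<and> W p = carrier V \<and>
     (\<forall>i \<le> p. right_subspace D V (W i)) \<and> (\<forall>i < p. W i \<subset> W (Suc i))"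

definition complete_flag ::
  "('a, 'm) ring_scheme \<Rightarrow> ('a, 'b, 'k) rmodule_scheme \<Rightarrow> nat \<Rightarrow> (nat \<Rightarrow> 'b set) \<Rightarrow> bool" where
  "complete_flag D V p W \<longleftrightarrow> flag D V p W \<and> right_dim D V p"

text \<open>The endomorphism \<open>x + U \<mapsto> u(x) + U\<close> of \<open>W/U\<close>, for an endomorphism \<open>u\<close> of \<open>V\<close> that leaves
  \<open>U\<close> and \<open>W\<close> invariant.\<close>

definition induced_map ::
  "('a, 'b, 'k) rmodule_scheme \<Rightarrow> 'b set \<Rightarrow> 'b set \<Rightarrow> ('b \<Rightarrow> 'b) \<Rightarrow> 'b set \<Rightarrow> 'b set" where
  "induced_map V W U u =
     (\<lambda>C \<in> carrier (subquotient V W U). \<Union>x\<in>C. U +>\<^bsub>V\<^esub> u x)"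

definition joint ::
  "('a, 'm) ring_scheme \<Rightarrow> ('a, 'b, 'k) rmodule_scheme \<Rightarrow> nat \<Rightarrow> (nat \<Rightarrow> 'b set)
     \<Rightarrow> (nat \<Rightarrow> ('b set \<Rightarrow> 'b set) set) \<Rightarrow> ('b \<Rightarrow> 'b) set" where
  "joint D V p W H = {u \<in> carrier (End_ring D V).
     (\<forall>i \<le> p. u ` W i \<subseteq> W i) \<and>
     (\<forall>i \<in> {1..p}. induced_map V (W i) (W (i - 1)) u \<in> H i)}"

text \<open>Quaternion algebras are the central simple algebras of dimension 4; this covers
  every characteristic.\<close>

definition quaternion_algebra :: "('a, 'm) ring_scheme \<Rightarrow> 'a set \<Rightarrow> bool" where
  "quaternion_algebra D F \<longleftrightarrow> ring.dimension D 4 F (carrier D) \<and> ring_center D = F \<and>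
     \<one>\<^bsub>D\<^esub> \<noteq> \<zero>\<^bsub>D\<^esub> \<and> (\<forall>I. ideal I D \<longrightarrow> I = {\<zero>\<^bsub>D\<^esub>} \<or> I = carrier D)"

text \<open>\<open>ring.\<sigma> D\<close> maps polynomials over \<open>D\<close> to polynomials over the algebraic closure of \<open>D\<close>. So this
  says that the minimal polynomial over \<open>F\<close> of every element of \<open>D\<close> has only simple roots in an
  algebraic closure.\<close>

definition separable_field_extension :: "('a, 'm) ring_scheme \<Rightarrow> 'a set \<Rightarrow> bool" where
  "separable_field_extension D F \<longleftrightarrow> field D \<and> subfield F D \<and>
     (\<forall>x \<in> carrier D. ring.algebraic D F x \<and>
        (\<forall>y \<in> carrier (field.alg_closure D).
           ring.alg_mult (field.alg_closure D) (ring.\<sigma> D (ring.Irr D F x)) y \<le> 1))"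

definition quadratic_type :: "('a, 'm) ring_scheme \<Rightarrow> 'a set \<Rightarrow> bool" where
  "quadratic_type D F \<longleftrightarrow>
     ring.dimension D 1 F (carrier D)
   \<or> (ring.dimension D 2 F (carrier D) \<and> separable_field_extension D F)
   \<or> (ring.dimension D 4 F (carrier D) \<and> quaternion_algebra D F)
   \<or> (\<exists>m\<ge>1. ring.dimension D (2 ^ m) F (carrier D) \<and> \<one>\<^bsub>D\<^esub> \<oplus>\<^bsub>D\<^esub> \<one>\<^bsub>D\<^esub> = \<zero>\<^bsub>D\<^esub> \<and>
        field D \<and> (\<forall>x \<in> carrier D. x \<otimes>\<^bsub>D\<^esub> x \<in> F))"

end

theory Submission
  imports Defs
begin

text \<open>Upper bound: choose \<open>x\<close> for which \<open>S x\<close> has the largest dimension over \<open>F\<close>. As \<open>F\<close> is large,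
  every \<open>u \<in> S\<close> that kills \<open>x\<close> has its image in \<open>S x\<close>; since \<open>x \<notin> S x\<close>, these operators restrict to
  a trivial spectrum space on a \<open>D\<close>-hyperplane \<open>W\<close> avoiding \<open>x\<close>, and induction on the dimension applies.

  If \<open>S\<close> is optimal, the restriction to \<open>W\<close> is optimal too, hence by induction a space of operators
  respecting a complete flag of \<open>W\<close>. The restrictions to \<open>W\<close> of the operators \<open>P \<circ> (t - u)\<close>, with \<open>u \<in> S\<close>,
  \<open>t \<in> F\<close> nonzero and \<open>P\<close> a projection onto \<open>W\<close> killing \<open>(t - u) x\<close>, differ from all of these by
  injective operators and must therefore respect the flag as well. The components of \<open>u\<close> mapping \<open>W\<close>
  to the line \<open>x D\<close> then satisfy an identity that, unless they vanish, forces every element of \<open>D\<close> to be quadratic over \<open>F\<close>,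
  and this happens only when \<open>D\<close> is of quadratic type. So \<open>W\<close> is \<open>S\<close>-invariant, which adds one step
  to the flag.\<close>

section \<open>Dimension of right vector spaces\<close>

text \<open>An operator of \<open>S\<close> need not preserve the chosen hyperplane W, so the
  induction hypothesis cannot be applied to restrictions; this is the obstacle. A Schur complement
  removes it. If P projects onto W along the line of (id - u) x, then a nonzero y in W with y - P (u
  y) = u0 y, where u0 in \<open>S\<close> kills x, extends to a nonzero fixed vector of u + u0. So P
  (id - u) on W avoids the whole optimal space there, although P varies with u. Rescaling u over F
  makes the resulting conditions quadratic polynomials in the scalar, and three scalars separate
  their coefficients; a non-quadratic element of D gives d >= 3, hence |F| >= n d >= 3. The bound is
  the sum of k d - 1 for k = 1, ..., n, each term being the F-dimension of a hyperplane in a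
  k-dimensional D-space. Quotients are postponed to the end. An endomorphism of a line is its value
  at a generator e, so a hyperplane of End(V_i / V_(i-1)) omitting the identity is the same as an
  F-hyperplane B of V_i containing V_(i-1) and omitting e.\<close>

context right_vector_space
begin

lemma rsmult_r_null [simp]: assumes "x \<in> carrier V" shows "x \<bullet>\<^bsub>V\<^esub> \<zero>\<^bsub>D\<^esub> = \<zero>\<^bsub>V\<^esub>"
proof -
  have "x \<bullet>\<^bsub>V\<^esub> \<zero>\<^bsub>D\<^esub> \<oplus>\<^bsub>V\<^esub> x \<bullet>\<^bsub>V\<^esub> \<zero>\<^bsub>D\<^esub> = x \<bullet>\<^bsub>V\<^esub> \<zero>\<^bsub>D\<^esub>"
    using rsmult_add_scalar[OF assms D.zero_closed D.zero_closed] by simp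
  then show ?thesis using V.add.l_cancel_one'[of "x \<bullet>\<^bsub>V\<^esub> \<zero>\<^bsub>D\<^esub>" "x \<bullet>\<^bsub>V\<^esub> \<zero>\<^bsub>D\<^esub>"] rsmult_closed[OF assms D.zero_closed]
    by simp
qed

lemma rsmult_l_null [simp]: assumes "a \<in> carrier D" shows "\<zero>\<^bsub>V\<^esub> \<bullet>\<^bsub>V\<^esub> a = \<zero>\<^bsub>V\<^esub>"
proof -
  have "\<zero>\<^bsub>V\<^esub> \<bullet>\<^bsub>V\<^esub> a \<oplus>\<^bsub>V\<^esub> \<zero>\<^bsub>V\<^esub> \<bullet>\<^bsub>V\<^esub> a = \<zero>\<^bsub>V\<^esub> \<bullet>\<^bsub>V\<^esub> a"
    using rsmult_add_vector[OF V.zero_closed V.zero_closed assms] by simp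
  then show ?thesis using V.add.l_cancel_one'[of "\<zero>\<^bsub>V\<^esub> \<bullet>\<^bsub>V\<^esub> a" "\<zero>\<^bsub>V\<^esub> \<bullet>\<^bsub>V\<^esub> a"] rsmult_closed[OF V.zero_closed assms]
    by simp
qed

lemma rsmult_r_minus: assumes "x \<in> carrier V" "a \<in> carrier D"
  shows "x \<bullet>\<^bsub>V\<^esub> (\<ominus>\<^bsub>D\<^esub> a) = \<ominus>\<^bsub>V\<^esub> (x \<bullet>\<^bsub>V\<^esub> a)"
proof -
  have "x \<bullet>\<^bsub>V\<^esub> (\<ominus>\<^bsub>D\<^esub> a) \<oplus>\<^bsub>V\<^esub> x \<bullet>\<^bsub>V\<^esub> a = \<zero>\<^bsub>V\<^esub>"
    using rsmult_add_scalar[OF assms(1) D.a_inv_closed[OF assms(2)] assms(2)] assms by (simp add: D.l_neg)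
  then show ?thesis using assms by (metis D.a_inv_closed V.minus_equality rsmult_closed)
qed

lemma rsmult_l_minus: assumes "x \<in> carrier V" "a \<in> carrier D"
  shows "(\<ominus>\<^bsub>V\<^esub> x) \<bullet>\<^bsub>V\<^esub> a = \<ominus>\<^bsub>V\<^esub> (x \<bullet>\<^bsub>V\<^esub> a)"
proof -
  have "(\<ominus>\<^bsub>V\<^esub> x) \<bullet>\<^bsub>V\<^esub> a \<oplus>\<^bsub>V\<^esub> x \<bullet>\<^bsub>V\<^esub> a = \<zero>\<^bsub>V\<^esub>"
    using rsmult_add_vector[OF V.a_inv_closed[OF assms(1)] assms(1) assms(2)] assms by (simp add: V.l_neg)
  then show ?thesis using assms by (metis V.a_inv_closed V.minus_equality rsmult_closed)
qed

lemma rsmult_minus_one: "x \<in> carrier V \<Longrightarrow> x \<bullet>\<^bsub>V\<^esub> (\<ominus>\<^bsub>D\<^esub> \<one>\<^bsub>D\<^esub>) = \<ominus>\<^bsub>V\<^esub> x"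
  by (simp add: rsmult_r_minus rsmult_one)

lemma inv_D: assumes "a \<in> carrier D" "a \<noteq> \<zero>\<^bsub>D\<^esub>"
  shows "inv\<^bsub>D\<^esub> a \<in> carrier D" "a \<otimes>\<^bsub>D\<^esub> inv\<^bsub>D\<^esub> a = \<one>\<^bsub>D\<^esub>" "inv\<^bsub>D\<^esub> a \<otimes>\<^bsub>D\<^esub> a = \<one>\<^bsub>D\<^esub>"
    "inv\<^bsub>D\<^esub> a \<noteq> \<zero>\<^bsub>D\<^esub>"
proof -
  have u: "a \<in> Units D" using assms D.Units_eq by auto
  show "inv\<^bsub>D\<^esub> a \<in> carrier D" "a \<otimes>\<^bsub>D\<^esub> inv\<^bsub>D\<^esub> a = \<one>\<^bsub>D\<^esub>" "inv\<^bsub>D\<^esub> a \<otimes>\<^bsub>D\<^esub> a = \<one>\<^bsub>D\<^esub>"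
    using u by auto
  show "inv\<^bsub>D\<^esub> a \<noteq> \<zero>\<^bsub>D\<^esub>"
    using u D.Units_inv_Units[OF u] D.Units_eq by auto
qed

lemma rsmult_inv_cancel:
  assumes "x \<in> carrier V" "a \<in> carrier D" "a \<noteq> \<zero>\<^bsub>D\<^esub>"
  shows "(x \<bullet>\<^bsub>V\<^esub> a) \<bullet>\<^bsub>V\<^esub> inv\<^bsub>D\<^esub> a = x" "(x \<bullet>\<^bsub>V\<^esub> inv\<^bsub>D\<^esub> a) \<bullet>\<^bsub>V\<^esub> a = x"
  using assms inv_D[OF assms(2,3)] by (metis rsmult_assoc rsmult_one)+

lemma right_subspaceD:
  assumes "right_subspace D V W"
  shows "W \<subseteq> carrier V" "\<zero>\<^bsub>V\<^esub> \<in> W"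
    and "\<And>x y. \<lbrakk>x \<in> W; y \<in> W\<rbrakk> \<Longrightarrow> x \<oplus>\<^bsub>V\<^esub> y \<in> W"
    and "\<And>x a. \<lbrakk>x \<in> W; a \<in> carrier D\<rbrakk> \<Longrightarrow> x \<bullet>\<^bsub>V\<^esub> a \<in> W"
    and "\<And>x. x \<in> W \<Longrightarrow> \<ominus>\<^bsub>V\<^esub> x \<in> W"
    and "\<And>x y. \<lbrakk>x \<in> W; y \<in> W\<rbrakk> \<Longrightarrow> x \<ominus>\<^bsub>V\<^esub> y \<in> W"
    and "\<And>x. x \<in> W \<Longrightarrow> x \<in> carrier V"
proof -
  have sg: "subgroup W (add_monoid V)" using assms unfolding right_subspace_def by auto
  show a: "W \<subseteq> carrier V" using subgroup.subset[OF sg] by simp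
  then show "\<And>x. x \<in> W \<Longrightarrow> x \<in> carrier V" by auto
  show "\<zero>\<^bsub>V\<^esub> \<in> W" using subgroup.one_closed[OF sg] by simp
  show b: "\<And>x y. \<lbrakk>x \<in> W; y \<in> W\<rbrakk> \<Longrightarrow> x \<oplus>\<^bsub>V\<^esub> y \<in> W" using subgroup.m_closed[OF sg] by simp
  show c: "\<And>x. x \<in> W \<Longrightarrow> \<ominus>\<^bsub>V\<^esub> x \<in> W" using subgroup.m_inv_closed[OF sg] by (simp add: a_inv_def)
  show "\<And>x a. \<lbrakk>x \<in> W; a \<in> carrier D\<rbrakk> \<Longrightarrow> x \<bullet>\<^bsub>V\<^esub> a \<in> W" using assms unfolding right_subspace_def by auto
  show "\<And>x y. \<lbrakk>x \<in> W; y \<in> W\<rbrakk> \<Longrightarrow> x \<ominus>\<^bsub>V\<^esub> y \<in> W" using b c by (simp add: a_minus_def)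
qed

lemma right_subspaceI:
  assumes "W \<subseteq> carrier V" "\<zero>\<^bsub>V\<^esub> \<in> W"
    and "\<And>x y. \<lbrakk>x \<in> W; y \<in> W\<rbrakk> \<Longrightarrow> x \<oplus>\<^bsub>V\<^esub> y \<in> W"
    and "\<And>x a. \<lbrakk>x \<in> W; a \<in> carrier D\<rbrakk> \<Longrightarrow> x \<bullet>\<^bsub>V\<^esub> a \<in> W"
  shows "right_subspace D V W"
  unfolding right_subspace_def
proof (intro conjI ballI)
  show "subgroup W (add_monoid V)"
  proof (rule V.add.subgroupI)
    show "W \<subseteq> carrier V" "W \<noteq> {}" using assms by auto
    fix x assume x: "x \<in> W"
    have "x \<bullet>\<^bsub>V\<^esub> (\<ominus>\<^bsub>D\<^esub> \<one>\<^bsub>D\<^esub>) \<in> W" using x assms(4) by simp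
    then show "\<ominus>\<^bsub>V\<^esub> x \<in> W" using x assms(1) by (simp add: rsmult_minus_one subset_iff)
  qed (use assms in auto)
qed (use assms in auto)

lemma right_subspace_carrier: "right_subspace D V (carrier V)"
  by (rule right_subspaceI) (auto simp: rsmult_closed)

lemma right_subspace_zero: "right_subspace D V {\<zero>\<^bsub>V\<^esub>}"
  by (rule right_subspaceI) auto

lemma right_subspace_Int:
  "right_subspace D V W \<Longrightarrow> right_subspace D V T \<Longrightarrow> right_subspace D V (W \<inter> T)"
  by (rule right_subspaceI) (auto dest: right_subspaceD)

lemma right_subspace_add_iff:
  assumes "right_subspace D V W" "x \<in> carrier V" "y \<in> W"
  shows "x \<oplus>\<^bsub>V\<^esub> y \<in> W \<longleftrightarrow> x \<in> W" "y \<oplus>\<^bsub>V\<^esub> x \<in> W \<longleftrightarrow> x \<in> W"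
proof -
  note W = right_subspaceD[OF assms(1)]
  have "x = (x \<oplus>\<^bsub>V\<^esub> y) \<ominus>\<^bsub>V\<^esub> y"
    using assms W(7) by (simp add: V.minus_eq V.a_assoc V.r_neg)
  then show *: "x \<oplus>\<^bsub>V\<^esub> y \<in> W \<longleftrightarrow> x \<in> W" using W(3,6) assms(3) by metis
  then show "y \<oplus>\<^bsub>V\<^esub> x \<in> W \<longleftrightarrow> x \<in> W" using assms W(7) by (simp add: V.a_comm)
qed

lemma right_subspace_smult_iff:
  assumes "right_subspace D V W" "x \<in> carrier V" "a \<in> carrier D" "a \<noteq> \<zero>\<^bsub>D\<^esub>"
  shows "x \<bullet>\<^bsub>V\<^esub> a \<in> W \<longleftrightarrow> x \<in> W"
  using right_subspaceD(4)[OF assms(1)] rsmult_inv_cancel(1)[OF assms(2-4)] inv_D(1)[OF assms(3,4)] assms(3)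
  by metis

definition adjoin :: "'b set \<Rightarrow> 'b \<Rightarrow> 'b set" where
  "adjoin W x = {w \<oplus>\<^bsub>V\<^esub> x \<bullet>\<^bsub>V\<^esub> a |w a. w \<in> W \<and> a \<in> carrier D}"

lemma adjoinI: "w \<in> W \<Longrightarrow> a \<in> carrier D \<Longrightarrow> w \<oplus>\<^bsub>V\<^esub> x \<bullet>\<^bsub>V\<^esub> a \<in> adjoin W x"
  unfolding adjoin_def by blast

lemma adjoinE:
  assumes "z \<in> adjoin W x"
  obtains w a where "w \<in> W" "a \<in> carrier D" "z = w \<oplus>\<^bsub>V\<^esub> x \<bullet>\<^bsub>V\<^esub> a"
  using assms unfolding adjoin_def by blast

lemma adjoin_subspace:
  assumes "right_subspace D V W" "x \<in> carrier V"
  shows "right_subspace D V (adjoin W x)"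
proof (rule right_subspaceI)
  note W = right_subspaceD[OF assms(1)]
  show "adjoin W x \<subseteq> carrier V"
    using W(7) assms(2) by (auto elim!: adjoinE simp: rsmult_closed)
  show "\<zero>\<^bsub>V\<^esub> \<in> adjoin W x"
    using adjoinI[OF W(2), of "\<zero>\<^bsub>D\<^esub>" x] assms(2) by simp
  fix y assume y: "y \<in> adjoin W x"
  then obtain w a where wa: "w \<in> W" "a \<in> carrier D" "y = w \<oplus>\<^bsub>V\<^esub> x \<bullet>\<^bsub>V\<^esub> a" by (rule adjoinE)
  show "y \<oplus>\<^bsub>V\<^esub> z \<in> adjoin W x" if z: "z \<in> adjoin W x" for z
  proof -
    obtain w' a' where wa': "w' \<in> W" "a' \<in> carrier D" "z = w' \<oplus>\<^bsub>V\<^esub> x \<bullet>\<^bsub>V\<^esub> a'" using z by (rule adjoinE)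
    have "y \<oplus>\<^bsub>V\<^esub> z = (w \<oplus>\<^bsub>V\<^esub> w') \<oplus>\<^bsub>V\<^esub> x \<bullet>\<^bsub>V\<^esub> (a \<oplus>\<^bsub>D\<^esub> a')"
      using wa wa' assms(2) W(7) by (simp add: rsmult_add_scalar V.a_ac rsmult_closed)
    then show ?thesis using wa wa' W(3) by (simp add: adjoinI)
  qed
  show "y \<bullet>\<^bsub>V\<^esub> c \<in> adjoin W x" if "c \<in> carrier D" for c
  proof -
    have "y \<bullet>\<^bsub>V\<^esub> c = w \<bullet>\<^bsub>V\<^esub> c \<oplus>\<^bsub>V\<^esub> x \<bullet>\<^bsub>V\<^esub> (a \<otimes>\<^bsub>D\<^esub> c)"
      using wa that assms(2) W(7) by (simp add: rsmult_add_vector rsmult_assoc rsmult_closed)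
    then show ?thesis using wa that W(4) by (simp add: adjoinI)
  qed
qed

lemma adjoin_incl: assumes "right_subspace D V W" "x \<in> carrier V"
  shows "W \<subseteq> adjoin W x" "x \<in> adjoin W x"
proof -
  note W = right_subspaceD[OF assms(1)]
  show "W \<subseteq> adjoin W x"
  proof
    fix w assume "w \<in> W"
    then show "w \<in> adjoin W x" using adjoinI[of w W "\<zero>\<^bsub>D\<^esub>" x] assms(2) W(7) by simp
  qed
  show "x \<in> adjoin W x"
    using adjoinI[OF W(2), of "\<one>\<^bsub>D\<^esub>" x] assms(2) by (simp add: rsmult_one)
qed

lemma adjoin_least:
  assumes "right_subspace D V T" "W \<subseteq> T" "x \<in> T"
  shows "adjoin W x \<subseteq> T"
  using right_subspaceD(3,4)[OF assms(1)] assms(2,3) by (auto elim!: adjoinE)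

text \<open>The scalar at \<open>x\<close> in the expansion of \<open>z\<close> cannot vanish, hence
  is invertible, and \<open>x\<close> can be expressed through \<open>z\<close> and
  \<open>W\<close>: one step of Steinitz exchange.\<close>

lemma adjoin_exchange:
  assumes "right_subspace D V W" "x \<in> carrier V" "z \<in> adjoin W x" "z \<notin> W"
  shows "adjoin W z = adjoin W x"
proof -
  note W = right_subspaceD[OF assms(1)]
  obtain w a where wa: "w \<in> W" "a \<in> carrier D" "z = w \<oplus>\<^bsub>V\<^esub> x \<bullet>\<^bsub>V\<^esub> a" using assms(3) by (rule adjoinE)
  have a0: "a \<noteq> \<zero>\<^bsub>D\<^esub>" using wa assms(4) W(7) assms(2) by auto
  have zc: "z \<in> carrier V" using wa W(7) assms(2) by (simp add: rsmult_closed)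
  note Z = right_subspaceD[OF adjoin_subspace[OF assms(1) zc]]
  note zi = adjoin_incl[OF assms(1) zc]
  have "x \<bullet>\<^bsub>V\<^esub> a = z \<ominus>\<^bsub>V\<^esub> w"
    using wa W(7) assms(2) by (simp add: V.minus_eq V.a_ac rsmult_closed V.r_neg1 V.r_neg2)
  then have "x \<bullet>\<^bsub>V\<^esub> a \<in> adjoin W z" using Z(6)[OF zi(2) subsetD[OF zi(1) wa(1)]] by simp
  then have "x \<in> adjoin W z"
    using right_subspace_smult_iff[OF adjoin_subspace[OF assms(1) zc] assms(2) wa(2) a0] by simp
  then have "adjoin W x \<subseteq> adjoin W z" using adjoin_least[OF adjoin_subspace[OF assms(1) zc] zi(1)] by simp
  moreover have "adjoin W z \<subseteq> adjoin W x"
    using adjoin_least[OF adjoin_subspace[OF assms(1,2)]] adjoin_incl[OF assms(1,2)] assms(3) by simp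
  ultimately show ?thesis by auto
qed

text \<open>Modular law, with \<open>z\<close> in \<open>T\<close>. A subspace not contained in a
  hyperplane thus meets it in a hyperplane of itself, which drives the dimension theory
  below.\<close>

lemma adjoin_modular:
  assumes "right_subspace D V H" "y \<in> carrier V" "right_subspace D V T" "T \<subseteq> adjoin H y" "z \<in> T" "z \<notin> H"
  shows "T = adjoin (T \<inter> H) z"
proof
  note T = right_subspaceD[OF assms(3)]
  note H = right_subspaceD[OF assms(1)]
  have zc: "z \<in> carrier V" using T(7) assms(5) by simp
  have ex: "adjoin H z = adjoin H y" using adjoin_exchange assms by auto
  show "adjoin (T \<inter> H) z \<subseteq> T" by (rule adjoin_least) (use assms in auto)
  show "T \<subseteq> adjoin (T \<inter> H) z"
  proof
    fix t assume t: "t \<in> T"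
    then have "t \<in> adjoin H z" using ex assms by auto
    then obtain h a where ha: "h \<in> H" "a \<in> carrier D" "t = h \<oplus>\<^bsub>V\<^esub> z \<bullet>\<^bsub>V\<^esub> a" by (rule adjoinE)
    have "z \<bullet>\<^bsub>V\<^esub> a \<in> T" using ha T assms by simp
    then have "h \<in> T" using t ha right_subspace_add_iff(1)[OF assms(3)] H(7) by metis
    then show "t \<in> adjoin (T \<inter> H) z" using ha by (auto intro: adjoinI)
  qed
qed

text \<open>Dimension as the length of a chain of one-vector extensions. Only a skew field of
  scalars is assumed, so the same predicate measures D-spaces, F-spaces and F-spaces of operators,
  and its induction rule takes the place of bases.\<close>

inductive vdim :: "'b set \<Rightarrow> nat \<Rightarrow> bool" where
  vdim_zero: "vdim {\<zero>\<^bsub>V\<^esub>} 0"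
| vdim_adjoin: "\<lbrakk>vdim W k; x \<in> carrier V; x \<notin> W\<rbrakk> \<Longrightarrow> vdim (adjoin W x) (Suc k)"

lemma vdim_subspace: "vdim W k \<Longrightarrow> right_subspace D V W"
  by (induction rule: vdim.induct) (auto intro: right_subspace_zero adjoin_subspace)

text \<open>A hyperplane \<open>H\<close> other than the last space \<open>W1\<close> of the chain
  meets \<open>W1\<close> in a hyperplane of both. The induction hypothesis gives the dimension of
  the intersection, and one extension leads back to \<open>H\<close>. Uniqueness of dimension rests
  on this.\<close>

lemma vdim_hyperplane:
  assumes "vdim W k" "right_subspace D V H" "y \<in> carrier V" "y \<notin> H" "W = adjoin H y"
  shows "\<exists>j. k = Suc j \<and> vdim H j"
  using assms
proof (induction arbitrary: H y rule: vdim.induct)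
  case vdim_zero
  have "y \<in> adjoin H y" using adjoin_incl(2) vdim_zero by blast
  then have "y \<in> {\<zero>\<^bsub>V\<^esub>}" by (simp only: vdim_zero(4)[symmetric])
  then have "y = \<zero>\<^bsub>V\<^esub>" by simp
  then show ?case using vdim_zero(3) right_subspaceD(2)[OF vdim_zero(1)] by simp
next
  case (vdim_adjoin W1 k x)
  have W1: "right_subspace D V W1" using vdim_subspace vdim_adjoin by auto
  let ?W = "adjoin W1 x"
  have HW: "H \<subseteq> ?W" "y \<in> ?W" unfolding vdim_adjoin(8) using adjoin_incl[OF vdim_adjoin(5,6)] by auto
  show ?case
  proof (cases "H \<subseteq> W1")
    case True
    have "W1 \<subseteq> H"
    proof (rule ccontr)
      assume "\<not> W1 \<subseteq> H"
      then obtain z where z: "z \<in> W1" "z \<notin> H" by auto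
      have "z \<in> adjoin H y" using z adjoin_incl[OF W1 vdim_adjoin(2)] vdim_adjoin(8) by auto
      then have "?W = adjoin H z" using vdim_adjoin(8) adjoin_exchange[OF vdim_adjoin(5,6) _ z(2)] by simp
      also have "\<dots> \<subseteq> W1" using adjoin_least[OF W1 True z(1)] .
      finally show False using adjoin_incl[OF W1 vdim_adjoin(2)] vdim_adjoin(3) by auto
    qed
    then show ?thesis using True vdim_adjoin by auto
  next
    case False
    then obtain z where z: "z \<in> H" "z \<notin> W1" by auto
    have Hz: "H = adjoin (H \<inter> W1) z" using adjoin_modular[OF W1 vdim_adjoin(2,5) HW(1) z] .
    have "\<not> W1 \<subseteq> H"
    proof
      assume "W1 \<subseteq> H"
      then have "adjoin W1 z \<subseteq> H" using adjoin_least[OF vdim_adjoin(5) _ z(1)] by simp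
      moreover have "adjoin W1 z = ?W" using adjoin_exchange[OF W1 vdim_adjoin(2) _ z(2)] HW z by auto
      ultimately show False using HW vdim_adjoin by auto
    qed
    then obtain y' where y': "y' \<in> W1" "y' \<notin> H" by auto
    have "W1 = adjoin (W1 \<inter> H) y'"
      using adjoin_modular[OF vdim_adjoin(5,6) W1 _ y'] adjoin_incl(1)[OF W1 vdim_adjoin(2)] vdim_adjoin(8) by auto
    moreover have "y' \<in> carrier V" using y' right_subspaceD(7)[OF W1] by auto
    ultimately obtain j where j: "k = Suc j" "vdim (W1 \<inter> H) j"
      using vdim_adjoin.IH[of "W1 \<inter> H" y'] right_subspace_Int[OF W1 vdim_adjoin(5)] y' by auto
    have "vdim (adjoin (W1 \<inter> H) z) (Suc j)"
      by (rule vdim.vdim_adjoin) (use j z right_subspaceD(7)[OF vdim_adjoin(5)] in auto)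
    then show ?thesis using Hz j by (simp add: Int_commute)
  qed
qed

text \<open>Cutting \<open>W\<close> with the penultimate space \<open>W1\<close> of the chain of
  \<open>W'\<close> lowers its dimension by at most one. The equality case is included because its
  induction needs the inequality at the same time.\<close>

lemma vdim_mono_eq:
  assumes "vdim W' k'" "vdim W k" "W \<subseteq> W'"
  shows "k \<le> k' \<and> (k = k' \<longrightarrow> W = W')"
  using assms
proof (induction arbitrary: W k rule: vdim.induct)
  case vdim_zero
  show ?case
    using vdim_zero(1)
  proof cases
    case (vdim_adjoin W1 k1 x)
    then have "x \<in> W" "\<zero>\<^bsub>V\<^esub> \<in> W1"
      using adjoin_incl(2)[OF vdim_subspace] right_subspaceD(2)[OF vdim_subspace] by auto
    then have False using vdim_zero vdim_adjoin by auto
    then show ?thesis ..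
  qed auto
next
  case (vdim_adjoin W1 k1 x)
  have W1: "right_subspace D V W1" and W: "right_subspace D V W" using vdim_subspace vdim_adjoin by auto
  show ?case
  proof (cases "W \<subseteq> W1")
    case True
    then show ?thesis using vdim_adjoin.IH[OF vdim_adjoin(5)] by auto
  next
    case False
    then obtain z where z: "z \<in> W" "z \<notin> W1" by auto
    have eq: "W = adjoin (W \<inter> W1) z" using adjoin_modular[OF W1 vdim_adjoin(2) W vdim_adjoin(6) z] .
    obtain j where j: "k = Suc j" "vdim (W \<inter> W1) j"
      using vdim_hyperplane[OF vdim_adjoin(5) right_subspace_Int[OF W W1] _ _ eq] z right_subspaceD(7)[OF W] by auto
    have IH: "j \<le> k1 \<and> (j = k1 \<longrightarrow> W \<inter> W1 = W1)" using vdim_adjoin.IH[OF j(2)] by auto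
    have "W = adjoin W1 x" if "j = k1"
    proof -
      have "adjoin W1 z = adjoin W1 x" using adjoin_exchange[OF W1 vdim_adjoin(2) _ z(2)] z vdim_adjoin by auto
      then show ?thesis using eq IH that by (simp add: Int_commute)
    qed
    then show ?thesis using j IH by auto
  qed
qed

lemma vdim_mono: "vdim W' k' \<Longrightarrow> vdim W k \<Longrightarrow> W \<subseteq> W' \<Longrightarrow> k \<le> k'"
  using vdim_mono_eq by blast

lemma vdim_eq: "vdim W' k \<Longrightarrow> vdim W k \<Longrightarrow> W \<subseteq> W' \<Longrightarrow> W = W'"
  using vdim_mono_eq by blast

lemma vdim_unique: "vdim W k \<Longrightarrow> vdim W k' \<Longrightarrow> k = k'"
  using vdim_mono le_antisym by blast

lemma vdim_sub_ex:
  assumes "vdim W k" "right_subspace D V T" "T \<subseteq> W"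
  shows "\<exists>j\<le>k. vdim T j"
  using assms
proof (induction arbitrary: T rule: vdim.induct)
  case vdim_zero
  then have "T = {\<zero>\<^bsub>V\<^esub>}" using right_subspaceD(2) by auto
  then show ?case using vdim.vdim_zero by auto
next
  case (vdim_adjoin W1 k1 x)
  have W1: "right_subspace D V W1" using vdim_subspace vdim_adjoin by auto
  show ?case
  proof (cases "T \<subseteq> W1")
    case True
    then show ?thesis using vdim_adjoin.IH[OF vdim_adjoin(5)] le_SucI by blast
  next
    case False
    then obtain z where z: "z \<in> T" "z \<notin> W1" by auto
    have eq: "T = adjoin (T \<inter> W1) z" using adjoin_modular[OF W1 vdim_adjoin(2) vdim_adjoin(5,6) z] .
    obtain j where j: "j \<le> k1" "vdim (T \<inter> W1) j"
      using vdim_adjoin.IH[of "T \<inter> W1"] right_subspace_Int[OF vdim_adjoin(5) W1] by auto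
    have "vdim T (Suc j)"
      by (subst eq, rule vdim.vdim_adjoin) (use j z right_subspaceD(7)[OF vdim_adjoin(5)] in auto)
    then show ?thesis using j by auto
  qed
qed

lemma vdim_0: "vdim W 0 \<Longrightarrow> W = {\<zero>\<^bsub>V\<^esub>}"
  using vdim.cases by blast

lemma vdim_Suc_ex_adjoin:
  assumes "vdim W (Suc k)"
  obtains H x where "vdim H k" "x \<in> carrier V" "x \<notin> H" "W = adjoin H x"
  using assms vdim.cases by blast

text \<open>A subspace of largest dimension among those containing \<open>W\<close> and missing
  \<open>x\<close> will do: if some \<open>z\<close> lay outside \<open>adjoin H x\<close>, then by
  exchange \<open>adjoin H z\<close> would still miss \<open>x\<close>.\<close>

lemma ex_hyperplane_avoiding:
  assumes "vdim (carrier V) n" "right_subspace D V W" "x \<in> carrier V" "x \<notin> W"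
  obtains H where "right_subspace D V H" "W \<subseteq> H" "x \<notin> H" "adjoin H x = carrier V"
proof -
  let ?P = "\<lambda>k. \<exists>H. right_subspace D V H \<and> W \<subseteq> H \<and> x \<notin> H \<and> vdim H k"
  obtain j where "?P j" using vdim_sub_ex[OF assms(1,2)] right_subspaceD(1)[OF assms(2)] assms(2,4) by blast
  moreover have "\<forall>k. ?P k \<longrightarrow> k \<le> n" using vdim_mono[OF assms(1)] right_subspaceD(1) by blast
  ultimately obtain k where k: "?P k" "\<And>k'. ?P k' \<Longrightarrow> k' \<le> k"
    using Greatest_le_nat[of ?P] GreatestI_nat[of ?P] by blast
  then obtain H where H: "right_subspace D V H" "W \<subseteq> H" "x \<notin> H" "vdim H k" by auto
  have "carrier V \<subseteq> adjoin H x"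
  proof
    fix z assume zc: "z \<in> carrier V"
    show "z \<in> adjoin H x"
    proof (rule ccontr)
      assume nz: "z \<notin> adjoin H x"
      have zH: "z \<notin> H" using nz adjoin_incl(1)[OF H(1) assms(3)] by auto
      have "vdim (adjoin H z) (Suc k)" using vdim_adjoin[OF H(4) zc zH] .
      moreover have "W \<subseteq> adjoin H z" using adjoin_incl[OF H(1) zc] H by auto
      moreover have "x \<notin> adjoin H z"
      proof
        assume "x \<in> adjoin H z"
        then have "adjoin H x = adjoin H z" using adjoin_exchange[OF H(1) zc _ H(3)] by simp
        then show False using nz adjoin_incl(2)[OF H(1) zc] by simp
      qed
      ultimately have "?P (Suc k)" using vdim_subspace by blast
      from k(2)[OF this] show False by simp
    qed
  qed
  moreover have "adjoin H x \<subseteq> carrier V" using adjoin_subspace[OF H(1) assms(3)] right_subspaceD(1) by auto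
  ultimately show ?thesis using that[OF H(1-3)] by auto
qed

lemma adjoin_unique:
  assumes "right_subspace D V H" "x \<in> carrier V" "x \<notin> H"
    "w \<in> H" "w' \<in> H" "a \<in> carrier D" "a' \<in> carrier D" "w \<oplus>\<^bsub>V\<^esub> x \<bullet>\<^bsub>V\<^esub> a = w' \<oplus>\<^bsub>V\<^esub> x \<bullet>\<^bsub>V\<^esub> a'"
  shows "w = w' \<and> a = a'"
proof -
  note H = right_subspaceD[OF assms(1)]
  note c = H(7)[OF assms(4)] H(7)[OF assms(5)] assms(2,6,7) rsmult_closed[OF assms(2) assms(6)] rsmult_closed[OF assms(2) assms(7)]
  have "x \<bullet>\<^bsub>V\<^esub> (a \<ominus>\<^bsub>D\<^esub> a') = w' \<ominus>\<^bsub>V\<^esub> w"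
  proof -
    have "x \<bullet>\<^bsub>V\<^esub> (a \<ominus>\<^bsub>D\<^esub> a') = x \<bullet>\<^bsub>V\<^esub> a \<ominus>\<^bsub>V\<^esub> x \<bullet>\<^bsub>V\<^esub> a'"
      using c by (simp add: D.minus_eq V.minus_eq rsmult_add_scalar rsmult_r_minus)
    also have "x \<bullet>\<^bsub>V\<^esub> a = (w' \<oplus>\<^bsub>V\<^esub> x \<bullet>\<^bsub>V\<^esub> a') \<ominus>\<^bsub>V\<^esub> w"
      unfolding assms(8)[symmetric] using c by (simp add: V.minus_eq V.a_ac V.r_neg1 V.r_neg2)
    also have "\<dots> \<ominus>\<^bsub>V\<^esub> x \<bullet>\<^bsub>V\<^esub> a' = w' \<ominus>\<^bsub>V\<^esub> w"
      using c by (simp add: V.minus_eq V.a_ac V.r_neg1 V.r_neg2 V.r_neg)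
    finally show ?thesis .
  qed
  then have "x \<bullet>\<^bsub>V\<^esub> (a \<ominus>\<^bsub>D\<^esub> a') \<in> H" using H assms by simp
  then have "a \<ominus>\<^bsub>D\<^esub> a' = \<zero>\<^bsub>D\<^esub>"
    using right_subspace_smult_iff[OF assms(1,2), of "a \<ominus>\<^bsub>D\<^esub> a'"] c assms(3) by auto
  then have "a = a'" using c by simp
  then show ?thesis using assms(8) c by simp
qed

end

section \<open>Linear maps, rank and nullity\<close>

definition linear_map ::
  "('a, 'm) ring_scheme \<Rightarrow> ('a, 'b, 'k) rmodule_scheme \<Rightarrow> ('a, 'c, 'l) rmodule_scheme \<Rightarrow> ('b \<Rightarrow> 'c) \<Rightarrow> bool" where
  "linear_map D V N f \<longleftrightarrow> f \<in> carrier V \<rightarrow> carrier N \<and>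
     (\<forall>x \<in> carrier V. \<forall>y \<in> carrier V. f (x \<oplus>\<^bsub>V\<^esub> y) = f x \<oplus>\<^bsub>N\<^esub> f y) \<and>
     (\<forall>x \<in> carrier V. \<forall>a \<in> carrier D. f (x \<bullet>\<^bsub>V\<^esub> a) = f x \<bullet>\<^bsub>N\<^esub> a)"

locale two_spaces = M: right_vector_space D M + N: right_vector_space D N
  for D :: "('a, 'm) ring_scheme" and M :: "('a, 'b, 'k) rmodule_scheme" and N :: "('a, 'c, 'l) rmodule_scheme"
begin

lemma linear_mapD:
  assumes "linear_map D M N f"
  shows "\<And>x. x \<in> carrier M \<Longrightarrow> f x \<in> carrier N"
    "\<And>x y. x \<in> carrier M \<Longrightarrow> y \<in> carrier M \<Longrightarrow> f (x \<oplus>\<^bsub>M\<^esub> y) = f x \<oplus>\<^bsub>N\<^esub> f y"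
    "\<And>x a. x \<in> carrier M \<Longrightarrow> a \<in> carrier D \<Longrightarrow> f (x \<bullet>\<^bsub>M\<^esub> a) = f x \<bullet>\<^bsub>N\<^esub> a"
    "f \<zero>\<^bsub>M\<^esub> = \<zero>\<^bsub>N\<^esub>"
    "\<And>x. x \<in> carrier M \<Longrightarrow> f (\<ominus>\<^bsub>M\<^esub> x) = \<ominus>\<^bsub>N\<^esub> f x"
    "\<And>x y. x \<in> carrier M \<Longrightarrow> y \<in> carrier M \<Longrightarrow> f (x \<ominus>\<^bsub>M\<^esub> y) = f x \<ominus>\<^bsub>N\<^esub> f y"
proof -
  show a: "\<And>x. x \<in> carrier M \<Longrightarrow> f x \<in> carrier N"
    and b: "\<And>x y. x \<in> carrier M \<Longrightarrow> y \<in> carrier M \<Longrightarrow> f (x \<oplus>\<^bsub>M\<^esub> y) = f x \<oplus>\<^bsub>N\<^esub> f y"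
    and c: "\<And>x a. x \<in> carrier M \<Longrightarrow> a \<in> carrier D \<Longrightarrow> f (x \<bullet>\<^bsub>M\<^esub> a) = f x \<bullet>\<^bsub>N\<^esub> a"
    using assms unfolding linear_map_def by auto
  show "f \<zero>\<^bsub>M\<^esub> = \<zero>\<^bsub>N\<^esub>"
    using c[of "\<zero>\<^bsub>M\<^esub>" "\<zero>\<^bsub>D\<^esub>"] a[of "\<zero>\<^bsub>M\<^esub>"] by simp
  show d: "\<And>x. x \<in> carrier M \<Longrightarrow> f (\<ominus>\<^bsub>M\<^esub> x) = \<ominus>\<^bsub>N\<^esub> f x"
    using c[of _ "\<ominus>\<^bsub>D\<^esub> \<one>\<^bsub>D\<^esub>"] a by (simp add: M.rsmult_minus_one N.rsmult_minus_one)
  show "\<And>x y. x \<in> carrier M \<Longrightarrow> y \<in> carrier M \<Longrightarrow> f (x \<ominus>\<^bsub>M\<^esub> y) = f x \<ominus>\<^bsub>N\<^esub> f y"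
    using b d by (simp add: a_minus_def)
qed

lemma image_subspace:
  assumes "linear_map D M N f" "right_subspace D M W"
  shows "right_subspace D N (f ` W)"
proof (rule N.right_subspaceI)
  note f = linear_mapD[OF assms(1)] and W = M.right_subspaceD[OF assms(2)]
  show "f ` W \<subseteq> carrier N" using f W by auto
  show "\<zero>\<^bsub>N\<^esub> \<in> f ` W" using f(4) W(2) by (metis imageI)
  show "x \<oplus>\<^bsub>N\<^esub> y \<in> f ` W" if "x \<in> f ` W" "y \<in> f ` W" for x y
  proof -
    obtain x' y' where "x' \<in> W" "y' \<in> W" "x = f x'" "y = f y'" using \<open>x \<in> f ` W\<close> \<open>y \<in> f ` W\<close> by auto
    then show ?thesis using f(2)[of x' y'] W by (metis imageI)
  qed
  show "x \<bullet>\<^bsub>N\<^esub> a \<in> f ` W" if "x \<in> f ` W" "a \<in> carrier D" for x a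
  proof -
    obtain x' where "x' \<in> W" "x = f x'" using \<open>x \<in> f ` W\<close> by auto
    then show ?thesis using f(3)[of x' a] W that by (metis imageI)
  qed
qed

lemma preimage_subspace:
  assumes "linear_map D M N f" "right_subspace D M W" "right_subspace D N T"
  shows "right_subspace D M {w \<in> W. f w \<in> T}"
proof (rule M.right_subspaceI)
  note f = linear_mapD[OF assms(1)] and W = M.right_subspaceD[OF assms(2)] and T = N.right_subspaceD[OF assms(3)]
  show "{w \<in> W. f w \<in> T} \<subseteq> carrier M" "\<zero>\<^bsub>M\<^esub> \<in> {w \<in> W. f w \<in> T}" using W T f by auto
  show "x \<oplus>\<^bsub>M\<^esub> y \<in> {w \<in> W. f w \<in> T}" if "x \<in> {w \<in> W. f w \<in> T}" "y \<in> {w \<in> W. f w \<in> T}" for x y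
    using that f(2)[of x y] W T by auto
  show "x \<bullet>\<^bsub>M\<^esub> a \<in> {w \<in> W. f w \<in> T}" if "x \<in> {w \<in> W. f w \<in> T}" "a \<in> carrier D" for x a
    using that f(3)[of x a] W T by auto
qed

lemma ker_subspace:
  assumes "linear_map D M N f" "right_subspace D M W"
  shows "right_subspace D M {w \<in> W. f w = \<zero>\<^bsub>N\<^esub>}"
  using preimage_subspace[OF assms N.right_subspace_zero] by simp

lemma image_adjoin:
  assumes "linear_map D M N f" "right_subspace D M W" "x \<in> carrier M"
  shows "f ` M.adjoin W x = N.adjoin (f ` W) (f x)"
proof -
  note f = linear_mapD[OF assms(1)] and W = M.right_subspaceD[OF assms(2)]
  have *: "f (w \<oplus>\<^bsub>M\<^esub> x \<bullet>\<^bsub>M\<^esub> a) = f w \<oplus>\<^bsub>N\<^esub> f x \<bullet>\<^bsub>N\<^esub> a" if "w \<in> W" "a \<in> carrier D" for w a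
    using that f W(7) assms(3) by (simp add: M.rsmult_closed)
  show ?thesis
  proof (intro equalityI subsetI)
    fix y assume "y \<in> f ` M.adjoin W x"
    then obtain z where z: "z \<in> M.adjoin W x" "y = f z" by auto
    then obtain w a where wa: "w \<in> W" "a \<in> carrier D" "z = w \<oplus>\<^bsub>M\<^esub> x \<bullet>\<^bsub>M\<^esub> a" by (blast elim: M.adjoinE)
    show "y \<in> N.adjoin (f ` W) (f x)" unfolding z(2) wa(3) *[OF wa(1,2)] using wa by (simp add: N.adjoinI)
  next
    fix y assume "y \<in> N.adjoin (f ` W) (f x)"
    then obtain v a where va: "v \<in> f ` W" "a \<in> carrier D" "y = v \<oplus>\<^bsub>N\<^esub> f x \<bullet>\<^bsub>N\<^esub> a" by (rule N.adjoinE)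
    then obtain w where w: "w \<in> W" "v = f w" by auto
    show "y \<in> f ` M.adjoin W x"
      unfolding va(3) w(2) *[OF w(1) va(2), symmetric] by (rule imageI[OF M.adjoinI[OF w(1) va(2)]])
  qed
qed

text \<open>Each vector added to the chain of \<open>W\<close> enlarges either the image or the
  kernel: if f x = f w with w already present, the kernel gains x - w; otherwise the image gains f
  x.\<close>

lemma rank_nullity:
  assumes "linear_map D M N f" "M.vdim W k"
  shows "\<exists>r j. N.vdim (f ` W) r \<and> M.vdim {w \<in> W. f w = \<zero>\<^bsub>N\<^esub>} j \<and> r + j = k"
  using assms(2)
proof (induction rule: M.vdim.induct)
  case vdim_zero
  have "f ` {\<zero>\<^bsub>M\<^esub>} = {\<zero>\<^bsub>N\<^esub>}" "{w \<in> {\<zero>\<^bsub>M\<^esub>}. f w = \<zero>\<^bsub>N\<^esub>} = {\<zero>\<^bsub>M\<^esub>}"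
    using linear_mapD(4)[OF assms(1)] by auto
  then show ?case using M.vdim_zero N.vdim_zero by auto
next
  case (vdim_adjoin W1 k x)
  note f = linear_mapD[OF assms(1)]
  have W1: "right_subspace D M W1" using vdim_adjoin M.vdim_subspace by auto
  note W = M.right_subspaceD[OF W1]
  have W2: "right_subspace D M (M.adjoin W1 x)" using M.adjoin_subspace[OF W1] vdim_adjoin by auto
  note incl = M.adjoin_incl[OF W1 vdim_adjoin(2)]
  obtain r j where rj: "N.vdim (f ` W1) r" "M.vdim {w \<in> W1. f w = \<zero>\<^bsub>N\<^esub>} j" "r + j = k"
    using vdim_adjoin by auto
  let ?K = "{w \<in> M.adjoin W1 x. f w = \<zero>\<^bsub>N\<^esub>}"
  have K: "right_subspace D M ?K" using ker_subspace[OF assms(1) W2] .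
  have im: "f ` M.adjoin W1 x = N.adjoin (f ` W1) (f x)" using image_adjoin[OF assms(1) W1 vdim_adjoin(2)] .
  have K1: "?K \<inter> W1 = {w \<in> W1. f w = \<zero>\<^bsub>N\<^esub>}" using incl by auto
  show ?case
  proof (cases "f x \<in> f ` W1")
    case True
    then obtain w where w: "w \<in> W1" "f x = f w" by auto
    let ?z = "x \<ominus>\<^bsub>M\<^esub> w"
    have zK: "?z \<in> ?K" "?z \<notin> W1"
    proof -
      have "?z \<in> M.adjoin W1 x" using M.right_subspaceD(6)[OF W2] incl w by auto
      moreover have "f ?z = \<zero>\<^bsub>N\<^esub>" using f(6)[of x w] w W(7) vdim_adjoin f(1) by (simp add: N.minus_eq N.r_neg)
      ultimately show "?z \<in> ?K" by simp
      show "?z \<notin> W1" using M.right_subspace_add_iff(1)[OF W1 vdim_adjoin(2), of "\<ominus>\<^bsub>M\<^esub> w"] W(5)[OF w(1)] vdim_adjoin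
        by (simp add: a_minus_def)
    qed
    have eq: "?K = M.adjoin (?K \<inter> W1) ?z"
      by (rule M.adjoin_modular[OF W1 vdim_adjoin(2) K _ zK]) auto
    have "?z \<in> carrier M" using zK M.right_subspaceD(7)[OF W2] by auto
    then have "M.vdim ?K (Suc j)" using M.vdim_adjoin[OF rj(2), of ?z] zK eq K1 by auto
    moreover have "f ` M.adjoin W1 x = f ` W1"
    proof
      show "f ` M.adjoin W1 x \<subseteq> f ` W1"
        unfolding im by (rule N.adjoin_least[OF N.vdim_subspace[OF rj(1)]]) (use True in auto)
    qed (use incl in auto)
    ultimately show ?thesis using rj by auto
  next
    case False
    have "N.vdim (f ` M.adjoin W1 x) (Suc r)"
      unfolding im using N.vdim_adjoin[OF rj(1) f(1)[OF vdim_adjoin(2)] False] .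
    moreover have "?K = {w \<in> W1. f w = \<zero>\<^bsub>N\<^esub>}"
    proof -
      have "w \<in> W1" if w: "w \<in> ?K" for w
      proof (rule ccontr)
        assume n: "w \<notin> W1"
        have "M.adjoin W1 w = M.adjoin W1 x" using M.adjoin_exchange[OF W1 vdim_adjoin(2)] w n by auto
        then have "x \<in> M.adjoin W1 w" using incl by simp
        then obtain v a where va: "v \<in> W1" "a \<in> carrier D" "x = v \<oplus>\<^bsub>M\<^esub> w \<bullet>\<^bsub>M\<^esub> a" by (rule M.adjoinE)
        have wc: "w \<in> carrier M" using w M.right_subspaceD(7)[OF W2] by auto
        have "f x = f v" using va f w W(7) wc by (simp add: M.rsmult_closed)
        then show False using va False by auto
      qed
      then show ?thesis using incl by auto
    qed
    ultimately show ?thesis using rj by auto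
  qed
qed

lemma vdim_inj_image:
  assumes "linear_map D M N f" "M.vdim W k" "\<And>w. w \<in> W \<Longrightarrow> f w = \<zero>\<^bsub>N\<^esub> \<Longrightarrow> w = \<zero>\<^bsub>M\<^esub>"
  shows "N.vdim (f ` W) k"
proof -
  have K: "{w \<in> W. f w = \<zero>\<^bsub>N\<^esub>} = {\<zero>\<^bsub>M\<^esub>}"
  proof (intro equalityI subsetI)
    fix w assume "w \<in> {w \<in> W. f w = \<zero>\<^bsub>N\<^esub>}"
    then show "w \<in> {\<zero>\<^bsub>M\<^esub>}" using assms(3) by simp
  next
    fix w assume "w \<in> {\<zero>\<^bsub>M\<^esub>}"
    then show "w \<in> {w \<in> W. f w = \<zero>\<^bsub>N\<^esub>}"
      using M.right_subspaceD(2)[OF M.vdim_subspace[OF assms(2)]] linear_mapD(4)[OF assms(1)] by simp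
  qed
  obtain r j where rj: "N.vdim (f ` W) r" "M.vdim {w \<in> W. f w = \<zero>\<^bsub>N\<^esub>} j" "r + j = k"
    using rank_nullity[OF assms(1,2)] by blast
  have "j = 0" using rj(2) M.vdim_unique[OF M.vdim_zero] unfolding K by blast
  then show ?thesis using rj by simp
qed

end

context right_vector_space
begin

lemma vdim_ex_nonzero: "vdim W (Suc k) \<Longrightarrow> \<exists>w\<in>W. w \<noteq> \<zero>\<^bsub>V\<^esub>"
  by (metis insertI1 right_subspaceD(2) subsetI singletonD subset_antisym vdim_subspace vdim_unique
      vdim_zero insert_absorb insert_subset old.nat.distinct(2))

text \<open>The spans of the first k basis vectors form the chain; independence makes every
  extension proper.\<close>

lemma right_basis_imp_vdim:
  assumes "right_basis D V n b"
  shows "vdim (carrier V) n"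
proof -
  have bc: "b i \<in> carrier V" if "i < n" for i using assms that unfolding right_basis_def by auto
  let ?s = "\<lambda>k. {\<Oplus>\<^bsub>V\<^esub>i\<in>{..<k}. b i \<bullet>\<^bsub>V\<^esub> a i |a. a \<in> {..<n} \<rightarrow> carrier D}"
  have step: "(\<Oplus>\<^bsub>V\<^esub>i\<in>{..<Suc k}. b i \<bullet>\<^bsub>V\<^esub> a i) = (\<Oplus>\<^bsub>V\<^esub>i\<in>{..<k}. b i \<bullet>\<^bsub>V\<^esub> a i) \<oplus>\<^bsub>V\<^esub> b k \<bullet>\<^bsub>V\<^esub> a k"
    and cl: "(\<Oplus>\<^bsub>V\<^esub>i\<in>{..<k}. b i \<bullet>\<^bsub>V\<^esub> a i) \<in> carrier V"
    if "a \<in> {..<n} \<rightarrow> carrier D" "k < n" for a k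
  proof -
    have 1: "(\<lambda>i. b i \<bullet>\<^bsub>V\<^esub> a i) \<in> {..<k} \<rightarrow> carrier V" using that bc by (auto simp: rsmult_closed Pi_iff)
    then show 2: "(\<Oplus>\<^bsub>V\<^esub>i\<in>{..<k}. b i \<bullet>\<^bsub>V\<^esub> a i) \<in> carrier V" by (rule V.finsum_closed)
    have 3: "b k \<bullet>\<^bsub>V\<^esub> a k \<in> carrier V" using that bc by (auto simp: rsmult_closed Pi_iff)
    show "(\<Oplus>\<^bsub>V\<^esub>i\<in>{..<Suc k}. b i \<bullet>\<^bsub>V\<^esub> a i) = (\<Oplus>\<^bsub>V\<^esub>i\<in>{..<k}. b i \<bullet>\<^bsub>V\<^esub> a i) \<oplus>\<^bsub>V\<^esub> b k \<bullet>\<^bsub>V\<^esub> a k"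
      unfolding lessThan_Suc using V.finsum_insert[of "{..<k}" k "\<lambda>i. b i \<bullet>\<^bsub>V\<^esub> a i"] 1 2 3
      by (simp add: V.a_comm)
  qed
  have cong: "(\<Oplus>\<^bsub>V\<^esub>i\<in>{..<k}. b i \<bullet>\<^bsub>V\<^esub> a i) = (\<Oplus>\<^bsub>V\<^esub>i\<in>{..<k}. b i \<bullet>\<^bsub>V\<^esub> a' i)"
    if "a' \<in> {..<n} \<rightarrow> carrier D" "k \<le> n" "\<And>i. i < k \<Longrightarrow> a i = a' i" for a a' k
    by (rule V.finsum_cong') (use that bc in \<open>auto simp: rsmult_closed Pi_iff\<close>)
  have "vdim (?s k) k" if "k \<le> n" for k
    using that
  proof (induction k)
    case 0
    have "?s 0 = {\<zero>\<^bsub>V\<^esub>}" by (auto intro!: exI[of _ "\<lambda>_. \<zero>\<^bsub>D\<^esub>"])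
    then show ?case using vdim_zero by simp
  next
    case (Suc k)
    then have k: "k < n" by simp
    have eq: "?s (Suc k) = adjoin (?s k) (b k)"
    proof (intro equalityI subsetI)
      fix y assume "y \<in> ?s (Suc k)"
      then obtain a where a: "a \<in> {..<n} \<rightarrow> carrier D" "y = (\<Oplus>\<^bsub>V\<^esub>i\<in>{..<Suc k}. b i \<bullet>\<^bsub>V\<^esub> a i)" by blast
      show "y \<in> adjoin (?s k) (b k)"
        unfolding a(2) step[OF a(1) k] by (rule adjoinI) (use a k in auto)
    next
      fix y assume "y \<in> adjoin (?s k) (b k)"
      then obtain w c where wc: "w \<in> ?s k" "c \<in> carrier D" "y = w \<oplus>\<^bsub>V\<^esub> b k \<bullet>\<^bsub>V\<^esub> c" by (rule adjoinE)
      then obtain a where a: "a \<in> {..<n} \<rightarrow> carrier D" "w = (\<Oplus>\<^bsub>V\<^esub>i\<in>{..<k}. b i \<bullet>\<^bsub>V\<^esub> a i)" by blast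
      let ?a = "a(k := c)"
      have a': "?a \<in> {..<n} \<rightarrow> carrier D" using a wc by auto
      have "w = (\<Oplus>\<^bsub>V\<^esub>i\<in>{..<k}. b i \<bullet>\<^bsub>V\<^esub> ?a i)" unfolding a(2) by (rule cong[OF a']) (use k in auto)
      then have "y = (\<Oplus>\<^bsub>V\<^esub>i\<in>{..<Suc k}. b i \<bullet>\<^bsub>V\<^esub> ?a i)" using step[OF a' k] wc by simp
      then show "y \<in> ?s (Suc k)" using a' by blast
    qed
    have "b k \<notin> ?s k"
    proof
      assume "b k \<in> ?s k"
      then obtain a where a: "a \<in> {..<n} \<rightarrow> carrier D" "b k = (\<Oplus>\<^bsub>V\<^esub>i\<in>{..<k}. b i \<bullet>\<^bsub>V\<^esub> a i)" by blast
      \<comment> \<open>The supposed expression of \<open>b k\<close> through earlier vectors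
        becomes a nontrivial relation among all \<open>n\<close> basis vectors, with coefficient -1
        at \<open>k\<close> and 0 beyond.\<close>
      let ?a = "\<lambda>i. if i < k then a i else if i = k then \<ominus>\<^bsub>D\<^esub> \<one>\<^bsub>D\<^esub> else \<zero>\<^bsub>D\<^esub>"
      have a': "?a \<in> {..<n} \<rightarrow> carrier D" using a by auto
      have "b k = (\<Oplus>\<^bsub>V\<^esub>i\<in>{..<k}. b i \<bullet>\<^bsub>V\<^esub> ?a i)" unfolding a(2) by (rule cong[OF a']) (use k in auto)
      then have z: "(\<Oplus>\<^bsub>V\<^esub>i\<in>{..<Suc k}. b i \<bullet>\<^bsub>V\<^esub> ?a i) = \<zero>\<^bsub>V\<^esub>"
        using step[OF a' k] bc[OF k] by (simp add: rsmult_minus_one V.r_neg)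
      have "(\<Oplus>\<^bsub>V\<^esub>i\<in>{..<n}. b i \<bullet>\<^bsub>V\<^esub> ?a i) = (\<Oplus>\<^bsub>V\<^esub>i\<in>{..<Suc k}. b i \<bullet>\<^bsub>V\<^esub> ?a i)"
      proof (rule V.add.finprod_mono_neutral_cong_right)
        show "b i \<bullet>\<^bsub>V\<^esub> ?a i = \<zero>\<^bsub>V\<^esub>" if "i \<in> {..<n} - {..<Suc k}" for i using bc that by auto
        show "(\<lambda>i. b i \<bullet>\<^bsub>V\<^esub> ?a i) \<in> {..<n} \<rightarrow> carrier V" using a' bc by (auto simp: rsmult_closed Pi_iff)
      qed (use k in auto)
      then have "(\<Oplus>\<^bsub>V\<^esub>i\<in>{..<n}. b i \<bullet>\<^bsub>V\<^esub> ?a i) = \<zero>\<^bsub>V\<^esub>" using z by simp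
      moreover have "\<forall>a\<in>{..<n} \<rightarrow> carrier D.
        (\<Oplus>\<^bsub>V\<^esub>i\<in>{..<n}. b i \<bullet>\<^bsub>V\<^esub> a i) = \<zero>\<^bsub>V\<^esub> \<longrightarrow> (\<forall>i<n. a i = \<zero>\<^bsub>D\<^esub>)"
        using assms unfolding right_basis_def by blast
      ultimately have "\<forall>i<n. ?a i = \<zero>\<^bsub>D\<^esub>" using bspec[OF _ a'] by fast
      then have "?a k = \<zero>\<^bsub>D\<^esub>" using spec[of "\<lambda>i. i < n \<longrightarrow> ?a i = \<zero>\<^bsub>D\<^esub>" k] k by blast
      then have "\<ominus>\<^bsub>D\<^esub> \<one>\<^bsub>D\<^esub> = \<zero>\<^bsub>D\<^esub>" by simp
      then show False using D.one_not_zero by (metis D.minus_minus D.minus_zero D.one_closed)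
    qed
    then show ?case unfolding eq using vdim_adjoin[of "?s k" k "b k"] Suc bc[OF k] by auto
  qed
  then have "vdim (?s n) n" by simp
  moreover have "?s n = carrier V"
  proof (intro equalityI subsetI)
    fix v assume "v \<in> carrier V"
    then show "v \<in> ?s n" using assms unfolding right_basis_def by blast
  next
    fix v assume "v \<in> ?s n"
    then show "v \<in> carrier V"
      by (auto intro!: V.finsum_closed simp: rsmult_closed Pi_iff bc)
  qed
  ultimately show ?thesis by simp
qed

lemma right_dim_imp_vdim: "right_dim D V n \<Longrightarrow> vdim (carrier V) n"
  unfolding right_dim_def using right_basis_imp_vdim by blast

section \<open>Subspaces as spaces in their own right\<close>

lemma restrict_space:
  assumes "right_subspace D V W"
  shows "right_vector_space D (V\<lparr>carrier := W\<rparr>)"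
proof -
  note W = right_subspaceD[OF assms]
  have "abelian_group (V\<lparr>carrier := W\<rparr>)"
  proof (rule abelian_groupI)
    fix x assume "x \<in> carrier (V\<lparr>carrier := W\<rparr>)"
    then show "\<exists>y\<in>carrier (V\<lparr>carrier := W\<rparr>). y \<oplus>\<^bsub>V\<lparr>carrier := W\<rparr>\<^esub> x = \<zero>\<^bsub>V\<lparr>carrier := W\<rparr>\<^esub>"
      using W by (auto intro!: bexI[of _ "\<ominus>\<^bsub>V\<^esub> x"] simp: V.l_neg)
  qed (use W in \<open>auto simp: V.a_ac\<close>)
  then interpret W: abelian_group "V\<lparr>carrier := W\<rparr>" .
  show ?thesis
    by unfold_locales (use W in \<open>auto simp: rsmult_add_scalar rsmult_add_vector rsmult_assoc rsmult_one\<close>)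
qed

lemma restrict_subspace_iff:
  assumes "right_subspace D V W"
  shows "right_subspace D (V\<lparr>carrier := W\<rparr>) T \<longleftrightarrow> right_subspace D V T \<and> T \<subseteq> W"
proof -
  interpret W: right_vector_space D "V\<lparr>carrier := W\<rparr>" using restrict_space[OF assms] .
  note W = right_subspaceD[OF assms]
  show ?thesis
  proof
    assume T: "right_subspace D (V\<lparr>carrier := W\<rparr>) T"
    show "right_subspace D V T \<and> T \<subseteq> W"
      using W.right_subspaceD[OF T] W by (auto intro!: right_subspaceI)
  next
    assume T: "right_subspace D V T \<and> T \<subseteq> W"
    show "right_subspace D (V\<lparr>carrier := W\<rparr>) T"
      using T right_subspaceD[of T] W by (auto intro!: W.right_subspaceI)
  qed
qed

lemma restrict_adjoin:
  assumes "right_subspace D V W"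
  shows "right_vector_space.adjoin D (V\<lparr>carrier := W\<rparr>) T x = adjoin T x"
  unfolding right_vector_space.adjoin_def[OF restrict_space[OF assms]] adjoin_def by simp

lemma restrict_vdim_iff:
  assumes "right_subspace D V W"
  shows "right_vector_space.vdim D (V\<lparr>carrier := W\<rparr>) T k \<longleftrightarrow> vdim T k \<and> T \<subseteq> W"
proof -
  interpret W: right_vector_space D "V\<lparr>carrier := W\<rparr>" using restrict_space[OF assms] .
  show ?thesis
  proof
    assume "W.vdim T k"
    then show "vdim T k \<and> T \<subseteq> W"
    proof (induction rule: W.vdim.induct)
      case vdim_zero
      then show ?case using vdim.vdim_zero right_subspaceD(2)[OF assms] by simp
    next
      case (vdim_adjoin T k x)
      then show ?case
        using vdim.vdim_adjoin[of T k x] adjoin_least[OF assms, of T x] right_subspaceD(7)[OF assms]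
        by (simp add: restrict_adjoin[OF assms])
    qed
  next
    assume "vdim T k \<and> T \<subseteq> W"
    then have "vdim T k" "T \<subseteq> W" by auto
    then show "W.vdim T k"
    proof (induction rule: vdim.induct)
      case vdim_zero
      then show ?case using W.vdim.vdim_zero by simp
    next
      case (vdim_adjoin T k x)
      have "T \<subseteq> W" "x \<in> W" using vdim_adjoin adjoin_incl[OF vdim_subspace[OF vdim_adjoin(1)] vdim_adjoin(2)] by auto
      then show ?case using W.vdim.vdim_adjoin[of T k x] vdim_adjoin by (simp add: restrict_adjoin[OF assms])
    qed
  qed
qed

end

context two_spaces
begin

text \<open>Modulo \<open>Y\<close> the target is at most a line, so the preimage of
  \<open>Y\<close> is all of \<open>W\<close> or is completed to \<open>W\<close> by a single
  vector.\<close>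

lemma preimage_hyperplane:
  assumes "linear_map D M N f" "M.vdim W k" "right_subspace D N Y" "y \<in> carrier N" "N.adjoin Y y = carrier N"
  shows "\<exists>j. M.vdim {w \<in> W. f w \<in> Y} j \<and> k \<le> Suc j"
proof (cases "{w \<in> W. f w \<in> Y} = W")
  case True
  then show ?thesis using assms by auto
next
  case False
  note f = linear_mapD[OF assms(1)]
  note Ws = M.vdim_subspace[OF assms(2)]
  note W = M.right_subspaceD[OF Ws]
  let ?H = "{w \<in> W. f w \<in> Y}"
  have H: "right_subspace D M ?H" using preimage_subspace[OF assms(1) Ws assms(3)] .
  obtain z where z: "z \<in> W" "f z \<notin> Y" using False by auto
  have fz: "f z \<in> carrier N" using f(1) W(7) z by auto
  have ad: "N.adjoin Y (f z) = carrier N" using N.adjoin_exchange[OF assms(3,4) _ z(2)] assms(5) fz by auto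
  have "W = M.adjoin ?H z"
  proof (intro equalityI subsetI)
    fix w assume w: "w \<in> W"
    then have "f w \<in> N.adjoin Y (f z)" using ad f W by auto
    then obtain v a where va: "v \<in> Y" "a \<in> carrier D" "f w = v \<oplus>\<^bsub>N\<^esub> f z \<bullet>\<^bsub>N\<^esub> a" by (rule N.adjoinE)
    have vc: "v \<in> carrier N" using va N.right_subspaceD(7)[OF assms(3)] by simp
    note c = w z W(7)[OF w] W(7)[OF z(1)] va(2) M.rsmult_closed[OF W(7)[OF z(1)] va(2)]
      N.rsmult_closed[OF fz va(2)]
    have "f (w \<ominus>\<^bsub>M\<^esub> z \<bullet>\<^bsub>M\<^esub> a) = v"
      using c f va vc fz by (simp add: N.minus_eq N.a_assoc N.r_neg)
    then have "w \<ominus>\<^bsub>M\<^esub> z \<bullet>\<^bsub>M\<^esub> a \<in> ?H" using W c va by simp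
    from M.adjoinI[OF this va(2), of z] show "w \<in> M.adjoin ?H z"
      using c by (simp add: M.minus_eq M.a_assoc M.l_neg)
  next
    fix w assume "w \<in> M.adjoin ?H z"
    then show "w \<in> W" using M.adjoin_least[OF Ws _ z(1), of ?H] by auto
  qed
  then show ?thesis using M.vdim_hyperplane[OF assms(2) H, of z] z W by auto
qed

text \<open>Unlike in \<open>rank_nullity\<close>, no dimension of \<open>W\<close> is presupposed:
  the chain of the image is pulled back and placed on top of the kernel. Dimensions of operator
  spaces are obtained this way, from evaluation at a vector.\<close>

lemma rank_nullity_converse:
  assumes "linear_map D M N f" "right_subspace D M W" "N.vdim (f ` W) r" "M.vdim {w \<in> W. f w = \<zero>\<^bsub>N\<^esub>} j"
  shows "M.vdim W (j + r)"
proof -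
  note f = linear_mapD[OF assms(1)]
  note W = M.right_subspaceD[OF assms(2)]
  have "M.vdim {w \<in> W. f w \<in> Y} (j + r)" if "N.vdim Y r" "Y \<subseteq> f ` W" for Y r
    using that
  proof (induction rule: N.vdim.induct)
    case vdim_zero
    then show ?case using assms(4) by simp
  next
    case (vdim_adjoin Y k y)
    note Y = N.vdim_subspace[OF vdim_adjoin(1)]
    note incl = N.adjoin_incl[OF Y vdim_adjoin(2)]
    let ?H = "{w \<in> W. f w \<in> Y}"
    have H: "right_subspace D M ?H" using preimage_subspace[OF assms(1,2) Y] .
    have A: "right_subspace D M {w \<in> W. f w \<in> N.adjoin Y y}"
      using preimage_subspace[OF assms(1,2) N.adjoin_subspace[OF Y vdim_adjoin(2)]] .
    obtain z where z: "z \<in> W" "y = f z" using vdim_adjoin incl by auto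
    have "{w \<in> W. f w \<in> N.adjoin Y y} = M.adjoin ?H z"
    proof (intro equalityI subsetI)
      fix w assume w: "w \<in> {w \<in> W. f w \<in> N.adjoin Y y}"
      then have "f w \<in> N.adjoin Y (f z)" "w \<in> W" using z by auto
      then obtain v a where va: "v \<in> Y" "a \<in> carrier D" "f w = v \<oplus>\<^bsub>N\<^esub> f z \<bullet>\<^bsub>N\<^esub> a" by (blast elim: N.adjoinE)
      have vc: "v \<in> carrier N" using va N.right_subspaceD(7)[OF Y] by simp
      have fz: "f z \<in> carrier N" using z vdim_adjoin by simp
      have w: "w \<in> W" using w by simp
      note c = w z W(7)[OF w] W(7)[OF z(1)] va(2) M.rsmult_closed[OF W(7)[OF z(1)] va(2)]
        N.rsmult_closed[OF fz va(2)]
      have "f (w \<ominus>\<^bsub>M\<^esub> z \<bullet>\<^bsub>M\<^esub> a) = v"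
        using c f va vc fz by (simp add: N.minus_eq N.a_assoc N.r_neg)
      then have "w \<ominus>\<^bsub>M\<^esub> z \<bullet>\<^bsub>M\<^esub> a \<in> ?H" using W c va by simp
      from M.adjoinI[OF this va(2), of z] show "w \<in> M.adjoin ?H z"
        using c by (simp add: M.minus_eq M.a_assoc M.l_neg)
    next
      fix w assume "w \<in> M.adjoin ?H z"
      then show "w \<in> {w \<in> W. f w \<in> N.adjoin Y y}"
        using M.adjoin_least[OF A, of ?H z] incl z by auto
    qed
    then show ?case
      using M.vdim_adjoin[of ?H "j + k" z] vdim_adjoin z W incl by auto
  qed
  from this[OF assms(3)] have "M.vdim {w \<in> W. f w \<in> f ` W} (j + r)" by simp
  moreover have "{w \<in> W. f w \<in> f ` W} = W" by auto
  ultimately show ?thesis by simp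
qed

text \<open>Lifting a chain vector by vector gives a subspace that \<open>f\<close> maps
  isomorphically onto \<open>Y\<close>.\<close>

lemma vdim_lift_image:
  assumes "linear_map D M N f" "right_subspace D M W" "N.vdim Y r" "Y \<subseteq> f ` W"
  shows "\<exists>T. M.vdim T r \<and> T \<subseteq> W \<and> f ` T = Y"
  using assms(3,4)
proof (induction rule: N.vdim.induct)
  case vdim_zero
  have "f ` {\<zero>\<^bsub>M\<^esub>} = {\<zero>\<^bsub>N\<^esub>}" using linear_mapD(4)[OF assms(1)] by auto
  then show ?case using M.vdim_zero M.right_subspaceD(2)[OF assms(2)] by (intro exI[of _ "{\<zero>\<^bsub>M\<^esub>}"]) auto
next
  case (vdim_adjoin Y k y)
  note incl = N.adjoin_incl[OF N.vdim_subspace[OF vdim_adjoin(1)] vdim_adjoin(2)]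
  obtain T where T: "M.vdim T k" "T \<subseteq> W" "f ` T = Y" using vdim_adjoin incl by blast
  obtain t where t: "t \<in> W" "y = f t" using vdim_adjoin incl by auto
  have tc: "t \<in> carrier M" using t M.right_subspaceD(7)[OF assms(2)] by simp
  have "t \<notin> T" using T t vdim_adjoin by auto
  then have "M.vdim (M.adjoin T t) (Suc k)" using M.vdim_adjoin[OF T(1) tc] by simp
  moreover have "f ` M.adjoin T t = N.adjoin Y y" using image_adjoin[OF assms(1) M.vdim_subspace[OF T(1)] tc] T t by simp
  moreover have "M.adjoin T t \<subseteq> W" using M.adjoin_least[OF assms(2) T(2) t(1)] .
  ultimately show ?case by blast
qed

end

section \<open>The central subfield and spaces of operators over it\<close>

locale division_algebra = D?: skew_field D for D :: "('a, 'm) ring_scheme" (structure) +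
  fixes F :: "'a set"
  assumes central: "central_subfield F D"
begin

lemma F_subfield: "subfield F D" and F_center: "F \<subseteq> ring_center D"
  using central unfolding central_subfield_def by auto

lemma F_closed [simp]: "c \<in> F \<Longrightarrow> c \<in> carrier D"
  using F_center unfolding ring_center_def by auto

lemma F_commute: "c \<in> F \<Longrightarrow> x \<in> carrier D \<Longrightarrow> c \<otimes> x = x \<otimes> c"
  using F_center unfolding ring_center_def by auto

lemma F_zero [simp]: "\<zero> \<in> F" and F_one [simp]: "\<one> \<in> F"
  and F_add [simp]: "a \<in> F \<Longrightarrow> b \<in> F \<Longrightarrow> a \<oplus> b \<in> F"
  and F_neg [simp]: "a \<in> F \<Longrightarrow> \<ominus> a \<in> F"
  and F_mult [simp]: "a \<in> F \<Longrightarrow> b \<in> F \<Longrightarrow> a \<otimes> b \<in> F"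
  using subringE[OF subfieldE(1)[OF F_subfield]] by auto

lemma F_minus [simp]: "a \<in> F \<Longrightarrow> b \<in> F \<Longrightarrow> a \<ominus> b \<in> F"
  by (simp add: a_minus_def)

lemma F_inv: "a \<in> F \<Longrightarrow> a \<noteq> \<zero> \<Longrightarrow> inv a \<in> F"
  using subfield_m_inv(1)[OF F_subfield, of a] by auto

lemma F_ring: "ring (D\<lparr>carrier := F\<rparr>)"
  using subring_is_ring[OF subfieldE(1)[OF F_subfield]] .

lemma F_skew_field: "skew_field (D\<lparr>carrier := F\<rparr>)"
proof -
  interpret FD: ring "D\<lparr>carrier := F\<rparr>" using F_ring .
  show ?thesis
    by unfold_locales (use one_not_zero subfield.subfield_Units[OF F_subfield] in auto)
qed

lemma scalar_restriction:
  assumes "right_vector_space D V"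
  shows "right_vector_space (D\<lparr>carrier := F\<rparr>) V"
proof -
  interpret V: right_vector_space D V by fact
  interpret FD: skew_field "D\<lparr>carrier := F\<rparr>" by (rule F_skew_field)
  show ?thesis
    by unfold_locales (auto simp: V.rsmult_closed V.rsmult_add_scalar V.rsmult_add_vector V.rsmult_assoc V.rsmult_one)
qed

end

text \<open>\<open>D\<close> as a right space over itself. Restricting scalars to \<open>F\<close>
  turns the degree \<open>d\<close> and the F-linear maps on \<open>D\<close> into instances of the
  general notions.\<close>

definition regular_space :: "('a, 'm) ring_scheme \<Rightarrow> ('a, 'a) rmodule" where
  "regular_space D = \<lparr>carrier = carrier D, monoid.mult = undefined, one = undefined,
     ring.zero = \<zero>\<^bsub>D\<^esub>, add = add D, rsmult = monoid.mult D\<rparr>"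

lemma regular_space_simps [simp]:
  "carrier (regular_space D) = carrier D" "\<zero>\<^bsub>regular_space D\<^esub> = \<zero>\<^bsub>D\<^esub>"
  "x \<oplus>\<^bsub>regular_space D\<^esub> y = x \<oplus>\<^bsub>D\<^esub> y" "x \<bullet>\<^bsub>regular_space D\<^esub> y = x \<otimes>\<^bsub>D\<^esub> y"
  by (simp_all add: regular_space_def)

lemma (in skew_field) regular_space: "right_vector_space R (regular_space R)"
proof -
  interpret A: abelian_group "regular_space R"
    by (rule abelian_groupI) (auto simp: a_ac intro!: bexI[of _ "\<ominus> x" for x] l_neg)
  show ?thesis by unfold_locales (auto simp: l_distr r_distr m_assoc)
qed

text \<open>Endomorphisms as a right space, so that chains, rank and nullity apply to sets of
  operators. The formula for \<open>rsmult\<close> preserves D-linearity when the scalar is central,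
  and so the space is taken over \<open>D\<lparr>carrier := F\<rparr>\<close>.\<close>

definition End_space ::
  "('a, 'm) ring_scheme \<Rightarrow> ('a, 'b, 'k) rmodule_scheme \<Rightarrow> ('a, 'b \<Rightarrow> 'b) rmodule" where
  "End_space D V = \<lparr>carrier = carrier (End_ring D V), monoid.mult = undefined, one = undefined,
     ring.zero = \<zero>\<^bsub>End_ring D V\<^esub>, add = add (End_ring D V),
     rsmult = (\<lambda>f a. \<lambda>x\<in>carrier V. f x \<bullet>\<^bsub>V\<^esub> a)\<rparr>"

locale algebra_space = division_algebra D F + V: right_vector_space D V
  for D :: "('a, 'm) ring_scheme" (structure) and F :: "'a set"
    and V :: "('a, 'b, 'k) rmodule_scheme"
begin

abbreviation "FD \<equiv> D\<lparr>carrier := F\<rparr>"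
abbreviation "E \<equiv> End_ring D V"
abbreviation "ES \<equiv> End_space D V"

lemma End_carrier:
  "f \<in> carrier E \<longleftrightarrow> f \<in> extensional (carrier V) \<and> linear_map D V V f"
  unfolding End_ring_def linear_map_def PiE_def by auto

lemma End_simps [simp]:
  "x \<in> carrier V \<Longrightarrow> (f \<oplus>\<^bsub>E\<^esub> g) x = f x \<oplus>\<^bsub>V\<^esub> g x"
  "x \<in> carrier V \<Longrightarrow> \<zero>\<^bsub>E\<^esub> x = \<zero>\<^bsub>V\<^esub>"
  "x \<in> carrier V \<Longrightarrow> \<one>\<^bsub>E\<^esub> x = x"
  "x \<in> carrier V \<Longrightarrow> (f \<otimes>\<^bsub>E\<^esub> g) x = f (g x)"
  by (auto simp: End_ring_def compose_def)

lemma End_space_simps [simp]: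
  "carrier ES = carrier E" "\<zero>\<^bsub>ES\<^esub> = \<zero>\<^bsub>E\<^esub>" "f \<oplus>\<^bsub>ES\<^esub> g = f \<oplus>\<^bsub>E\<^esub> g"
  "x \<in> carrier V \<Longrightarrow> (f \<bullet>\<^bsub>ES\<^esub> a) x = f x \<bullet>\<^bsub>V\<^esub> a"
  by (auto simp: End_space_def)

lemma EndD:
  assumes "f \<in> carrier E"
  shows "\<And>x. x \<in> carrier V \<Longrightarrow> f x \<in> carrier V"
    "\<And>x y. x \<in> carrier V \<Longrightarrow> y \<in> carrier V \<Longrightarrow> f (x \<oplus>\<^bsub>V\<^esub> y) = f x \<oplus>\<^bsub>V\<^esub> f y"
    "\<And>x a. x \<in> carrier V \<Longrightarrow> a \<in> carrier D \<Longrightarrow> f (x \<bullet>\<^bsub>V\<^esub> a) = f x \<bullet>\<^bsub>V\<^esub> a"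
    "f \<zero>\<^bsub>V\<^esub> = \<zero>\<^bsub>V\<^esub>"
    "\<And>x. x \<in> carrier V \<Longrightarrow> f (\<ominus>\<^bsub>V\<^esub> x) = \<ominus>\<^bsub>V\<^esub> f x"
    "\<And>x y. x \<in> carrier V \<Longrightarrow> y \<in> carrier V \<Longrightarrow> f (x \<ominus>\<^bsub>V\<^esub> y) = f x \<ominus>\<^bsub>V\<^esub> f y"
    "f \<in> extensional (carrier V)"
proof -
  interpret two_spaces D V V by unfold_locales
  have f: "linear_map D V V f" "f \<in> extensional (carrier V)" using assms End_carrier by auto
  show "f \<in> extensional (carrier V)" by fact
  show "\<And>x. x \<in> carrier V \<Longrightarrow> f x \<in> carrier V"
    "\<And>x y. x \<in> carrier V \<Longrightarrow> y \<in> carrier V \<Longrightarrow> f (x \<oplus>\<^bsub>V\<^esub> y) = f x \<oplus>\<^bsub>V\<^esub> f y"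
    "\<And>x a. x \<in> carrier V \<Longrightarrow> a \<in> carrier D \<Longrightarrow> f (x \<bullet>\<^bsub>V\<^esub> a) = f x \<bullet>\<^bsub>V\<^esub> a"
    "f \<zero>\<^bsub>V\<^esub> = \<zero>\<^bsub>V\<^esub>"
    "\<And>x. x \<in> carrier V \<Longrightarrow> f (\<ominus>\<^bsub>V\<^esub> x) = \<ominus>\<^bsub>V\<^esub> f x"
    "\<And>x y. x \<in> carrier V \<Longrightarrow> y \<in> carrier V \<Longrightarrow> f (x \<ominus>\<^bsub>V\<^esub> y) = f x \<ominus>\<^bsub>V\<^esub> f y"
    using linear_mapD[OF f(1)] by auto
qed

lemma EndI:
  assumes "f \<in> extensional (carrier V)" "\<And>x. x \<in> carrier V \<Longrightarrow> f x \<in> carrier V"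
    "\<And>x y. x \<in> carrier V \<Longrightarrow> y \<in> carrier V \<Longrightarrow> f (x \<oplus>\<^bsub>V\<^esub> y) = f x \<oplus>\<^bsub>V\<^esub> f y"
    "\<And>x a. x \<in> carrier V \<Longrightarrow> a \<in> carrier D \<Longrightarrow> f (x \<bullet>\<^bsub>V\<^esub> a) = f x \<bullet>\<^bsub>V\<^esub> a"
  shows "f \<in> carrier E"
  using assms unfolding End_carrier linear_map_def by auto

lemma End_eqI:
  assumes "f \<in> carrier E" "g \<in> carrier E" "\<And>x. x \<in> carrier V \<Longrightarrow> f x = g x"
  shows "f = g"
  using assms EndD(7) extensionalityI by blast

lemma End_add_closed: "f \<in> carrier E \<Longrightarrow> g \<in> carrier E \<Longrightarrow> f \<oplus>\<^bsub>E\<^esub> g \<in> carrier E"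
  by (rule EndI) (auto simp: EndD V.a_ac V.rsmult_add_vector V.rsmult_closed, auto simp: End_ring_def)

lemma End_zero_closed: "\<zero>\<^bsub>E\<^esub> \<in> carrier E"
  by (rule EndI) (auto simp: V.rsmult_closed, auto simp: End_ring_def)

lemma End_one_closed: "\<one>\<^bsub>E\<^esub> \<in> carrier E"
  by (rule EndI) (auto simp: V.rsmult_closed, auto simp: End_ring_def)

lemma End_mult_closed: "f \<in> carrier E \<Longrightarrow> g \<in> carrier E \<Longrightarrow> f \<otimes>\<^bsub>E\<^esub> g \<in> carrier E"
  by (rule EndI) (auto simp: EndD V.rsmult_closed, auto simp: End_ring_def)

lemma End_smult_closed:
  assumes "f \<in> carrier E" "c \<in> F"
  shows "f \<bullet>\<^bsub>ES\<^esub> c \<in> carrier E"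
proof (rule EndI)
  show "f \<bullet>\<^bsub>ES\<^esub> c \<in> extensional (carrier V)" by (auto simp: End_space_def)
  show "(f \<bullet>\<^bsub>ES\<^esub> c) (x \<bullet>\<^bsub>V\<^esub> a) = (f \<bullet>\<^bsub>ES\<^esub> c) x \<bullet>\<^bsub>V\<^esub> a" if "x \<in> carrier V" "a \<in> carrier D" for x a
    using that assms EndD[OF assms(1)] F_commute[OF assms(2) that(2)]
    by (simp add: V.rsmult_closed V.rsmult_assoc[symmetric])
qed (use assms EndD[OF assms(1)] in \<open>auto simp: V.rsmult_closed V.rsmult_add_vector\<close>)

lemma End_ring: "ring E"
proof (rule ringI)
  show "abelian_group E"
  proof (rule abelian_groupI)
    fix f assume f: "f \<in> carrier E"
    let ?g = "\<lambda>x\<in>carrier V. \<ominus>\<^bsub>V\<^esub> f x"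
    have g: "?g \<in> carrier E"
      by (rule EndI) (auto simp: EndD[OF f] V.rsmult_closed V.minus_add V.rsmult_l_minus V.a_comm)
    show "\<exists>g\<in>carrier E. g \<oplus>\<^bsub>E\<^esub> f = \<zero>\<^bsub>E\<^esub>"
      by (rule bexI[OF _ g], rule End_eqI) (use f g in \<open>auto simp: End_add_closed End_zero_closed EndD V.l_neg\<close>)
  qed (auto intro!: End_eqI simp: End_add_closed End_zero_closed EndD V.a_ac)
  show "monoid E"
    by (rule monoidI) (auto intro!: End_eqI simp: End_mult_closed End_one_closed EndD)
qed (auto intro!: End_eqI simp: End_mult_closed End_add_closed EndD)

lemma End_minus_apply:
  assumes "f \<in> carrier E" "g \<in> carrier E" "x \<in> carrier V"
  shows "(f \<ominus>\<^bsub>E\<^esub> g) x = f x \<ominus>\<^bsub>V\<^esub> g x" "(\<ominus>\<^bsub>E\<^esub> g) x = \<ominus>\<^bsub>V\<^esub> g x"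
proof -
  interpret R: ring E by (rule End_ring)
  have "(\<ominus>\<^bsub>E\<^esub> g) x \<oplus>\<^bsub>V\<^esub> g x = (\<ominus>\<^bsub>E\<^esub> g \<oplus>\<^bsub>E\<^esub> g) x" using assms by simp
  also have "\<dots> = \<zero>\<^bsub>V\<^esub>" using assms by (simp add: R.l_neg)
  finally show *: "(\<ominus>\<^bsub>E\<^esub> g) x = \<ominus>\<^bsub>V\<^esub> g x"
    using assms EndD(1) R.a_inv_closed by (metis V.minus_equality)
  then show "(f \<ominus>\<^bsub>E\<^esub> g) x = f x \<ominus>\<^bsub>V\<^esub> g x" using assms by (simp add: a_minus_def)
qed

lemma End_space: "right_vector_space FD ES"
proof -
  interpret FD: skew_field FD by (rule F_skew_field)
  interpret R: ring E by (rule End_ring)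
  interpret A: abelian_group ES
    by (rule abelian_groupI) (auto simp: R.a_ac intro!: bexI[of _ "\<ominus>\<^bsub>E\<^esub> f" for f] R.l_neg)
  show ?thesis
    by unfold_locales
      (auto intro!: End_eqI simp: End_smult_closed EndD V.rsmult_add_scalar V.rsmult_add_vector
         V.rsmult_assoc V.rsmult_one)
qed

end

sublocale algebra_space \<subseteq> VF: right_vector_space "D\<lparr>carrier := F\<rparr>" V
  by (rule scalar_restriction) unfold_locales

sublocale algebra_space \<subseteq> EF: right_vector_space "D\<lparr>carrier := F\<rparr>" "End_space D V"
  by (rule End_space)

sublocale algebra_space \<subseteq> ev: two_spaces "D\<lparr>carrier := F\<rparr>" "End_space D V" V
  by unfold_locales

section \<open>Decompositions along hyperplanes\<close>

text \<open>The decomposition V = W + x K, where K is the skew field of scalars. It is instantiated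
  over \<open>D\<close> with a D-hyperplane and over \<open>F\<close> with an F-hyperplane; in the
  latter case \<open>coord\<close> is an F-linear form.\<close>

locale complement = right_vector_space D V
  for D :: "('a, 'm) ring_scheme" (structure) and V :: "('a, 'b, 'k) rmodule_scheme" +
  fixes W x
  assumes W: "right_subspace D V W" and xV: "x \<in> carrier V" and xW: "x \<notin> W"
    and adjoin_eq: "adjoin W x = carrier V"
begin

definition "proj y = (SOME w. w \<in> W \<and> (\<exists>a\<in>carrier D. y = w \<oplus>\<^bsub>V\<^esub> x \<bullet>\<^bsub>V\<^esub> a))"
definition "coord y = (SOME a. a \<in> carrier D \<and> (\<exists>w\<in>W. y = w \<oplus>\<^bsub>V\<^esub> x \<bullet>\<^bsub>V\<^esub> a))"

lemmas Ws = right_subspaceD[OF W]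

lemma proj_coord_eq:
  assumes "w \<in> W" "a \<in> carrier D"
  shows "proj (w \<oplus>\<^bsub>V\<^esub> x \<bullet>\<^bsub>V\<^esub> a) = w" "coord (w \<oplus>\<^bsub>V\<^esub> x \<bullet>\<^bsub>V\<^esub> a) = a"
proof -
  note u = adjoin_unique[OF W xV xW]
  show "proj (w \<oplus>\<^bsub>V\<^esub> x \<bullet>\<^bsub>V\<^esub> a) = w" unfolding proj_def
    by (rule some_equality) (use assms u in blast)+
  show "coord (w \<oplus>\<^bsub>V\<^esub> x \<bullet>\<^bsub>V\<^esub> a) = a" unfolding coord_def
    by (rule some_equality) (use assms u in blast)+
qed

lemma decomp:
  assumes "y \<in> carrier V"
  shows "proj y \<in> W" "coord y \<in> carrier D" "y = proj y \<oplus>\<^bsub>V\<^esub> x \<bullet>\<^bsub>V\<^esub> coord y" "proj y \<in> carrier V"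
proof -
  have "y \<in> adjoin W x" using assms adjoin_eq by simp
  then obtain w a where wa: "w \<in> W" "a \<in> carrier D" "y = w \<oplus>\<^bsub>V\<^esub> x \<bullet>\<^bsub>V\<^esub> a" by (rule adjoinE)
  show "proj y \<in> W" "coord y \<in> carrier D" "y = proj y \<oplus>\<^bsub>V\<^esub> x \<bullet>\<^bsub>V\<^esub> coord y" "proj y \<in> carrier V"
    using wa proj_coord_eq[OF wa(1,2)] Ws(7) by auto
qed

lemma proj_coord_add:
  assumes "y \<in> carrier V" "z \<in> carrier V"
  shows "proj (y \<oplus>\<^bsub>V\<^esub> z) = proj y \<oplus>\<^bsub>V\<^esub> proj z" "coord (y \<oplus>\<^bsub>V\<^esub> z) = coord y \<oplus>\<^bsub>D\<^esub> coord z"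
proof -
  note d = decomp[OF assms(1)] decomp[OF assms(2)]
  have "y \<oplus>\<^bsub>V\<^esub> z = (proj y \<oplus>\<^bsub>V\<^esub> x \<bullet>\<^bsub>V\<^esub> coord y) \<oplus>\<^bsub>V\<^esub> (proj z \<oplus>\<^bsub>V\<^esub> x \<bullet>\<^bsub>V\<^esub> coord z)" using d by simp
  also have "\<dots> = (proj y \<oplus>\<^bsub>V\<^esub> proj z) \<oplus>\<^bsub>V\<^esub> x \<bullet>\<^bsub>V\<^esub> (coord y \<oplus>\<^bsub>D\<^esub> coord z)"
    using d(1,2,4-6,8) xV by (simp add: rsmult_add_scalar V.a_ac rsmult_closed)
  finally show "proj (y \<oplus>\<^bsub>V\<^esub> z) = proj y \<oplus>\<^bsub>V\<^esub> proj z" "coord (y \<oplus>\<^bsub>V\<^esub> z) = coord y \<oplus>\<^bsub>D\<^esub> coord z"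
    using proj_coord_eq[of "proj y \<oplus>\<^bsub>V\<^esub> proj z" "coord y \<oplus>\<^bsub>D\<^esub> coord z"] d Ws(3) by auto
qed

lemma proj_coord_smult:
  assumes "y \<in> carrier V" "c \<in> carrier D"
  shows "proj (y \<bullet>\<^bsub>V\<^esub> c) = proj y \<bullet>\<^bsub>V\<^esub> c" "coord (y \<bullet>\<^bsub>V\<^esub> c) = coord y \<otimes>\<^bsub>D\<^esub> c"
proof -
  note d = decomp[OF assms(1)]
  have "y \<bullet>\<^bsub>V\<^esub> c = (proj y \<oplus>\<^bsub>V\<^esub> x \<bullet>\<^bsub>V\<^esub> coord y) \<bullet>\<^bsub>V\<^esub> c" using d by simp
  also have "\<dots> = proj y \<bullet>\<^bsub>V\<^esub> c \<oplus>\<^bsub>V\<^esub> x \<bullet>\<^bsub>V\<^esub> (coord y \<otimes>\<^bsub>D\<^esub> c)"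
    using d(1,2,4) xV assms by (simp add: rsmult_add_vector rsmult_assoc rsmult_closed)
  finally show "proj (y \<bullet>\<^bsub>V\<^esub> c) = proj y \<bullet>\<^bsub>V\<^esub> c" "coord (y \<bullet>\<^bsub>V\<^esub> c) = coord y \<otimes>\<^bsub>D\<^esub> c"
    using proj_coord_eq[of "proj y \<bullet>\<^bsub>V\<^esub> c" "coord y \<otimes>\<^bsub>D\<^esub> c"] d Ws(4) assms by auto
qed

lemma proj_W: assumes "w \<in> W" shows "proj w = w" "coord w = \<zero>\<^bsub>D\<^esub>"
  using proj_coord_eq[OF assms, of "\<zero>\<^bsub>D\<^esub>"] xV Ws(7)[OF assms] by auto

lemma proj_x: "proj x = \<zero>\<^bsub>V\<^esub>" "coord x = \<one>\<^bsub>D\<^esub>"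
  using proj_coord_eq[OF Ws(2), of "\<one>\<^bsub>D\<^esub>"] xV rsmult_one[OF xV] by auto

lemma coord_zero_iff: "y \<in> carrier V \<Longrightarrow> coord y = \<zero>\<^bsub>D\<^esub> \<longleftrightarrow> y \<in> W"
  using decomp[of y] proj_W xV by (metis V.r_zero rsmult_r_null)

end

sublocale division_algebra \<subseteq> RF: right_vector_space "D\<lparr>carrier := F\<rparr>" "regular_space D"
  by (rule scalar_restriction[OF regular_space])

text \<open>The library puts scalars on the left, \<open>vdim\<close> on the right; for central
  \<open>F\<close> both give the same one-vector extensions.\<close>

lemma (in division_algebra) dimension_iff_vdim:
  "dimension k F P \<longleftrightarrow> RF.vdim P k"
proof -
  have ext: "line_extension F v T = RF.adjoin T v" if "v \<in> carrier D" "T \<subseteq> carrier D" for v T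
  proof (intro equalityI subsetI)
    fix z assume "z \<in> line_extension F v T"
    then obtain c t where ct: "c \<in> F" "t \<in> T" "z = c \<otimes> v \<oplus> t" unfolding line_extension_mem_iff by blast
    then have "z = t \<oplus>\<^bsub>regular_space D\<^esub> v \<bullet>\<^bsub>regular_space D\<^esub> c"
      using that F_commute[OF ct(1) that(1)] by (simp add: a_comm subset_iff)
    then show "z \<in> RF.adjoin T v" using RF.adjoinI[OF ct(2)] ct(1) by simp
  next
    fix z assume "z \<in> RF.adjoin T v"
    then obtain t c where ct: "t \<in> T" "c \<in> F" "z = t \<oplus> v \<otimes> c" by (rule RF.adjoinE) auto
    then have "z = c \<otimes> v \<oplus> t" using that F_commute[OF ct(2) that(1)] by (simp add: a_comm subset_iff)
    then show "z \<in> line_extension F v T" unfolding line_extension_mem_iff using ct by blast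
  qed
  have "RF.vdim P k" if "dimension k K P" "K = F" for K
    using that
  proof (induction rule: dimension.induct)
    case (zero_dim K)
    then show ?case using RF.vdim_zero by simp
  next
    case (Suc_dim v T n K)
    then have "RF.vdim T n" by simp
    then show ?case
      using RF.vdim_adjoin[of T n v] ext[of v T] Suc_dim RF.right_subspaceD(1)[OF RF.vdim_subspace] by simp
  qed
  moreover have "dimension k F P" if "RF.vdim P k"
    using that
  proof (induction rule: RF.vdim.induct)
    case vdim_zero
    then show ?case by auto
  next
    case (vdim_adjoin T k x)
    then show ?case
      using Suc_dim[of x T k F] ext[of x T] RF.right_subspaceD(1)[OF RF.vdim_subspace[OF vdim_adjoin(1)]] by simp
  qed
  ultimately show ?thesis by blast
qed

context algebra_space
begin

lemma scalars_mult:
  assumes "f \<in> carrier E" "c \<in> F"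
  shows "(\<lambda>y\<in>carrier V. y \<bullet>\<^bsub>V\<^esub> c) \<otimes>\<^bsub>E\<^esub> f = f \<bullet>\<^bsub>ES\<^esub> c"
  using EndD(1)[OF assms(1)] by (auto simp: End_ring_def End_space_def compose_def)

lemma End_dimension_iff_vdim:
  "End_dimension D F V k S \<longleftrightarrow> EF.vdim S k"
proof -
  interpret R: ring E by (rule End_ring)
  have ext: "R.line_extension (scalars F V) v T = EF.adjoin T v" if "v \<in> carrier E" "T \<subseteq> carrier E" for v T
  proof (intro equalityI subsetI)
    fix z assume "z \<in> R.line_extension (scalars F V) v T"
    then obtain c t where ct: "c \<in> F" "t \<in> T" "z = (\<lambda>y\<in>carrier V. y \<bullet>\<^bsub>V\<^esub> c) \<otimes>\<^bsub>E\<^esub> v \<oplus>\<^bsub>E\<^esub> t"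
      unfolding R.line_extension_mem_iff scalars_def by blast
    then have "z = t \<oplus>\<^bsub>ES\<^esub> v \<bullet>\<^bsub>ES\<^esub> c"
      using that by (simp add: scalars_mult R.a_comm subset_iff End_smult_closed)
    then show "z \<in> EF.adjoin T v" using EF.adjoinI[OF ct(2)] ct(1) by simp
  next
    fix z assume "z \<in> EF.adjoin T v"
    then obtain t c where ct: "t \<in> T" "c \<in> F" "z = t \<oplus>\<^bsub>E\<^esub> v \<bullet>\<^bsub>ES\<^esub> c" by (rule EF.adjoinE) auto
    then have "z = (\<lambda>y\<in>carrier V. y \<bullet>\<^bsub>V\<^esub> c) \<otimes>\<^bsub>E\<^esub> v \<oplus>\<^bsub>E\<^esub> t"
      using that by (simp add: scalars_mult R.a_comm subset_iff End_smult_closed)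
    then show "z \<in> R.line_extension (scalars F V) v T"
      unfolding R.line_extension_mem_iff scalars_def using ct by blast
  qed
  have "EF.vdim S k" if "R.dimension k K S" "K = scalars F V" for K
    using that
  proof (induction rule: R.dimension.induct)
    case (zero_dim K)
    then show ?case using EF.vdim_zero by simp
  next
    case (Suc_dim v T n K)
    then have "EF.vdim T n" by simp
    then show ?case
      using EF.vdim_adjoin[of T n v] ext[of v T] Suc_dim EF.right_subspaceD(1)[OF EF.vdim_subspace] by simp
  qed
  moreover have "R.dimension k (scalars F V) S" if "EF.vdim S k"
    using that
  proof (induction rule: EF.vdim.induct)
    case vdim_zero
    then show ?case by auto
  next
    case (vdim_adjoin T k x)
    then show ?case
      using R.Suc_dim[of x T k "scalars F V"] ext[of x T] EF.right_subspaceD(1)[OF EF.vdim_subspace[OF vdim_adjoin(1)]] by simp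
  qed
  ultimately show ?thesis by blast
qed

lemma End_subspace_iff:
  "End_subspace D F V S \<longleftrightarrow> right_subspace FD ES S"
proof -
  interpret R: ring E by (rule End_ring)
  show ?thesis
  proof
    assume "End_subspace D F V S"
    then interpret S: subalgebra "scalars F V" S E .
    have sub: "S \<subseteq> carrier E" using S.subset by simp
    show "right_subspace FD ES S"
    proof (rule EF.right_subspaceI)
      show "S \<subseteq> carrier ES" using sub by simp
      show "\<zero>\<^bsub>ES\<^esub> \<in> S" using S.one_closed by simp
      show "f \<oplus>\<^bsub>ES\<^esub> g \<in> S" if "f \<in> S" "g \<in> S" for f g using S.m_closed[OF that] by simp
      show "f \<bullet>\<^bsub>ES\<^esub> c \<in> S" if "f \<in> S" "c \<in> carrier FD" for f c
      proof -
        have "(\<lambda>y\<in>carrier V. y \<bullet>\<^bsub>V\<^esub> c) \<in> scalars F V" using that(2) unfolding scalars_def by simp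
        from S.smult_closed[OF this that(1)] show ?thesis
          using scalars_mult[OF subsetD[OF sub that(1)], of c] that(2) by simp
      qed
    qed
  next
    assume S: "right_subspace FD ES S"
    note Ss = EF.right_subspaceD[OF S]
    have "subgroup S (add_monoid E)"
    proof (rule R.add.subgroupI)
      show "S \<subseteq> carrier E" using Ss(1) by simp
      show "S \<noteq> {}" using Ss(2) by blast
      fix f g assume f: "f \<in> S" and g: "g \<in> S"
      show "f \<oplus>\<^bsub>E\<^esub> g \<in> S" using Ss(3)[OF f g] by simp
      have "\<ominus>\<^bsub>ES\<^esub> f = \<ominus>\<^bsub>E\<^esub> f"
      proof -
        have "(\<ominus>\<^bsub>E\<^esub> f) \<oplus>\<^bsub>ES\<^esub> f = \<zero>\<^bsub>ES\<^esub>" using Ss(7)[OF f] by (simp add: R.l_neg)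
        then show ?thesis using EF.V.minus_equality[of "\<ominus>\<^bsub>E\<^esub> f" f] Ss(7)[OF f] by simp
      qed
      then show "\<ominus>\<^bsub>E\<^esub> f \<in> S" using Ss(5)[OF f] by simp
    qed
    then show "End_subspace D F V S"
    proof (intro subalgebra.intro subalgebra_axioms.intro)
      show "k \<otimes>\<^bsub>E\<^esub> v \<in> S" if k: "k \<in> scalars F V" and v: "v \<in> S" for k v
      proof -
        obtain c where c: "c \<in> F" "k = (\<lambda>y\<in>carrier V. y \<bullet>\<^bsub>V\<^esub> c)" using k unfolding scalars_def by auto
        have "v \<in> carrier E" using Ss(7)[OF v] by simp
        then show ?thesis using scalars_mult[of v c] c Ss(4)[OF v, of c] by simp
      qed
    qed
  qed
qed

lemma ev_linear: "y \<in> carrier V \<Longrightarrow> linear_map FD ES V (\<lambda>u. u y)"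
  unfolding linear_map_def by (auto simp: EndD)

text \<open>A chain of \<open>P\<close> is carried to the line of \<open>x\<close> by multiplication
  and stacked on \<open>W\<close>. Each step is proper because a D-subspace without \<open>x\<close>
  meets the line of \<open>x\<close> only in 0. With \<open>P\<close> all of \<open>D\<close>, one
  D-step is worth \<open>d\<close> F-steps.\<close>

lemma vdim_add_line:
  assumes "right_subspace D V W" "x \<in> carrier V" "x \<notin> W" "VF.vdim W k" "RF.vdim P j"
  shows "VF.vdim {w \<oplus>\<^bsub>V\<^esub> x \<bullet>\<^bsub>V\<^esub> p |w p. w \<in> W \<and> p \<in> P} (k + j)"
  using assms(5)
proof (induction rule: RF.vdim.induct)
  case vdim_zero
  have "{w \<oplus>\<^bsub>V\<^esub> x \<bullet>\<^bsub>V\<^esub> p |w p. w \<in> W \<and> p \<in> {\<zero>\<^bsub>regular_space D\<^esub>}} = W"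
  proof (intro equalityI subsetI)
    fix w assume "w \<in> W"
    then show "w \<in> {w \<oplus>\<^bsub>V\<^esub> x \<bullet>\<^bsub>V\<^esub> p |w p. w \<in> W \<and> p \<in> {\<zero>\<^bsub>regular_space D\<^esub>}}"
      using assms(2) V.right_subspaceD(7)[OF assms(1)] by (intro CollectI exI[of _ w] exI[of _ "\<zero>\<^bsub>D\<^esub>"]) simp
  qed (use assms(2) V.right_subspaceD(7)[OF assms(1)] in auto)
  then show ?case using assms(4) by simp
next
  case (vdim_adjoin P j c)
  note W = V.right_subspaceD[OF assms(1)]
  let ?T = "\<lambda>P. {w \<oplus>\<^bsub>V\<^esub> x \<bullet>\<^bsub>V\<^esub> p |w p. w \<in> W \<and> p \<in> P}"
  have c: "c \<in> carrier D" using vdim_adjoin by simp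
  have Pc: "p \<in> carrier D" if "p \<in> P" for p
    using RF.right_subspaceD(7)[OF RF.vdim_subspace[OF vdim_adjoin(1)] that] by simp
  have eq: "?T (RF.adjoin P c) = VF.adjoin (?T P) (x \<bullet>\<^bsub>V\<^esub> c)"
  proof (intro equalityI subsetI)
    fix z assume "z \<in> ?T (RF.adjoin P c)"
    then obtain w q where wq: "w \<in> W" "q \<in> RF.adjoin P c" "z = w \<oplus>\<^bsub>V\<^esub> x \<bullet>\<^bsub>V\<^esub> q" by blast
    from wq(2) obtain p a where pa: "p \<in> P" "a \<in> F" "q = p \<oplus>\<^bsub>D\<^esub> c \<otimes>\<^bsub>D\<^esub> a" by (rule RF.adjoinE) auto
    have "z = (w \<oplus>\<^bsub>V\<^esub> x \<bullet>\<^bsub>V\<^esub> p) \<oplus>\<^bsub>V\<^esub> (x \<bullet>\<^bsub>V\<^esub> c) \<bullet>\<^bsub>V\<^esub> a"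
      unfolding wq(3) pa(3) using wq pa c Pc W(7) assms(2)
      by (simp add: V.rsmult_add_scalar V.rsmult_assoc V.rsmult_closed V.a_ac)
    then show "z \<in> VF.adjoin (?T P) (x \<bullet>\<^bsub>V\<^esub> c)" using VF.adjoinI[of "w \<oplus>\<^bsub>V\<^esub> x \<bullet>\<^bsub>V\<^esub> p" "?T P" a] wq pa by auto
  next
    fix z assume "z \<in> VF.adjoin (?T P) (x \<bullet>\<^bsub>V\<^esub> c)"
    then obtain y a where ya: "y \<in> ?T P" "a \<in> F" "z = y \<oplus>\<^bsub>V\<^esub> (x \<bullet>\<^bsub>V\<^esub> c) \<bullet>\<^bsub>V\<^esub> a" by (rule VF.adjoinE) auto
    then obtain w p where wp: "w \<in> W" "p \<in> P" "y = w \<oplus>\<^bsub>V\<^esub> x \<bullet>\<^bsub>V\<^esub> p" by blast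
    have "z = w \<oplus>\<^bsub>V\<^esub> x \<bullet>\<^bsub>V\<^esub> (p \<oplus>\<^bsub>D\<^esub> c \<otimes>\<^bsub>D\<^esub> a)"
      unfolding ya(3) wp(3) using ya wp c Pc W(7) assms(2)
      by (simp add: V.rsmult_add_scalar V.rsmult_assoc V.rsmult_closed V.a_ac)
    moreover have "p \<oplus>\<^bsub>D\<^esub> c \<otimes>\<^bsub>D\<^esub> a \<in> RF.adjoin P c" using RF.adjoinI[OF wp(2), of a c] ya by simp
    ultimately show "z \<in> ?T (RF.adjoin P c)" using wp by blast
  qed
  have "x \<bullet>\<^bsub>V\<^esub> c \<notin> ?T P"
  proof
    assume "x \<bullet>\<^bsub>V\<^esub> c \<in> ?T P"
    then obtain w p where wp: "w \<in> W" "p \<in> P" "x \<bullet>\<^bsub>V\<^esub> c = w \<oplus>\<^bsub>V\<^esub> x \<bullet>\<^bsub>V\<^esub> p" by blast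
    moreover have "\<zero>\<^bsub>V\<^esub> \<oplus>\<^bsub>V\<^esub> x \<bullet>\<^bsub>V\<^esub> c = x \<bullet>\<^bsub>V\<^esub> c" using assms(2) c by (simp add: V.rsmult_closed)
    ultimately have "c = p" using V.adjoin_unique[OF assms(1-3) W(2) wp(1) c Pc[OF wp(2)]] by simp
    then show False using wp vdim_adjoin by simp
  qed
  then show ?case
    unfolding eq using VF.vdim_adjoin[OF vdim_adjoin(4), of "x \<bullet>\<^bsub>V\<^esub> c"] c assms(2) by (simp add: V.rsmult_closed)
qed

lemma vdim_F_of_vdim_D:
  assumes "V.vdim W k" "RF.vdim (carrier D) d"
  shows "VF.vdim W (k * d)"
  using assms(1)
proof (induction rule: V.vdim.induct)
  case vdim_zero
  then show ?case using VF.vdim_zero by simp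
next
  case (vdim_adjoin W k x)
  then show ?case
    using vdim_add_line[OF V.vdim_subspace[OF vdim_adjoin(1)] vdim_adjoin(2,3,4) assms(2)]
    unfolding V.adjoin_def by (simp add: add.commute)
qed

text \<open>Each vector \<open>c\<close> in a chain of \<open>P\<close> adds one condition, that v c
  lie in \<open>Y\<close>; this is the preimage of \<open>Y\<close> under an F-linear map and costs
  at most one dimension. With \<open>P\<close> all of \<open>D\<close> it bounds the codimension of
  the largest D-subspace inside \<open>Y\<close> by \<open>d\<close>.\<close>

lemma vdim_conductor:
  assumes "right_subspace FD V Y" "y \<in> carrier V" "VF.adjoin Y y = carrier V"
    "VF.vdim (carrier V) N" "RF.vdim P j"
  shows "\<exists>i. VF.vdim {v \<in> carrier V. \<forall>p\<in>P. v \<bullet>\<^bsub>V\<^esub> p \<in> Y} i \<and> N \<le> i + j"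
  using assms(5)
proof (induction rule: RF.vdim.induct)
  case vdim_zero
  have "{v \<in> carrier V. \<forall>p\<in>{\<zero>\<^bsub>regular_space D\<^esub>}. v \<bullet>\<^bsub>V\<^esub> p \<in> Y} = carrier V"
    using VF.right_subspaceD(2)[OF assms(1)] by auto
  then show ?case using assms(4) by auto
next
  case (vdim_adjoin P j c)
  interpret VV: two_spaces FD V V by unfold_locales
  let ?Q = "\<lambda>P. {v \<in> carrier V. \<forall>p\<in>P. v \<bullet>\<^bsub>V\<^esub> p \<in> Y}"
  have c: "c \<in> carrier D" using vdim_adjoin by simp
  note P = RF.vdim_subspace[OF vdim_adjoin(1)]
  have Pc: "p \<in> carrier D" if "p \<in> P" for p
    using RF.right_subspaceD(7)[OF P that] by simp
  note Y = VF.right_subspaceD[OF assms(1)]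
  obtain i where i: "VF.vdim (?Q P) i" "N \<le> i + j" using vdim_adjoin by auto
  have lin: "linear_map FD V V (\<lambda>v. v \<bullet>\<^bsub>V\<^esub> c)"
    unfolding linear_map_def using c F_commute[OF _ c]
    by (auto simp: V.rsmult_closed V.rsmult_add_vector V.rsmult_assoc[symmetric])
  have "{v \<in> ?Q P. v \<bullet>\<^bsub>V\<^esub> c \<in> Y} = ?Q (RF.adjoin P c)"
  proof (intro equalityI subsetI)
    fix v assume v: "v \<in> {v \<in> ?Q P. v \<bullet>\<^bsub>V\<^esub> c \<in> Y}"
    have "v \<bullet>\<^bsub>V\<^esub> q \<in> Y" if "q \<in> RF.adjoin P c" for q
    proof -
      from that obtain p a where pa: "p \<in> P" "a \<in> F" "q = p \<oplus>\<^bsub>D\<^esub> c \<otimes>\<^bsub>D\<^esub> a" by (rule RF.adjoinE) auto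
      have "v \<bullet>\<^bsub>V\<^esub> q = v \<bullet>\<^bsub>V\<^esub> p \<oplus>\<^bsub>V\<^esub> (v \<bullet>\<^bsub>V\<^esub> c) \<bullet>\<^bsub>V\<^esub> a"
        unfolding pa(3) using pa v c Pc by (simp add: V.rsmult_add_scalar V.rsmult_assoc)
      moreover have "v \<bullet>\<^bsub>V\<^esub> p \<in> Y" "(v \<bullet>\<^bsub>V\<^esub> c) \<bullet>\<^bsub>V\<^esub> a \<in> Y" using v pa Y(4) by auto
      ultimately show ?thesis using Y(3) by simp
    qed
    then show "v \<in> ?Q (RF.adjoin P c)" using v by simp
  next
    fix v assume v: "v \<in> ?Q (RF.adjoin P c)"
    then show "v \<in> {v \<in> ?Q P. v \<bullet>\<^bsub>V\<^esub> c \<in> Y}"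
      using RF.adjoin_incl[OF P vdim_adjoin(2)] by auto
  qed
  then obtain i' where "VF.vdim (?Q (RF.adjoin P c)) i'" "i \<le> Suc i'"
    using VV.preimage_hyperplane[OF lin i(1) assms(1-3)] by auto
  then show ?case using i(2) by (intro exI[of _ i']) simp
qed

end

section \<open>The dimension bound\<close>

context algebra_space
begin

abbreviation "vals S y \<equiv> (\<lambda>u. u y) ` S"

text \<open>The trivial spectrum condition in finite dimension, where injective endomorphisms are
  invertible. In this form it passes to restrictions at once.\<close>

definition "fixed_point_free S \<longleftrightarrow> (\<forall>u\<in>S. \<forall>y\<in>carrier V. u y = y \<longrightarrow> y = \<zero>\<^bsub>V\<^esub>)"

lemma vals_subspace:
  "right_subspace FD ES S \<Longrightarrow> y \<in> carrier V \<Longrightarrow> right_subspace FD V (vals S y)"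
  using ev.image_subspace[OF ev_linear] .

text \<open>If the image \<open>u y\<close> escaped \<open>vals S x\<close>, then every \<open>y \<oplus> x \<bullet> c\<close> with \<open>c \<in> F\<close> would be killed
  by some \<open>s\<^sub>c \<in> S\<close> with \<open>s\<^sub>c x \<noteq> 0\<close>. The \<open>s\<^sub>c\<close> behave like eigenvectors for distinct
  eigenvalues, so they are linearly independent, and \<open>F\<close> has too many elements for that.\<close>

lemma max_rank_kernel_image:
  assumes S: "EF.vdim S k"
    and x: "x \<in> carrier V" "VF.vdim (vals S x) r"
    and max: "\<And>y r'. y \<in> carrier V \<Longrightarrow> VF.vdim (vals S y) r' \<Longrightarrow> r' \<le> r"
    and F: "infinite F \<or> r < card F"
    and u: "u \<in> S" "u x = \<zero>\<^bsub>V\<^esub>" and y: "y \<in> carrier V"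
  shows "u y \<in> vals S x"
proof (rule ccontr)
  assume uy: "u y \<notin> vals S x"
  note Ssub = EF.vdim_subspace[OF S]
  note Ss = EF.right_subspaceD[OF Ssub, simplified]
  note O = VF.right_subspaceD[OF VF.vdim_subspace[OF x(2)], simplified]
  \<comment> \<open>A complement in \<open>S\<close> of the operators killing \<open>x\<close>:
    evaluation at \<open>x\<close> maps it isomorphically onto \<open>vals S x\<close>.\<close>
  obtain T where T: "EF.vdim T r" "T \<subseteq> S" "vals T x = vals S x"
    using ev.vdim_lift_image[OF ev_linear[OF x(1)] Ssub x(2)] by auto
  note Ts = EF.right_subspaceD[OF EF.vdim_subspace[OF T(1)], simplified]
  have injT: "t = \<zero>\<^bsub>E\<^esub>" if t: "t \<in> T" "t x = \<zero>\<^bsub>V\<^esub>" for t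
  proof -
    obtain r' j where "VF.vdim (vals T x) r'" "EF.vdim {t \<in> T. t x = \<zero>\<^bsub>V\<^esub>} j" "r' + j = r"
      using ev.rank_nullity[OF ev_linear[OF x(1)] T(1)] by auto
    moreover from this have "r' = r" using VF.vdim_unique x(2) unfolding T(3) by blast
    ultimately have "{t \<in> T. t x = \<zero>\<^bsub>V\<^esub>} = {\<zero>\<^bsub>E\<^esub>}" using EF.vdim_0 by simp
    then show ?thesis using t by blast
  qed
  have uE: "u \<in> carrier E" using u Ss(7) by simp
  have uT: "u \<notin> T"
  proof
    assume "u \<in> T"
    then have "u = \<zero>\<^bsub>E\<^esub>" using injT u by simp
    then have "u y = \<zero>\<^bsub>V\<^esub>" using y by simp
    then show False using uy O(2) by simp
  qed
  define S1 where "S1 = EF.adjoin T u"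
  have S1: "EF.vdim S1 (Suc r)" unfolding S1_def by (rule EF.vdim_adjoin) (use T uE uT in auto)
  have S1S: "S1 \<subseteq> S" unfolding S1_def by (rule EF.adjoin_least[OF Ssub T(2) u(1)])
  note S1s = EF.right_subspaceD[OF EF.vdim_subspace[OF S1], simplified]
  have ker1: "\<exists>c\<in>F. p = u \<bullet>\<^bsub>ES\<^esub> c" if p: "p \<in> S1" "p x = \<zero>\<^bsub>V\<^esub>" for p
  proof -
    obtain t c where tc: "t \<in> T" "c \<in> F" "p = t \<oplus>\<^bsub>E\<^esub> u \<bullet>\<^bsub>ES\<^esub> c"
      using p(1) unfolding S1_def by (rule EF.adjoinE) auto
    have tE: "t \<in> carrier E" using tc Ts(7) by simp
    have "p x = t x" unfolding tc(3) using x(1) u(2) tc(2) EndD(1)[OF tE x(1)] by simp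
    then have "t = \<zero>\<^bsub>E\<^esub>" using injT tc p by simp
    then have "p = u \<bullet>\<^bsub>ES\<^esub> c" using tc EF.V.l_zero[of "u \<bullet>\<^bsub>ES\<^esub> c"] End_smult_closed[OF uE tc(2)] by simp
    then show ?thesis using tc by blast
  qed
  \<comment> \<open>The dimension r + 1 of \<open>S1\<close> exceeds the largest rank, so evaluation
    at y + x c has a kernel in \<open>S1\<close>. A kernel element that also killed \<open>x\<close>
    would be a nonzero multiple of \<open>u\<close>, and then \<open>u y\<close> would be 0.\<close>
  have "\<exists>s\<in>S1. s y \<oplus>\<^bsub>V\<^esub> s x \<bullet>\<^bsub>V\<^esub> c = \<zero>\<^bsub>V\<^esub> \<and> s x \<noteq> \<zero>\<^bsub>V\<^esub>" if c: "c \<in> F" for c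
  proof -
    let ?z = "y \<oplus>\<^bsub>V\<^esub> x \<bullet>\<^bsub>V\<^esub> c"
    have z: "?z \<in> carrier V" using x y c by (simp add: V.rsmult_closed)
    obtain r' j where rj: "VF.vdim (vals S1 ?z) r'" "EF.vdim {s \<in> S1. s ?z = \<zero>\<^bsub>V\<^esub>} j" "r' + j = Suc r"
      using ev.rank_nullity[OF ev_linear[OF z] S1] by auto
    obtain r'' where r'': "VF.vdim (vals S ?z) r''"
      using ev.rank_nullity[OF ev_linear[OF z] S] by auto
    have "r' \<le> r''" using VF.vdim_mono[OF r'' rj(1)] S1S by auto
    then have "j \<noteq> 0" using max[OF z r''] rj(3) by auto
    then obtain s where s: "s \<in> S1" "s ?z = \<zero>\<^bsub>V\<^esub>" "s \<noteq> \<zero>\<^bsub>E\<^esub>"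
      using EF.vdim_ex_nonzero[of _ "j - 1"] rj(2) by fastforce
    have sE: "s \<in> carrier E" using s S1s(7) by simp
    have e: "s y \<oplus>\<^bsub>V\<^esub> s x \<bullet>\<^bsub>V\<^esub> c = \<zero>\<^bsub>V\<^esub>"
      using s(2) EndD(2,3)[OF sE] x y c by (simp add: V.rsmult_closed)
    have "s x \<noteq> \<zero>\<^bsub>V\<^esub>"
    proof
      assume sx: "s x = \<zero>\<^bsub>V\<^esub>"
      then obtain a where a: "a \<in> F" "s = u \<bullet>\<^bsub>ES\<^esub> a" using ker1 s(1) by blast
      have "u y \<bullet>\<^bsub>V\<^esub> a = \<zero>\<^bsub>V\<^esub>" using e sx a y c EndD(1)[OF sE y] by simp
      moreover have "a \<noteq> \<zero>"
      proof
        assume "a = \<zero>"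
        then have "s = \<zero>\<^bsub>E\<^esub>" using a EF.rsmult_r_null[of u] uE by simp
        then show False using s by simp
      qed
      ultimately have "u y \<in> vals S x"
        using VF.right_subspace_smult_iff[OF VF.vdim_subspace[OF x(2)], of "u y" a] a O(2) EndD(1)[OF uE y] by simp
      then show False using uy by simp
    qed
    then show ?thesis using e s by blast
  qed
  then obtain s where s: "\<And>c. c \<in> F \<Longrightarrow> s c \<in> S1" "\<And>c. c \<in> F \<Longrightarrow> s c y \<oplus>\<^bsub>V\<^esub> s c x \<bullet>\<^bsub>V\<^esub> c = \<zero>\<^bsub>V\<^esub>"
    "\<And>c. c \<in> F \<Longrightarrow> s c x \<noteq> \<zero>\<^bsub>V\<^esub>" by metis
  \<comment> \<open>Independence of the \<open>s c\<close> without linear combinations: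
    \<open>T\<close> is their span for c in \<open>L\<close>. Since evaluation at \<open>x\<close>
    is injective on \<open>T\<close>, the relation p y = - q x defines an operator p \<mapsto> q on
    \<open>T\<close> that has \<open>s c\<close> as an eigenvector for c. The fourth clause says
    that no scalar outside \<open>L\<close> is an eigenvalue.\<close>
  have fam: "\<exists>T. EF.vdim T (card L) \<and> T \<subseteq> S1 \<and> (\<forall>p\<in>T. \<exists>q\<in>T. p y \<oplus>\<^bsub>V\<^esub> q x = \<zero>\<^bsub>V\<^esub>)
      \<and> (\<forall>p\<in>T. \<forall>c\<in>F - L. p y \<oplus>\<^bsub>V\<^esub> p x \<bullet>\<^bsub>V\<^esub> c = \<zero>\<^bsub>V\<^esub> \<longrightarrow> p = \<zero>\<^bsub>E\<^esub>)
      \<and> (\<forall>p\<in>T. p x = \<zero>\<^bsub>V\<^esub> \<longrightarrow> p = \<zero>\<^bsub>E\<^esub>)" if "finite L" "L \<subseteq> F" for L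
    using that
  proof (induction L rule: finite_induct)
    case empty
    have "EF.vdim {\<zero>\<^bsub>E\<^esub>} 0" using EF.vdim_zero by simp
    moreover have "{\<zero>\<^bsub>E\<^esub>} \<subseteq> S1" using S1s(2) by simp
    ultimately show ?case using x(1) y by (intro exI[of _ "{\<zero>\<^bsub>E\<^esub>}"]) simp
  next
    case (insert c L)
    then have cF: "c \<in> F" by simp
    obtain T where T: "EF.vdim T (card L)" "T \<subseteq> S1" "\<And>p. p \<in> T \<Longrightarrow> \<exists>q\<in>T. p y \<oplus>\<^bsub>V\<^esub> q x = \<zero>\<^bsub>V\<^esub>"
      "\<And>p c. \<lbrakk>p \<in> T; c \<in> F - L; p y \<oplus>\<^bsub>V\<^esub> p x \<bullet>\<^bsub>V\<^esub> c = \<zero>\<^bsub>V\<^esub>\<rbrakk> \<Longrightarrow> p = \<zero>\<^bsub>E\<^esub>"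
      "\<And>p. p \<in> T \<Longrightarrow> p x = \<zero>\<^bsub>V\<^esub> \<Longrightarrow> p = \<zero>\<^bsub>E\<^esub>" using insert.IH insert.prems by blast
    note Tsub = EF.vdim_subspace[OF T(1)]
    note Ts = EF.right_subspaceD[OF Tsub, simplified]
    note sc = s[OF cF]
    have sE: "s c \<in> carrier E" using sc S1s(7) by simp
    have sT: "s c \<notin> T"
    proof
      assume "s c \<in> T"
      then have "s c = \<zero>\<^bsub>E\<^esub>" using T(4)[of "s c" c] sc cF insert(2) by simp
      then show False using sc(3) x(1) by simp
    qed
    define T' where "T' = EF.adjoin T (s c)"
    have vT': "EF.vdim T' (card (insert c L))"
      unfolding T'_def using EF.vdim_adjoin[OF T(1), of "s c"] sE sT insert by simp
    have T'S: "T' \<subseteq> S1" unfolding T'_def by (rule EF.adjoin_least[OF EF.vdim_subspace[OF S1] T(2) sc(1)])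
    note T's = EF.right_subspaceD[OF EF.vdim_subspace[OF vT'], simplified]
    have inV [simp]: "p x \<in> carrier V" "p y \<in> carrier V" if "p \<in> carrier E" for p
      using EndD(1)[OF that] x y by auto
    have scy: "s c y = \<ominus>\<^bsub>V\<^esub> (s c x \<bullet>\<^bsub>V\<^esub> c)"
      using sc(2) sE cF V.minus_equality[of "s c y" "s c x \<bullet>\<^bsub>V\<^esub> c"] by (simp add: V.rsmult_closed)
    have split: "\<exists>t q a. t \<in> T \<and> q \<in> T \<and> a \<in> F \<and> p = t \<oplus>\<^bsub>E\<^esub> s c \<bullet>\<^bsub>ES\<^esub> a \<and> t y = \<ominus>\<^bsub>V\<^esub> q x
        \<and> p x = t x \<oplus>\<^bsub>V\<^esub> s c x \<bullet>\<^bsub>V\<^esub> a \<and> p y = \<ominus>\<^bsub>V\<^esub> q x \<oplus>\<^bsub>V\<^esub> \<ominus>\<^bsub>V\<^esub> (s c x \<bullet>\<^bsub>V\<^esub> (c \<otimes> a))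
        \<and> t \<in> carrier E \<and> q \<in> carrier E" if p: "p \<in> T'" for p
    proof -
      obtain t a where ta: "t \<in> T" "a \<in> F" "p = t \<oplus>\<^bsub>E\<^esub> s c \<bullet>\<^bsub>ES\<^esub> a"
        using p unfolding T'_def by (rule EF.adjoinE) auto
      obtain q where q: "q \<in> T" "t y \<oplus>\<^bsub>V\<^esub> q x = \<zero>\<^bsub>V\<^esub>" using T(3)[OF ta(1)] by blast
      have tE: "t \<in> carrier E" and qE: "q \<in> carrier E" using ta(1) q(1) Ts(7) by auto
      have ty: "t y = \<ominus>\<^bsub>V\<^esub> q x" using q(2) tE qE V.minus_equality[of "t y" "q x"] by simp
      have px: "p x = t x \<oplus>\<^bsub>V\<^esub> s c x \<bullet>\<^bsub>V\<^esub> a" unfolding ta(3) using x(1) by simp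
      have py: "p y = \<ominus>\<^bsub>V\<^esub> q x \<oplus>\<^bsub>V\<^esub> \<ominus>\<^bsub>V\<^esub> (s c x \<bullet>\<^bsub>V\<^esub> (c \<otimes> a))" unfolding ta(3)
        using y scy sE cF ta(2) by (simp add: ty V.rsmult_l_minus V.rsmult_assoc V.rsmult_closed)
      show ?thesis using ta q(1) tE qE ty px py by blast
    qed
    \<comment> \<open>An element of \<open>S1\<close> killing \<open>x\<close> is a multiple of
      \<open>u\<close>, but here its value at \<open>y\<close> is also a value at \<open>x\<close>
      of elements of \<open>S\<close>. As \<open>u y\<close> is not, the multiple is 0.\<close>
    have iv: "p = \<zero>\<^bsub>E\<^esub>" if p: "p \<in> T'" "p x = \<zero>\<^bsub>V\<^esub>" for p
    proof -
      obtain b where b: "b \<in> F" "p = u \<bullet>\<^bsub>ES\<^esub> b" using ker1 p T'S by blast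
      obtain t q a where tq: "q \<in> T" "a \<in> F" "p y = \<ominus>\<^bsub>V\<^esub> q x \<oplus>\<^bsub>V\<^esub> \<ominus>\<^bsub>V\<^esub> (s c x \<bullet>\<^bsub>V\<^esub> (c \<otimes> a))"
        using split[OF p(1)] by blast
      have "q x \<in> vals S x" "s c x \<in> vals S x" using tq T(2) S1S sc(1) by auto
      then have "p y \<in> vals S x" unfolding tq(3) using O(3,4,5) cF tq(2) by simp
      then have "u y \<bullet>\<^bsub>V\<^esub> b \<in> vals S x" using b y by simp
      then have "b = \<zero>"
        using VF.right_subspace_smult_iff[OF VF.vdim_subspace[OF x(2)], of "u y" b] b uy EndD(1)[OF uE y] by auto
      then show ?thesis using b EF.rsmult_r_null[of u] uE by simp
    qed
    have ii: "\<exists>q\<in>T'. p y \<oplus>\<^bsub>V\<^esub> q x = \<zero>\<^bsub>V\<^esub>" if p: "p \<in> T'" for p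
    proof -
      obtain t q a where tq: "q \<in> T" "a \<in> F" "p y = \<ominus>\<^bsub>V\<^esub> q x \<oplus>\<^bsub>V\<^esub> \<ominus>\<^bsub>V\<^esub> (s c x \<bullet>\<^bsub>V\<^esub> (c \<otimes> a))" "q \<in> carrier E"
        using split[OF p(1)] by blast
      let ?q = "q \<oplus>\<^bsub>E\<^esub> s c \<bullet>\<^bsub>ES\<^esub> (c \<otimes> a)"
      have "?q \<in> T'" unfolding T'_def using EF.adjoinI[OF tq(1), of "c \<otimes> a" "s c"] cF tq(2) by simp
      moreover have "p y \<oplus>\<^bsub>V\<^esub> ?q x = \<zero>\<^bsub>V\<^esub>"
        unfolding tq(3) using x(1) tq sE cF
        by (simp add: V.rsmult_closed V.a_ac V.r_neg1 V.r_neg2 V.r_neg)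
      ultimately show ?thesis by blast
    qed
    have iii: "p = \<zero>\<^bsub>E\<^esub>" if p: "p \<in> T'" "b \<in> F - insert c L" "p y \<oplus>\<^bsub>V\<^esub> p x \<bullet>\<^bsub>V\<^esub> b = \<zero>\<^bsub>V\<^esub>" for p b
    proof -
      obtain t q a where tq: "t \<in> T" "q \<in> T" "a \<in> F" "p = t \<oplus>\<^bsub>E\<^esub> s c \<bullet>\<^bsub>ES\<^esub> a"
        "p x = t x \<oplus>\<^bsub>V\<^esub> s c x \<bullet>\<^bsub>V\<^esub> a" "t y = \<ominus>\<^bsub>V\<^esub> q x"
        "p y = \<ominus>\<^bsub>V\<^esub> q x \<oplus>\<^bsub>V\<^esub> \<ominus>\<^bsub>V\<^esub> (s c x \<bullet>\<^bsub>V\<^esub> (c \<otimes> a))" "t \<in> carrier E" "q \<in> carrier E"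
        using split[OF p(1)] by blast
      have b: "b \<in> F" "b \<noteq> c" "b \<in> F - L" using p by auto
      \<comment> \<open>The scalar \<open>b\<close> minus the operator p \<mapsto> q described
        above, applied to \<open>p\<close>. The value of \<open>?g\<close> at \<open>x\<close> is p
        y + p x b = 0, so \<open>?g\<close> vanishes, and its coefficient a (b - c) at
        \<open>s c\<close> must be 0.\<close>
      let ?g = "(t \<bullet>\<^bsub>ES\<^esub> b \<oplus>\<^bsub>E\<^esub> q \<bullet>\<^bsub>ES\<^esub> (\<ominus> \<one>)) \<oplus>\<^bsub>E\<^esub> s c \<bullet>\<^bsub>ES\<^esub> (a \<otimes> b \<ominus> c \<otimes> a)"
      have w: "t \<bullet>\<^bsub>ES\<^esub> b \<oplus>\<^bsub>E\<^esub> q \<bullet>\<^bsub>ES\<^esub> (\<ominus> \<one>) \<in> T" using tq b Ts(3,4) by simp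
      have gT: "?g \<in> T'" unfolding T'_def using EF.adjoinI[OF w, of "a \<otimes> b \<ominus> c \<otimes> a" "s c"] cF tq(3) b by simp
      have "?g x = t x \<bullet>\<^bsub>V\<^esub> b \<oplus>\<^bsub>V\<^esub> \<ominus>\<^bsub>V\<^esub> q x \<oplus>\<^bsub>V\<^esub> (s c x \<bullet>\<^bsub>V\<^esub> (a \<otimes> b) \<oplus>\<^bsub>V\<^esub> \<ominus>\<^bsub>V\<^esub> (s c x \<bullet>\<^bsub>V\<^esub> (c \<otimes> a)))"
        using x(1) tq(3,8,9) sE cF b
        by (simp add: V.rsmult_one V.rsmult_add_scalar V.rsmult_r_minus D.minus_eq)
      also have "\<dots> = p y \<oplus>\<^bsub>V\<^esub> p x \<bullet>\<^bsub>V\<^esub> b"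
        unfolding tq(5,7) using tq(3,8,9) sE cF b
        by (simp add: V.rsmult_add_vector V.rsmult_assoc V.rsmult_closed V.a_ac)
      finally have "?g = \<zero>\<^bsub>E\<^esub>" using iv[OF gT] p(3) by simp
      also have "\<zero>\<^bsub>E\<^esub> = \<zero>\<^bsub>E\<^esub> \<oplus>\<^bsub>E\<^esub> s c \<bullet>\<^bsub>ES\<^esub> \<zero>"
        using EF.V.l_zero[of "\<zero>\<^bsub>E\<^esub>"] EF.rsmult_r_null[of "s c"] sE End_zero_closed by simp
      finally have "a \<otimes> b \<ominus> c \<otimes> a = \<zero>"
        using EF.adjoin_unique[OF Tsub, of "s c", OF _ sT w Ts(2), of "a \<otimes> b \<ominus> c \<otimes> a" \<zero>] sE cF tq(3) b by simp
      then have "a \<otimes> (b \<ominus> c) = \<zero>"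
        using F_commute[OF cF, of a] cF tq(3) b by (simp add: D.minus_eq D.r_distr D.r_minus)
      moreover have "b \<ominus> c \<noteq> \<zero>" using b cF D.r_right_minus_eq by simp
      ultimately have "a = \<zero>"
        using V.inv_D[of "b \<ominus> c"] tq(3) b cF by (metis D.m_assoc D.minus_closed D.l_null D.r_one F_closed)
      then have "p = t" using tq(4,8) EF.V.r_zero[of t] EF.rsmult_r_null[of "s c"] sE by simp
      then show ?thesis using T(4)[OF tq(1) b(3)] p(3) by simp
    qed
    show ?case using vT' T'S ii iii iv by blast
  qed
  obtain L where L: "finite L" "L \<subseteq> F" "card L = Suc r"
  proof (cases "finite F")
    case True
    then have "Suc r \<le> card F" using F by auto
    then show ?thesis using that obtain_subset_with_card_n by metis
  next
    case False
    then show ?thesis using that infinite_arbitrarily_large by metis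
  qed
  then obtain T' where T': "EF.vdim T' (Suc r)" "T' \<subseteq> S1" "\<And>p. p \<in> T' \<Longrightarrow> p x = \<zero>\<^bsub>V\<^esub> \<Longrightarrow> p = \<zero>\<^bsub>E\<^esub>"
    using fam[of L] by auto
  \<comment> \<open>With r + 1 scalars in \<open>L\<close>, evaluation at \<open>x\<close> has rank
    r + 1 on \<open>T'\<close> but only r on all of \<open>S\<close>.\<close>
  have "VF.vdim (vals T' x) (Suc r)"
    using ev.vdim_inj_image[OF ev_linear[OF x(1)] T'(1)] T'(3) by simp
  then show False using VF.vdim_mono[OF x(2), of "vals T' x"] T'(2) S1S by fastforce
qed

lemma ex_generic_vector:
  assumes S: "EF.vdim S k" "fixed_point_free S"
    and V: "V.vdim (carrier V) (Suc m)" and d: "RF.vdim (carrier D) d"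
    and F: "infinite F \<or> Suc m * d \<le> card F"
  obtains x r j where "x \<in> carrier V" "x \<notin> vals S x" "VF.vdim (vals S x) r"
    "EF.vdim {u \<in> S. u x = \<zero>\<^bsub>V\<^esub>} j" "r + j = k" "r < Suc m * d"
    "\<And>u y. u \<in> S \<Longrightarrow> u x = \<zero>\<^bsub>V\<^esub> \<Longrightarrow> y \<in> carrier V \<Longrightarrow> u y \<in> vals S x"
proof -
  note Ssub = EF.vdim_subspace[OF S(1)]
  have VN: "VF.vdim (carrier V) (Suc m * d)" using vdim_F_of_vdim_D[OF V d] .
  have ex: "\<exists>r. VF.vdim (vals S y) r" if "y \<in> carrier V" for y
    using ev.rank_nullity[OF ev_linear[OF that] S(1)] by blast
  have sub: "vals S y \<subseteq> carrier V" if "y \<in> carrier V" for y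
    using VF.right_subspaceD(1)[OF vals_subspace[OF Ssub that]] .
  have out: "y \<notin> vals S y" if "y \<in> carrier V" "y \<noteq> \<zero>\<^bsub>V\<^esub>" for y
    using S(2) that unfolding fixed_point_free_def by (metis imageE)
  \<comment> \<open>Zero is excluded as a candidate: were all ranks 0, the maximum could be attained
    there, and \<open>x\<close> must be nonzero to lie outside \<open>vals S x\<close>.\<close>
  define P where "P r \<longleftrightarrow> (\<exists>y\<in>carrier V. y \<noteq> \<zero>\<^bsub>V\<^esub> \<and> VF.vdim (vals S y) r)" for r
  obtain y0 where y0: "y0 \<in> carrier V" "y0 \<noteq> \<zero>\<^bsub>V\<^esub>" using V.vdim_ex_nonzero[OF V] by blast
  obtain r0 where r0: "P r0" unfolding P_def using y0 ex[OF y0(1)] by blast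
  have bd: "r \<le> Suc m * d" if "P r" for r
    using that VF.vdim_mono[OF VN _ sub] unfolding P_def by blast
  obtain r where r: "P r" "\<And>r'. P r' \<Longrightarrow> r' \<le> r"
    using GreatestI_nat[of P, OF r0 bd] Greatest_le_nat[of P, OF _ bd] by blast
  from r(1) obtain x where x: "x \<in> carrier V" "x \<noteq> \<zero>\<^bsub>V\<^esub>" "VF.vdim (vals S x) r" unfolding P_def by blast
  have max: "r' \<le> r" if "y \<in> carrier V" "VF.vdim (vals S y) r'" for y r'
  proof (cases "y = \<zero>\<^bsub>V\<^esub>")
    case True
    have "u y = \<zero>\<^bsub>V\<^esub>" if "u \<in> S" for u
      using True EndD(4)[of u] EF.right_subspaceD(7)[OF Ssub that] by simp
    then have "vals S y \<subseteq> {\<zero>\<^bsub>V\<^esub>}" by blast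
    then show ?thesis using VF.vdim_mono[OF VF.vdim_zero that(2)] by simp
  next
    case False
    then show ?thesis using r(2)[of r'] that unfolding P_def by blast
  qed
  \<comment> \<open>As it misses \<open>x\<close>, \<open>vals S x\<close> is proper in a space of
    F-dimension \<open>Suc m * d\<close>. So a finite \<open>F\<close> of at least that size has
    more than \<open>r\<close> elements, as \<open>max_rank_kernel_image\<close> demands.\<close>
  have lt: "r < Suc m * d"
    using VF.vdim_mono_eq[OF VN x(3) sub[OF x(1)]] out[OF x(1,2)] x(1) by (metis le_neq_implies_less)
  have F': "infinite F \<or> r < card F" using F lt by auto
  obtain r' j where rj: "VF.vdim (vals S x) r'" "EF.vdim {u \<in> S. u x = \<zero>\<^bsub>V\<^esub>} j" "r' + j = k"
    using ev.rank_nullity[OF ev_linear[OF x(1)] S(1)] by blast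
  have r': "r' = r" using VF.vdim_unique[OF rj(1) x(3)] .
  have im: "u y \<in> vals S x" if "u \<in> S" "u x = \<zero>\<^bsub>V\<^esub>" "y \<in> carrier V" for u y
    by (rule max_rank_kernel_image[OF S(1) x(1,3) _ F' that]) (rule max)
  show ?thesis
  proof (rule that[of x r j])
    show "x \<in> carrier V" "VF.vdim (vals S x) r" "EF.vdim {u \<in> S. u x = \<zero>\<^bsub>V\<^esub>} j" "r < Suc m * d"
      using x rj lt by auto
    show "x \<notin> vals S x" using out[OF x(1,2)] .
    show "r + j = k" using rj(3) r' by simp
    show "u y \<in> vals S x" if "u \<in> S" "u x = \<zero>\<^bsub>V\<^esub>" "y \<in> carrier V" for u y using im[OF that] .
  qed
qed

end

section \<open>Compression to a hyperplane and extension by zero\<close>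

locale algebra_complement = algebra_space D F V + complement D V W x
  for D :: "('a, 'm) ring_scheme" (structure) and F :: "'a set"
    and V :: "('a, 'b, 'k) rmodule_scheme" and W and x

sublocale algebra_complement \<subseteq> R: algebra_space D F "V\<lparr>carrier := W\<rparr>"
proof -
  interpret R: right_vector_space D "V\<lparr>carrier := W\<rparr>" by (rule V.restrict_space[OF W])
  show "algebra_space D F (V\<lparr>carrier := W\<rparr>)" by unfold_locales
qed

sublocale algebra_complement \<subseteq> rst: two_spaces "D\<lparr>carrier := F\<rparr>" "End_space D V" "End_space D (V\<lparr>carrier := W\<rparr>)"
  by unfold_locales

sublocale algebra_complement \<subseteq> ext: two_spaces "D\<lparr>carrier := F\<rparr>" "End_space D (V\<lparr>carrier := W\<rparr>)" "End_space D V"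
  by unfold_locales

context algebra_complement
begin

text \<open>Composing with \<open>proj\<close> makes this F-linear on all operators, whether or not
  they preserve \<open>W\<close>; on those that do, it is the restriction.\<close>

definition "restr u = (\<lambda>y\<in>W. proj (u y))"
definition "extn f = (\<lambda>y\<in>carrier V. f (proj y))"

lemma restr_closed: assumes "u \<in> carrier E" shows "restr u \<in> carrier R.E"
proof (rule R.EndI)
  note u = EndD[OF assms]
  show "restr u \<in> extensional (carrier (V\<lparr>carrier := W\<rparr>))" by (simp add: restr_def)
qed (use EndD[OF assms] Ws decomp in \<open>auto simp: restr_def proj_coord_add proj_coord_smult\<close>)

lemma extn_closed: assumes "f \<in> carrier R.E" shows "extn f \<in> carrier E"
proof (rule EndI)
  note f = R.EndD[OF assms, simplified]
  show "extn f \<in> extensional (carrier V)" by (simp add: extn_def)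
qed (use R.EndD[OF assms, simplified] Ws decomp in \<open>auto simp: extn_def proj_coord_add proj_coord_smult V.rsmult_closed\<close>)

lemma restr_linear: "linear_map FD ES R.ES restr"
  unfolding linear_map_def
proof (intro conjI ballI)
  show "restr \<in> carrier ES \<rightarrow> carrier R.ES" using restr_closed by simp
  fix u assume u: "u \<in> carrier ES"
  show "restr (u \<oplus>\<^bsub>ES\<^esub> v) = restr u \<oplus>\<^bsub>R.ES\<^esub> restr v" if v: "v \<in> carrier ES" for v
  proof (rule R.End_eqI)
    show "restr (u \<oplus>\<^bsub>ES\<^esub> v) \<in> carrier R.E" "restr u \<oplus>\<^bsub>R.ES\<^esub> restr v \<in> carrier R.E"
      using u v restr_closed End_add_closed R.End_add_closed by auto
    fix y assume "y \<in> carrier (V\<lparr>carrier := W\<rparr>)"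
    then have y: "y \<in> W" by simp
    show "restr (u \<oplus>\<^bsub>ES\<^esub> v) y = (restr u \<oplus>\<^bsub>R.ES\<^esub> restr v) y"
      using y Ws(7)[OF y] u v EndD(1) by (simp add: restr_def proj_coord_add)
  qed
  show "restr (u \<bullet>\<^bsub>ES\<^esub> c) = restr u \<bullet>\<^bsub>R.ES\<^esub> c" if c: "c \<in> carrier FD" for c
  proof (rule R.End_eqI)
    show "restr (u \<bullet>\<^bsub>ES\<^esub> c) \<in> carrier R.E" "restr u \<bullet>\<^bsub>R.ES\<^esub> c \<in> carrier R.E"
      using u c restr_closed End_smult_closed R.End_smult_closed by auto
    fix y assume "y \<in> carrier (V\<lparr>carrier := W\<rparr>)"
    then have y: "y \<in> W" by simp
    show "restr (u \<bullet>\<^bsub>ES\<^esub> c) y = (restr u \<bullet>\<^bsub>R.ES\<^esub> c) y"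
      using y Ws(7)[OF y] u c EndD(1) by (simp add: restr_def proj_coord_smult)
  qed
qed

lemma extn_linear: "linear_map FD R.ES ES extn"
  unfolding linear_map_def
proof (intro conjI ballI)
  show "extn \<in> carrier R.ES \<rightarrow> carrier ES" using extn_closed by simp
  fix f assume f: "f \<in> carrier R.ES"
  show "extn (f \<oplus>\<^bsub>R.ES\<^esub> g) = extn f \<oplus>\<^bsub>ES\<^esub> extn g" if g: "g \<in> carrier R.ES" for g
  proof (rule End_eqI)
    show "extn (f \<oplus>\<^bsub>R.ES\<^esub> g) \<in> carrier E" "extn f \<oplus>\<^bsub>ES\<^esub> extn g \<in> carrier E"
      using f g extn_closed End_add_closed R.End_add_closed by auto
    fix y assume y: "y \<in> carrier V"
    show "extn (f \<oplus>\<^bsub>R.ES\<^esub> g) y = (extn f \<oplus>\<^bsub>ES\<^esub> extn g) y"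
      using y decomp(1)[OF y] by (simp add: extn_def)
  qed
  show "extn (f \<bullet>\<^bsub>R.ES\<^esub> c) = extn f \<bullet>\<^bsub>ES\<^esub> c" if c: "c \<in> carrier FD" for c
  proof (rule End_eqI)
    show "extn (f \<bullet>\<^bsub>R.ES\<^esub> c) \<in> carrier E" "extn f \<bullet>\<^bsub>ES\<^esub> c \<in> carrier E"
      using f c extn_closed End_smult_closed R.End_smult_closed by auto
    fix y assume y: "y \<in> carrier V"
    show "extn (f \<bullet>\<^bsub>R.ES\<^esub> c) y = (extn f \<bullet>\<^bsub>ES\<^esub> c) y"
      using y decomp(1)[OF y] by (simp add: extn_def)
  qed
qed

lemma restr_extn: assumes "f \<in> carrier R.E" shows "restr (extn f) = f"
proof (rule R.End_eqI[OF restr_closed[OF extn_closed[OF assms]] assms])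
  fix y assume "y \<in> carrier (V\<lparr>carrier := W\<rparr>)"
  then have y: "y \<in> W" by simp
  show "restr (extn f) y = f y"
    using y Ws(7)[OF y] R.EndD(1)[OF assms, of y] by (simp add: restr_def extn_def proj_W)
qed

lemma extn_apply: "f \<in> carrier R.E \<Longrightarrow> y \<in> W \<Longrightarrow> extn f y = f y" "f \<in> carrier R.E \<Longrightarrow> extn f x = \<zero>\<^bsub>V\<^esub>"
  using R.EndD(4)[of f] Ws(7) xV by (auto simp: extn_def proj_W proj_x)

lemma extn_in: "f \<in> carrier R.E \<Longrightarrow> y \<in> carrier V \<Longrightarrow> extn f y \<in> W"
  using R.EndD(1)[of f "proj y"] decomp(1)[of y] by (simp add: extn_def)

lemma restr_apply: "u y \<in> W \<Longrightarrow> y \<in> W \<Longrightarrow> restr u y = u y"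
  by (simp add: restr_def proj_W)

lemma extn_restr:
  assumes u: "u \<in> carrier E" "u x = \<zero>\<^bsub>V\<^esub>" "\<And>y. y \<in> W \<Longrightarrow> u y \<in> W"
  shows "extn (restr u) = u"
proof (rule End_eqI[OF extn_closed[OF restr_closed[OF u(1)]] u(1)])
  fix y assume y: "y \<in> carrier V"
  note d = decomp[OF y]
  have "u y = u (proj y \<oplus>\<^bsub>V\<^esub> x \<bullet>\<^bsub>V\<^esub> coord y)" using d by simp
  also have "\<dots> = u (proj y)"
    using EndD[OF u(1)] d(2,4) xV u(2) by (simp add: V.rsmult_closed)
  finally show "extn (restr u) y = u y"
    using y d(1) u(3) by (simp add: extn_def restr_def proj_W)
qed

lemma vdim_restr:
  assumes "EF.vdim U j" "\<And>u. u \<in> U \<Longrightarrow> u x = \<zero>\<^bsub>V\<^esub>" "\<And>u y. u \<in> U \<Longrightarrow> y \<in> W \<Longrightarrow> u y \<in> W"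
  shows "R.EF.vdim (restr ` U) j"
proof (rule rst.vdim_inj_image[OF restr_linear assms(1)])
  fix u assume u: "u \<in> U" "restr u = \<zero>\<^bsub>R.ES\<^esub>"
  have uE: "u \<in> carrier E" using EF.right_subspaceD(7)[OF EF.vdim_subspace[OF assms(1)] u(1)] by simp
  have "u = extn (restr u)" using extn_restr[OF uE] assms u by simp
  also have "\<dots> = \<zero>\<^bsub>ES\<^esub>" unfolding u(2) using ext.linear_mapD(4)[OF extn_linear] .
  finally show "u = \<zero>\<^bsub>ES\<^esub>" .
qed

lemma vdim_extn:
  assumes "R.EF.vdim U j"
  shows "EF.vdim (extn ` U) j"
proof (rule ext.vdim_inj_image[OF extn_linear assms(1)])
  fix f assume f: "f \<in> U" "extn f = \<zero>\<^bsub>ES\<^esub>"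
  have fE: "f \<in> carrier R.E" using R.EF.right_subspaceD(7)[OF R.EF.vdim_subspace[OF assms(1)] f(1)] by simp
  have "f = restr (extn f)" using restr_extn[OF fE] by simp
  also have "\<dots> = \<zero>\<^bsub>R.ES\<^esub>" unfolding f(2) using rst.linear_mapD(4)[OF restr_linear] .
  finally show "f = \<zero>\<^bsub>R.ES\<^esub>" .
qed

lemma restr_fixed_point_free:
  assumes "fixed_point_free S" "U \<subseteq> S" "U \<subseteq> carrier E" "\<And>u y. u \<in> U \<Longrightarrow> y \<in> W \<Longrightarrow> u y \<in> W"
  shows "R.fixed_point_free (restr ` U)"
  unfolding R.fixed_point_free_def
proof (intro ballI impI)
  fix f y assume f: "f \<in> restr ` U" and "y \<in> carrier (V\<lparr>carrier := W\<rparr>)" and fy: "f y = y"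
  then have y: "y \<in> W" by simp
  obtain u where u: "u \<in> U" "f = restr u" using f by auto
  have "u y = y" using fy restr_apply[of u y] assms(4)[OF u(1) y] y u(2) by simp
  then show "y = \<zero>\<^bsub>V\<lparr>carrier := W\<rparr>\<^esub>"
    using assms(1,2) u y Ws(7) unfolding fixed_point_free_def by auto
qed

lemma vdim_W: assumes "V.vdim (carrier V) (Suc m)" shows "V.vdim W m"
  using V.vdim_hyperplane[OF assms W xV xW adjoin_eq[symmetric]] by simp

end

text \<open>For positive \<open>d\<close> the value is d n (n + 1) / 2 - n. The increment
  \<open>Suc n * d - 1\<close> is the F-dimension of a hyperplane in a D-space of dimension
  \<open>Suc n\<close>, the most that the values at a vector can fill without containing it.\<close>

fun max_dim :: "nat \<Rightarrow> nat \<Rightarrow> nat" where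
  "max_dim d 0 = 0"
| "max_dim d (Suc n) = max_dim d n + (Suc n * d - 1)"

context algebra_space
begin

text \<open>The largest D-subspace inside the F-subspace \<open>Y\<close>. As the image of a
  D-linear map is a D-subspace, an image contained in \<open>Y\<close> already lies here.\<close>

definition "core Y = {v \<in> carrier V. \<forall>a\<in>carrier D. v \<bullet>\<^bsub>V\<^esub> a \<in> Y}"

lemma core_subspace:
  assumes "right_subspace FD V Y" shows "right_subspace D V (core Y)" "core Y \<subseteq> Y"
proof -
  note Y = VF.right_subspaceD[OF assms]
  show "right_subspace D V (core Y)"
  proof (rule V.right_subspaceI)
    show "core Y \<subseteq> carrier V" "\<zero>\<^bsub>V\<^esub> \<in> core Y" using Y(2) by (auto simp: core_def)
    fix v assume v: "v \<in> core Y"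
    show "v \<oplus>\<^bsub>V\<^esub> w \<in> core Y" if "w \<in> core Y" for w
      using v that Y(3) by (simp add: core_def V.rsmult_add_vector)
    show "v \<bullet>\<^bsub>V\<^esub> a \<in> core Y" if "a \<in> carrier D" for a
      using v that by (simp add: core_def V.rsmult_closed V.rsmult_assoc[symmetric])
  qed
  show "core Y \<subseteq> Y"
  proof
    fix v assume v: "v \<in> core Y"
    then have "v \<bullet>\<^bsub>V\<^esub> \<one> \<in> Y" "v \<in> carrier V" unfolding core_def by auto
    then show "v \<in> Y" by (simp add: V.rsmult_one)
  qed
qed

lemma kernel_image_core:
  assumes "u \<in> carrier E" "\<And>y. y \<in> carrier V \<Longrightarrow> u y \<in> Y" "y \<in> carrier V"
  shows "u y \<in> core Y"
proof -
  have "u y \<bullet>\<^bsub>V\<^esub> a \<in> Y" if "a \<in> carrier D" for a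
    using assms(2)[OF V.rsmult_closed[OF assms(3) that]] EndD(3)[OF assms(1,3) that] by simp
  then show ?thesis unfolding core_def using EndD(1)[OF assms(1,3)] by simp
qed

end

text \<open>The images of the operators killing \<open>x\<close> lie in \<open>vals S x\<close>,
  which is only an F-space. Passing to its core gives a D-subspace missing \<open>x\<close>;
  enlarged to a D-hyperplane, it supports the induction.\<close>

lemma (in division_algebra) fixed_point_free_dim_le:
  assumes "algebra_space D F V" "right_vector_space.vdim D V (carrier V) n" "RF.vdim (carrier D) d"
    "right_vector_space.vdim (D\<lparr>carrier := F\<rparr>) (End_space D V) S k" "algebra_space.fixed_point_free V S"
    "infinite F \<or> n * d \<le> card F"
  shows "k \<le> max_dim d n"
  using assms
proof (induction n arbitrary: V S k)
  case 0
  interpret algebra_space D F V by fact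
  have "carrier V = {\<zero>\<^bsub>V\<^esub>}" using V.vdim_0 0 by simp
  then have "f = \<zero>\<^bsub>E\<^esub>" if "f \<in> carrier E" for f
    using End_eqI[OF that End_zero_closed] EndD(1)[OF that] by simp
  then have "S \<subseteq> {\<zero>\<^bsub>ES\<^esub>}" using EF.right_subspaceD(1)[OF EF.vdim_subspace[OF 0(4)]] by auto
  then show ?case using EF.vdim_mono[OF EF.vdim_zero 0(4)] by simp
next
  case (Suc m)
  interpret algebra_space D F V by fact
  obtain x r j where x: "x \<in> carrier V" "x \<notin> vals S x" "VF.vdim (vals S x) r"
    "EF.vdim {u \<in> S. u x = \<zero>\<^bsub>V\<^esub>} j" "r + j = k" "r < Suc m * d"
    "\<And>u y. u \<in> S \<Longrightarrow> u x = \<zero>\<^bsub>V\<^esub> \<Longrightarrow> y \<in> carrier V \<Longrightarrow> u y \<in> vals S x"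
    using ex_generic_vector[OF Suc.prems(4,5,2,3,6)] by blast
  let ?U = "{u \<in> S. u x = \<zero>\<^bsub>V\<^esub>}"
  have UE: "?U \<subseteq> carrier E" using EF.right_subspaceD(1)[OF EF.vdim_subspace[OF x(4)]] by simp
  note C = core_subspace[OF VF.vdim_subspace[OF x(3)]]
  have "x \<notin> core (vals S x)" using C(2) x(2) by blast
  then obtain H where H: "right_subspace D V H" "core (vals S x) \<subseteq> H" "x \<notin> H" "V.adjoin H x = carrier V"
    using V.ex_hyperplane_avoiding[OF Suc.prems(2) C(1) x(1)] by blast
  interpret algebra_complement D F V H x by unfold_locales (use H x in auto)
  have UH: "u y \<in> H" if "u \<in> ?U" "y \<in> carrier V" for u y
    using kernel_image_core[of u "vals S x"] x(7) that UE H(2) by blast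
  have 1: "R.EF.vdim (restr ` ?U) j" by (rule vdim_restr[OF x(4)]) (use UH H(1) Ws(7) in auto)
  have 2: "R.fixed_point_free (restr ` ?U)"
    by (rule restr_fixed_point_free[OF Suc.prems(5)]) (use UE UH Ws(7) in auto)
  have "right_vector_space.vdim D (V\<lparr>carrier := H\<rparr>) (carrier (V\<lparr>carrier := H\<rparr>)) m"
    using V.restrict_vdim_iff[OF H(1)] vdim_W[OF Suc.prems(2)] by simp
  moreover have "infinite F \<or> m * d \<le> card F" using Suc.prems(6) by auto
  ultimately have "j \<le> max_dim d m"
    using Suc.IH[OF R.algebra_space_axioms _ assms(3) 1 2] by simp
  then show ?case using x(5,6) by simp
qed

section \<open>Flags and triangular operator spaces\<close>

context algebra_space
begin

text \<open>An endomorphism of the line W (i + 1) / W i is determined by its value at the class of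
  \<open>e i\<close>. A hyperplane of such endomorphisms omitting the identity therefore corresponds
  to an F-hyperplane \<open>B i\<close> of W (i + 1) that contains \<open>W i\<close> and omits
  \<open>e i\<close>.\<close>

definition flag_data :: "nat \<Rightarrow> (nat \<Rightarrow> 'b set) \<Rightarrow> (nat \<Rightarrow> 'b) \<Rightarrow> (nat \<Rightarrow> 'b set) \<Rightarrow> bool" where
  "flag_data n W e B \<longleftrightarrow> W 0 = {\<zero>\<^bsub>V\<^esub>} \<and> W n = carrier V \<and>
     (\<forall>i<n. e i \<in> carrier V \<and> e i \<notin> W i \<and> W (Suc i) = V.adjoin (W i) (e i) \<and>
        right_subspace FD V (B i) \<and> W i \<subseteq> B i \<and> e i \<notin> B i \<and> VF.adjoin (B i) (e i) = W (Suc i))"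

text \<open>A joint described on \<open>V\<close> itself: membership of the induced map on a line in
  its hyperplane becomes a condition on the vector \<open>u (e i)\<close>.\<close>

definition triangular :: "nat \<Rightarrow> (nat \<Rightarrow> 'b set) \<Rightarrow> (nat \<Rightarrow> 'b) \<Rightarrow> (nat \<Rightarrow> 'b set) \<Rightarrow> ('b \<Rightarrow> 'b) set" where
  "triangular n W e B = {u \<in> carrier E. (\<forall>i\<le>n. u ` W i \<subseteq> W i) \<and> (\<forall>i<n. u (e i) \<in> B i)}"

lemma flag_dataD:
  assumes "flag_data n W e B"
  shows "W 0 = {\<zero>\<^bsub>V\<^esub>}" "W n = carrier V"
    "\<And>i. i < n \<Longrightarrow> e i \<in> carrier V" "\<And>i. i < n \<Longrightarrow> e i \<notin> W i"
    "\<And>i. i < n \<Longrightarrow> W (Suc i) = V.adjoin (W i) (e i)"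
    "\<And>i. i < n \<Longrightarrow> right_subspace FD V (B i)" "\<And>i. i < n \<Longrightarrow> W i \<subseteq> B i"
    "\<And>i. i < n \<Longrightarrow> e i \<notin> B i" "\<And>i. i < n \<Longrightarrow> VF.adjoin (B i) (e i) = W (Suc i)"
  using assms unfolding flag_data_def by auto

lemma flag_data_vdim:
  assumes "flag_data n W e B" "i \<le> n"
  shows "V.vdim (W i) i"
  using assms(2)
proof (induction i)
  case 0
  then show ?case using flag_dataD(1)[OF assms(1)] V.vdim_zero by simp
next
  case (Suc i)
  then show ?case using flag_dataD(3-5)[OF assms(1), of i] V.vdim_adjoin[of "W i" i "e i"] by simp
qed

lemma flag_data_subspace: "flag_data n W e B \<Longrightarrow> i \<le> n \<Longrightarrow> right_subspace D V (W i)"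
  using flag_data_vdim V.vdim_subspace by blast

lemma flag_data_Suc_subset: "flag_data n W e B \<Longrightarrow> i < n \<Longrightarrow> W i \<subseteq> W (Suc i) \<and> e i \<in> W (Suc i) \<and> B i \<subseteq> W (Suc i)"
  using V.adjoin_incl[OF flag_data_subspace[of n W e B i], of "e i"] flag_dataD[of n W e B]
    VF.adjoin_incl[of "B i" "e i"] by auto

lemma flag_data_mono:
  assumes "flag_data n W e B" "j \<le> n" "i \<le> j"
  shows "W i \<subseteq> W j"
  using assms(3,2)
proof (induction j rule: dec_induct)
  case (step j)
  then show ?case using flag_data_Suc_subset[OF assms(1), of j] by auto
qed simp

lemma D_subspace_imp_F: "right_subspace D V W \<Longrightarrow> right_subspace FD V W"
  using V.right_subspaceD[of W] by (intro VF.right_subspaceI) auto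

lemma triangularD:
  assumes "u \<in> triangular n W e B"
  shows "u \<in> carrier E" "\<And>i w. i \<le> n \<Longrightarrow> w \<in> W i \<Longrightarrow> u w \<in> W i" "\<And>i. i < n \<Longrightarrow> u (e i) \<in> B i"
  using assms unfolding triangular_def by (blast, blast, blast)

lemma triangular_subspace:
  assumes "flag_data n W e B"
  shows "right_subspace FD ES (triangular n W e B)"
proof (rule EF.right_subspaceI)
  have Ws: "right_subspace FD V (W i)" if "i \<le> n" for i
    using D_subspace_imp_F flag_data_subspace[OF assms that] by blast
  have Wc: "w \<in> carrier V" if "w \<in> W i" "i \<le> n" for w i
    using VF.right_subspaceD(7)[OF Ws[OF that(2)] that(1)] .
  note B = flag_dataD(6)[OF assms] and ec = flag_dataD(3)[OF assms]
  show "triangular n W e B \<subseteq> carrier ES" by (auto simp: triangular_def)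
  show "\<zero>\<^bsub>ES\<^esub> \<in> triangular n W e B"
    using Ws B Wc ec VF.right_subspaceD(2) by (fastforce simp: triangular_def End_zero_closed)
  fix u assume u: "u \<in> triangular n W e B"
  then have uE: "u \<in> carrier E" by (simp add: triangular_def)
  show "u \<oplus>\<^bsub>ES\<^esub> v \<in> triangular n W e B" if v: "v \<in> triangular n W e B" for v
    unfolding triangular_def
  proof (intro CollectI conjI allI impI)
    show "u \<oplus>\<^bsub>ES\<^esub> v \<in> carrier E" using u v by (simp add: triangular_def End_add_closed)
    show "(u \<oplus>\<^bsub>ES\<^esub> v) ` W i \<subseteq> W i" if "i \<le> n" for i
    proof
      fix y assume "y \<in> (u \<oplus>\<^bsub>ES\<^esub> v) ` W i"
      then obtain w where w: "w \<in> W i" "y = (u \<oplus>\<^bsub>ES\<^esub> v) w" by auto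
      have "u w \<in> W i" "v w \<in> W i" using triangularD(2) u v w(1) that by blast+
      then show "y \<in> W i" using w VF.right_subspaceD(3)[OF Ws[OF that]] Wc[OF w(1) that] by simp
    qed
    show "(u \<oplus>\<^bsub>ES\<^esub> v) (e i) \<in> B i" if "i < n" for i
      using u v that ec[OF that] VF.right_subspaceD(3)[OF B[OF that]] by (simp add: triangular_def)
  qed
  show "u \<bullet>\<^bsub>ES\<^esub> c \<in> triangular n W e B" if c: "c \<in> carrier FD" for c
    unfolding triangular_def
  proof (intro CollectI conjI allI impI)
    show "u \<bullet>\<^bsub>ES\<^esub> c \<in> carrier E" using uE c by (simp add: End_smult_closed)
    show "(u \<bullet>\<^bsub>ES\<^esub> c) ` W i \<subseteq> W i" if "i \<le> n" for i
    proof
      fix y assume "y \<in> (u \<bullet>\<^bsub>ES\<^esub> c) ` W i"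
      then obtain w where w: "w \<in> W i" "y = (u \<bullet>\<^bsub>ES\<^esub> c) w" by auto
      have "u w \<in> W i" using triangularD(2) u w(1) that by blast
      then show "y \<in> W i" using w c VF.right_subspaceD(4)[OF Ws[OF that]] Wc[OF w(1) that] by simp
    qed
    show "(u \<bullet>\<^bsub>ES\<^esub> c) (e i) \<in> B i" if "i < n" for i
      using u c that ec[OF that] VF.right_subspaceD(4)[OF B[OF that]] by (simp add: triangular_def)
  qed
qed

text \<open>If a fixed vector had a nonzero component at \<open>e i\<close>, comparison modulo
  \<open>W i\<close> would put e i - u (e i) into \<open>W i\<close>, which lies in
  \<open>B i\<close>, and so \<open>e i\<close> into \<open>B i\<close>. Fixed vectors thus descend
  through the flag to zero.\<close>

lemma triangular_fixed_point_free:
  assumes T: "flag_data n W e B"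
  shows "fixed_point_free (triangular n W e B)"
  unfolding fixed_point_free_def
proof (intro ballI impI)
  fix u y assume u: "u \<in> triangular n W e B" and y: "y \<in> carrier V" "u y = y"
  have uE: "u \<in> carrier E" using u by (simp add: triangular_def)
  have "y \<in> W i \<Longrightarrow> y = \<zero>\<^bsub>V\<^esub>" if "i \<le> n" for i
    using that
  proof (induction i)
    case 0
    then show ?case using flag_dataD(1)[OF T] by simp
  next
    case (Suc i)
    then have i: "i < n" by simp
    note ei = flag_dataD(3-9)[OF T i]
    note Wi = V.right_subspaceD[OF flag_data_subspace[OF T less_imp_le[OF i]]]
    note Bi = VF.right_subspaceD[OF ei(4)]
    obtain w a where wa: "w \<in> W i" "a \<in> carrier D" "y = w \<oplus>\<^bsub>V\<^esub> e i \<bullet>\<^bsub>V\<^esub> a"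
      using Suc.prems(1) unfolding ei(3) by (rule V.adjoinE)
    have "a = \<zero>"
    proof (rule ccontr)
      assume a: "a \<noteq> \<zero>"
      have uw: "u w \<in> W i" using triangularD(2)[OF u _ wa(1)] i by simp
      have ue: "u (e i) \<in> B i" "u (e i) \<in> carrier V" using u i EndD(1)[OF uE ei(1)] by (auto simp: triangular_def)
      have "u y = u w \<oplus>\<^bsub>V\<^esub> u (e i) \<bullet>\<^bsub>V\<^esub> a"
        unfolding wa(3) using EndD(2,3)[OF uE] Wi(7)[OF wa(1)] ei(1) wa(2) by (simp add: V.rsmult_closed)
      then have eq: "w \<oplus>\<^bsub>V\<^esub> e i \<bullet>\<^bsub>V\<^esub> a = u w \<oplus>\<^bsub>V\<^esub> u (e i) \<bullet>\<^bsub>V\<^esub> a" using y(2) wa(3) by simp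
      note c = Wi(7)[OF wa(1)] Wi(7)[OF uw] ei(1) ue(2) wa(2) V.rsmult_closed[OF ei(1) wa(2)] V.rsmult_closed[OF ue(2) wa(2)]
      have "(e i \<ominus>\<^bsub>V\<^esub> u (e i)) \<bullet>\<^bsub>V\<^esub> a = (w \<oplus>\<^bsub>V\<^esub> e i \<bullet>\<^bsub>V\<^esub> a) \<ominus>\<^bsub>V\<^esub> u (e i) \<bullet>\<^bsub>V\<^esub> a \<ominus>\<^bsub>V\<^esub> w"
        using c by (simp add: V.minus_eq V.rsmult_add_vector V.rsmult_l_minus V.a_ac V.r_neg1 V.r_neg2)
      also have "\<dots> = u w \<ominus>\<^bsub>V\<^esub> w"
        unfolding eq using c by (simp add: V.minus_eq V.a_ac V.r_neg1 V.r_neg2 V.r_neg)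
      finally have "(e i \<ominus>\<^bsub>V\<^esub> u (e i)) \<bullet>\<^bsub>V\<^esub> a \<in> W i" using Wi(6)[OF uw wa(1)] by simp
      then have "e i \<ominus>\<^bsub>V\<^esub> u (e i) \<in> W i"
        using V.right_subspace_smult_iff[OF flag_data_subspace[OF T less_imp_le[OF i]] _ wa(2) a] c by simp
      then have "(e i \<ominus>\<^bsub>V\<^esub> u (e i)) \<oplus>\<^bsub>V\<^esub> u (e i) \<in> B i" using ei(5) ue Bi(3) by blast
      then show False using ei(6) c by (simp add: V.minus_eq V.a_assoc V.l_neg)
    qed
    then have "y = w" using wa ei(1) Wi(7) by simp
    then show ?case using Suc wa i by simp
  qed
  then show "y = \<zero>\<^bsub>V\<^esub>" using y(1) flag_dataD(2)[OF T] by blast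
qed

end

context algebra_complement
begin

lemma flag_data_restrict:
  assumes "flag_data (Suc m) Z e B" "Z m = W"
  shows "R.flag_data m Z e B"
proof -
  note T = flag_dataD[OF assms(1)]
  have sub: "Z i \<subseteq> W" if "i \<le> m" for i using flag_data_mono[OF assms(1), of m i] that assms(2) by simp
  have fs: "right_subspace FD (V\<lparr>carrier := W\<rparr>) (B i)" "e i \<in> W" if "i < m" for i
  proof -
    have BW: "B i \<subseteq> W" and "e i \<in> W" using flag_data_Suc_subset[OF assms(1), of i] sub[of "Suc i"] that by auto
    then show "right_subspace FD (V\<lparr>carrier := W\<rparr>) (B i)" "e i \<in> W"
      using VF.restrict_subspace_iff[OF D_subspace_imp_F[OF W]] T(6)[of i] that by auto
  qed
  show ?thesis
    unfolding R.flag_data_def V.restrict_adjoin[OF W] VF.restrict_adjoin[OF D_subspace_imp_F[OF W]]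
    using T fs assms(2) by auto
qed

lemma flag_data_extn:
  assumes T: "R.flag_data m Z e B"
    and Y: "right_subspace FD V Y" "W \<subseteq> Y" "x \<notin> Y" "VF.adjoin Y x = carrier V"
  shows "flag_data (Suc m) (Z(Suc m := carrier V)) (e(m := x)) (B(m := Y))"
proof -
  note T' = R.flag_dataD[OF T, unfolded V.restrict_adjoin[OF W] VF.restrict_adjoin[OF D_subspace_imp_F[OF W]], simplified]
  have fs: "right_subspace FD V (B i)" if "i < m" for i
    using T'(6)[OF that] VF.restrict_subspace_iff[OF D_subspace_imp_F[OF W]] by simp
  show ?thesis
    unfolding flag_data_def
    using T' fs Y xV xW adjoin_eq Ws(7) by (auto simp: less_Suc_eq)
qed

text \<open>The recursion behind the inductions on the flag: one condition at the top vector and a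
  triangular operator on the hyperplane below.\<close>

lemma triangular_Suc_iff:
  assumes T: "flag_data (Suc m) Z e B" "Z m = W" "e m = x"
  shows "u \<in> triangular (Suc m) Z e B \<longleftrightarrow>
    u \<in> carrier E \<and> u ` W \<subseteq> W \<and> u x \<in> B m \<and> restr u \<in> R.triangular m Z e B"
proof -
  have sub: "Z i \<subseteq> W" if "i \<le> m" for i using flag_data_mono[OF T(1), of m i] that T(2) by simp
  have eW: "e i \<in> W" if "i < m" for i using flag_data_Suc_subset[OF T(1), of i] sub[of "Suc i"] that by auto
  have eq: "restr u w = u w" if "u ` W \<subseteq> W" "w \<in> W" for u w using restr_apply that by blast
  show ?thesis
  proof
    assume u: "u \<in> triangular (Suc m) Z e B"
    note u' = triangularD[OF u]
    have uE: "u \<in> carrier E" and uW: "u ` W \<subseteq> W" and ux: "u x \<in> B m"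
      and uZ: "\<And>i. i \<le> Suc m \<Longrightarrow> u ` Z i \<subseteq> Z i" and ue: "\<And>i. i < m \<Longrightarrow> u (e i) \<in> B i"
      using u'(1) u'(2)[of m] u'(3)[of m] u'(2) u'(3) unfolding T(2,3) by auto
    have "restr u \<in> R.triangular m Z e B"
      unfolding R.triangular_def
    proof (intro CollectI conjI allI impI)
      show "restr u \<in> carrier R.E" using restr_closed[OF uE] .
      show "restr u ` Z i \<subseteq> Z i" if "i \<le> m" for i
      proof
        fix y assume "y \<in> restr u ` Z i"
        then obtain z where z: "z \<in> Z i" "y = restr u z" by blast
        then have "y = u z" using eq[OF uW, of z] sub[OF that] by blast
        then show "y \<in> Z i" using uZ[of i] z(1) that by auto
      qed
      show "restr u (e i) \<in> B i" if "i < m" for i using eq[OF uW eW[OF that]] ue[OF that] by simp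
    qed
    then show "u \<in> carrier E \<and> u ` W \<subseteq> W \<and> u x \<in> B m \<and> restr u \<in> R.triangular m Z e B"
      using uE uW ux by blast
  next
    assume u: "u \<in> carrier E \<and> u ` W \<subseteq> W \<and> u x \<in> B m \<and> restr u \<in> R.triangular m Z e B"
    then have uE: "u \<in> carrier E" and uW: "u ` W \<subseteq> W" and ux: "u x \<in> B m" by auto
    have r: "restr u ` Z i \<subseteq> Z i" if "i \<le> m" for i using u that unfolding R.triangular_def by blast
    have re: "restr u (e i) \<in> B i" if "i < m" for i using u that unfolding R.triangular_def by blast
    show "u \<in> triangular (Suc m) Z e B"
      unfolding triangular_def
    proof (intro CollectI conjI allI impI)
      show "u \<in> carrier E" by fact
      show "u ` Z i \<subseteq> Z i" if "i \<le> Suc m" for i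
      proof (cases "i = Suc m")
        case True
        then show ?thesis using flag_dataD(2)[OF T(1)] EndD(1)[OF uE] by auto
      next
        case False
        then have i: "i \<le> m" using that by simp
        show ?thesis
        proof
          fix y assume "y \<in> u ` Z i"
          then obtain z where z: "z \<in> Z i" "y = u z" by blast
          then have "y = restr u z" using eq[OF uW, of z] sub[OF i] by auto
          then show "y \<in> Z i" using r[OF i] z(1) by auto
        qed
      qed
      show "u (e i) \<in> B i" if "i < Suc m" for i
        using that ux T(3) re[of i] eq[OF uW eW[of i]] by (cases "i = m") auto
    qed
  qed
qed

lemma extn_triangular:
  assumes T: "flag_data (Suc m) Z e B" "Z m = W" "e m = x" and f: "f \<in> R.triangular m Z e B"
  shows "extn f \<in> triangular (Suc m) Z e B"
proof -
  have fE: "f \<in> carrier R.E" using f by (simp add: R.triangular_def)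
  have "\<zero>\<^bsub>V\<^esub> \<in> B m" using VF.right_subspaceD(2)[OF flag_dataD(6)[OF T(1)]] by simp
  moreover have "extn f ` W \<subseteq> W" using extn_in[OF fE] Ws(7) by auto
  ultimately show ?thesis
    unfolding triangular_Suc_iff[OF T] using extn_closed[OF fE] extn_apply(2)[OF fE] restr_extn[OF fE] f by simp
qed

lemma ex_End_eval:
  assumes v: "v \<in> carrier V"
  shows "\<exists>h\<in>carrier E. (\<forall>y\<in>carrier V. h y = v \<bullet>\<^bsub>V\<^esub> coord y) \<and> h x = v \<and> (\<forall>w\<in>W. h w = \<zero>\<^bsub>V\<^esub>)"
proof -
  let ?h = "\<lambda>y\<in>carrier V. v \<bullet>\<^bsub>V\<^esub> coord y"
  have "?h \<in> carrier E"
    by (rule EndI) (use v decomp(2) in \<open>auto simp: V.rsmult_closed proj_coord_add proj_coord_smult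
      V.rsmult_add_scalar V.rsmult_assoc\<close>)
  moreover have "?h x = v" using xV v proj_x V.rsmult_one by simp
  moreover have "?h w = \<zero>\<^bsub>V\<^esub>" if "w \<in> W" for w using that Ws(7)[OF that] v proj_W(2) by simp
  ultimately show ?thesis by (intro bexI[of _ ?h]) auto
qed

text \<open>A rank-one operator vanishing on the hyperplane restricts to zero there, so only its
  value at the top vector is constrained.\<close>

lemma ex_triangular_eval:
  assumes T: "flag_data (Suc m) Z e B" "Z m = W" "e m = x" and v: "v \<in> B m"
  shows "\<exists>h\<in>triangular (Suc m) Z e B. h x = v \<and> (\<forall>w\<in>W. h w = \<zero>\<^bsub>V\<^esub>)"
proof -
  have vV: "v \<in> carrier V" using VF.right_subspaceD(7)[OF flag_dataD(6)[OF T(1)] v] by simp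
  obtain h where hE: "h \<in> carrier E" and hx: "h x = v" and hW: "\<And>w. w \<in> W \<Longrightarrow> h w = \<zero>\<^bsub>V\<^esub>"
    using ex_End_eval[OF vV] by blast
  have "restr h = \<zero>\<^bsub>R.E\<^esub>"
    by (rule R.End_eqI[OF restr_closed[OF hE] R.End_zero_closed]) (use hW Ws(2) restr_apply in simp)
  also have "\<dots> \<in> R.triangular m Z e B"
    using R.EF.right_subspaceD(2)[OF R.triangular_subspace[OF flag_data_restrict[OF T(1,2)]]] by simp
  finally have "h \<in> triangular (Suc m) Z e B"
    unfolding triangular_Suc_iff[OF T] using hE hW hx v Ws(2) by auto
  then show ?thesis using hx hW by blast
qed

lemma flag_data_vdim_B:
  assumes "V.vdim (carrier V) (Suc m)" "RF.vdim (carrier D) d" "right_subspace FD V Y" "x \<notin> Y"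
    "VF.adjoin Y x = carrier V"
  shows "VF.vdim Y (Suc m * d - 1)"
  using VF.vdim_hyperplane[OF vdim_F_of_vdim_D[OF assms(1,2)] assms(3) xV assms(4) assms(5)[symmetric]] by auto

end

lemma (in algebra_space) flag_data_complement:
  assumes T: "flag_data (Suc m) Z e B"
  shows "algebra_complement D F V (Z m) (e m)"
  by unfold_locales (use flag_data_subspace[OF T, of m] flag_dataD[OF T] in auto)

text \<open>Evaluation at the top vector is onto \<open>B m\<close>, an F-hyperplane of the whole
  space, and its kernel consists of the extensions by zero of triangular operators on
  \<open>W m\<close>. These dimensions are the two summands of \<open>max_dim\<close>.\<close>

lemma (in division_algebra) vdim_triangular:
  assumes "algebra_space D F V" "algebra_space.flag_data D F V n W e B" "RF.vdim (carrier D) d"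
  shows "right_vector_space.vdim (D\<lparr>carrier := F\<rparr>) (End_space D V) (algebra_space.triangular D V n W e B) (max_dim d n)"
  using assms
proof (induction n arbitrary: V)
  case (0 V)
  interpret algebra_space D F V by fact
  have "carrier V = {\<zero>\<^bsub>V\<^esub>}" using flag_dataD(1,2)[OF 0(2)] by simp
  then have "f = \<zero>\<^bsub>E\<^esub>" if "f \<in> carrier E" for f
    using End_eqI[OF that End_zero_closed] EndD(1)[OF that] by simp
  moreover have "\<zero>\<^bsub>ES\<^esub> \<in> triangular 0 W e B" using EF.right_subspaceD(2)[OF triangular_subspace[OF 0(2)]] .
  ultimately have "triangular 0 W e B = {\<zero>\<^bsub>ES\<^esub>}" unfolding triangular_def by auto
  then show ?case using EF.vdim_zero by simp
next
  case (Suc m V)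
  interpret algebra_space D F V by fact
  note T = Suc.prems(2)
  interpret algebra_complement D F V "W m" "e m" using flag_data_complement[OF T] .
  let ?T = "triangular (Suc m) W e B"
  have "R.EF.vdim (R.triangular m W e B) (max_dim d m)"
    using Suc.IH[OF R.algebra_space_axioms flag_data_restrict[OF T refl] Suc.prems(3)] .
  then have 1: "EF.vdim (extn ` R.triangular m W e B) (max_dim d m)" by (rule vdim_extn)
  have "extn ` R.triangular m W e B = {u \<in> ?T. u (e m) = \<zero>\<^bsub>V\<^esub>}"
  proof (intro equalityI subsetI)
    fix u assume "u \<in> extn ` R.triangular m W e B"
    then show "u \<in> {u \<in> ?T. u (e m) = \<zero>\<^bsub>V\<^esub>}"
      using extn_triangular[OF T refl refl] extn_apply(2) by (auto simp: R.triangular_def)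
  next
    fix u assume u: "u \<in> {u \<in> ?T. u (e m) = \<zero>\<^bsub>V\<^esub>}"
    then have r: "restr u \<in> R.triangular m W e B" "u ` W m \<subseteq> W m" "u \<in> carrier E" "u (e m) = \<zero>\<^bsub>V\<^esub>"
      using triangular_Suc_iff[OF T refl refl] by blast+
    have "extn (restr u) = u" by (rule extn_restr[OF r(3,4)]) (use r(2) in blast)
    then show "u \<in> extn ` R.triangular m W e B" using r(1) by (metis image_eqI)
  qed
  then have ker: "EF.vdim {u \<in> ?T. u (e m) = \<zero>\<^bsub>V\<^esub>} (max_dim d m)" using 1 by simp
  have im: "vals ?T (e m) = B m"
  proof (intro equalityI subsetI)
    fix y assume "y \<in> vals ?T (e m)" then show "y \<in> B m" by (auto simp: triangular_def)
  next
    fix y assume "y \<in> B m" then show "y \<in> vals ?T (e m)" using ex_triangular_eval[OF T refl refl] by blast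
  qed
  have "V.vdim (carrier V) (Suc m)" using flag_data_vdim[OF T, of "Suc m"] flag_dataD(2)[OF T] by simp
  then have "VF.vdim (vals ?T (e m)) (Suc m * d - 1)"
    unfolding im using flag_data_vdim_B[OF _ Suc.prems(3)] flag_dataD(2,6,8,9)[OF T] by simp
  then show ?case using ev.rank_nullity_converse[OF ev_linear[OF xV] triangular_subspace[OF T] _ ker] by simp
qed

text \<open>An operator that differs from every triangular one by an injective operator is itself
  triangular with diagonal entries outside the prescribed hyperplanes.\<close>

lemma (in division_algebra) avoids_triangular:
  assumes "algebra_space D F V" "algebra_space.flag_data D F V n W e B" "z \<in> carrier (End_ring D V)"
    "\<And>h y. \<lbrakk>h \<in> algebra_space.triangular D V n W e B; y \<in> carrier V; z y = h y\<rbrakk> \<Longrightarrow> y = \<zero>\<^bsub>V\<^esub>"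
  shows "(\<forall>i\<le>n. z ` W i \<subseteq> W i) \<and> (\<forall>i<n. z (e i) \<notin> B i)"
  using assms
proof (induction n arbitrary: V z)
  case (0 V z)
  interpret algebra_space D F V by fact
  show ?case using flag_dataD(1)[OF 0(2)] EndD(4)[OF 0(3)] by simp
next
  case (Suc m V z)
  interpret algebra_space D F V by fact
  note T = Suc.prems(2) and z = Suc.prems(3) and avoid = Suc.prems(4)
  interpret algebra_complement D F V "W m" "e m" using flag_data_complement[OF T] .
  note zE = EndD[OF z]
  have e0: "e m \<noteq> \<zero>\<^bsub>V\<^esub>" using xW Ws(2) by auto
  \<comment> \<open>Otherwise a rank-one triangular operator would agree with \<open>z\<close> at
    \<open>e m\<close>.\<close>
  have zem: "z (e m) \<notin> B m"
  proof
    assume "z (e m) \<in> B m"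
    then obtain h where "h \<in> triangular (Suc m) W e B" "h (e m) = z (e m)"
      using ex_triangular_eval[OF T refl refl] by blast
    then show False using avoid[of h "e m"] xV e0 by simp
  qed
  have zW: "z y \<in> W m" if y: "y \<in> W m" for y
  proof (rule ccontr)
    assume n: "z y \<notin> W m"
    have yV: "y \<in> carrier V" using Ws(7)[OF y] .
    let ?c = "coord (z y)"
    have c: "?c \<in> carrier D" "?c \<noteq> \<zero>" using decomp(2) coord_zero_iff n zE(1)[OF yV] by auto
    let ?g = "coord (z (e m))"
    have g: "?g \<in> carrier D" using decomp(2) zE(1)[OF xV] .
    \<comment> \<open>Chosen to cancel the component along \<open>e m\<close>: \<open>z\<close> maps
      e m + y a into \<open>W m\<close>, hence into \<open>B m\<close>. Some rank-one triangular
      operator takes that value at \<open>e m\<close>, and also at e m + y a because it kills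
      \<open>W m\<close>.\<close>
    let ?a = "\<ominus> (inv ?c \<otimes> ?g)"
    have a: "?a \<in> carrier D" using c g V.inv_D[of ?c] by simp
    let ?y = "e m \<oplus>\<^bsub>V\<^esub> y \<bullet>\<^bsub>V\<^esub> ?a"
    have y': "?y \<in> carrier V" using xV yV a by (simp add: V.rsmult_closed)
    have ya: "y \<bullet>\<^bsub>V\<^esub> ?a \<in> W m" using Ws(4) y a by simp
    have "coord (z ?y) = ?g \<oplus> ?c \<otimes> ?a"
      using zE xV yV a by (simp add: V.rsmult_closed proj_coord_add proj_coord_smult)
    also have "?c \<otimes> ?a = \<ominus> ?g"
      using c g V.inv_D[of ?c] by (simp add: D.r_minus D.m_assoc[symmetric])
    finally have "coord (z ?y) = \<zero>" using g by (simp add: D.r_neg)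
    then have "z ?y \<in> W m" using coord_zero_iff zE(1)[OF y'] by simp
    then have "z ?y \<in> B m" using flag_dataD(7)[OF T] by auto
    then obtain h where h: "h \<in> triangular (Suc m) W e B" "h (e m) = z ?y" "\<And>w. w \<in> W m \<Longrightarrow> h w = \<zero>\<^bsub>V\<^esub>"
      using ex_triangular_eval[OF T refl refl] by blast
    have hE: "h \<in> carrier E" using h by (simp add: triangular_def)
    have "h ?y = h (e m) \<oplus>\<^bsub>V\<^esub> h (y \<bullet>\<^bsub>V\<^esub> ?a)" using EndD(2)[OF hE xV] yV a by (simp add: V.rsmult_closed)
    also have "\<dots> = z ?y" using h ya zE(1)[OF y'] by simp
    finally have "?y = \<zero>\<^bsub>V\<^esub>" using avoid[OF h(1) y'] by simp
    then have "e m \<in> W m" using V.right_subspace_add_iff(1)[OF W xV ya] Ws(2) by simp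
    then show False using xW by simp
  qed
  have "(\<forall>i\<le>m. restr z ` W i \<subseteq> W i) \<and> (\<forall>i<m. restr z (e i) \<notin> B i)"
  proof (rule Suc.IH[OF R.algebra_space_axioms flag_data_restrict[OF T refl] restr_closed[OF z]])
    fix f y assume f: "f \<in> R.triangular m W e B" and "y \<in> carrier (V\<lparr>carrier := W m\<rparr>)" and eq: "restr z y = f y"
    then have y: "y \<in> W m" by simp
    have fE: "f \<in> carrier R.E" using f by (simp add: R.triangular_def)
    have "z y = extn f y" using eq restr_apply[of z y, OF zW[OF y] y] extn_apply(1)[OF fE y] by simp
    then show "y = \<zero>\<^bsub>V\<lparr>carrier := W m\<rparr>\<^esub>"
      using avoid[OF extn_triangular[OF T refl refl f], of y] Ws(7)[OF y] by simp
  qed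
  then have IH: "restr z ` W i \<subseteq> W i" if "i \<le> m" for i using that by blast
  have IHe: "restr z (e i) \<notin> B i" if "i < m" for i
    using \<open>(\<forall>i\<le>m. restr z ` W i \<subseteq> W i) \<and> (\<forall>i<m. restr z (e i) \<notin> B i)\<close> that by blast
  have sub: "W i \<subseteq> W m" if "i \<le> m" for i using flag_data_mono[OF T, of m i] that by simp
  have "z ` W i \<subseteq> W i" if "i \<le> Suc m" for i
  proof (cases "i = Suc m")
    case True
    then show ?thesis using flag_dataD(2)[OF T] zE(1) by auto
  next
    case False
    then have i: "i \<le> m" using that by simp
    show ?thesis
    proof
      fix y assume "y \<in> z ` W i"
      then obtain w where w: "w \<in> W i" "y = z w" by blast
      then have "w \<in> W m" using sub[OF i] by auto
      then have "y = restr z w" using restr_apply[of z, OF zW] w(2) by simp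
      then show "y \<in> W i" using IH[OF i] w(1) by auto
    qed
  qed
  moreover have "z (e i) \<notin> B i" if "i < Suc m" for i
  proof (cases "i = m")
    case True
    then show ?thesis using zem by simp
  next
    case False
    then have i: "i < m" using that by simp
    have "e i \<in> W m" using flag_data_Suc_subset[OF T, of i] sub[of "Suc i"] i by auto
    then show ?thesis using IHe[OF i] restr_apply[of z, OF zW] by simp
  qed
  ultimately show ?case by blast
qed

section \<open>Optimal spaces are triangular\<close>

context division_algebra
begin

text \<open>Equivalently, F + z F is closed under multiplication; the elements of \<open>F\<close>
  are included.\<close>

definition "quadratic z \<longleftrightarrow> (\<exists>a\<in>F. \<exists>b\<in>F. z \<otimes> z = z \<otimes> a \<oplus> b)"

abbreviation "F_functional t \<equiv> linear_map (D\<lparr>carrier := F\<rparr>) (regular_space D) (regular_space (D\<lparr>carrier := F\<rparr>)) t"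
abbreviation "F_endo f \<equiv> linear_map (D\<lparr>carrier := F\<rparr>) (regular_space D) (regular_space D) f"

lemma F_functionalD:
  assumes "F_functional t"
  shows "\<And>b. b \<in> carrier D \<Longrightarrow> t b \<in> F"
    "\<And>a b. a \<in> carrier D \<Longrightarrow> b \<in> carrier D \<Longrightarrow> t (a \<oplus> b) = t a \<oplus> t b"
    "\<And>a c. a \<in> carrier D \<Longrightarrow> c \<in> F \<Longrightarrow> t (a \<otimes> c) = t a \<otimes> c"
    "t \<zero> = \<zero>"
proof -
  show *: "\<And>b. b \<in> carrier D \<Longrightarrow> t b \<in> F"
    "\<And>a b. a \<in> carrier D \<Longrightarrow> b \<in> carrier D \<Longrightarrow> t (a \<oplus> b) = t a \<oplus> t b"
    "\<And>a c. a \<in> carrier D \<Longrightarrow> c \<in> F \<Longrightarrow> t (a \<otimes> c) = t a \<otimes> c"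
    using assms unfolding linear_map_def by auto
  show "t \<zero> = \<zero>" using *(3)[of \<zero> \<zero>] *(1)[of \<zero>] by simp
qed

lemma F_endoD:
  assumes "F_endo f"
  shows "\<And>b. b \<in> carrier D \<Longrightarrow> f b \<in> carrier D"
    "\<And>a b. a \<in> carrier D \<Longrightarrow> b \<in> carrier D \<Longrightarrow> f (a \<oplus> b) = f a \<oplus> f b"
    "\<And>a c. a \<in> carrier D \<Longrightarrow> c \<in> F \<Longrightarrow> f (a \<otimes> c) = f a \<otimes> c"
  using assms unfolding linear_map_def by auto

lemma inv_closed': "a \<in> carrier D \<Longrightarrow> a \<noteq> \<zero> \<Longrightarrow> inv a \<in> carrier D \<and> a \<otimes> inv a = \<one> \<and> inv a \<otimes> a = \<one> \<and> inv a \<noteq> \<zero>"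
  using right_vector_space.inv_D[OF regular_space] by blast

text \<open>A nonzero \<open>g\<close> would give g D = D, which contains 1.\<close>

lemma F_functional_annihilates:
  assumes t: "F_functional t" "t \<one> \<noteq> \<zero>" and g: "g \<in> carrier D" "\<And>b. b \<in> carrier D \<Longrightarrow> t (g \<otimes> b) = \<zero>"
  shows "g = \<zero>"
proof (rule ccontr)
  assume "g \<noteq> \<zero>"
  then have "inv g \<in> carrier D" "g \<otimes> inv g = \<one>" using inv_closed' g(1) by auto
  then show False using g(2)[of "inv g"] t(2) by simp
qed

lemma quadratic_F: "z \<in> F \<Longrightarrow> quadratic z"
  unfolding quadratic_def by (intro bexI[of _ z] bexI[of _ \<zero>]) auto

text \<open>Multiplication by z (z + 1) clears both inverses and leaves z^2 C = z (A - B - C) - B,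
  with C invertible in \<open>F\<close>.\<close>

lemma quadratic_of_inverses:
  assumes z: "z \<in> carrier D" "z \<noteq> \<zero>" "z \<oplus> \<one> \<noteq> \<zero>" and c: "A \<in> F" "B \<in> F" "C \<in> F" "C \<noteq> \<zero>"
    and eq: "inv (z \<oplus> \<one>) \<otimes> A = inv z \<otimes> B \<oplus> C"
  shows "quadratic z"
proof -
  have y: "z \<oplus> \<one> \<in> carrier D" using z by simp
  note iy = inv_closed'[OF y z(3)] and iz = inv_closed'[OF z(1,2)]
  note cD = F_closed[OF c(1)] F_closed[OF c(2)] F_closed[OF c(3)]
  have "(z \<oplus> \<one>) \<otimes> (inv (z \<oplus> \<one>) \<otimes> A) = A" using iy y cD(1) by (metis m_assoc l_one)
  then have A: "A = (z \<oplus> \<one>) \<otimes> (inv z \<otimes> B \<oplus> C)" using eq by simp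
  have zz: "z \<otimes> (inv z \<otimes> B) = B" using iz z(1) cD(2) by (metis m_assoc l_one)
  have "z \<otimes> A = (z \<otimes> (z \<oplus> \<one>)) \<otimes> (inv z \<otimes> B \<oplus> C)"
    using m_assoc[OF z(1) y, of "inv z \<otimes> B \<oplus> C"] iz cD A by simp
  also have "z \<otimes> (z \<oplus> \<one>) = (z \<oplus> \<one>) \<otimes> z" using z by (simp add: r_distr l_distr)
  also have "((z \<oplus> \<one>) \<otimes> z) \<otimes> (inv z \<otimes> B \<oplus> C) = (z \<oplus> \<one>) \<otimes> (z \<otimes> (inv z \<otimes> B \<oplus> C))"
    using m_assoc[OF y z(1), of "inv z \<otimes> B \<oplus> C"] iz cD by simp
  also have "z \<otimes> (inv z \<otimes> B \<oplus> C) = B \<oplus> z \<otimes> C"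
    using zz iz cD z(1) by (simp add: r_distr)
  also have "(z \<oplus> \<one>) \<otimes> (B \<oplus> z \<otimes> C) = z \<otimes> B \<oplus> (z \<otimes> z) \<otimes> C \<oplus> B \<oplus> z \<otimes> C"
    using z(1) cD by (simp add: l_distr r_distr m_assoc a_ac)
  finally have eq: "z \<otimes> A = z \<otimes> B \<oplus> (z \<otimes> z) \<otimes> C \<oplus> B \<oplus> z \<otimes> C" .
  have "(z \<otimes> z) \<otimes> C = z \<otimes> A \<ominus> z \<otimes> B \<ominus> z \<otimes> C \<ominus> B"
  proof -
    have cancel: "(u \<oplus> v) \<ominus> v = u" if "u \<in> carrier D" "v \<in> carrier D" for u v
      using that by (simp add: minus_eq a_assoc r_neg)
    have "z \<otimes> A = (((z \<otimes> z) \<otimes> C \<oplus> B) \<oplus> z \<otimes> C) \<oplus> z \<otimes> B"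
      unfolding eq using z(1) cD by (simp add: a_ac)
    then show ?thesis using z(1) cD by (simp add: cancel)
  qed
  also have "\<dots> = z \<otimes> (A \<ominus> B \<ominus> C) \<oplus> \<ominus> B"
    using z(1) cD by (simp add: minus_eq r_distr r_minus)
  finally have e: "(z \<otimes> z) \<otimes> C = z \<otimes> (A \<ominus> B \<ominus> C) \<oplus> \<ominus> B" .
  have iC: "inv C \<in> F" "C \<otimes> inv C = \<one>" using F_inv[OF c(3,4)] inv_closed'[OF cD(3) c(4)] by auto
  note iCD = F_closed[OF iC(1)]
  have "z \<otimes> z = ((z \<otimes> z) \<otimes> C) \<otimes> inv C" using z(1) iC(2) iCD cD by (simp add: m_assoc)
  also have "\<dots> = z \<otimes> ((A \<ominus> B \<ominus> C) \<otimes> inv C) \<oplus> (\<ominus> B) \<otimes> inv C"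
    unfolding e using z(1) iCD cD by (simp add: l_distr m_assoc)
  finally show ?thesis unfolding quadratic_def
    using iC c by (intro bexI[of _ "(A \<ominus> B \<ominus> C) \<otimes> inv C"] bexI[of _ "(\<ominus> B) \<otimes> inv C"]) auto
qed

text \<open>With \<open>\<beta> v w = psi (v \<otimes> lam w)\<close> and \<open>q v = \<beta> v v\<close>, the vanishing hypothesis means
  \<open>\<beta> v w = t (v\<inverse> w) q v\<close>, and additivity of \<open>\<beta>\<close> in its first argument forces \<open>v \<mapsto> q v v\<inverse>\<close> to be
  additive. Comparing the values at \<open>p z\<close>, \<open>p\<close> and \<open>p z \<oplus> p\<close> gives a quadratic equation for \<open>z\<close>.\<close>

lemma quadratic_of_twisted_form:
  assumes t: "F_functional t" "t \<one> = \<one>" and psi: "F_functional psi" "psi \<one> = \<one>"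
    and lam: "F_endo lam"
    and zero: "\<And>b c. \<lbrakk>b \<in> carrier D; c \<in> carrier D; t b = \<zero>\<rbrakk> \<Longrightarrow> psi (c \<otimes> lam (c \<otimes> b)) = \<zero>"
    and w: "w \<in> carrier D" "lam w \<noteq> \<zero>" and z: "z \<in> carrier D"
  shows "quadratic z"
proof -
  note t' = F_functionalD[OF t(1)] and p' = F_functionalD[OF psi(1)] and l' = F_endoD[OF lam]
  define q where "q v = psi (v \<otimes> lam v)" for v
  have qF [simp]: "q v \<in> F" if "v \<in> carrier D" for v using that p'(1) l'(1) unfolding q_def by simp
  have tF [simp]: "t v \<in> F" if "v \<in> carrier D" for v using that t'(1) by simp
  \<comment> \<open>Write b as (b - t b) + t b. Since t 1 = 1, the first summand lies in the kernel
    of \<open>t\<close>, where the hypothesis applies, and the second is a scalar.\<close>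
  have key: "psi (v \<otimes> lam (v \<otimes> b)) = q v \<otimes> t b" if v: "v \<in> carrier D" and b: "b \<in> carrier D" for v b
  proof -
    let ?b = "b \<ominus> t b"
    have bc: "?b \<in> carrier D" using b by simp
    have b_eq: "b = ?b \<oplus> t b" using b by (simp add: minus_eq a_assoc l_neg)
    have "t b = t ?b \<oplus> t (\<one> \<otimes> t b)" using t'(2)[of ?b "t b"] b bc b_eq by simp
    also have "t (\<one> \<otimes> t b) = t b" using t'(3)[of \<one> "t b"] t(2) b by simp
    finally have "t ?b = \<zero>" using b bc by (metis F_closed l_zero t'(1) zero_closed add.r_cancel)
    then have z0: "psi (v \<otimes> lam (v \<otimes> ?b)) = \<zero>" using zero bc v by simp
    have "v \<otimes> b = v \<otimes> ?b \<oplus> v \<otimes> t b" using b_eq r_distr[of ?b "t b" v] v b bc by simp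
    then have "lam (v \<otimes> b) = lam (v \<otimes> ?b) \<oplus> lam v \<otimes> t b" using l' v b bc by simp
    then have "v \<otimes> lam (v \<otimes> b) = v \<otimes> lam (v \<otimes> ?b) \<oplus> (v \<otimes> lam v) \<otimes> t b"
      using l'(1) v b bc by (simp add: r_distr m_assoc)
    then have "psi (v \<otimes> lam (v \<otimes> b)) = psi (v \<otimes> lam (v \<otimes> ?b)) \<oplus> psi (v \<otimes> lam v) \<otimes> t b"
      using p'(2)[of "v \<otimes> lam (v \<otimes> ?b)" "(v \<otimes> lam v) \<otimes> t b"] p'(3)[of "v \<otimes> lam v" "t b"] l'(1) v b bc by simp
    then show ?thesis unfolding z0 q_def using p'(1) l'(1) v b by simp
  qed
  \<comment> \<open>If \<open>q\<close> vanished identically, then so would every psi (v lam (v b));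
    for v inverse to \<open>lam w\<close> and v b = w this is psi 1 = 1.\<close>
  obtain p where p: "p \<in> carrier D" "q p \<noteq> \<zero>"
  proof (rule ccontr)
    assume n: "\<not> thesis"
    have q0: "q v = \<zero>" if "v \<in> carrier D" for v using n that \<open>\<And>p. \<lbrakk>p \<in> carrier D; q p \<noteq> \<zero>\<rbrakk> \<Longrightarrow> thesis\<close> by blast
    let ?v = "inv (lam w)"
    have v: "?v \<in> carrier D" "?v \<otimes> lam w = \<one>" "?v \<noteq> \<zero>" using inv_closed'[OF l'(1)[OF w(1)] w(2)] by auto
    have iv: "inv ?v \<in> carrier D" "?v \<otimes> inv ?v = \<one>" using inv_closed'[OF v(1,3)] by auto
    have "?v \<otimes> (inv ?v \<otimes> w) = w" using iv v w by (simp add: m_assoc[symmetric])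
    then have "psi (?v \<otimes> lam w) = \<zero>" using key[OF v(1), of "inv ?v \<otimes> w"] q0[OF v(1)] iv w by simp
    then show False using v(2) psi(2) one_not_zero by simp
  qed
  have p0: "p \<noteq> \<zero>" using p(2) p'(4) l'(1)[of \<zero>] unfolding q_def by auto
  show ?thesis
  proof (cases "z = \<zero> \<or> z \<oplus> \<one> = \<zero>")
    case True
    then have "z \<in> F"
    proof
      assume "z \<oplus> \<one> = \<zero>"
      then have "z = \<ominus> \<one>" using z by (metis minus_equality one_closed)
      then show ?thesis by simp
    qed simp
    then show ?thesis by (rule quadratic_F)
  next
    case False
    let ?y = "z \<oplus> \<one>"
    have y: "?y \<in> carrier D" "?y \<noteq> \<zero>" using z False by auto
    note iy = inv_closed'[OF y] and iz = inv_closed'[OF z, simplified]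
    have iz: "inv z \<in> carrier D" "z \<otimes> inv z = \<one>" using iz False by auto
    let ?v = "p \<otimes> z"
    let ?A = "q (?v \<oplus> p)" and ?B = "q ?v" and ?C = "q p"
    have c: "?A \<in> F" "?B \<in> F" "?C \<in> F" using p(1) z by auto
    \<comment> \<open>The vectors p z, p and their sum p (z + 1) all reach the argument p b of
      \<open>lam\<close> by suitable right factors. Additivity compares the three instances of
      \<open>key\<close>, and since b is arbitrary, \<open>F_functional_annihilates\<close> removes
      \<open>t\<close>.\<close>
    have "t ((inv ?y \<otimes> ?A \<ominus> (inv z \<otimes> ?B \<oplus> ?C)) \<otimes> b) = \<zero>" if b: "b \<in> carrier D" for b
    proof -
      have vy: "(?v \<oplus> p) \<otimes> (inv ?y \<otimes> b) = p \<otimes> b"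
      proof -
        have "?v \<oplus> p = p \<otimes> ?y" using p z by (simp add: r_distr)
        moreover have "?y \<otimes> (inv ?y \<otimes> b) = b" using iy y(1) b by (simp add: m_assoc[symmetric])
        ultimately show ?thesis using p(1) y(1) iy b m_assoc[of p ?y "inv ?y \<otimes> b"] by simp
      qed
      have vz: "?v \<otimes> (inv z \<otimes> b) = p \<otimes> b"
      proof -
        have "z \<otimes> (inv z \<otimes> b) = b" using iz z b by (simp add: m_assoc[symmetric])
        then show ?thesis using p(1) z iz b m_assoc[of p z "inv z \<otimes> b"] by simp
      qed
      let ?L = "lam (p \<otimes> b)"
      have L: "?L \<in> carrier D" using l'(1) p b by simp
      have "psi ((?v \<oplus> p) \<otimes> ?L) = psi (?v \<otimes> ?L) \<oplus> psi (p \<otimes> ?L)"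
        using p'(2)[of "?v \<otimes> ?L" "p \<otimes> ?L"] p z L by (simp add: l_distr)
      moreover have "psi ((?v \<oplus> p) \<otimes> ?L) = ?A \<otimes> t (inv ?y \<otimes> b)"
        using key[of "?v \<oplus> p" "inv ?y \<otimes> b"] vy p z iy b by simp
      moreover have "psi (?v \<otimes> ?L) = ?B \<otimes> t (inv z \<otimes> b)"
        using key[of ?v "inv z \<otimes> b"] vz p z iz b by simp
      moreover have "psi (p \<otimes> ?L) = ?C \<otimes> t b" using key p b by simp
      ultimately have eq: "?A \<otimes> t (inv ?y \<otimes> b) = ?B \<otimes> t (inv z \<otimes> b) \<oplus> ?C \<otimes> t b" by simp
      have sc: "t ((g \<otimes> a) \<otimes> b) = a \<otimes> t (g \<otimes> b)" if "a \<in> F" "g \<in> carrier D" for a g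
      proof -
        have "(g \<otimes> a) \<otimes> b = (g \<otimes> b) \<otimes> a" using F_commute[OF that(1) b] that b by (simp add: m_assoc)
        then show ?thesis using t'(3)[of "g \<otimes> b" a] that b F_commute[OF that(1), of "t (g \<otimes> b)"] by simp
      qed
      let ?l = "(inv ?y \<otimes> ?A) \<otimes> b" and ?r = "(inv z \<otimes> ?B \<oplus> ?C) \<otimes> b"
      have l: "?l \<in> carrier D" and r: "?r \<in> carrier D" using iy iz c b by simp_all
      have "t ?r = ?B \<otimes> t (inv z \<otimes> b) \<oplus> ?C \<otimes> t b"
        using sc[OF c(2) iz(1)] sc[OF c(3), of \<one>] iz c b t'(2)[of "(inv z \<otimes> ?B) \<otimes> b" "?C \<otimes> b"] by (simp add: l_distr)
      then have tl: "t ?l = t ?r" using sc[OF c(1), of "inv ?y"] iy eq by simp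
      have "?l = (inv ?y \<otimes> ?A \<ominus> (inv z \<otimes> ?B \<oplus> ?C)) \<otimes> b \<oplus> ?r"
        using iy iz c b by (simp add: l_distr[symmetric] minus_eq a_assoc l_neg)
      then have "t ?l = t ((inv ?y \<otimes> ?A \<ominus> (inv z \<otimes> ?B \<oplus> ?C)) \<otimes> b) \<oplus> t ?r"
        using t'(2)[of "(inv ?y \<otimes> ?A \<ominus> (inv z \<otimes> ?B \<oplus> ?C)) \<otimes> b" ?r] iy iz c b by simp
      then have "\<zero> \<oplus> t ?r = t ((inv ?y \<otimes> ?A \<ominus> (inv z \<otimes> ?B \<oplus> ?C)) \<otimes> b) \<oplus> t ?r"
        using tl tF[OF r] by simp
      then show ?thesis using tF[OF r] tF[of "(inv ?y \<otimes> ?A \<ominus> (inv z \<otimes> ?B \<oplus> ?C)) \<otimes> b"] iy iz c b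
        by (metis F_closed add.r_cancel minus_closed m_closed a_closed zero_closed)
    qed
    from F_functional_annihilates[OF t(1) _ _ this]
    have "inv ?y \<otimes> ?A \<ominus> (inv z \<otimes> ?B \<oplus> ?C) = \<zero>"
      using t(2) one_not_zero iy iz c by simp
    then have "inv ?y \<otimes> ?A = inv z \<otimes> ?B \<oplus> ?C" using iy iz c by simp
    then show ?thesis using quadratic_of_inverses[OF z _ y(2) c p(2)] False by simp
  qed
qed

end

context right_vector_space
begin

text \<open>A Vandermonde argument at the points 0, 1 and \<open>s\<close>. It is applied over
  \<open>F\<close>, whence the demand for a third scalar there.\<close>

lemma quadratic_values_in_subspace:
  assumes T: "right_subspace D V T" and c: "\<alpha> \<in> carrier V" "\<beta> \<in> carrier V" "\<gamma> \<in> carrier V"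
    and s: "s \<in> carrier D" "s \<noteq> \<zero>\<^bsub>D\<^esub>" "s \<noteq> \<one>\<^bsub>D\<^esub>"
    and val: "\<And>a. a = \<zero>\<^bsub>D\<^esub> \<or> a = \<one>\<^bsub>D\<^esub> \<or> a = s \<Longrightarrow> \<alpha> \<oplus>\<^bsub>V\<^esub> \<beta> \<bullet>\<^bsub>V\<^esub> a \<oplus>\<^bsub>V\<^esub> \<gamma> \<bullet>\<^bsub>V\<^esub> (a \<otimes>\<^bsub>D\<^esub> a) \<in> T"
  shows "\<alpha> \<in> T" "\<beta> \<in> T" "\<gamma> \<in> T"
proof -
  note Ts = right_subspaceD[OF T]
  show a: "\<alpha> \<in> T" using val[of "\<zero>\<^bsub>D\<^esub>"] c by simp
  have "\<alpha> \<oplus>\<^bsub>V\<^esub> (\<beta> \<oplus>\<^bsub>V\<^esub> \<gamma>) \<in> T" using val[of "\<one>\<^bsub>D\<^esub>"] c by (simp add: rsmult_one V.a_assoc)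
  then have 1: "\<beta> \<oplus>\<^bsub>V\<^esub> \<gamma> \<in> T" using right_subspace_add_iff(2)[OF T _ a] c by simp
  have "\<alpha> \<oplus>\<^bsub>V\<^esub> (\<beta> \<bullet>\<^bsub>V\<^esub> s \<oplus>\<^bsub>V\<^esub> \<gamma> \<bullet>\<^bsub>V\<^esub> (s \<otimes>\<^bsub>D\<^esub> s)) \<in> T"
    using val[of s] c s by (simp add: V.a_assoc rsmult_closed)
  then have "\<beta> \<bullet>\<^bsub>V\<^esub> s \<oplus>\<^bsub>V\<^esub> \<gamma> \<bullet>\<^bsub>V\<^esub> (s \<otimes>\<^bsub>D\<^esub> s) \<in> T"
    using right_subspace_add_iff(2)[OF T _ a] c s by (simp add: rsmult_closed)
  also have "\<beta> \<bullet>\<^bsub>V\<^esub> s \<oplus>\<^bsub>V\<^esub> \<gamma> \<bullet>\<^bsub>V\<^esub> (s \<otimes>\<^bsub>D\<^esub> s) = (\<beta> \<oplus>\<^bsub>V\<^esub> \<gamma> \<bullet>\<^bsub>V\<^esub> s) \<bullet>\<^bsub>V\<^esub> s"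
    using c s by (simp add: rsmult_add_vector rsmult_assoc rsmult_closed)
  finally have 2: "\<beta> \<oplus>\<^bsub>V\<^esub> \<gamma> \<bullet>\<^bsub>V\<^esub> s \<in> T"
    using right_subspace_smult_iff[OF T _ s(1,2)] c s by (simp add: rsmult_closed)
  have sm: "s \<ominus>\<^bsub>D\<^esub> \<one>\<^bsub>D\<^esub> \<in> carrier D" "s \<ominus>\<^bsub>D\<^esub> \<one>\<^bsub>D\<^esub> \<noteq> \<zero>\<^bsub>D\<^esub>" using s by auto
  have "(\<beta> \<oplus>\<^bsub>V\<^esub> \<gamma>) \<oplus>\<^bsub>V\<^esub> \<gamma> \<bullet>\<^bsub>V\<^esub> (s \<ominus>\<^bsub>D\<^esub> \<one>\<^bsub>D\<^esub>) = \<beta> \<oplus>\<^bsub>V\<^esub> \<gamma> \<bullet>\<^bsub>V\<^esub> s"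
    using c s by (simp add: D.minus_eq rsmult_add_scalar rsmult_minus_one V.a_assoc rsmult_closed V.a_comm V.a_lcomm V.r_neg1 V.r_neg2)
  then have "\<gamma> \<bullet>\<^bsub>V\<^esub> (s \<ominus>\<^bsub>D\<^esub> \<one>\<^bsub>D\<^esub>) \<in> T"
    using right_subspace_add_iff(2)[OF T _ 1, of "\<gamma> \<bullet>\<^bsub>V\<^esub> (s \<ominus>\<^bsub>D\<^esub> \<one>\<^bsub>D\<^esub>)"] 2 c sm by (simp add: rsmult_closed)
  then show g: "\<gamma> \<in> T" using right_subspace_smult_iff[OF T c(3) sm] by simp
  show "\<beta> \<in> T" using right_subspace_add_iff(1)[OF T c(2) g] 1 by simp
qed

text \<open>\<open>h\<close> and \<open>g\<close> lie in a line extension of \<open>T\<close>, where a nonzero \<open>h\<close> is a direction along which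
  the affine line through \<open>g\<close> must meet \<open>T\<close>.\<close>

lemma affine_line_avoids:
  assumes T: "right_subspace D V T" and e: "e \<in> carrier V" and h: "h \<in> adjoin T e" and g: "g \<in> adjoin T e"
    and avoid: "\<And>a. a \<in> carrier D \<Longrightarrow> g \<ominus>\<^bsub>V\<^esub> h \<bullet>\<^bsub>V\<^esub> a \<notin> T"
  shows "h \<in> T"
proof (rule ccontr)
  assume n: "h \<notin> T"
  have "g \<in> adjoin T h" using adjoin_exchange[OF T e h n] g by simp
  then obtain k a where ka: "k \<in> T" "a \<in> carrier D" "g = k \<oplus>\<^bsub>V\<^esub> h \<bullet>\<^bsub>V\<^esub> a" by (rule adjoinE)
  have c: "k \<in> carrier V" "h \<in> carrier V"
    using ka(1) h right_subspaceD(7)[OF T] right_subspaceD(7)[OF adjoin_subspace[OF T e]] by auto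
  have "g \<ominus>\<^bsub>V\<^esub> h \<bullet>\<^bsub>V\<^esub> a = k" unfolding ka(3) using c ka(2)
    by (simp add: V.minus_eq V.a_assoc V.r_neg rsmult_closed)
  then show False using avoid[OF ka(2)] ka(1) by simp
qed

end

text \<open>The induction step for an optimal space, with the count of dimensions already turned
  into geometry: \<open>Y\<close> is an F-hyperplane that misses \<open>x\<close> and contains the
  D-hyperplane \<open>W\<close>, and the operators killing \<open>x\<close> yield on
  \<open>W\<close> the entire triangular space given by the induction hypothesis.\<close>

locale optimal_step = algebra_complement D F V W x
  for D :: "('a, 'm) ring_scheme" (structure) and F :: "'a set"
    and V :: "('a, 'b, 'k) rmodule_scheme" and W and x +
  fixes S Y and m and Z :: "nat \<Rightarrow> 'b set" and e B
  assumes S: "right_subspace (D\<lparr>carrier := F\<rparr>) (End_space D V) S" and fpf: "fixed_point_free S"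
    and Y: "Y = (\<lambda>u. u x) ` S" "W \<subseteq> Y" "x \<notin> Y" "VF.adjoin Y x = carrier V"
    and ker_image: "\<And>u y. \<lbrakk>u \<in> S; u x = \<zero>\<^bsub>V\<^esub>; y \<in> carrier V\<rbrakk> \<Longrightarrow> u y \<in> W"
    and T: "R.flag_data m Z e B"
    and restr_ker: "restr ` {u \<in> S. u x = \<zero>\<^bsub>V\<^esub>} = R.triangular m Z e B"
    and three_scalars: "\<exists>s\<in>F. s \<noteq> \<zero> \<and> s \<noteq> \<one>"
    and not_quadratic: "\<exists>z\<in>carrier D. \<not> quadratic z"

sublocale optimal_step \<subseteq> YC: complement "D\<lparr>carrier := F\<rparr>" V Y x
  by unfold_locales (use vals_subspace[OF S xV] xV Y in auto)

context optimal_step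
begin

lemmas Ss = EF.right_subspaceD[OF S, simplified]
lemmas Ysub = YC.W
lemmas Tr = R.flag_dataD[OF T, unfolded V.restrict_adjoin[OF W] VF.restrict_adjoin[OF D_subspace_imp_F[OF W]], simplified]

lemma SE [simp]: "u \<in> S \<Longrightarrow> u \<in> carrier E"
  using Ss(7) .

lemma S_apply [simp]: "u \<in> S \<Longrightarrow> y \<in> carrier V \<Longrightarrow> u y \<in> carrier V"
  using EndD(1) SE by blast

lemma WV [simp]: "w \<in> W \<Longrightarrow> w \<in> carrier V"
  using Ws(7) .

lemma proj_in [simp]: "y \<in> carrier V \<Longrightarrow> proj y \<in> carrier V" "y \<in> carrier V \<Longrightarrow> coord y \<in> carrier D"
  using decomp by auto

lemma ex_S: "y \<in> Y \<Longrightarrow> \<exists>u\<in>S. u x = y"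
  using Y(1) by auto

lemma Z_sub: "i \<le> m \<Longrightarrow> right_subspace D V (Z i)" "i \<le> m \<Longrightarrow> Z i \<subseteq> W"
  using R.flag_data_subspace[OF T, of i] V.restrict_subspace_iff[OF W] by auto

lemma Z_subF: "i \<le> m \<Longrightarrow> right_subspace FD V (Z i)"
  using Z_sub D_subspace_imp_F by blast

lemma B_sub: "i < m \<Longrightarrow> right_subspace FD V (B i)" "i < m \<Longrightarrow> B i \<subseteq> W"
  using Tr(6)[of i] VF.restrict_subspace_iff[OF D_subspace_imp_F[OF W]] by auto

lemma e_in: "i < m \<Longrightarrow> e i \<in> Z (Suc i)"
  using R.flag_data_Suc_subset[OF T, of i] by auto

text \<open>The position of x b modulo \<open>Y\<close>, measured along x F. The kernel of this form
  consists of those b for which x b is itself the value at \<open>x\<close> of an operator in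
  \<open>S\<close>.\<close>

definition "t b = YC.coord (x \<bullet>\<^bsub>V\<^esub> b)"

lemma t_functional: "F_functional t"
  unfolding linear_map_def
proof (intro conjI ballI)
  show "t \<in> carrier (regular_space D) \<rightarrow> carrier (regular_space FD)"
    using YC.decomp(2) xV by (auto simp: t_def V.rsmult_closed)
  fix a assume a: "a \<in> carrier (regular_space D)"
  show "t (a \<oplus>\<^bsub>regular_space D\<^esub> b) = t a \<oplus>\<^bsub>regular_space FD\<^esub> t b" if "b \<in> carrier (regular_space D)" for b
    using a that xV by (simp add: t_def V.rsmult_add_scalar YC.proj_coord_add V.rsmult_closed)
  show "t (a \<bullet>\<^bsub>regular_space D\<^esub> c) = t a \<bullet>\<^bsub>regular_space FD\<^esub> c" if "c \<in> carrier FD" for c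
    using a that xV YC.proj_coord_smult(2)[of "x \<bullet>\<^bsub>V\<^esub> a" c] by (simp add: t_def V.rsmult_assoc V.rsmult_closed)
qed

lemmas t = F_functionalD[OF t_functional]

lemma t_one: "t \<one> = \<one>"
  using YC.proj_x xV by (simp add: t_def V.rsmult_one)

lemma t_zero_iff: "b \<in> carrier D \<Longrightarrow> t b = \<zero> \<longleftrightarrow> x \<bullet>\<^bsub>V\<^esub> b \<in> Y"
  using YC.coord_zero_iff[of "x \<bullet>\<^bsub>V\<^esub> b"] xV by (simp add: t_def V.rsmult_closed)

text \<open>\<open>twist v u\<close> is \<open>u\<close> restricted to \<open>W\<close> and followed by the projection onto \<open>W\<close> along the line of
  \<open>x - v\<close>; subtracted from the identity it is a Schur complement of the identity minus \<open>u\<close>.\<close>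

definition "twist v u w = proj (u w) \<oplus>\<^bsub>V\<^esub> v \<bullet>\<^bsub>V\<^esub> coord (u w)"

lemma twist_in_W:
  assumes "v \<in> W" "u \<in> S" "w \<in> W"
  shows "twist v u w \<in> W"
  using assms decomp(1,2)[of "u w"] Ws(3,4) by (simp add: twist_def)

lemma twist_lin:
  assumes v: "v \<in> W" and u: "u \<in> S" and w: "w \<in> W"
  shows "w' \<in> W \<Longrightarrow> twist v u (w \<oplus>\<^bsub>V\<^esub> w') = twist v u w \<oplus>\<^bsub>V\<^esub> twist v u w'"
    "a \<in> carrier D \<Longrightarrow> twist v u (w \<bullet>\<^bsub>V\<^esub> a) = twist v u w \<bullet>\<^bsub>V\<^esub> a"
  using assms EndD(2,3)[OF SE[OF u]]
  by (simp_all add: twist_def proj_coord_add proj_coord_smult V.rsmult_add_scalar V.rsmult_add_vector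
      V.rsmult_assoc V.rsmult_closed V.a_ac)

lemma twist_add:
  assumes v: "v \<in> W" and u: "u \<in> S" "u' \<in> S" and w: "w \<in> W"
  shows "twist v (u \<oplus>\<^bsub>E\<^esub> u') w = twist v u w \<oplus>\<^bsub>V\<^esub> twist v u' w"
  using assms by (simp add: twist_def proj_coord_add V.rsmult_add_scalar V.rsmult_closed V.a_ac)

lemma twist_smult:
  assumes v: "v \<in> W" and u: "u \<in> S" and w: "w \<in> W" and c: "c \<in> F"
  shows "twist v (u \<bullet>\<^bsub>ES\<^esub> c) w = twist v u w \<bullet>\<^bsub>V\<^esub> c"
  using assms by (simp add: twist_def proj_coord_smult V.rsmult_add_vector V.rsmult_assoc V.rsmult_closed)

text \<open>The hypothesis on \<open>u\<close> reads (id - u) x = (x - v) b. Let u0 in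
  \<open>S\<close> kill \<open>x\<close> and restrict to \<open>f\<close>. Then p = u + u0 sends y
  to y + (x - v) a, where a is the coordinate of u y. A multiple of \<open>x\<close> added to y
  corrects this error and gives a fixed vector of p, which must vanish.\<close>

lemma id_minus_twist_avoids:
  assumes v: "v \<in> W" and b: "b \<in> carrier D" "t b = \<one>" and u: "u \<in> S"
    and ux: "u x \<oplus>\<^bsub>V\<^esub> x \<bullet>\<^bsub>V\<^esub> b = x \<oplus>\<^bsub>V\<^esub> v \<bullet>\<^bsub>V\<^esub> b"
    and f: "f \<in> R.triangular m Z e B" and y: "y \<in> W" and eq: "y \<ominus>\<^bsub>V\<^esub> twist v u y = f y"
  shows "y = \<zero>\<^bsub>V\<^esub>"
proof -
  obtain u0 where u0: "u0 \<in> S" "u0 x = \<zero>\<^bsub>V\<^esub>" "f = restr u0"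
    using f restr_ker by blast
  have fy: "f y = u0 y" and u0y: "u0 y \<in> W" using restr_apply[of u0 y] ker_image[OF u0(1,2)] y u0(3) by auto
  have b0: "b \<noteq> \<zero>" using b(2) t(4) one_not_zero by auto
  note ib = inv_closed'[OF b(1) b0]
  define p where "p = u \<oplus>\<^bsub>E\<^esub> u0"
  have pS: "p \<in> S" unfolding p_def using Ss(3)[OF u u0(1)] .
  have px: "p x = u x" unfolding p_def using u u0 xV by simp
  define a where "a = coord (u y)"
  have aD: "a \<in> carrier D" unfolding a_def using y u by simp
  have cp: "coord (p y) = a" "proj (p y) = proj (u y) \<oplus>\<^bsub>V\<^esub> u0 y"
    unfolding p_def a_def using u u0 y u0y by (simp_all add: proj_coord_add proj_W)
  have pyV: "p y \<in> carrier V" using pS y by simp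
  note cl = pyV u0y[THEN WV] y[THEN WV] v[THEN WV] xV aD V.rsmult_closed[OF v[THEN WV] aD]
    V.rsmult_closed[OF xV aD] proj_in(1)[OF S_apply[OF u WV[OF y]]]
  have tw: "twist v u y = proj (u y) \<oplus>\<^bsub>V\<^esub> v \<bullet>\<^bsub>V\<^esub> a" by (simp add: twist_def a_def)
  have "y = (y \<ominus>\<^bsub>V\<^esub> twist v u y) \<oplus>\<^bsub>V\<^esub> twist v u y"
    using twist_in_W[OF v u y] y by (simp add: V.minus_eq V.a_assoc V.l_neg)
  then have "y = u0 y \<oplus>\<^bsub>V\<^esub> twist v u y" unfolding eq fy .
  then have y_eq: "y = u0 y \<oplus>\<^bsub>V\<^esub> (proj (u y) \<oplus>\<^bsub>V\<^esub> v \<bullet>\<^bsub>V\<^esub> a)" unfolding tw .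
  have py: "p y = (proj (u y) \<oplus>\<^bsub>V\<^esub> u0 y) \<oplus>\<^bsub>V\<^esub> x \<bullet>\<^bsub>V\<^esub> a" using decomp(3)[OF pyV] unfolding cp .
  have 1: "p y \<oplus>\<^bsub>V\<^esub> v \<bullet>\<^bsub>V\<^esub> a = y \<oplus>\<^bsub>V\<^esub> x \<bullet>\<^bsub>V\<^esub> a"
  proof -
    have "p y \<oplus>\<^bsub>V\<^esub> v \<bullet>\<^bsub>V\<^esub> a = (u0 y \<oplus>\<^bsub>V\<^esub> (proj (u y) \<oplus>\<^bsub>V\<^esub> v \<bullet>\<^bsub>V\<^esub> a)) \<oplus>\<^bsub>V\<^esub> x \<bullet>\<^bsub>V\<^esub> a"
      unfolding py using cl by (simp add: V.a_ac)
    then show ?thesis using y_eq by simp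
  qed
  \<comment> \<open>The multiplier for which (id - p) (y + x g) = (x - v) (b g - a) is zero.\<close>
  define g where "g = inv b \<otimes> a"
  have gD: "g \<in> carrier D" unfolding g_def using ib aD by simp
  have bg: "b \<otimes> g = a" unfolding g_def using ib b aD by (simp add: D.m_assoc[symmetric])
  have "(u x \<oplus>\<^bsub>V\<^esub> x \<bullet>\<^bsub>V\<^esub> b) \<bullet>\<^bsub>V\<^esub> g = (x \<oplus>\<^bsub>V\<^esub> v \<bullet>\<^bsub>V\<^esub> b) \<bullet>\<^bsub>V\<^esub> g" using ux by simp
  then have 2: "u x \<bullet>\<^bsub>V\<^esub> g \<oplus>\<^bsub>V\<^esub> x \<bullet>\<^bsub>V\<^esub> a = x \<bullet>\<^bsub>V\<^esub> g \<oplus>\<^bsub>V\<^esub> v \<bullet>\<^bsub>V\<^esub> a"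
    using u xV v b gD bg by (simp add: V.rsmult_add_vector V.rsmult_closed V.rsmult_assoc[symmetric])
  define q where "q = y \<oplus>\<^bsub>V\<^esub> x \<bullet>\<^bsub>V\<^esub> g"
  have qV: "q \<in> carrier V" unfolding q_def using cl gD by (simp add: V.rsmult_closed)
  have pq: "p q = p y \<oplus>\<^bsub>V\<^esub> u x \<bullet>\<^bsub>V\<^esub> g"
    unfolding q_def using EndD(2,3)[OF SE[OF pS]] cl gD px by (simp add: V.rsmult_closed)
  have uxg: "u x \<bullet>\<^bsub>V\<^esub> g \<in> carrier V" "x \<bullet>\<^bsub>V\<^esub> g \<in> carrier V" using u xV gD by (simp_all add: V.rsmult_closed)
  have "p q \<oplus>\<^bsub>V\<^esub> (v \<bullet>\<^bsub>V\<^esub> a \<oplus>\<^bsub>V\<^esub> x \<bullet>\<^bsub>V\<^esub> a) = (p y \<oplus>\<^bsub>V\<^esub> v \<bullet>\<^bsub>V\<^esub> a) \<oplus>\<^bsub>V\<^esub> (u x \<bullet>\<^bsub>V\<^esub> g \<oplus>\<^bsub>V\<^esub> x \<bullet>\<^bsub>V\<^esub> a)"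
    unfolding pq using cl uxg by (simp add: V.a_ac)
  also have "\<dots> = q \<oplus>\<^bsub>V\<^esub> (v \<bullet>\<^bsub>V\<^esub> a \<oplus>\<^bsub>V\<^esub> x \<bullet>\<^bsub>V\<^esub> a)"
    unfolding 1 2 q_def using cl uxg by (simp add: V.a_ac)
  finally have eqs: "p q \<oplus>\<^bsub>V\<^esub> (v \<bullet>\<^bsub>V\<^esub> a \<oplus>\<^bsub>V\<^esub> x \<bullet>\<^bsub>V\<^esub> a) = q \<oplus>\<^bsub>V\<^esub> (v \<bullet>\<^bsub>V\<^esub> a \<oplus>\<^bsub>V\<^esub> x \<bullet>\<^bsub>V\<^esub> a)" .
  have "v \<bullet>\<^bsub>V\<^esub> a \<oplus>\<^bsub>V\<^esub> x \<bullet>\<^bsub>V\<^esub> a \<in> carrier V" using cl(7,8) by simp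
  from V.add.r_cancel[OF eqs S_apply[OF pS qV] qV this] have "p q = q" .
  then have "q = \<zero>\<^bsub>V\<^esub>" using fpf pS qV unfolding fixed_point_free_def by blast
  then have "proj q = \<zero>\<^bsub>V\<^esub>" using proj_W(1)[OF Ws(2)] by simp
  then show ?thesis unfolding q_def using proj_coord_eq(1)[OF y gD] by simp
qed

text \<open>The identity minus the twist differs from every triangular operator on \<open>W\<close>
  by an injective one, so \<open>avoids_triangular\<close> applies to it.\<close>

lemma twist_flag:
  assumes v: "v \<in> W" and b: "b \<in> carrier D" "t b = \<one>" and u: "u \<in> S"
    and ux: "u x \<oplus>\<^bsub>V\<^esub> x \<bullet>\<^bsub>V\<^esub> b = x \<oplus>\<^bsub>V\<^esub> v \<bullet>\<^bsub>V\<^esub> b"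
  shows "\<And>i w. i \<le> m \<Longrightarrow> w \<in> Z i \<Longrightarrow> twist v u w \<in> Z i"
    and "\<And>i. i < m \<Longrightarrow> e i \<ominus>\<^bsub>V\<^esub> twist v u (e i) \<notin> B i"
proof -
  let ?z = "\<lambda>w\<in>W. w \<ominus>\<^bsub>V\<^esub> twist v u w"
  have tW: "twist v u w \<in> carrier V" if "w \<in> W" for w using twist_in_W[OF v u that] by simp
  have z: "?z \<in> carrier R.E"
  proof (rule R.EndI)
    show "?z w \<in> carrier (V\<lparr>carrier := W\<rparr>)" if "w \<in> carrier (V\<lparr>carrier := W\<rparr>)" for w
      using that twist_in_W[OF v u] Ws(6) by simp
    show "?z (w \<oplus>\<^bsub>V\<lparr>carrier := W\<rparr>\<^esub> w') = ?z w \<oplus>\<^bsub>V\<lparr>carrier := W\<rparr>\<^esub> ?z w'"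
      if "w \<in> carrier (V\<lparr>carrier := W\<rparr>)" "w' \<in> carrier (V\<lparr>carrier := W\<rparr>)" for w w'
      using that tW Ws(3) twist_lin(1)[OF v u, of w w'] by (simp add: V.minus_eq V.minus_add V.a_ac)
    show "?z (w \<bullet>\<^bsub>V\<lparr>carrier := W\<rparr>\<^esub> a) = ?z w \<bullet>\<^bsub>V\<lparr>carrier := W\<rparr>\<^esub> a"
      if "w \<in> carrier (V\<lparr>carrier := W\<rparr>)" "a \<in> carrier D" for w a
      using that tW Ws(4) twist_lin(2)[OF v u, of w a]
      by (simp add: V.minus_eq V.rsmult_add_vector V.rsmult_l_minus)
  qed simp
  have "(\<forall>i\<le>m. ?z ` Z i \<subseteq> Z i) \<and> (\<forall>i<m. ?z (e i) \<notin> B i)"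
  proof (rule avoids_triangular[OF R.algebra_space_axioms T z])
    fix h y assume "h \<in> R.triangular m Z e B" "y \<in> carrier (V\<lparr>carrier := W\<rparr>)" "?z y = h y"
    then show "y = \<zero>\<^bsub>V\<lparr>carrier := W\<rparr>\<^esub>" using id_minus_twist_avoids[OF v b u ux, of h y] by simp
  qed
  then have 1: "?z ` Z i \<subseteq> Z i" if "i \<le> m" for i using that by blast
  have 2: "?z (e i) \<notin> B i" if "i < m" for i
    using \<open>(\<forall>i\<le>m. ?z ` Z i \<subseteq> Z i) \<and> (\<forall>i<m. ?z (e i) \<notin> B i)\<close> that by blast
  show "twist v u w \<in> Z i" if i: "i \<le> m" and w: "w \<in> Z i" for i w
  proof -
    have wW: "w \<in> W" using Z_sub(2)[OF i] w by auto
    have "?z w \<in> Z i" using 1[OF i] w by blast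
    then have "w \<ominus>\<^bsub>V\<^esub> twist v u w \<in> Z i" using wW by simp
    then have "w \<ominus>\<^bsub>V\<^esub> (w \<ominus>\<^bsub>V\<^esub> twist v u w) \<in> Z i" using V.right_subspaceD(6)[OF Z_sub(1)[OF i] w] by simp
    moreover have "w \<ominus>\<^bsub>V\<^esub> (w \<ominus>\<^bsub>V\<^esub> twist v u w) = twist v u w"
      using wW tW[OF wW] by (simp add: V.minus_eq V.minus_add V.r_neg2)
    ultimately show ?thesis by simp
  qed
  show "e i \<ominus>\<^bsub>V\<^esub> twist v u (e i) \<notin> B i" if i: "i < m" for i
  proof -
    have "e i \<in> W" using e_in[OF i] Z_sub(2)[of "Suc i"] i by auto
    then show ?thesis using 2[OF i] by simp
  qed
qed

lemma e_W: "i < m \<Longrightarrow> e i \<in> W"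
  using e_in[of i] Z_sub(2)[of "Suc i"] by auto

lemma u_smult_x: "u \<in> S \<Longrightarrow> c \<in> F \<Longrightarrow> (u \<bullet>\<^bsub>ES\<^esub> c) x = u x \<bullet>\<^bsub>V\<^esub> c"
  using xV by simp

text \<open>The case b = 1, in which \<open>v\<close> is forced to be \<open>u x\<close>.\<close>

lemma twist_flag_W:
  assumes u: "u \<in> S" and ux: "u x \<in> W"
  shows "\<And>i w. i \<le> m \<Longrightarrow> w \<in> Z i \<Longrightarrow> twist (u x) u w \<in> Z i"
    and "\<And>i. i < m \<Longrightarrow> e i \<ominus>\<^bsub>V\<^esub> twist (u x) u (e i) \<notin> B i"
proof -
  have *: "u x \<oplus>\<^bsub>V\<^esub> x \<bullet>\<^bsub>V\<^esub> \<one> = x \<oplus>\<^bsub>V\<^esub> u x \<bullet>\<^bsub>V\<^esub> \<one>" using u xV by (simp add: V.rsmult_one V.a_comm)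
  show "\<And>i w. i \<le> m \<Longrightarrow> w \<in> Z i \<Longrightarrow> twist (u x) u w \<in> Z i"
    and "\<And>i. i < m \<Longrightarrow> e i \<ominus>\<^bsub>V\<^esub> twist (u x) u (e i) \<notin> B i"
    using twist_flag[OF ux _ _ u *] t_one by auto
qed

text \<open>Replacing u by u a with a in \<open>F\<close> turns the twist into a polynomial in a,
  whose coefficients of degree one and two are the two components. As its values stay in
  \<open>Z i\<close>, so do the coefficients.\<close>

lemma components_flag:
  assumes u: "u \<in> S" and ux: "u x \<in> W" and i: "i \<le> m" and w: "w \<in> Z i"
  shows "proj (u w) \<in> Z i" "u x \<bullet>\<^bsub>V\<^esub> coord (u w) \<in> Z i"
proof -
  obtain s where s: "s \<in> F" "s \<noteq> \<zero>" "s \<noteq> \<one>" using three_scalars by blast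
  have wW: "w \<in> W" using w Z_sub(2)[OF i] by auto
  have uw: "u w \<in> carrier V" using u wW by simp
  have uxc: "u x \<bullet>\<^bsub>V\<^esub> coord (u w) \<in> carrier V" using ux uw by (simp add: V.rsmult_closed)
  have val: "\<zero>\<^bsub>V\<^esub> \<oplus>\<^bsub>V\<^esub> proj (u w) \<bullet>\<^bsub>V\<^esub> a \<oplus>\<^bsub>V\<^esub> (u x \<bullet>\<^bsub>V\<^esub> coord (u w)) \<bullet>\<^bsub>V\<^esub> (a \<otimes> a) \<in> Z i" if a: "a \<in> F" for a
  proof -
    have us: "u \<bullet>\<^bsub>ES\<^esub> a \<in> S" using Ss(4)[OF u a] .
    have usx: "(u \<bullet>\<^bsub>ES\<^esub> a) x = u x \<bullet>\<^bsub>V\<^esub> a" using u_smult_x[OF u a] .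
    have "u x \<bullet>\<^bsub>V\<^esub> a \<in> W" using Ws(4)[OF ux] a by simp
    then have "twist (u x \<bullet>\<^bsub>V\<^esub> a) (u \<bullet>\<^bsub>ES\<^esub> a) w \<in> Z i" using twist_flag_W(1)[OF us _ i w] usx by simp
    moreover have "(u x \<bullet>\<^bsub>V\<^esub> a) \<bullet>\<^bsub>V\<^esub> (coord (u w) \<otimes> a) = (u x \<bullet>\<^bsub>V\<^esub> coord (u w)) \<bullet>\<^bsub>V\<^esub> (a \<otimes> a)"
      using ux uw a F_commute[OF a, of "coord (u w)"] by (simp add: V.rsmult_assoc[symmetric] D.m_assoc) (simp add: D.m_assoc[symmetric])
    ultimately show ?thesis
      using wW uw a uxc by (simp add: twist_def proj_coord_smult V.rsmult_closed)
  qed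
  have sD: "s \<in> carrier FD" using s by simp
  have c: "proj (u w) \<in> carrier V" using uw by simp
  have q: "\<zero>\<^bsub>V\<^esub> \<oplus>\<^bsub>V\<^esub> proj (u w) \<bullet>\<^bsub>V\<^esub> a \<oplus>\<^bsub>V\<^esub> (u x \<bullet>\<^bsub>V\<^esub> coord (u w)) \<bullet>\<^bsub>V\<^esub> (a \<otimes>\<^bsub>FD\<^esub> a) \<in> Z i" if "a = \<zero>\<^bsub>FD\<^esub> \<or> a = \<one>\<^bsub>FD\<^esub> \<or> a = s" for a
  proof -
    have "a \<in> F" using that s(1) by auto
    from val[OF this] show ?thesis by simp
  qed
  show "proj (u w) \<in> Z i" "u x \<bullet>\<^bsub>V\<^esub> coord (u w) \<in> Z i"
    using VF.quadratic_values_in_subspace[OF Z_subF[OF i] V.zero_closed c uxc sD _ _ q] s by auto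
qed

text \<open>The homogeneous counterpart of \<open>twist_flag\<close>, with - u x in the place of (id
  - u) x. If \<open>u'\<close> takes the value v at \<open>x\<close>, then u s + u' satisfies the
  hypothesis there with b s + 1, for every s in \<open>F\<close>. This yields an affine line in s
  that never meets \<open>B i\<close>, so its direction lies in \<open>B i\<close>.\<close>

lemma twist_triangular:
  assumes v: "v \<in> W" and b: "b \<in> carrier D" "t b = \<zero>" and u: "u \<in> S"
    and ux: "u x \<oplus>\<^bsub>V\<^esub> x \<bullet>\<^bsub>V\<^esub> b = v \<bullet>\<^bsub>V\<^esub> b"
  shows "\<And>i w. i \<le> m \<Longrightarrow> w \<in> Z i \<Longrightarrow> twist v u w \<in> Z i"
    and "\<And>i. i < m \<Longrightarrow> twist v u (e i) \<in> B i"
proof -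
  obtain u' where u': "u' \<in> S" "u' x = v" using ex_S v Y(2) by blast
  have flag: "twist v u' w \<in> Z i" if "i \<le> m" "w \<in> Z i" for i w
    using twist_flag_W(1)[OF u'(1) _ that] u'(2) v by simp
  have step: "\<And>i w. i \<le> m \<Longrightarrow> w \<in> Z i \<Longrightarrow> twist v u w \<bullet>\<^bsub>V\<^esub> s \<oplus>\<^bsub>V\<^esub> twist v u' w \<in> Z i"
    "\<And>i. i < m \<Longrightarrow> e i \<ominus>\<^bsub>V\<^esub> (twist v u (e i) \<bullet>\<^bsub>V\<^esub> s \<oplus>\<^bsub>V\<^esub> twist v u' (e i)) \<notin> B i" if s: "s \<in> F" for s
  proof -
    have us: "u \<bullet>\<^bsub>ES\<^esub> s \<in> S" using Ss(4)[OF u s] .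
    then have p: "u \<bullet>\<^bsub>ES\<^esub> s \<oplus>\<^bsub>E\<^esub> u' \<in> S" using Ss(3) u'(1) by simp
    have bs: "b \<otimes> s \<oplus> \<one> \<in> carrier D" using b s by simp
    have tb: "t (b \<otimes> s \<oplus> \<one>) = \<one>" using t b s t_one by simp
    have uxV: "u x \<in> carrier V" using u xV by simp
    have e1: "(u \<bullet>\<^bsub>ES\<^esub> s \<oplus>\<^bsub>E\<^esub> u') x \<oplus>\<^bsub>V\<^esub> x \<bullet>\<^bsub>V\<^esub> (b \<otimes> s \<oplus> \<one>) = (u x \<oplus>\<^bsub>V\<^esub> x \<bullet>\<^bsub>V\<^esub> b) \<bullet>\<^bsub>V\<^esub> s \<oplus>\<^bsub>V\<^esub> (v \<oplus>\<^bsub>V\<^esub> x)"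
      using xV uxV u' b s v by (simp add: V.rsmult_add_scalar V.rsmult_add_vector V.rsmult_assoc V.rsmult_one V.rsmult_closed V.a_ac)
    have e2: "(v \<bullet>\<^bsub>V\<^esub> b) \<bullet>\<^bsub>V\<^esub> s \<oplus>\<^bsub>V\<^esub> (v \<oplus>\<^bsub>V\<^esub> x) = x \<oplus>\<^bsub>V\<^esub> v \<bullet>\<^bsub>V\<^esub> (b \<otimes> s \<oplus> \<one>)"
      using xV b s v by (simp add: V.rsmult_add_scalar V.rsmult_assoc V.rsmult_one V.rsmult_closed V.a_ac)
    have eq: "(u \<bullet>\<^bsub>ES\<^esub> s \<oplus>\<^bsub>E\<^esub> u') x \<oplus>\<^bsub>V\<^esub> x \<bullet>\<^bsub>V\<^esub> (b \<otimes> s \<oplus> \<one>) = x \<oplus>\<^bsub>V\<^esub> v \<bullet>\<^bsub>V\<^esub> (b \<otimes> s \<oplus> \<one>)"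
      unfolding e1 ux e2 ..
    have tw: "twist v (u \<bullet>\<^bsub>ES\<^esub> s \<oplus>\<^bsub>E\<^esub> u') w = twist v u w \<bullet>\<^bsub>V\<^esub> s \<oplus>\<^bsub>V\<^esub> twist v u' w" if "w \<in> W" for w
      using twist_add[OF v us u'(1) that] twist_smult[OF v u that s] by simp
    show "twist v u w \<bullet>\<^bsub>V\<^esub> s \<oplus>\<^bsub>V\<^esub> twist v u' w \<in> Z i" if "i \<le> m" "w \<in> Z i" for i w
      using twist_flag(1)[OF v bs tb p eq that] tw[of w] Z_sub(2)[OF that(1)] that(2) by auto
    show "e i \<ominus>\<^bsub>V\<^esub> (twist v u (e i) \<bullet>\<^bsub>V\<^esub> s \<oplus>\<^bsub>V\<^esub> twist v u' (e i)) \<notin> B i" if "i < m" for i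
      using twist_flag(2)[OF v bs tb p eq that] tw[OF e_W[OF that]] by simp
  qed
  show Zi: "twist v u w \<in> Z i" if i: "i \<le> m" and w: "w \<in> Z i" for i w
  proof -
    have wW: "w \<in> W" using w Z_sub(2)[OF i] by auto
    have "twist v u w \<oplus>\<^bsub>V\<^esub> twist v u' w \<in> Z i"
      using step(1)[OF F_one i w] twist_in_W[OF v u wW] by (simp add: V.rsmult_one)
    then show ?thesis
      using V.right_subspace_add_iff(1)[OF Z_sub(1)[OF i] _ flag[OF i w], of "twist v u w"] twist_in_W[OF v u wW] by simp
  qed
  show "twist v u (e i) \<in> B i" if i: "i < m" for i
  proof (rule VF.affine_line_avoids[OF B_sub(1)[OF i]])
    have Si: "Suc i \<le> m" using i by simp
    show "e i \<in> carrier V" using e_W[OF i] by simp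
    show "twist v u (e i) \<in> VF.adjoin (B i) (e i)" using Zi[OF Si e_in[OF i]] Tr(9)[OF i] by simp
    show "e i \<ominus>\<^bsub>V\<^esub> twist v u' (e i) \<in> VF.adjoin (B i) (e i)"
      using V.right_subspaceD(6)[OF Z_sub(1)[OF Si] e_in[OF i] flag[OF Si e_in[OF i]]] Tr(9)[OF i] by simp
    fix s assume "s \<in> carrier FD"
    then have s: "s \<in> F" by simp
    have c: "e i \<in> carrier V" "twist v u (e i) \<bullet>\<^bsub>V\<^esub> s \<in> carrier V" "twist v u' (e i) \<in> carrier V"
      using e_W[OF i] twist_in_W[OF v u e_W[OF i]] twist_in_W[OF v u'(1) e_W[OF i]] s by (simp_all add: V.rsmult_closed)
    have "e i \<ominus>\<^bsub>V\<^esub> (twist v u (e i) \<bullet>\<^bsub>V\<^esub> s \<oplus>\<^bsub>V\<^esub> twist v u' (e i)) = e i \<ominus>\<^bsub>V\<^esub> twist v u' (e i) \<ominus>\<^bsub>V\<^esub> twist v u (e i) \<bullet>\<^bsub>V\<^esub> s"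
      using c by (simp add: V.minus_eq V.minus_add V.a_ac)
    then show "e i \<ominus>\<^bsub>V\<^esub> twist v u' (e i) \<ominus>\<^bsub>V\<^esub> twist v u (e i) \<bullet>\<^bsub>V\<^esub> s \<notin> B i" using step(2)[OF s i] by simp
  qed
qed

text \<open>For r in \<open>F\<close> the vector v r and the operator u r + a again satisfy the
  condition on twists, since \<open>a\<close> supplies the term - x b. The twist is then a
  polynomial of degree two in r with the three given vectors as coefficients. The space
  \<open>G\<close> is arbitrary so as to serve for \<open>Z i\<close> and \<open>B i\<close>
  alike.\<close>

lemma twist_components:
  assumes v: "v \<in> W" and b: "b \<in> carrier D" "t b = \<zero>" and u: "u \<in> S" "u x = v \<bullet>\<^bsub>V\<^esub> b"
    and a: "a \<in> S" "a x \<oplus>\<^bsub>V\<^esub> x \<bullet>\<^bsub>V\<^esub> b = \<zero>\<^bsub>V\<^esub>"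
    and G: "right_subspace FD V G" and w: "w \<in> W"
      "\<And>v u. \<lbrakk>v \<in> W; u \<in> S; u x \<oplus>\<^bsub>V\<^esub> x \<bullet>\<^bsub>V\<^esub> b = v \<bullet>\<^bsub>V\<^esub> b\<rbrakk> \<Longrightarrow> twist v u w \<in> G"
  shows "proj (a w) \<in> G" "proj (u w) \<oplus>\<^bsub>V\<^esub> v \<bullet>\<^bsub>V\<^esub> coord (a w) \<in> G" "v \<bullet>\<^bsub>V\<^esub> coord (u w) \<in> G"
proof -
  obtain s where s: "s \<in> F" "s \<noteq> \<zero>" "s \<noteq> \<one>" using three_scalars by blast
  have c: "u w \<in> carrier V" "a w \<in> carrier V" "v \<in> carrier V" using u a w(1) v by simp_all
  have val: "proj (a w) \<oplus>\<^bsub>V\<^esub> (proj (u w) \<oplus>\<^bsub>V\<^esub> v \<bullet>\<^bsub>V\<^esub> coord (a w)) \<bullet>\<^bsub>V\<^esub> r \<oplus>\<^bsub>V\<^esub> (v \<bullet>\<^bsub>V\<^esub> coord (u w)) \<bullet>\<^bsub>V\<^esub> (r \<otimes> r) \<in> G"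
    if r: "r \<in> F" for r
  proof -
    have vr: "v \<bullet>\<^bsub>V\<^esub> r \<in> W" using Ws(4)[OF v] r by simp
    have p: "u \<bullet>\<^bsub>ES\<^esub> r \<oplus>\<^bsub>E\<^esub> a \<in> S" using Ss(3,4) u(1) a(1) r by simp
    have "(u \<bullet>\<^bsub>ES\<^esub> r \<oplus>\<^bsub>E\<^esub> a) x \<oplus>\<^bsub>V\<^esub> x \<bullet>\<^bsub>V\<^esub> b = (v \<bullet>\<^bsub>V\<^esub> b) \<bullet>\<^bsub>V\<^esub> r \<oplus>\<^bsub>V\<^esub> (a x \<oplus>\<^bsub>V\<^esub> x \<bullet>\<^bsub>V\<^esub> b)"
      using xV u a b r c by (simp add: V.a_assoc V.rsmult_closed)
    also have "\<dots> = (v \<bullet>\<^bsub>V\<^esub> b) \<bullet>\<^bsub>V\<^esub> r" using a c b r by (simp add: V.rsmult_closed)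
    also have "\<dots> = (v \<bullet>\<^bsub>V\<^esub> r) \<bullet>\<^bsub>V\<^esub> b"
      using c b r F_commute[OF r b(1)] by (simp add: V.rsmult_assoc[symmetric])
    finally have tw: "twist (v \<bullet>\<^bsub>V\<^esub> r) (u \<bullet>\<^bsub>ES\<^esub> r \<oplus>\<^bsub>E\<^esub> a) w \<in> G" using w(2)[OF vr p] by simp
    have 1: "(v \<bullet>\<^bsub>V\<^esub> r) \<bullet>\<^bsub>V\<^esub> (coord (u w) \<otimes> r) = (v \<bullet>\<^bsub>V\<^esub> coord (u w)) \<bullet>\<^bsub>V\<^esub> (r \<otimes> r)"
      using c r F_commute[OF r, of "coord (u w)"] by (simp add: V.rsmult_assoc[symmetric] D.m_assoc) (simp add: D.m_assoc[symmetric])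
    have 2: "(v \<bullet>\<^bsub>V\<^esub> r) \<bullet>\<^bsub>V\<^esub> coord (a w) = (v \<bullet>\<^bsub>V\<^esub> coord (a w)) \<bullet>\<^bsub>V\<^esub> r"
      using c r F_commute[OF r, of "coord (a w)"] by (simp add: V.rsmult_assoc[symmetric])
    have "twist (v \<bullet>\<^bsub>V\<^esub> r) (u \<bullet>\<^bsub>ES\<^esub> r \<oplus>\<^bsub>E\<^esub> a) w =
      (proj (u w) \<bullet>\<^bsub>V\<^esub> r \<oplus>\<^bsub>V\<^esub> proj (a w)) \<oplus>\<^bsub>V\<^esub> ((v \<bullet>\<^bsub>V\<^esub> r) \<bullet>\<^bsub>V\<^esub> (coord (u w) \<otimes> r) \<oplus>\<^bsub>V\<^esub> (v \<bullet>\<^bsub>V\<^esub> r) \<bullet>\<^bsub>V\<^esub> coord (a w))"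
      using c r w(1) by (simp add: twist_def proj_coord_add proj_coord_smult V.rsmult_closed V.rsmult_add_scalar)
    also have "\<dots> = proj (a w) \<oplus>\<^bsub>V\<^esub> (proj (u w) \<oplus>\<^bsub>V\<^esub> v \<bullet>\<^bsub>V\<^esub> coord (a w)) \<bullet>\<^bsub>V\<^esub> r \<oplus>\<^bsub>V\<^esub> (v \<bullet>\<^bsub>V\<^esub> coord (u w)) \<bullet>\<^bsub>V\<^esub> (r \<otimes> r)"
      unfolding 1 2 using c r by (simp add: V.rsmult_closed V.rsmult_add_vector V.a_ac)
    finally show ?thesis using tw by simp
  qed
  have q: "proj (a w) \<oplus>\<^bsub>V\<^esub> (proj (u w) \<oplus>\<^bsub>V\<^esub> v \<bullet>\<^bsub>V\<^esub> coord (a w)) \<bullet>\<^bsub>V\<^esub> r \<oplus>\<^bsub>V\<^esub> (v \<bullet>\<^bsub>V\<^esub> coord (u w)) \<bullet>\<^bsub>V\<^esub> (r \<otimes>\<^bsub>FD\<^esub> r) \<in> G" if "r = \<zero>\<^bsub>FD\<^esub> \<or> r = \<one>\<^bsub>FD\<^esub> \<or> r = s" for r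
  proof -
    have "r \<in> F" using that s(1) by auto
    from val[OF this] show ?thesis by simp
  qed
  have cc: "proj (a w) \<in> carrier V" "proj (u w) \<oplus>\<^bsub>V\<^esub> v \<bullet>\<^bsub>V\<^esub> coord (a w) \<in> carrier V" "v \<bullet>\<^bsub>V\<^esub> coord (u w) \<in> carrier V"
    using c by (simp_all add: V.rsmult_closed)
  have sD: "s \<in> carrier FD" "s \<noteq> \<zero>\<^bsub>FD\<^esub>" "s \<noteq> \<one>\<^bsub>FD\<^esub>" using s by simp_all
  show "proj (a w) \<in> G" "proj (u w) \<oplus>\<^bsub>V\<^esub> v \<bullet>\<^bsub>V\<^esub> coord (a w) \<in> G" "v \<bullet>\<^bsub>V\<^esub> coord (u w) \<in> G"
    using VF.quadratic_values_in_subspace[OF G cc sD q] by auto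
qed

end

section \<open>Stability of the hyperplane\<close>

context optimal_step
begin

lemma coord_ker: "u \<in> S \<Longrightarrow> u x = \<zero>\<^bsub>V\<^esub> \<Longrightarrow> y \<in> carrier V \<Longrightarrow> coord (u y) = \<zero>"
  using proj_W(2)[OF ker_image] by simp

text \<open>The difference of the two operators kills \<open>x\<close>, so its image lies in
  \<open>W\<close>. The component of u y along \<open>x\<close> is thus a function of
  \<open>u x\<close>.\<close>

lemma coord_determined:
  assumes u: "u \<in> S" "u' \<in> S" and eq: "u x = u' x" and y: "y \<in> carrier V"
  shows "coord (u y) = coord (u' y)"
proof -
  let ?d = "u \<oplus>\<^bsub>E\<^esub> u' \<bullet>\<^bsub>ES\<^esub> (\<ominus> \<one>)"
  have d: "?d \<in> S" using u Ss(3,4) by simp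
  have "?d x = \<zero>\<^bsub>V\<^esub>" using u xV eq by (simp add: V.rsmult_minus_one V.r_neg)
  then have c0: "coord (?d y) = \<zero>" using coord_ker[OF d] y by simp
  have "?d y = u y \<oplus>\<^bsub>V\<^esub> u' y \<bullet>\<^bsub>V\<^esub> (\<ominus> \<one>)" using y by simp
  then have "coord (u y) \<oplus> coord (u' y) \<otimes> (\<ominus> \<one>) = \<zero>"
    using c0 u y by (simp only: proj_coord_add proj_coord_smult V.rsmult_closed S_apply D.a_inv_closed D.one_closed)
  then have "coord (u y) \<oplus> \<ominus> coord (u' y) = \<zero>" using u y by (simp add: D.r_minus)
  then show ?thesis using u y by (metis D.minus_eq D.r_right_minus_eq proj_in(2) S_apply)
qed

lemma coord_add:
  assumes "u \<in> S" "u' \<in> S" "y \<in> carrier V"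
  shows "coord ((u \<oplus>\<^bsub>E\<^esub> u') y) = coord (u y) \<oplus> coord (u' y)"
  using assms by (simp add: proj_coord_add)

text \<open>If \<open>u x\<close> lies outside \<open>Z l\<close>, then
  \<open>components_flag\<close> puts its multiple by the coordinate into \<open>Z l\<close>, so the
  coordinate is 0. The remaining operators are differences of two of that kind, the subtracted one
  having value \<open>e l\<close> at \<open>x\<close>.\<close>

lemma coord_zero_below_top:
  assumes l: "m = Suc l" and u: "u \<in> S" "u x \<in> W" and w: "w \<in> Z l"
  shows "coord (u w) = \<zero>"
proof -
  have lm: "l \<le> m" "l < m" using l by auto
  have wV: "w \<in> carrier V" using w Z_sub(2)[OF lm(1)] by auto
  have out: "coord (p w) = \<zero>" if p: "p \<in> S" "p x \<in> W" "p x \<notin> Z l" for p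
  proof (rule ccontr)
    assume n: "coord (p w) \<noteq> \<zero>"
    have "p x \<bullet>\<^bsub>V\<^esub> coord (p w) \<in> Z l" using components_flag(2)[OF p(1,2) lm(1) w] .
    then have "p x \<in> Z l" using V.right_subspace_smult_iff[OF Z_sub(1)[OF lm(1)] _ _ n] p wV by simp
    then show False using p(3) by simp
  qed
  show ?thesis
  proof (cases "u x \<in> Z l")
    case False
    then show ?thesis using out u by simp
  next
    case True
    have el: "e l \<in> W" "e l \<notin> Z l" using e_W[OF lm(2)] Tr(4)[OF lm(2)] by auto
    then obtain p where p: "p \<in> S" "p x = e l" using ex_S Y(2) by blast
    have s: "u \<oplus>\<^bsub>E\<^esub> p \<in> S" using Ss(3) u p by simp
    have sx: "(u \<oplus>\<^bsub>E\<^esub> p) x = u x \<oplus>\<^bsub>V\<^esub> e l" using xV p by simp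
    have "(u \<oplus>\<^bsub>E\<^esub> p) x \<in> W" unfolding sx using Ws(3) u(2) el by simp
    moreover have "(u \<oplus>\<^bsub>E\<^esub> p) x \<notin> Z l"
      unfolding sx using V.right_subspace_add_iff(2)[OF Z_sub(1)[OF lm(1)] _ True] el by simp
    ultimately have "coord ((u \<oplus>\<^bsub>E\<^esub> p) w) = \<zero>" using out[OF s] by simp
    moreover have "coord (p w) = \<zero>" using out[OF p(1)] p(2) el by simp
    ultimately show ?thesis using coord_add[OF u(1) p(1) wV] u wV by simp
  qed
qed

lemma ex_annihilator:
  assumes b: "b \<in> carrier D" "t b = \<zero>"
  shows "\<exists>a\<in>S. a x \<oplus>\<^bsub>V\<^esub> x \<bullet>\<^bsub>V\<^esub> b = \<zero>\<^bsub>V\<^esub>"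
proof -
  have "x \<bullet>\<^bsub>V\<^esub> b \<in> Y" using t_zero_iff b by simp
  then have "\<ominus>\<^bsub>V\<^esub> (x \<bullet>\<^bsub>V\<^esub> b) \<in> Y" using VF.right_subspaceD(5)[OF Ysub] by simp
  then obtain a where "a \<in> S" "a x = \<ominus>\<^bsub>V\<^esub> (x \<bullet>\<^bsub>V\<^esub> b)" using ex_S by blast
  then show ?thesis using xV b by (intro bexI[of _ a]) (simp_all add: V.l_neg V.rsmult_closed)
qed

text \<open>The quadratic coefficient from \<open>twist_components\<close>, taken with
  \<open>B i\<close> as the ambient space. This identity is the source of the quadratic
  equations.\<close>

lemma diagonal_component:
  assumes v: "v \<in> W" and b: "b \<in> carrier D" "t b = \<zero>" and u: "u \<in> S" "u x = v \<bullet>\<^bsub>V\<^esub> b" and i: "i < m"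
  shows "v \<bullet>\<^bsub>V\<^esub> coord (u (e i)) \<in> B i"
proof -
  obtain a where a: "a \<in> S" "a x \<oplus>\<^bsub>V\<^esub> x \<bullet>\<^bsub>V\<^esub> b = \<zero>\<^bsub>V\<^esub>" using ex_annihilator[OF b] by blast
  show ?thesis
    using twist_components(3)[OF v b u a B_sub(1)[OF i] e_W[OF i]] twist_triangular(2)[OF _ b _ _ i] by blast
qed

text \<open>The coordinate of u (e l) depends on the multiplier \<open>c\<close> alone, through an
  F-linear map \<open>lam\<close>, and the position of e l c modulo \<open>B l\<close> is an F-form
  \<open>psi\<close> with psi 1 = 1. If \<open>lam\<close> were nonzero,
  \<open>diagonal_component\<close> would supply the hypothesis of
  \<open>quadratic_of_twisted_form\<close>, and every element of \<open>D\<close> would be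
  quadratic.\<close>

lemma coord_zero_at_top_multiples:
  assumes l: "m = Suc l" and c: "c \<in> carrier D" and u: "u \<in> S" "u x = e l \<bullet>\<^bsub>V\<^esub> c"
  shows "coord (u (e l)) = \<zero>"
proof (rule ccontr)
  assume n: "coord (u (e l)) \<noteq> \<zero>"
  have lm: "l < m" using l by simp
  have elW: "e l \<in> W" and elV: "e l \<in> carrier V" using e_W[OF lm] by auto
  have ad: "R.VF.adjoin (B l) (e l) = carrier (V\<lparr>carrier := W\<rparr>)"
    using VF.restrict_adjoin[OF D_subspace_imp_F[OF W]] Tr(9)[OF lm] Tr(2) l by simp
  interpret BC: complement FD "V\<lparr>carrier := W\<rparr>" "B l" "e l"
    by unfold_locales (use Tr(6,8)[OF lm] elW ad in auto)
  define psi where "psi c = BC.coord (e l \<bullet>\<^bsub>V\<^esub> c)" for c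
  have elc: "e l \<bullet>\<^bsub>V\<^esub> c \<in> W" if "c \<in> carrier D" for c using Ws(4)[OF elW that] .
  have psi: "F_functional psi"
    unfolding linear_map_def
  proof (intro conjI ballI)
    show "psi \<in> carrier (regular_space D) \<rightarrow> carrier (regular_space FD)"
      using BC.decomp(2) elc by (auto simp: psi_def)
    fix a assume a: "a \<in> carrier (regular_space D)"
    show "psi (a \<oplus>\<^bsub>regular_space D\<^esub> b) = psi a \<oplus>\<^bsub>regular_space FD\<^esub> psi b" if "b \<in> carrier (regular_space D)" for b
      using a that elV elc BC.proj_coord_add(2)[of "e l \<bullet>\<^bsub>V\<^esub> a" "e l \<bullet>\<^bsub>V\<^esub> b"] by (simp add: psi_def V.rsmult_add_scalar)
    show "psi (a \<bullet>\<^bsub>regular_space D\<^esub> c) = psi a \<bullet>\<^bsub>regular_space FD\<^esub> c" if "c \<in> carrier FD" for c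
      using a that elV elc BC.proj_coord_smult(2)[of "e l \<bullet>\<^bsub>V\<^esub> a" c] by (simp add: psi_def V.rsmult_assoc)
  qed
  have psi1: "psi \<one> = \<one>" using BC.proj_x elV by (simp add: psi_def V.rsmult_one)
  have psi0: "psi c = \<zero>" if "c \<in> carrier D" "e l \<bullet>\<^bsub>V\<^esub> c \<in> B l" for c
    using BC.coord_zero_iff[of "e l \<bullet>\<^bsub>V\<^esub> c"] elc that by (simp add: psi_def)
  have "\<exists>p\<in>S. p x = e l \<bullet>\<^bsub>V\<^esub> c" if "c \<in> carrier D" for c using ex_S elc[OF that] Y(2) by blast
  then obtain p where p: "\<And>c. c \<in> carrier D \<Longrightarrow> p c \<in> S \<and> p c x = e l \<bullet>\<^bsub>V\<^esub> c" by metis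
  define lam where "lam c = coord (p c (e l))" for c
  have lam_eq: "lam c = coord (u (e l))" if "c \<in> carrier D" "u \<in> S" "u x = e l \<bullet>\<^bsub>V\<^esub> c" for c u
    unfolding lam_def using coord_determined[of "p c" u "e l"] p[OF that(1)] that elV by simp
  have lam: "F_endo lam"
    unfolding linear_map_def
  proof (intro conjI ballI)
    show "lam \<in> carrier (regular_space D) \<rightarrow> carrier (regular_space D)"
      using p elV by (auto simp: lam_def)
    fix a assume "a \<in> carrier (regular_space D)"
    then have a: "a \<in> carrier D" by simp
    show "lam (a \<oplus>\<^bsub>regular_space D\<^esub> b) = lam a \<oplus>\<^bsub>regular_space D\<^esub> lam b" if "b \<in> carrier (regular_space D)" for b
    proof -
      have b: "b \<in> carrier D" using that by simp
      have s: "p a \<oplus>\<^bsub>E\<^esub> p b \<in> S" using Ss(3) p a b by simp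
      have "(p a \<oplus>\<^bsub>E\<^esub> p b) x = e l \<bullet>\<^bsub>V\<^esub> (a \<oplus> b)" using p a b xV elV by (simp add: V.rsmult_add_scalar)
      then have "lam (a \<oplus> b) = coord ((p a \<oplus>\<^bsub>E\<^esub> p b) (e l))" using lam_eq[OF _ s] a b by simp
      then show ?thesis using coord_add[of "p a" "p b" "e l"] p a b elV by (simp add: lam_def)
    qed
    show "lam (a \<bullet>\<^bsub>regular_space D\<^esub> c) = lam a \<bullet>\<^bsub>regular_space D\<^esub> c" if "c \<in> carrier FD" for c
    proof -
      have c: "c \<in> F" using that by simp
      have pa: "p a \<in> S" using p a by simp
      have s: "p a \<bullet>\<^bsub>ES\<^esub> c \<in> S" using Ss(4)[OF pa c] .
      have "(p a \<bullet>\<^bsub>ES\<^esub> c) x = e l \<bullet>\<^bsub>V\<^esub> (a \<otimes> c)" using p a c xV elV by (simp add: V.rsmult_assoc)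
      then have "lam (a \<otimes> c) = coord ((p a \<bullet>\<^bsub>ES\<^esub> c) (e l))" using lam_eq[OF _ s] a c by simp
      then show ?thesis using elV pa c by (simp add: lam_def proj_coord_smult)
    qed
  qed
  have zero: "psi (c \<otimes> lam (c \<otimes> b)) = \<zero>" if b: "b \<in> carrier D" "t b = \<zero>" and c: "c \<in> carrier D" for b c
  proof (rule psi0)
    have cb: "c \<otimes> b \<in> carrier D" using b c by simp
    have pcb: "p (c \<otimes> b) \<in> S" "p (c \<otimes> b) x = (e l \<bullet>\<^bsub>V\<^esub> c) \<bullet>\<^bsub>V\<^esub> b"
      using p[OF cb] elV b c by (simp_all add: V.rsmult_assoc)
    have L: "lam (c \<otimes> b) \<in> carrier D" using pcb elV by (simp add: lam_def)
    then show "c \<otimes> lam (c \<otimes> b) \<in> carrier D" using c by simp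
    have "(e l \<bullet>\<^bsub>V\<^esub> c) \<bullet>\<^bsub>V\<^esub> coord (p (c \<otimes> b) (e l)) \<in> B l"
      using diagonal_component[OF elc[OF c] b pcb lm] .
    then show "e l \<bullet>\<^bsub>V\<^esub> (c \<otimes> lam (c \<otimes> b)) \<in> B l"
      using L c elV unfolding lam_def by (simp add: V.rsmult_assoc)
  qed
  have "lam c \<noteq> \<zero>" using n lam_eq[OF c u] by simp
  then have "\<forall>z\<in>carrier D. quadratic z"
    using quadratic_of_twisted_form[OF t_functional t_one psi psi1 lam zero c] by blast
  then show False using not_quadratic by blast
qed

text \<open>\<open>D\<close> is larger than \<open>F\<close>, as scalars are quadratic; an element z
  outside \<open>F\<close> gives z - t z.\<close>

lemma ex_t_kernel: "\<exists>b\<in>carrier D. b \<noteq> \<zero> \<and> t b = \<zero>"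
proof -
  obtain z where z: "z \<in> carrier D" "\<not> quadratic z" using not_quadratic by blast
  let ?b = "z \<ominus> t z"
  have tz: "t z \<in> F" using t z by simp
  have "?b \<noteq> \<zero>"
  proof
    assume "?b = \<zero>"
    then have "z = t z" using z tz by (metis D.r_right_minus_eq F_closed)
    then have "z \<in> F" using tz by simp
    then show False using z quadratic_F by blast
  qed
  moreover have "t ?b = \<zero>"
  proof -
    have "t (\<one> \<otimes> t z) = t z" using t(3)[of \<one> "t z"] t_one tz by simp
    then have e: "t (t z) = t z" using tz by simp
    have "z = ?b \<oplus> t z" using z tz by (simp add: D.minus_eq D.a_assoc D.l_neg)
    then have "t z = t ?b \<oplus> t z" using t(2)[of ?b "t z"] z tz e by simp
    then show ?thesis using D.add.r_cancel_one'[of "t z" "t ?b"] t(1)[of ?b] z tz by simp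
  qed
  ultimately show ?thesis using z tz by (intro bexI[of _ ?b]) auto
qed

text \<open>Splitting \<open>u x\<close> along W = Z l + e l D leaves only the operators whose value
  at \<open>x\<close> lies in \<open>Z l\<close>, the multiples of \<open>e l\<close> being
  settled.\<close>

lemma coord_zero_at_top:
  assumes l: "m = Suc l" and u: "u \<in> S" "u x \<in> W"
  shows "coord (u (e l)) = \<zero>"
proof -
  have lm: "l < m" "l \<le> m" using l by auto
  have elW: "e l \<in> W" and elV: "e l \<in> carrier V" using e_W[OF lm(1)] by auto
  have ZW: "W = V.adjoin (Z l) (e l)" using Tr(2) Tr(5)[OF lm(1)] l by simp
  obtain b where b: "b \<in> carrier D" "b \<noteq> \<zero>" "t b = \<zero>" using ex_t_kernel by blast
  note ib = inv_closed'[OF b(1,2)]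
  have low: "coord (p (e l)) = \<zero>" if p: "p \<in> S" "p x \<in> Z l" for p
  proof (rule ccontr)
    let ?k = "coord (p (e l))"
    assume n: "?k \<noteq> \<zero>"
    have k: "?k \<in> carrier D" using p elV by simp
    note ik = inv_closed'[OF k n]
    let ?v' = "p x \<bullet>\<^bsub>V\<^esub> inv b"
    have v': "?v' \<in> Z l" using V.right_subspaceD(4)[OF Z_sub(1)[OF lm(2)] p(2)] ib by simp
    have v'V: "?v' \<in> carrier V" using v' Z_sub(2)[OF lm(2)] by auto
    \<comment> \<open>With k the supposed nonzero coordinate, v k is \<open>e l\<close> modulo
      \<open>Z l\<close>. The operator \<open>q\<close> below makes v b a value at \<open>x\<close>
      without changing the coordinate, and then \<open>diagonal_component\<close> would put
      \<open>e l\<close> into \<open>B l\<close>.\<close>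
    let ?v = "e l \<bullet>\<^bsub>V\<^esub> inv ?k \<oplus>\<^bsub>V\<^esub> ?v'"
    have vW: "?v \<in> W" using Ws(3)[OF Ws(4)[OF elW]] ik v' Z_sub(2)[OF lm(2)] by auto
    have "e l \<bullet>\<^bsub>V\<^esub> (inv ?k \<otimes> b) \<in> W" using Ws(4)[OF elW] ik b by simp
    then obtain q where q: "q \<in> S" "q x = e l \<bullet>\<^bsub>V\<^esub> (inv ?k \<otimes> b)" using ex_S Y(2) by blast
    have cq: "coord (q (e l)) = \<zero>" using coord_zero_at_top_multiples[OF l _ q] ik b by simp
    have s: "q \<oplus>\<^bsub>E\<^esub> p \<in> S" using Ss(3) p q by simp
    have px: "p x \<in> carrier V" using p xV by simp
    have "(p x \<bullet>\<^bsub>V\<^esub> inv b) \<bullet>\<^bsub>V\<^esub> b = p x" using V.rsmult_inv_cancel(2)[OF px b(1,2)] .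
    then have sx: "(q \<oplus>\<^bsub>E\<^esub> p) x = ?v \<bullet>\<^bsub>V\<^esub> b"
      using q ik b elV px ib xV by (simp add: V.rsmult_add_vector V.rsmult_assoc V.rsmult_closed)
    have "coord ((q \<oplus>\<^bsub>E\<^esub> p) (e l)) = ?k" using coord_add[OF q(1) p(1) elV] cq k by simp
    then have "?v \<bullet>\<^bsub>V\<^esub> ?k \<in> B l" using diagonal_component[OF vW b(1,3) s sx lm(1)] by simp
    moreover have "?v \<bullet>\<^bsub>V\<^esub> ?k = e l \<oplus>\<^bsub>V\<^esub> ?v' \<bullet>\<^bsub>V\<^esub> ?k"
      using V.rsmult_inv_cancel(2)[OF elV k n] elV ik k v'V by (simp add: V.rsmult_add_vector V.rsmult_closed)
    moreover have "?v' \<bullet>\<^bsub>V\<^esub> ?k \<in> B l"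
      using V.right_subspaceD(4)[OF Z_sub(1)[OF lm(2)] v' k] Tr(7)[OF lm(1)] by auto
    ultimately have "e l \<in> B l" using VF.right_subspace_add_iff(1)[OF B_sub(1)[OF lm(1)] elV] by simp
    then show False using Tr(8)[OF lm(1)] by simp
  qed
  obtain v c where vc: "v \<in> Z l" "c \<in> carrier D" "u x = v \<oplus>\<^bsub>V\<^esub> e l \<bullet>\<^bsub>V\<^esub> c"
    using u(2) unfolding ZW by (rule V.adjoinE)
  have vW: "v \<in> W" using vc Z_sub(2)[OF lm(2)] by auto
  obtain p where p: "p \<in> S" "p x = v" using ex_S vW Y(2) by blast
  have "e l \<bullet>\<^bsub>V\<^esub> c \<in> W" using Ws(4)[OF elW vc(2)] .
  then obtain q where q: "q \<in> S" "q x = e l \<bullet>\<^bsub>V\<^esub> c" using ex_S Y(2) by blast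
  have s: "p \<oplus>\<^bsub>E\<^esub> q \<in> S" using Ss(3) p q by simp
  have "u x = (p \<oplus>\<^bsub>E\<^esub> q) x" using p q vc(3) xV by simp
  then have "coord (u (e l)) = coord ((p \<oplus>\<^bsub>E\<^esub> q) (e l))" using coord_determined[OF u(1) s _ elV] by simp
  also have "\<dots> = \<zero>" using coord_add[OF p(1) q(1) elV] low[OF p(1)] p(2) vc(1)
      coord_zero_at_top_multiples[OF l vc(2) q] by simp
  finally show ?thesis .
qed

lemma W_stable:
  assumes u: "u \<in> S" "u x \<in> W" and w: "w \<in> W"
  shows "u w \<in> W"
proof -
  have "coord (u w) = \<zero>"
  proof (cases m)
    case 0
    then have "w \<in> {\<zero>\<^bsub>V\<^esub>}" using Tr(1,2) w by metis
    then have "w = \<zero>\<^bsub>V\<^esub>" by simp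
    then show ?thesis using EndD(4)[OF SE[OF u(1)]] proj_W(2)[OF Ws(2)] by simp
  next
    case (Suc l)
    then have lm: "l < m" "l \<le> m" by auto
    have ZW: "W = V.adjoin (Z l) (e l)" using Tr(2) Tr(5)[OF lm(1)] Suc by simp
    obtain v c where vc: "v \<in> Z l" "c \<in> carrier D" "w = v \<oplus>\<^bsub>V\<^esub> e l \<bullet>\<^bsub>V\<^esub> c"
      using w unfolding ZW by (rule V.adjoinE)
    have vV: "v \<in> carrier V" and eV: "e l \<in> carrier V" using vc Z_sub(2)[OF lm(2)] e_W[OF lm(1)] by auto
    have "u w = u v \<oplus>\<^bsub>V\<^esub> u (e l) \<bullet>\<^bsub>V\<^esub> c"
      unfolding vc(3) using EndD(2,3)[OF SE[OF u(1)]] vV eV vc(2) by (simp add: V.rsmult_closed)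
    then show ?thesis
      using coord_zero_below_top[OF Suc u vc(1)] coord_zero_at_top[OF Suc u] u(1) vV eV vc(2)
      by (simp add: proj_coord_add proj_coord_smult V.rsmult_closed)
  qed
  then show ?thesis using coord_zero_iff u w by simp
qed

lemma restr_triangular_iff:
  assumes "u \<in> S" "\<And>w. w \<in> W \<Longrightarrow> u w \<in> W"
  shows "restr u \<in> R.triangular m Z e B \<longleftrightarrow> (\<forall>i\<le>m. u ` Z i \<subseteq> Z i) \<and> (\<forall>i<m. u (e i) \<in> B i)"
proof -
  have eq: "restr u w = u w" if "w \<in> W" for w using restr_apply assms(2) that by blast
  have "restr u ` Z i = u ` Z i" if "i \<le> m" for i
    by (rule image_cong) (use eq Z_sub(2)[OF that] in auto)
  moreover have "restr u (e i) = u (e i)" if "i < m" for i using eq[OF e_W[OF that]] .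
  ultimately show ?thesis unfolding R.triangular_def using restr_closed[OF SE[OF assms(1)]] by simp
qed

text \<open>As these operators preserve \<open>W\<close>, their coordinate is 0 on \<open>W\<close>
  and the twist of u s is u s itself. That e i - u (e i) s avoids \<open>B i\<close> for all s in
  \<open>F\<close> forces \<open>u (e i)\<close> into \<open>B i\<close>.\<close>

lemma restr_triangular_W:
  assumes u: "u \<in> S" "u x \<in> W"
  shows "restr u \<in> R.triangular m Z e B"
proof -
  have stab: "u w \<in> W" if "w \<in> W" for w using W_stable[OF u that] .
  have ZZ: "u w \<in> Z i" if i: "i \<le> m" and w: "w \<in> Z i" for i w
  proof -
    have "u w \<in> W" using stab w Z_sub(2)[OF i] by blast
    then show ?thesis using components_flag(1)[OF u i w] proj_W(1) by simp
  qed
  have BB: "u (e i) \<in> B i" if i: "i < m" for i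
  proof (rule VF.affine_line_avoids[OF B_sub(1)[OF i]])
    have Si: "Suc i \<le> m" using i by simp
    have ueW: "u (e i) \<in> W" using stab e_W[OF i] by simp
    show eV: "e i \<in> carrier V" using e_W[OF i] by simp
    show "u (e i) \<in> VF.adjoin (B i) (e i)" using ZZ[OF Si e_in[OF i]] Tr(9)[OF i] by simp
    show "e i \<in> VF.adjoin (B i) (e i)" using e_in[OF i] Tr(9)[OF i] by simp
    fix s assume "s \<in> carrier FD"
    then have s: "s \<in> F" by simp
    have us: "u \<bullet>\<^bsub>ES\<^esub> s \<in> S" using Ss(4)[OF u(1) s] .
    have usx: "(u \<bullet>\<^bsub>ES\<^esub> s) x \<in> W" using u_smult_x[OF u(1) s] Ws(4)[OF u(2)] s by simp
    have ues: "u (e i) \<bullet>\<^bsub>V\<^esub> s \<in> W" using Ws(4)[OF ueW] s by simp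
    have "twist ((u \<bullet>\<^bsub>ES\<^esub> s) x) (u \<bullet>\<^bsub>ES\<^esub> s) (e i) = u (e i) \<bullet>\<^bsub>V\<^esub> s"
      using eV proj_W[OF ues] usx ues by (simp add: twist_def)
    then show "e i \<ominus>\<^bsub>V\<^esub> u (e i) \<bullet>\<^bsub>V\<^esub> s \<notin> B i" using twist_flag_W(2)[OF us usx i] by simp
  qed
  show ?thesis using restr_triangular_iff[OF u(1) stab] ZZ BB by blast
qed

text \<open>In \<open>twist_components\<close> the operator u takes a value in \<open>W\<close> at
  \<open>x\<close>, so its contribution is already triangular and drops out. What remains is that,
  for every v in \<open>W\<close>, the vector v coord (a w) lies in \<open>Z i\<close> when w does,
  and in \<open>B i\<close> when w is \<open>e i\<close>.\<close>

lemma annihilator_triangular: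
  assumes a: "a \<in> S" "a x \<oplus>\<^bsub>V\<^esub> x \<bullet>\<^bsub>V\<^esub> b = \<zero>\<^bsub>V\<^esub>" and b: "b \<in> carrier D" "t b = \<zero>"
  shows "\<And>w. w \<in> W \<Longrightarrow> a w \<in> W" "restr a \<in> R.triangular m Z e B"
proof -
  have comp: "proj (a w) \<in> G" "v \<bullet>\<^bsub>V\<^esub> coord (a w) \<in> G"
    if v: "v \<in> W" and G: "right_subspace FD V G" and w: "w \<in> W"
      and tw: "\<And>v u. \<lbrakk>v \<in> W; u \<in> S; u x \<oplus>\<^bsub>V\<^esub> x \<bullet>\<^bsub>V\<^esub> b = v \<bullet>\<^bsub>V\<^esub> b\<rbrakk> \<Longrightarrow> twist v u w \<in> G"
      and uG: "\<And>u. u \<in> S \<Longrightarrow> u x \<in> W \<Longrightarrow> u w \<in> G" for v w G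
  proof -
    have vb: "v \<bullet>\<^bsub>V\<^esub> b \<in> W" using Ws(4)[OF v b(1)] .
    then obtain u where u: "u \<in> S" "u x = v \<bullet>\<^bsub>V\<^esub> b" using ex_S Y(2) by blast
    note tc = twist_components[OF v b u a G w tw]
    show "proj (a w) \<in> G" using tc(1) .
    have ux: "u x \<in> W" using u vb by simp
    have pG: "proj (u w) \<in> G" using uG[OF u(1) ux] proj_W(1)[OF W_stable[OF u(1) ux w]] by simp
    have "v \<bullet>\<^bsub>V\<^esub> coord (a w) \<in> carrier V" using V.rsmult_closed[OF WV[OF v] proj_in(2)[OF S_apply[OF a(1) WV[OF w]]]] .
    from VF.right_subspace_add_iff(2)[OF G this pG] show "v \<bullet>\<^bsub>V\<^esub> coord (a w) \<in> G" using tc(2) by blast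
  qed
  have Zc: "proj (a w) \<in> Z i \<and> v \<bullet>\<^bsub>V\<^esub> coord (a w) \<in> Z i" if v: "v \<in> W" and i: "i \<le> m" and w: "w \<in> Z i" for v i w
  proof -
    have wW: "w \<in> W" using w Z_sub(2)[OF i] by auto
    have uG: "u w \<in> Z i" if u: "u \<in> S" "u x \<in> W" for u
      using restr_triangular_iff[OF u(1) W_stable[OF u]] restr_triangular_W[OF u] i w by blast
    have tw: "twist v' u w \<in> Z i" if "v' \<in> W" "u \<in> S" "u x \<oplus>\<^bsub>V\<^esub> x \<bullet>\<^bsub>V\<^esub> b = v' \<bullet>\<^bsub>V\<^esub> b" for v' u
      using twist_triangular(1)[OF that(1) b that(2,3) i w] .
    show ?thesis
    proof
      show "proj (a w) \<in> Z i" by (rule comp(1)[OF v Z_subF[OF i] wW]) (rule tw uG; assumption)+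
      show "v \<bullet>\<^bsub>V\<^esub> coord (a w) \<in> Z i" by (rule comp(2)[OF v Z_subF[OF i] wW]) (rule tw uG; assumption)+
    qed
  qed
  have Bc: "proj (a (e i)) \<in> B i \<and> v \<bullet>\<^bsub>V\<^esub> coord (a (e i)) \<in> B i" if v: "v \<in> W" and i: "i < m" for v i
  proof -
    have uG: "u (e i) \<in> B i" if u: "u \<in> S" "u x \<in> W" for u
      using restr_triangular_iff[OF u(1) W_stable[OF u]] restr_triangular_W[OF u] i by blast
    have tw: "twist v' u (e i) \<in> B i" if "v' \<in> W" "u \<in> S" "u x \<oplus>\<^bsub>V\<^esub> x \<bullet>\<^bsub>V\<^esub> b = v' \<bullet>\<^bsub>V\<^esub> b" for v' u
      using twist_triangular(2)[OF that(1) b that(2,3) i] .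
    show ?thesis
    proof
      show "proj (a (e i)) \<in> B i" by (rule comp(1)[OF v B_sub(1)[OF i] e_W[OF i]]) (rule tw uG; assumption)+
      show "v \<bullet>\<^bsub>V\<^esub> coord (a (e i)) \<in> B i" by (rule comp(2)[OF v B_sub(1)[OF i] e_W[OF i]]) (rule tw uG; assumption)+
    qed
  qed
  have c0: "coord (a w) = \<zero>" if w: "w \<in> W" for w
  proof (rule ccontr)
    let ?k = "coord (a w)"
    assume n: "?k \<noteq> \<zero>"
    have k: "?k \<in> carrier D" using a w by simp
    note ik = inv_closed'[OF k n]
    let ?v = "w \<bullet>\<^bsub>V\<^esub> inv ?k"
    have v: "?v \<in> W" using Ws(4)[OF w] ik by simp
    \<comment> \<open>By the two inclusions this operator is triangular on \<open>W\<close>, but the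
      choice of \<open>?v\<close> makes it fix \<open>w\<close>, contrary to
      \<open>triangular_fixed_point_free\<close> if \<open>w\<close> is nonzero.\<close>
    let ?f = "\<lambda>y\<in>W. ?v \<bullet>\<^bsub>V\<^esub> coord (a y)"
    have f: "?f \<in> carrier R.E"
      by (rule R.EndI) (use Ws(3,4) v a EndD(2,3)[OF SE[OF a(1)]] in
        \<open>auto simp: proj_coord_add proj_coord_smult V.rsmult_add_scalar V.rsmult_assoc\<close>)
    have fy: "?f y = ?v \<bullet>\<^bsub>V\<^esub> coord (a y)" if "y \<in> W" for y using that by simp
    have "?f \<in> R.triangular m Z e B"
      unfolding R.triangular_def
    proof (intro CollectI conjI allI impI)
      show "?f ` Z i \<subseteq> Z i" if i: "i \<le> m" for i
      proof
        fix y assume "y \<in> ?f ` Z i"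
        then obtain z where z: "z \<in> Z i" "y = ?f z" by blast
        have "z \<in> W" using z(1) Z_sub(2)[OF i] by auto
        then show "y \<in> Z i" using Zc[OF v i z(1)] z(2) fy by simp
      qed
      show "?f (e i) \<in> B i" if i: "i < m" for i using Bc[OF v i] fy[OF e_W[OF i]] by simp
    qed (rule f)
    moreover have "?f w = w" using fy[OF w] V.rsmult_inv_cancel(2)[OF WV[OF w] k n] by simp
    ultimately have "w = \<zero>\<^bsub>V\<^esub>"
      using R.triangular_fixed_point_free[OF T] w unfolding R.fixed_point_free_def by simp
    then have "?k = \<zero>" using EndD(4)[OF SE[OF a(1)]] proj_W(2)[OF Ws(2)] by simp
    then show False using n by simp
  qed
  show stab: "a w \<in> W" if "w \<in> W" for w using c0[OF that] coord_zero_iff a that by simp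
  have "a w \<in> Z i" if "i \<le> m" "w \<in> Z i" for i w
    using Zc[OF Ws(2) that] proj_W(1)[OF stab[of w]] Z_sub(2)[OF that(1)] that(2) by auto
  moreover have "a (e i) \<in> B i" if "i < m" for i
    using Bc[OF Ws(2) that] proj_W(1)[OF stab[OF e_W[OF that]]] by simp
  ultimately show "restr a \<in> R.triangular m Z e B" using restr_triangular_iff[OF a(1) stab] by blast
qed

text \<open>Every operator splits as q + p + a according to its value v + x c at \<open>x\<close>: p
  takes the value v in \<open>W\<close>, a takes the value x c with t c = 0, and q kills
  \<open>x\<close>. Each kind is known to preserve \<open>W\<close> and to be triangular
  there.\<close>

lemma step_triangular:
  assumes u: "u \<in> S"
  shows "u ` W \<subseteq> W" "restr u \<in> R.triangular m Z e B"
proof -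
  have ux: "u x \<in> Y" "u x \<in> carrier V" using u Y(1) xV by auto
  define v where "v = proj (u x)"
  define c where "c = coord (u x)"
  have vW: "v \<in> W" and cD: "c \<in> carrier D" and ux_eq: "u x = v \<oplus>\<^bsub>V\<^esub> x \<bullet>\<^bsub>V\<^esub> c"
    unfolding v_def c_def using decomp[OF ux(2)] by auto
  have xcV: "x \<bullet>\<^bsub>V\<^esub> c \<in> carrier V" using xV cD by (simp add: V.rsmult_closed)
  have xc: "x \<bullet>\<^bsub>V\<^esub> c \<in> Y"
    using VF.right_subspace_add_iff(2)[OF Ysub xcV, of v] ux(1) vW Y(2) unfolding ux_eq by blast
  then have "t c = \<zero>" using t_zero_iff cD by simp
  have "x \<bullet>\<^bsub>V\<^esub> (\<ominus> c) = \<ominus>\<^bsub>V\<^esub> (x \<bullet>\<^bsub>V\<^esub> c)" using xV cD by (rule V.rsmult_r_minus)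
  then have tc: "t (\<ominus> c) = \<zero>" using t_zero_iff[of "\<ominus> c"] cD xc VF.right_subspaceD(5)[OF Ysub xc] by simp
  obtain a where a: "a \<in> S" "a x = x \<bullet>\<^bsub>V\<^esub> c" using ex_S[OF xc] by blast
  have ax: "a x \<oplus>\<^bsub>V\<^esub> x \<bullet>\<^bsub>V\<^esub> (\<ominus> c) = \<zero>\<^bsub>V\<^esub>"
    using a xV cD xcV by (simp add: V.rsmult_r_minus V.r_neg)
  have cD': "\<ominus> c \<in> carrier D" using cD by simp
  note A = annihilator_triangular[OF a(1) ax cD' tc]
  obtain p where p: "p \<in> S" "p x = v" using ex_S vW Y(2) by blast
  have pW: "p x \<in> W" using p vW by simp
  note P = restr_triangular_W[OF p(1) pW]
  let ?s = "p \<oplus>\<^bsub>E\<^esub> a"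
  have s: "?s \<in> S" using Ss(3) p a by simp
  define q where "q = u \<oplus>\<^bsub>E\<^esub> ?s \<bullet>\<^bsub>ES\<^esub> (\<ominus> \<one>)"
  have q: "q \<in> S" unfolding q_def using Ss(3,4) u s by simp
  have qx: "q x = \<zero>\<^bsub>V\<^esub>"
    unfolding q_def using xV p a ux_eq u vW xcV by (simp add: V.rsmult_minus_one V.r_neg)
  have Q: "restr q \<in> R.triangular m Z e B" using q qx restr_ker by blast
  interpret ER: ring E by (rule End_ring)
  have u_eq: "u = q \<oplus>\<^bsub>ES\<^esub> ?s"
  proof (rule End_eqI)
    show "u \<in> carrier E" "q \<oplus>\<^bsub>ES\<^esub> ?s \<in> carrier E" using u q s Ss(3) by auto
    fix y assume y: "y \<in> carrier V"
    have c: "u y \<in> carrier V" "p y \<in> carrier V" "a y \<in> carrier V" using u p a y by auto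
    show "u y = (q \<oplus>\<^bsub>ES\<^esub> ?s) y"
      using y c by (simp add: q_def V.rsmult_minus_one V.a_assoc V.l_neg)
  qed
  have "restr u = restr q \<oplus>\<^bsub>R.ES\<^esub> (restr p \<oplus>\<^bsub>R.ES\<^esub> restr a)"
    using rst.linear_mapD(2)[OF restr_linear] q s p(1) a(1) u_eq by simp
  then show "restr u \<in> R.triangular m Z e B"
    using R.EF.right_subspaceD(3)[OF R.triangular_subspace[OF T]] Q P A(2) by simp
  show "u ` W \<subseteq> W"
  proof
    fix y assume "y \<in> u ` W"
    then obtain w where w: "w \<in> W" "y = u w" by blast
    have "u w = q w \<oplus>\<^bsub>V\<^esub> (p w \<oplus>\<^bsub>V\<^esub> a w)" using u_eq w by simp
    moreover have "q w \<in> W" "p w \<in> W" "a w \<in> W"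
      using ker_image[OF q qx] W_stable[OF p(1) pW] A(1) w by auto
    ultimately show "y \<in> W" using w Ws(3) by simp
  qed
qed

end

lemma (in division_algebra) fixed_point_free_structure:
  assumes "algebra_space D F V" "right_vector_space.vdim D V (carrier V) n" "RF.vdim (carrier D) d"
    "right_vector_space.vdim (D\<lparr>carrier := F\<rparr>) (End_space D V) S (max_dim d n)"
    "algebra_space.fixed_point_free V S"
    "infinite F \<or> n * d \<le> card F" "\<exists>s\<in>F. s \<noteq> \<zero> \<and> s \<noteq> \<one>" "\<exists>z\<in>carrier D. \<not> quadratic z"
  shows "\<exists>W e B. algebra_space.flag_data D F V n W e B \<and> S = algebra_space.triangular D V n W e B"
  using assms
proof (induction n arbitrary: V S)
  case (0 V S)
  interpret algebra_space D F V by fact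
  have V0: "carrier V = {\<zero>\<^bsub>V\<^esub>}" using V.vdim_0 0 by simp
  then have fd: "flag_data 0 (\<lambda>_. {\<zero>\<^bsub>V\<^esub>}) e B" for e B unfolding flag_data_def by simp
  have "EF.vdim (triangular 0 (\<lambda>_. {\<zero>\<^bsub>V\<^esub>}) e B) 0" for e B
    using vdim_triangular[OF algebra_space_axioms fd 0(3)] by simp
  then have "S = triangular 0 (\<lambda>_. {\<zero>\<^bsub>V\<^esub>}) e B" for e B
    using EF.vdim_0 0(4) by (metis max_dim.simps(1))
  then show ?case using fd by blast
next
  case (Suc m V S)
  interpret algebra_space D F V by fact
  note Vdim = Suc.prems(2) and d = Suc.prems(3) and Sdim = Suc.prems(4) and fpf = Suc.prems(5)
  note Ssub = EF.vdim_subspace[OF Sdim]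
  obtain x r j where x: "x \<in> carrier V" "x \<notin> vals S x" "VF.vdim (vals S x) r"
    "EF.vdim {u \<in> S. u x = \<zero>\<^bsub>V\<^esub>} j" "r + j = max_dim d (Suc m)" "r < Suc m * d"
    "\<And>u y. u \<in> S \<Longrightarrow> u x = \<zero>\<^bsub>V\<^esub> \<Longrightarrow> y \<in> carrier V \<Longrightarrow> u y \<in> vals S x"
    using ex_generic_vector[OF Sdim fpf Vdim d Suc.prems(6)] by blast
  let ?U = "{u \<in> S. u x = \<zero>\<^bsub>V\<^esub>}" and ?Y = "vals S x"
  have UE: "?U \<subseteq> carrier E" using EF.right_subspaceD(1)[OF EF.vdim_subspace[OF x(4)]] by simp
  note C = core_subspace[OF VF.vdim_subspace[OF x(3)]]
  have "x \<notin> core ?Y" using C(2) x(2) by blast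
  then obtain H where H: "right_subspace D V H" "core ?Y \<subseteq> H" "x \<notin> H" "V.adjoin H x = carrier V"
    using V.ex_hyperplane_avoiding[OF Vdim C(1) x(1)] by blast
  interpret algebra_complement D F V H x by unfold_locales (use H x in auto)
  have UH: "u y \<in> H" if "u \<in> ?U" "y \<in> carrier V" for u y
    using kernel_image_core[of u ?Y] x(7) that UE H(2) by blast
  have 1: "R.EF.vdim (restr ` ?U) j" by (rule vdim_restr[OF x(4)]) (use UH H(1) Ws(7) in auto)
  have 2: "R.fixed_point_free (restr ` ?U)"
    by (rule restr_fixed_point_free[OF fpf]) (use UE UH Ws(7) in auto)
  have Hdim: "V.vdim H m" using vdim_W[OF Vdim] .
  then have Rdim: "right_vector_space.vdim D (V\<lparr>carrier := H\<rparr>) (carrier (V\<lparr>carrier := H\<rparr>)) m"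
    using V.restrict_vdim_iff[OF H(1)] by simp
  have F': "infinite F \<or> m * d \<le> card F" using Suc.prems(6) by auto
  have "j \<le> max_dim d m"
    using fixed_point_free_dim_le[OF R.algebra_space_axioms Rdim d 1 2 F'] .
  \<comment> \<open>\<open>max_dim\<close> is reached only if both summands are extremal: the
    operators killing \<open>x\<close> have the largest dimension on \<open>H\<close>, and
    \<open>vals S x\<close> has F-codimension one.\<close>
  then have j: "j = max_dim d m" and r: "Suc r = Suc m * d" using x(5,6) by auto
  have VN: "VF.vdim (carrier V) (Suc m * d)" using vdim_F_of_vdim_D[OF Vdim d] .
  have adY: "VF.adjoin ?Y x = carrier V"
  proof (rule VF.vdim_eq[OF VN])
    show "VF.vdim (VF.adjoin ?Y x) (Suc m * d)" using VF.vdim_adjoin[OF x(3,1,2)] r by simp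
    show "VF.adjoin ?Y x \<subseteq> carrier V"
      using VF.right_subspaceD(1)[OF VF.adjoin_subspace[OF VF.vdim_subspace[OF x(3)] x(1)]] .
  qed
  obtain i where i: "VF.vdim (core ?Y) i" "Suc m * d \<le> i + d"
    using vdim_conductor[OF VF.vdim_subspace[OF x(3)] x(1) adY VN d] unfolding core_def by auto
  \<comment> \<open>The core has F-codimension at most \<open>d\<close>, that of a D-hyperplane, and
    it is contained in \<open>H\<close>. So the hyperplane, chosen only to contain the core, is the
    core and lies in \<open>vals S x\<close>.\<close>
  have "core ?Y = H"
  proof -
    have HF: "VF.vdim H (m * d)" using vdim_F_of_vdim_D[OF Hdim d] .
    have "i \<le> m * d" using VF.vdim_mono[OF HF i(1) H(2)] .
    then have "i = m * d" using i(2) by simp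
    then show ?thesis using VF.vdim_eq[OF HF _ H(2)] i(1) by simp
  qed
  then have HY: "H \<subseteq> ?Y" using C(2) by simp
  have "\<exists>W e B. R.flag_data m W e B \<and> restr ` ?U = R.triangular m W e B"
    using Suc.IH[OF R.algebra_space_axioms Rdim d _ 2 F' Suc.prems(7,8)] 1 j by simp
  then obtain Z e B where Z: "R.flag_data m Z e B" "restr ` ?U = R.triangular m Z e B" by blast
  interpret optimal_step D F V H x S ?Y m Z e B
    by unfold_locales
      (use Ssub fpf HY x(2) adY UH Z Suc.prems(7,8) in auto)
  let ?Z = "Z(Suc m := carrier V)" and ?e = "e(m := x)" and ?B = "B(m := ?Y)"
  have T': "flag_data (Suc m) ?Z ?e ?B"
    using flag_data_extn[OF Z(1) VF.vdim_subspace[OF x(3)] HY x(2) adY] .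
  have Zm: "?Z m = H" "?e m = x" using Tr(2) by simp_all
  have Req: "R.triangular m ?Z ?e ?B = R.triangular m Z e B"
    unfolding R.triangular_def by auto
  have "S \<subseteq> triangular (Suc m) ?Z ?e ?B"
  proof
    fix u assume u: "u \<in> S"
    show "u \<in> triangular (Suc m) ?Z ?e ?B"
      unfolding triangular_Suc_iff[OF T' Zm] Req using u step_triangular[OF u] by auto
  qed
  moreover have "EF.vdim (triangular (Suc m) ?Z ?e ?B) (max_dim d (Suc m))"
    using vdim_triangular[OF algebra_space_axioms T' d] .
  ultimately have "S = triangular (Suc m) ?Z ?e ?B" using EF.vdim_eq Sdim by blast
  then show ?case using T' by blast
qed

section \<open>Division algebras all of whose elements are quadratic\<close>

context division_algebra
begin

lemma D_m_eq_zero_iff: "a \<in> carrier D \<Longrightarrow> b \<in> carrier D \<Longrightarrow> a \<otimes> b = \<zero> \<longleftrightarrow> a = \<zero> \<or> b = \<zero>"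
proof (cases "a = \<zero>")
  case False
  assume ab: "a \<in> carrier D" "b \<in> carrier D"
  note ia = inv_closed'[OF ab(1) False]
  have "b = inv a \<otimes> (a \<otimes> b)" using ab ia by (simp add: m_assoc[symmetric])
  then show ?thesis using ab ia False by auto
qed simp

lemma inv_unique_D: "a \<in> carrier D \<Longrightarrow> b \<in> carrier D \<Longrightarrow> a \<otimes> b = \<one> \<Longrightarrow> inv a = b"
  using inv_closed'[of a] m_assoc[of "inv a" a b] one_not_zero by (metis l_null l_one r_one)

text \<open>For a quadratic \<open>x\<close> this is the subfield F(x).\<close>

definition "quad_field x = {a \<oplus> x \<otimes> b |a b. a \<in> F \<and> b \<in> F}"

lemma quad_fieldI: "a \<in> F \<Longrightarrow> b \<in> F \<Longrightarrow> a \<oplus> x \<otimes> b \<in> quad_field x"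
  unfolding quad_field_def by blast

lemma quad_fieldE:
  assumes "z \<in> quad_field x"
  obtains a b where "a \<in> F" "b \<in> F" "z = a \<oplus> x \<otimes> b"
  using assms unfolding quad_field_def by blast

lemma quad_field_F: "x \<in> carrier D \<Longrightarrow> a \<in> F \<Longrightarrow> a \<in> quad_field x"
  using quad_fieldI[of a \<zero> x] by simp

lemma quad_field_self: "x \<in> carrier D \<Longrightarrow> x \<in> quad_field x"
  using quad_fieldI[of \<zero> \<one> x] by simp

lemma quad_field_closed:
  assumes "x \<in> carrier D" shows "z \<in> quad_field x \<Longrightarrow> z \<in> carrier D"
  using assms by (auto elim: quad_fieldE)

lemma quad_field_add:
  assumes x: "x \<in> carrier D" and "z \<in> quad_field x" "w \<in> quad_field x"
  shows "z \<oplus> w \<in> quad_field x"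
proof -
  obtain a b where ab: "a \<in> F" "b \<in> F" "z = a \<oplus> x \<otimes> b" using assms(2) by (rule quad_fieldE)
  obtain a' b' where ab': "a' \<in> F" "b' \<in> F" "w = a' \<oplus> x \<otimes> b'" using assms(3) by (rule quad_fieldE)
  have "z \<oplus> w = (a \<oplus> a') \<oplus> x \<otimes> (b \<oplus> b')" using ab ab' x by (simp add: r_distr a_ac)
  then show ?thesis using quad_fieldI[of "a \<oplus> a'" "b \<oplus> b'" x] ab ab' by simp
qed

lemma quad_field_smult:
  assumes x: "x \<in> carrier D" and "z \<in> quad_field x" "c \<in> F"
  shows "z \<otimes> c \<in> quad_field x"
proof -
  obtain a b where ab: "a \<in> F" "b \<in> F" "z = a \<oplus> x \<otimes> b" using assms(2) by (rule quad_fieldE)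
  have "z \<otimes> c = (a \<otimes> c) \<oplus> x \<otimes> (b \<otimes> c)" using ab x assms(3) by (simp add: l_distr m_assoc)
  then show ?thesis using quad_fieldI[of "a \<otimes> c" "b \<otimes> c" x] ab assms(3) by simp
qed

lemma quad_field_neg:
  assumes x: "x \<in> carrier D" and "z \<in> quad_field x"
  shows "\<ominus> z \<in> quad_field x"
proof -
  have "z \<otimes> (\<ominus> \<one>) \<in> quad_field x" using quad_field_smult[OF assms] by simp
  then show ?thesis using quad_field_closed[OF assms] by (simp add: r_minus)
qed

lemma quad_field_mult:
  assumes x: "x \<in> carrier D" "quadratic x" and "z \<in> quad_field x" "w \<in> quad_field x"
  shows "z \<otimes> w \<in> quad_field x"
proof -
  obtain p q where pq: "p \<in> F" "q \<in> F" "x \<otimes> x = x \<otimes> p \<oplus> q" using x(2) unfolding quadratic_def by blast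
  obtain a b where ab: "a \<in> F" "b \<in> F" "z = a \<oplus> x \<otimes> b" using assms(3) by (rule quad_fieldE)
  obtain a' b' where ab': "a' \<in> F" "b' \<in> F" "w = a' \<oplus> x \<otimes> b'" using assms(4) by (rule quad_fieldE)
  have xw: "x \<otimes> w \<in> quad_field x"
  proof -
    have "x \<otimes> w = x \<otimes> a' \<oplus> (x \<otimes> x) \<otimes> b'" using ab' x by (simp add: r_distr m_assoc)
    also have "\<dots> = q \<otimes> b' \<oplus> x \<otimes> (a' \<oplus> p \<otimes> b')" unfolding pq(3) using ab' x pq by (simp add: l_distr r_distr m_assoc a_ac)
    finally show ?thesis using quad_fieldI[of "q \<otimes> b'" "a' \<oplus> p \<otimes> b'" x] ab' pq by simp
  qed
  have wD: "w \<in> carrier D" using quad_field_closed[OF x(1) assms(4)] .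
  have "z \<otimes> w = w \<otimes> a \<oplus> (x \<otimes> w) \<otimes> b"
    unfolding ab(3) using ab x wD F_commute[OF ab(1) wD] F_commute[OF ab(2) wD] by (simp add: l_distr m_assoc)
  then show ?thesis using quad_field_add[OF x(1) quad_field_smult[OF x(1) assms(4) ab(1)] quad_field_smult[OF x(1) xw ab(2)]] by simp
qed

text \<open>From m (m - p) = q: either q is nonzero and dividing by it gives the inverse, or m = p
  lies in \<open>F\<close>.\<close>

lemma quadratic_inv:
  assumes m: "m \<in> carrier D" "quadratic m" "m \<noteq> \<zero>"
  shows "inv m \<in> quad_field m"
proof -
  obtain p q where pq: "p \<in> F" "q \<in> F" "m \<otimes> m = m \<otimes> p \<oplus> q" using m(2) unfolding quadratic_def by blast
  have e: "m \<otimes> (m \<ominus> p) = q"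
  proof -
    have "m \<otimes> (m \<ominus> p) = (q \<oplus> m \<otimes> p) \<oplus> \<ominus> (m \<otimes> p)" using m pq by (simp add: minus_eq r_distr r_minus a_comm)
    also have "\<dots> = q" using m pq by (simp add: a_assoc r_neg)
    finally show ?thesis .
  qed
  show ?thesis
  proof (cases "q = \<zero>")
    case True
    then have "m \<ominus> p = \<zero>" using e m pq D_m_eq_zero_iff[of m "m \<ominus> p"] by simp
    then have "m = p" using m pq by simp
    then have "inv m \<in> F" using F_inv m(3) pq by simp
    then show ?thesis using quad_field_F m by simp
  next
    case False
    note iq = F_inv[OF pq(2) False] inv_closed'[OF F_closed[OF pq(2)] False]
    have "m \<otimes> ((m \<ominus> p) \<otimes> inv q) = \<one>" using e m pq iq by (simp add: m_assoc[symmetric])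
    then have "inv m = (m \<ominus> p) \<otimes> inv q" using inv_unique_D m pq iq by simp
    moreover have "m \<ominus> p \<in> quad_field m"
      using quad_field_add[OF m(1) quad_field_self[OF m(1)] quad_field_F[OF m(1), of "\<ominus> p"]] pq by (simp add: minus_eq)
    ultimately show ?thesis using quad_field_smult[OF m(1)] iq by simp
  qed
qed

lemma quad_field_inv:
  assumes x: "x \<in> carrier D" "quadratic x" and all: "\<forall>z\<in>carrier D. quadratic z"
    and z: "z \<in> quad_field x" "z \<noteq> \<zero>"
  shows "inv z \<in> quad_field x"
proof -
  have zD: "z \<in> carrier D" using quad_field_closed[OF x(1) z(1)] .
  obtain a b where ab: "a \<in> F" "b \<in> F" "inv z = a \<oplus> z \<otimes> b"
    using quadratic_inv[OF zD bspec[OF all, OF zD] z(2)] by (rule quad_fieldE)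
  then show ?thesis using quad_field_add[OF x(1) quad_field_F[OF x(1) ab(1)] quad_field_smult[OF x(1) z(1) ab(2)]] by simp
qed

lemma quad_field_zero:
  assumes x: "x \<in> carrier D" "x \<notin> F" and ab: "a \<in> F" "b \<in> F" "a \<oplus> x \<otimes> b = \<zero>"
  shows "a = \<zero> \<and> b = \<zero>"
proof -
  have b: "b = \<zero>"
  proof (rule ccontr)
    assume n: "b \<noteq> \<zero>"
    note ib = F_inv[OF ab(2) n] inv_closed'[OF F_closed[OF ab(2)] n]
    have "x \<otimes> b = \<ominus> a" using ab x by (metis F_closed a_comm m_closed minus_equality)
    then have "(x \<otimes> b) \<otimes> inv b = \<ominus> a \<otimes> inv b" by simp
    then have "x = \<ominus> a \<otimes> inv b" using ab x ib by (simp add: m_assoc)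
    then show False using x ab ib by simp
  qed
  then show ?thesis using ab x by simp
qed

text \<open>A nonzero \<open>m\<close> would be invertible within F(x), and y = - l m^-1 would lie
  there.\<close>

lemma quad_field_indep:
  assumes x: "x \<in> carrier D" "quadratic x" and all: "\<forall>z\<in>carrier D. quadratic z"
    and y: "y \<in> carrier D" "y \<notin> quad_field x"
    and lm: "l \<in> quad_field x" "m \<in> quad_field x" "l \<oplus> y \<otimes> m = \<zero>"
  shows "l = \<zero> \<and> m = \<zero>"
proof -
  note c = quad_field_closed[OF x(1) lm(1)] quad_field_closed[OF x(1) lm(2)]
  have m: "m = \<zero>"
  proof (rule ccontr)
    assume n: "m \<noteq> \<zero>"
    note im = quad_field_inv[OF x all lm(2) n] inv_closed'[OF c(2) n]
    have "y \<otimes> m = \<ominus> l" using lm(3) c y by (metis a_comm m_closed minus_equality)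
    then have "(y \<otimes> m) \<otimes> inv m = \<ominus> l \<otimes> inv m" by simp
    then have "y = \<ominus> l \<otimes> inv m" using c y im by (simp add: m_assoc)
    then show False using y quad_field_mult[OF x quad_field_neg[OF x(1) lm(1)] im(1)] by simp
  qed
  then show ?thesis using lm(3) c y by simp
qed

lemma eq_imp_diff: "a \<in> carrier D \<Longrightarrow> a = b \<Longrightarrow> a \<oplus> \<ominus> b = \<zero>"
  by (simp add: r_neg)

lemma cancel_right: "a \<in> carrier D \<Longrightarrow> b \<in> carrier D \<Longrightarrow> (a \<oplus> b) \<ominus> b = a"
  by (simp add: minus_eq a_assoc r_neg)

text \<open>If \<open>y\<close> commuted with \<open>x\<close> without lying in \<open>F(x)\<close>, the quadratic equations of \<open>x + y\<close> and \<open>xy\<close>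
  would be relations over \<open>F(x)\<close> between \<open>1\<close> and \<open>y\<close>, hence trivial.\<close>

lemma separable_centralizer:
  assumes all: "\<forall>z\<in>carrier D. quadratic z"
    and x: "x \<in> carrier D" "x \<notin> F" and pq: "p \<in> F" "q \<in> F" "x \<otimes> x = x \<otimes> p \<oplus> q" "x \<oplus> x \<noteq> p"
    and y: "y \<in> carrier D" "y \<otimes> x = x \<otimes> y"
  shows "y \<in> quad_field x"
proof (rule ccontr)
  assume n: "y \<notin> quad_field x"
  note qx = bspec[OF all, OF x(1)]
  note ind = quad_field_indep[OF x(1) qx all y(1) n]
  obtain p' q' where pq': "p' \<in> F" "q' \<in> F" "y \<otimes> y = y \<otimes> p' \<oplus> q'" using bspec[OF all, OF y(1)] unfolding quadratic_def by blast
  have xy: "x \<oplus> y \<in> carrier D" "x \<otimes> y \<in> carrier D" using x y by auto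
  obtain r s where rs: "r \<in> F" "s \<in> F" "(x \<oplus> y) \<otimes> (x \<oplus> y) = (x \<oplus> y) \<otimes> r \<oplus> s"
    using bspec[OF all, OF xy(1)] unfolding quadratic_def by blast
  obtain r2 s2 where rs2: "r2 \<in> F" "s2 \<in> F" "(x \<otimes> y) \<otimes> (x \<otimes> y) = (x \<otimes> y) \<otimes> r2 \<oplus> s2"
    using bspec[OF all, OF xy(2)] unfolding quadratic_def by blast
  note cF = F_closed[OF pq(1)] F_closed[OF pq(2)] F_closed[OF pq'(1)] F_closed[OF pq'(2)] F_closed[OF rs(1)] F_closed[OF rs(2)]
    F_closed[OF rs2(1)] F_closed[OF rs2(2)]
  have L: "a \<oplus> x \<otimes> b \<in> quad_field x" if "a \<in> F" "b \<in> F" for a b using quad_fieldI that .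
  have LF: "x \<otimes> b \<oplus> a \<in> quad_field x" if "a \<in> F" "b \<in> F" for a b
    using quad_fieldI[OF that, of x] that x(1) by (simp add: a_comm)
  \<comment> \<open>The quadratic equations of x, y and x + y combined, and sorted by 1 and y over
    F(x).\<close>
  have 1: "(x \<otimes> (p \<ominus> r) \<oplus> (q \<oplus> q' \<ominus> s)) \<oplus> y \<otimes> (x \<oplus> x \<oplus> p' \<ominus> r) = \<zero>"
  proof -
    have "(x \<oplus> y) \<otimes> (x \<oplus> y) = (x \<otimes> x \<oplus> y \<otimes> y) \<oplus> (y \<otimes> x \<oplus> y \<otimes> x)"
      using x(1) y by (simp add: l_distr r_distr a_ac)
    also have "\<dots> = x \<otimes> p \<oplus> (q \<oplus> q') \<oplus> y \<otimes> (x \<oplus> x \<oplus> p')"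
      unfolding pq(3) pq'(3) using x(1) y(1) cF by (simp add: r_distr a_ac)
    finally have e: "x \<otimes> p \<oplus> (q \<oplus> q') \<oplus> y \<otimes> (x \<oplus> x \<oplus> p') = (x \<oplus> y) \<otimes> r \<oplus> s" using rs(3) by simp
    have "(x \<otimes> p \<oplus> (q \<oplus> q') \<oplus> y \<otimes> (x \<oplus> x \<oplus> p')) \<oplus> \<ominus> ((x \<oplus> y) \<otimes> r \<oplus> s) = \<zero>"
      by (rule eq_imp_diff[OF _ e]) (use x(1) y(1) cF in simp)
    moreover have "(x \<otimes> p \<oplus> (q \<oplus> q') \<oplus> y \<otimes> (x \<oplus> x \<oplus> p')) \<oplus> \<ominus> ((x \<oplus> y) \<otimes> r \<oplus> s)
      = (x \<otimes> (p \<ominus> r) \<oplus> (q \<oplus> q' \<ominus> s)) \<oplus> y \<otimes> (x \<oplus> x \<oplus> p' \<ominus> r)"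
      using x(1) y(1) cF by (simp add: minus_eq minus_add l_distr r_distr r_minus l_minus a_ac)
    ultimately show ?thesis by simp
  qed
  have "x \<oplus> x \<oplus> p' \<ominus> r \<in> quad_field x"
    using L[of "p' \<ominus> r" "\<one> \<oplus> \<one>"] pq' rs x(1) cF by (simp add: r_distr minus_eq a_ac)
  then have A: "x \<otimes> (p \<ominus> r) \<oplus> (q \<oplus> q' \<ominus> s) = \<zero>" "x \<oplus> x \<oplus> p' \<ominus> r = \<zero>"
    using ind[OF LF _ 1] pq pq' rs by auto
  have pr: "p \<ominus> r = \<zero>"
    using quad_field_zero[OF x, of "q \<oplus> q' \<ominus> s" "p \<ominus> r"] A(1) pq pq' rs x(1) by (simp add: a_comm)
  have "(p' \<ominus> r) \<oplus> x \<otimes> (\<one> \<oplus> \<one>) = \<zero>" using A(2) x(1) cF by (simp add: r_distr minus_eq a_ac)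
  \<comment> \<open>The coefficient of y is (p' - r) + x (1 + 1), and x is not in \<open>F\<close>,
    so both parts vanish: the characteristic is two and p' = r.\<close>
  then have 2: "p' \<ominus> r = \<zero>" "\<one> \<oplus> \<one> = \<zero>"
    using quad_field_zero[OF x, of "p' \<ominus> r" "\<one> \<oplus> \<one>"] pq' rs by auto
  have two: "z \<oplus> z = \<zero>" if "z \<in> carrier D" for z
    using r_distr[of \<one> \<one> z] 2(2) that by simp
  have p0: "p \<noteq> \<zero>" using pq(4) two[OF x(1)] by auto
  have pp': "p' = p" using pr 2(1) cF by simp
  have 3: "(x \<otimes> (p \<otimes> q') \<oplus> (q \<otimes> q' \<ominus> s2)) \<oplus> y \<otimes> (q \<otimes> p \<oplus> x \<otimes> (p \<otimes> p \<ominus> r2)) = \<zero>"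
  proof -
    have "(x \<otimes> y) \<otimes> (x \<otimes> y) = x \<otimes> ((y \<otimes> x) \<otimes> y)" using x(1) y(1) by (simp add: m_assoc)
    also have "\<dots> = (x \<otimes> x) \<otimes> (y \<otimes> y)" unfolding y(2) using x(1) y(1) by (simp add: m_assoc)
    also have "\<dots> = (x \<otimes> x) \<otimes> y \<otimes> p \<oplus> (x \<otimes> x) \<otimes> q'"
      unfolding pq'(3) pp' using x(1) y(1) cF by (simp add: r_distr m_assoc)
    also have "(x \<otimes> x) \<otimes> y = y \<otimes> (x \<otimes> x)" using x(1) y by (metis m_assoc)
    also have "y \<otimes> (x \<otimes> x) \<otimes> p \<oplus> (x \<otimes> x) \<otimes> q' = (x \<otimes> (p \<otimes> q') \<oplus> q \<otimes> q') \<oplus> y \<otimes> (q \<otimes> p \<oplus> x \<otimes> (p \<otimes> p))"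
      unfolding pq(3) using x(1) y(1) cF by (simp add: l_distr r_distr m_assoc a_ac)
    finally have e: "(x \<otimes> (p \<otimes> q') \<oplus> q \<otimes> q') \<oplus> y \<otimes> (q \<otimes> p \<oplus> x \<otimes> (p \<otimes> p)) = (y \<otimes> x) \<otimes> r2 \<oplus> s2"
      using rs2(3) y(2) by simp
    have "((x \<otimes> (p \<otimes> q') \<oplus> q \<otimes> q') \<oplus> y \<otimes> (q \<otimes> p \<oplus> x \<otimes> (p \<otimes> p))) \<oplus> \<ominus> ((y \<otimes> x) \<otimes> r2 \<oplus> s2) = \<zero>"
      by (rule eq_imp_diff[OF _ e]) (use x(1) y(1) cF in simp)
    moreover have "((x \<otimes> (p \<otimes> q') \<oplus> q \<otimes> q') \<oplus> y \<otimes> (q \<otimes> p \<oplus> x \<otimes> (p \<otimes> p))) \<oplus> \<ominus> ((y \<otimes> x) \<otimes> r2 \<oplus> s2)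
      = (x \<otimes> (p \<otimes> q') \<oplus> (q \<otimes> q' \<ominus> s2)) \<oplus> y \<otimes> (q \<otimes> p \<oplus> x \<otimes> (p \<otimes> p \<ominus> r2))"
      using x(1) y(1) cF by (simp add: minus_eq minus_add l_distr r_distr r_minus l_minus m_assoc a_ac)
    ultimately show ?thesis by simp
  qed
  have "q \<otimes> p \<oplus> x \<otimes> (p \<otimes> p \<ominus> r2) = \<zero>"
    using ind[OF LF L 3] pq pq' rs2 by simp
  \<comment> \<open>In characteristic two the assumption on \<open>p\<close> says that p is nonzero.
    Hence q = 0 and x (x - p) = 0, which would put x into \<open>F\<close>.\<close>
  then have "q \<otimes> p = \<zero>" using quad_field_zero[OF x, of "q \<otimes> p" "p \<otimes> p \<ominus> r2"] pq rs2 by simp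
  then have "q = \<zero>" using D_m_eq_zero_iff[OF cF(2,1)] p0 by simp
  then have "x \<otimes> x \<ominus> x \<otimes> p = \<zero>" using pq(3) x(1) cF by simp
  then have "x \<otimes> (x \<ominus> p) = \<zero>" using x(1) cF by (simp add: minus_eq r_distr r_minus)
  then have "x = \<zero> \<or> x \<ominus> p = \<zero>" using D_m_eq_zero_iff x(1) cF by simp
  then show False using x cF pq(1) by auto
qed

lemma vdim_F: "RF.vdim F 1"
proof -
  have "RF.adjoin {\<zero>} \<one> = F"
  proof (intro equalityI subsetI)
    fix a assume "a \<in> RF.adjoin {\<zero>} \<one>"
    then show "a \<in> F" by (auto elim!: RF.adjoinE)
  next
    fix a assume a: "a \<in> F"
    then show "a \<in> RF.adjoin {\<zero>} \<one>" using RF.adjoinI[of \<zero> "{\<zero>}" a \<one>] by simp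
  qed
  moreover have "RF.vdim (RF.adjoin {\<zero>} \<one>) (Suc 0)"
    using RF.vdim_adjoin[OF RF.vdim_zero, of \<one>] one_not_zero by simp
  ultimately show ?thesis by simp
qed

lemma quad_field_adjoin: "x \<in> carrier D \<Longrightarrow> RF.adjoin F x = quad_field x"
  unfolding RF.adjoin_def quad_field_def by auto

lemma vdim_quad_field: "x \<in> carrier D \<Longrightarrow> x \<notin> F \<Longrightarrow> RF.vdim (quad_field x) 2"
  using RF.vdim_adjoin[OF vdim_F, of x] quad_field_adjoin by (simp add: numeral_2_eq_2)

text \<open>Every commutator with x intertwines x and its conjugate p - x. If u is a nonzero one,
  its inverse times any other centralises x and so lies in L = F(x). This gives D = L + u L, the
  classical shape of a quaternion algebra, with basis 1, x, u, u x.\<close>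

lemma noncommutative_quaternion:
  assumes all: "\<forall>z\<in>carrier D. quadratic z"
    and x: "x \<in> carrier D" "x \<notin> F" and pq: "p \<in> F" "q \<in> F" "x \<otimes> x = x \<otimes> p \<oplus> q" "x \<oplus> x \<noteq> p"
    and y: "y \<in> carrier D" "y \<otimes> x \<noteq> x \<otimes> y"
  shows "RF.vdim (carrier D) 4" "ring_center D = F"
proof -
  note qx = bspec[OF all, OF x(1)]
  note cF = F_closed[OF pq(1)] F_closed[OF pq(2)]
  note cent = separable_centralizer[OF all x pq]
  define xb where "xb = p \<ominus> x"
  have xbD: "xb \<in> carrier D" unfolding xb_def using x cF by simp
  define ad where "ad z = x \<otimes> z \<ominus> z \<otimes> x" for z
  have adD: "ad z \<in> carrier D" if "z \<in> carrier D" for z unfolding ad_def using x that by simp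
  have ad_x: "ad z \<otimes> x = xb \<otimes> ad z" if z: "z \<in> carrier D" for z
  proof -
    have l: "ad z \<otimes> x = (x \<otimes> z) \<otimes> x \<ominus> ((z \<otimes> x) \<otimes> p \<oplus> z \<otimes> q)"
    proof -
      have "ad z \<otimes> x = (x \<otimes> z) \<otimes> x \<ominus> z \<otimes> (x \<otimes> x)"
        unfolding ad_def using x(1) z by (simp add: minus_eq l_distr l_minus m_assoc)
      then show ?thesis unfolding pq(3) using x(1) z cF by (simp add: r_distr m_assoc)
    qed
    have "xb \<otimes> ad z = p \<otimes> (x \<otimes> z) \<ominus> p \<otimes> (z \<otimes> x) \<ominus> (x \<otimes> x) \<otimes> z \<oplus> x \<otimes> (z \<otimes> x)"
      unfolding ad_def xb_def using x(1) z cF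
      by (simp add: minus_eq l_distr r_distr l_minus r_minus minus_add m_assoc a_ac)
    also have "(x \<otimes> x) \<otimes> z = p \<otimes> (x \<otimes> z) \<oplus> z \<otimes> q"
      unfolding pq(3) using x(1) z cF F_commute[OF pq(1) x(1)] F_commute[OF pq(2) z]
      by (simp add: l_distr m_assoc[symmetric])
    also have "p \<otimes> (x \<otimes> z) \<ominus> p \<otimes> (z \<otimes> x) \<ominus> (p \<otimes> (x \<otimes> z) \<oplus> z \<otimes> q) \<oplus> x \<otimes> (z \<otimes> x)
      = ((x \<otimes> z) \<otimes> x \<ominus> (p \<otimes> (z \<otimes> x) \<oplus> z \<otimes> q)) \<oplus> (p \<otimes> (x \<otimes> z) \<ominus> p \<otimes> (x \<otimes> z))"
      using x(1) z cF by (simp add: minus_eq minus_add m_assoc a_ac)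
    also have "\<dots> = ad z \<otimes> x"
      unfolding l using x(1) z cF F_commute[OF pq(1), of "z \<otimes> x"] by (simp add: minus_eq r_neg)
    finally show ?thesis by simp
  qed
  define u where "u = ad y"
  have uD: "u \<in> carrier D" unfolding u_def using adD y by simp
  have u0: "u \<noteq> \<zero>" unfolding u_def ad_def using y x by auto
  have ux: "u \<otimes> x = xb \<otimes> u" unfolding u_def using ad_x y by simp
  note iu = inv_closed'[OF uD u0]
  \<comment> \<open>The conjugate of \<open>x\<close> minus \<open>x\<close>, nonzero because x + x
    differs from p. Commutation with \<open>x\<close> sends u e to u \<delta> e for e in
    F(x).\<close>
  define \<delta> where "\<delta> = xb \<ominus> x"
  have dL: "\<delta> \<in> quad_field x"
    using quad_fieldI[of p "\<ominus> \<one> \<oplus> \<ominus> \<one>" x] pq x cF unfolding \<delta>_def xb_def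
    by (simp add: minus_eq r_distr r_minus a_ac)
  have dD: "\<delta> \<in> carrier D" using quad_field_closed[OF x(1) dL] .
  have d0: "\<delta> \<noteq> \<zero>"
  proof
    assume "\<delta> = \<zero>"
    then have "p \<ominus> x = x" using x(1) xbD unfolding \<delta>_def xb_def by simp
    then have "p = x \<oplus> x" using x(1) cF by (metis minus_eq a_assoc l_neg r_zero a_inv_closed)
    then show False using pq(4) by simp
  qed
  note id = inv_closed'[OF dD d0] quad_field_inv[OF x(1) qx all dL d0]
  have xu: "x \<otimes> u = u \<otimes> xb"
  proof -
    have "u \<otimes> xb = p \<otimes> u \<ominus> xb \<otimes> u"
      using ux uD x(1) cF F_commute[OF pq(1) uD] unfolding xb_def by (simp add: minus_eq r_distr r_minus)
    also have "\<dots> = (x \<otimes> u \<oplus> p \<otimes> u) \<ominus> p \<otimes> u"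
      unfolding xb_def using uD x(1) cF by (simp add: minus_eq l_distr l_minus minus_add a_ac)
    finally show ?thesis using cancel_right[of "x \<otimes> u" "p \<otimes> u"] uD x(1) cF by simp
  qed
  have ad_ue: "ad (u \<otimes> e) = u \<otimes> (\<delta> \<otimes> e)" if e: "e \<in> quad_field x" for e
  proof -
    have eD: "e \<in> carrier D" using quad_field_closed[OF x(1) e] .
    have "e \<otimes> x = x \<otimes> e"
    proof -
      obtain a b where ab: "a \<in> F" "b \<in> F" "e = a \<oplus> x \<otimes> b" using e by (rule quad_fieldE)
      show ?thesis unfolding ab(3) using ab x(1) F_commute[OF ab(1) x(1)] F_commute[OF ab(2) x(1)] by (simp add: l_distr r_distr m_assoc)
    qed
    then have "ad (u \<otimes> e) = (x \<otimes> u) \<otimes> e \<ominus> (u \<otimes> x) \<otimes> e"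
      unfolding ad_def using x(1) uD eD by (simp add: m_assoc)
    then show ?thesis unfolding xu \<delta>_def using x(1) uD eD xbD
      by (simp add: minus_eq l_distr r_distr l_minus r_minus m_assoc)
  qed
  have span: "\<exists>l\<in>quad_field x. \<exists>e\<in>quad_field x. z = l \<oplus> u \<otimes> e" if z: "z \<in> carrier D" for z
  proof -
    let ?w = "ad z"
    have wD: "?w \<in> carrier D" using adD z .
    let ?c = "inv u \<otimes> ?w"
    have cD: "?c \<in> carrier D" using iu wD by simp
    have iux: "x \<otimes> inv u = inv u \<otimes> xb"
    proof -
      have "inv u \<otimes> (u \<otimes> x) \<otimes> inv u = inv u \<otimes> (xb \<otimes> u) \<otimes> inv u" using ux by simp
      moreover have "inv u \<otimes> (u \<otimes> x) = x" using iu uD x(1) by (simp add: m_assoc[symmetric])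
      moreover have "inv u \<otimes> (xb \<otimes> u) \<otimes> inv u = inv u \<otimes> xb" using iu uD xbD by (simp add: m_assoc)
      ultimately show ?thesis by simp
    qed
    have "?c \<otimes> x = x \<otimes> ?c"
    proof -
      have "?c \<otimes> x = (inv u \<otimes> xb) \<otimes> ?w" using ad_x[OF z] iu wD x(1) xbD by (simp add: m_assoc)
      then show ?thesis unfolding iux[symmetric] using iu wD x(1) by (simp add: m_assoc)
    qed
    then have cL: "?c \<in> quad_field x" using cent[OF cD] by simp
    \<comment> \<open>Division by \<delta> gives u e and z the same commutator with
      \<open>x\<close>, so z - u e centralises \<open>x\<close>.\<close>
    let ?e = "inv \<delta> \<otimes> ?c"
    have eL: "?e \<in> quad_field x" using quad_field_mult[OF x(1) qx id(2) cL] .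
    have eD: "?e \<in> carrier D" using quad_field_closed[OF x(1) eL] .
    have "\<delta> \<otimes> ?e = ?c" using id dD cD by (simp add: m_assoc[symmetric])
    then have "ad (u \<otimes> ?e) = ?w" using ad_ue[OF eL] iu uD wD by (simp add: m_assoc[symmetric])
    then have eq: "x \<otimes> (u \<otimes> ?e) \<ominus> (u \<otimes> ?e) \<otimes> x = x \<otimes> z \<ominus> z \<otimes> x" unfolding ad_def .
    let ?l = "z \<ominus> u \<otimes> ?e"
    have lD: "?l \<in> carrier D" using z uD eD by simp
    have "?l \<otimes> x = x \<otimes> ?l"
    proof -
      let ?g = "u \<otimes> ?e"
      have gD: "?g \<in> carrier D" using uD eD by simp
      have "x \<otimes> ?l \<ominus> ?l \<otimes> x = (x \<otimes> z \<ominus> z \<otimes> x) \<ominus> (x \<otimes> ?g \<ominus> ?g \<otimes> x)"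
        using x(1) z gD by (simp add: minus_eq l_distr r_distr l_minus r_minus minus_add a_ac del: m_assoc)
      also have "\<dots> = \<zero>" unfolding eq using x(1) z by (simp add: minus_eq r_neg)
      finally show ?thesis using x(1) lD by simp
    qed
    then have "?l \<in> quad_field x" using cent[OF lD] by simp
    moreover have "z = ?l \<oplus> u \<otimes> ?e" using z uD eD by (simp add: minus_eq a_assoc l_neg)
    ultimately show ?thesis using eL by blast
  qed
  have uL: "u \<notin> quad_field x"
  proof
    assume "u \<in> quad_field x"
    then obtain a b where ab: "a \<in> F" "b \<in> F" "u = a \<oplus> x \<otimes> b" by (rule quad_fieldE)
    have "u \<otimes> x = x \<otimes> u" unfolding ab(3) using ab x(1) F_commute[OF ab(1) x(1)] F_commute[OF ab(2) x(1)] by (simp add: l_distr r_distr m_assoc)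
    then have "\<delta> \<otimes> u = \<zero>" unfolding \<delta>_def using ux xbD uD x(1) by (simp add: minus_eq l_distr l_minus r_neg)
    then show False using D_m_eq_zero_iff[OF dD uD] d0 u0 by simp
  qed
  have L2: "RF.vdim (quad_field x) 2" using vdim_quad_field[OF x] .
  have L3: "RF.vdim (RF.adjoin (quad_field x) u) 3"
    using RF.vdim_adjoin[OF L2, of u] uL uD by (simp add: numeral_3_eq_3)
  have "u \<otimes> x \<notin> RF.adjoin (quad_field x) u"
  proof
    assume "u \<otimes> x \<in> RF.adjoin (quad_field x) u"
    then obtain l a where la: "l \<in> quad_field x" "a \<in> F" "u \<otimes> x = l \<oplus> u \<otimes> a" by (rule RF.adjoinE) auto
    have lD: "l \<in> carrier D" using quad_field_closed[OF x(1) la(1)] .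
    have aD: "a \<in> carrier D" using la by simp
    have e: "l \<oplus> u \<otimes> (a \<ominus> x) = \<zero>"
    proof -
      have "(l \<oplus> u \<otimes> a) \<oplus> \<ominus> (u \<otimes> x) = \<zero>" by (rule eq_imp_diff) (use la lD uD aD in auto)
      then show ?thesis using lD uD aD x(1) by (simp add: minus_eq r_distr r_minus a_assoc)
    qed
    have "a \<ominus> x \<in> quad_field x" using quad_fieldI[of a "\<ominus> \<one>" x] la x(1) by (simp add: minus_eq r_minus)
    then have "a \<ominus> x = \<zero>" using quad_field_indep[OF x(1) qx all uD uL la(1) _ e] by simp
    then have "a = x" using aD x(1) by simp
    then show False using la x by simp
  qed
  then have L4: "RF.vdim (RF.adjoin (RF.adjoin (quad_field x) u) (u \<otimes> x)) 4"
    using RF.vdim_adjoin[OF L3, of "u \<otimes> x"] uD x(1) by (simp add: eval_nat_numeral)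
  moreover have "RF.adjoin (RF.adjoin (quad_field x) u) (u \<otimes> x) = carrier D"
  proof
    show "RF.adjoin (RF.adjoin (quad_field x) u) (u \<otimes> x) \<subseteq> carrier D"
      using RF.right_subspaceD(1)[OF RF.vdim_subspace[OF L4]] by simp
    show "carrier D \<subseteq> RF.adjoin (RF.adjoin (quad_field x) u) (u \<otimes> x)"
    proof
      fix z assume z: "z \<in> carrier D"
      obtain l e where le: "l \<in> quad_field x" "e \<in> quad_field x" "z = l \<oplus> u \<otimes> e" using span[OF z] by blast
      obtain a b where ab: "a \<in> F" "b \<in> F" "e = a \<oplus> x \<otimes> b" using le(2) by (rule quad_fieldE)
      have lD: "l \<in> carrier D" using quad_field_closed[OF x(1) le(1)] .
      have "z = (l \<oplus> u \<otimes> a) \<oplus> (u \<otimes> x) \<otimes> b"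
        unfolding le(3) ab(3) using lD uD x(1) ab by (simp add: r_distr m_assoc a_assoc)
      moreover have "l \<oplus> u \<otimes> a \<in> RF.adjoin (quad_field x) u" using RF.adjoinI[OF le(1), of a u] ab by simp
      ultimately show "z \<in> RF.adjoin (RF.adjoin (quad_field x) u) (u \<otimes> x)"
        using RF.adjoinI[of "l \<oplus> u \<otimes> a" "RF.adjoin (quad_field x) u" b "u \<otimes> x"] ab by simp
    qed
  qed
  ultimately show "RF.vdim (carrier D) 4" by simp
  show "ring_center D = F"
  proof
    show "F \<subseteq> ring_center D" by (rule F_center)
    show "ring_center D \<subseteq> F"
    proof
      fix z assume "z \<in> ring_center D"
      then have z: "z \<in> carrier D" "\<And>w. w \<in> carrier D \<Longrightarrow> z \<otimes> w = w \<otimes> z" unfolding ring_center_def by auto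
      have "z \<in> quad_field x" using cent[OF z(1)] z(2) x(1) by simp
      then obtain a b where ab: "a \<in> F" "b \<in> F" "z = a \<oplus> x \<otimes> b" by (rule quad_fieldE)
      have bD: "b \<in> carrier D" using ab by simp
      \<comment> \<open>Since x u and u x differ by u \<delta>, commuting with \<open>u\<close>
        forces b = 0.\<close>
      have "z \<otimes> u = a \<otimes> u \<oplus> (x \<otimes> u) \<otimes> b"
        unfolding ab(3) using ab x(1) uD F_commute[OF ab(2) uD] by (simp add: l_distr m_assoc)
      moreover have "u \<otimes> z = a \<otimes> u \<oplus> (u \<otimes> x) \<otimes> b"
        unfolding ab(3) using ab x(1) uD F_commute[OF ab(1) uD] by (simp add: r_distr m_assoc)
      ultimately have "(x \<otimes> u) \<otimes> b = (u \<otimes> x) \<otimes> b" using z(2)[OF uD] ab x(1) uD by simp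
      then have "(u \<otimes> xb) \<otimes> b \<ominus> (u \<otimes> x) \<otimes> b = \<zero>" unfolding xu using uD xbD bD x(1) by simp
      then have "(u \<otimes> \<delta>) \<otimes> b = \<zero>"
        unfolding \<delta>_def using uD xbD bD x(1) by (simp add: minus_eq l_distr r_distr l_minus r_minus)
      then have "b = \<zero>" using D_m_eq_zero_iff[of "u \<otimes> \<delta>" b] D_m_eq_zero_iff[OF uD dD] u0 d0 uD dD bD by simp
      then show "z \<in> F" using ab x(1) by simp
    qed
  qed
qed

end

section \<open>The commutative cases and the classification\<close>

context division_algebra
begin

lemma commutative_imp_field:
  assumes "\<And>x y. x \<in> carrier D \<Longrightarrow> y \<in> carrier D \<Longrightarrow> x \<otimes> y = y \<otimes> x"
  shows "field D"
proof -
  interpret cring D by unfold_locales (use assms in auto)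
  show ?thesis
    by unfold_locales (use one_not_zero D_m_eq_zero_iff Units_eq in auto)
qed

lemma skew_field_ideal:
  assumes "ideal I D" shows "I = {\<zero>} \<or> I = carrier D"
proof (cases "I = {\<zero>}")
  case False
  interpret I: ideal I D by fact
  have "\<zero> \<in> I" by (rule I.zero_closed)
  then obtain a where a: "a \<in> I" "a \<noteq> \<zero>" using False by auto
  have aD: "a \<in> carrier D" using a I.a_subset by auto
  have "inv a \<otimes> a \<in> I" by (rule I.I_l_closed[OF a(1)]) (use inv_closed'[OF aD a(2)] in simp)
  then show ?thesis using I.one_imp_carrier inv_closed'[OF aD a(2)] by simp
qed simp

text \<open>Minimal polynomials have degree at most two. In degree two, with middle coefficient b0,
  the roots are z and - b0 - z, and \<open>sep\<close> makes them different; counting roots in the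
  algebraic closure then bounds the multiplicities.\<close>

lemma quadratic_field_separable:
  assumes fld: "field D" and fin: "dimension d F (carrier D)"
    and all: "\<forall>z\<in>carrier D. quadratic z"
    and sep: "\<And>z p q. \<lbrakk>z \<in> carrier D; z \<notin> F; p \<in> F; q \<in> F; z \<otimes> z = z \<otimes> p \<oplus> q\<rbrakk> \<Longrightarrow> z \<oplus> z \<noteq> p"
  shows "separable_field_extension D F"
proof -
  interpret field D by fact
  define L where "L = field.alg_closure D"
  have ac: "algebraic_closure L (indexed_const ` carrier D)" and hom: "indexed_const \<in> ring_hom D L"
    unfolding L_def using alg_closureE by auto
  interpret L: algebraic_closure L "indexed_const ` carrier D" by fact
  have Lf: "field L" by unfold_locales
  interpret h: ring_hom_ring D L indexed_const
    using ring_hom_ringI2[OF ring_axioms L.ring_axioms hom] .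
  have inj: "a = b" if "a \<in> carrier D" "b \<in> carrier D" "(indexed_const a :: ('a list \<times> nat) multiset \<Rightarrow> 'a) = indexed_const b" for a b
  proof (rule ccontr)
    assume n: "a \<noteq> b"
    let ?c = "a \<ominus> b"
    have c: "?c \<in> carrier D" "?c \<noteq> \<zero>" using that n by auto
    have "indexed_const ?c = indexed_const a \<oplus>\<^bsub>L\<^esub> \<ominus>\<^bsub>L\<^esub> indexed_const b" using that(1,2) by (simp add: minus_eq)
    also have "\<dots> = \<zero>\<^bsub>L\<^esub>" using L.r_neg[OF h.hom_closed[OF that(2)]] that(3) by metis
    finally have "indexed_const ?c = \<zero>\<^bsub>L\<^esub>" .
    note c0 = this
    have ic: "inv ?c \<in> carrier D" "?c \<otimes> inv ?c = \<one>" using inv_closed'[OF c] by auto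
    have "\<one>\<^bsub>L\<^esub> = indexed_const ?c \<otimes>\<^bsub>L\<^esub> indexed_const (inv ?c)"
      using h.hom_mult[OF c(1) ic(1)] ic(2) h.hom_one by metis
    then show False unfolding c0 using L.l_null[OF h.hom_closed[OF ic(1)]] L.one_not_zero by metis
  qed
  have alg: "algebraic F z" if "z \<in> carrier D" for z
    using finite_dimension_imp_algebraic[OF F_subfield carrier_is_subring, of z] finite_dimensionI[OF fin] that
    unfolding over_def by blast
  have mult: "L.alg_mult (\<sigma> (Irr F z)) y \<le> 1" if z: "z \<in> carrier D" and y: "y \<in> carrier L" for z y
  proof -
    have az: "(algebraic over F) z" using alg[OF z] unfolding over_def .
    note Irr = IrrE[OF F_subfield z az]
    let ?I = "Irr F z"
    have setI: "set ?I \<subseteq> F" using polynomial_incl[of F ?I] Irr(1) univ_poly_carrier by blast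
    have setID: "set ?I \<subseteq> carrier D" using setI F_closed by blast
    have ID: "?I \<in> carrier (poly_ring D)"
      using carrier_polynomial_shell[OF subfieldE(1)[OF F_subfield] Irr(1)] .
    have IL: "\<sigma> ?I \<in> carrier (poly_ring L)"
      using polynomial_hom[OF hom fld Lf ID] unfolding \<sigma>_def .
    have Ine: "?I \<noteq> []" using Irr(2) unfolding ring_irreducible_def univ_poly_zero by auto
    have degI: "degree (\<sigma> ?I) = degree ?I" unfolding \<sigma>_def by simp
    have size: "size (L.roots (\<sigma> ?I)) \<le> degree ?I" using L.size_roots_le_degree[OF IL] degI by simp
    have cnt: "L.alg_mult (\<sigma> ?I) = count (L.roots (\<sigma> ?I))" using L.alg_mult_eq_count_roots[OF IL] .
    have minimal: "degree ?I \<le> degree p" if "p \<in> carrier (F[X])" "p \<noteq> []" "eval p z = \<zero>" for p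
      using pdivides_imp_degree_le[OF subfieldE(1)[OF F_subfield] Irr(1) that(1,2) Irr_minimal[OF F_subfield z az that(1,3)]] .
    have ev1: "eval [\<one>, b] w = w \<oplus> b" if "b \<in> carrier D" "w \<in> carrier D" for b w using that by simp
    have ev2: "eval [\<one>, b, c] w = w \<otimes> w \<oplus> b \<otimes> w \<oplus> c" if "b \<in> carrier D" "c \<in> carrier D" "w \<in> carrier D" for b c w
      using that by (simp add: numeral_2_eq_2 a_assoc)
    show ?thesis
    proof (cases "z \<in> F")
      case True
      have "[\<one>, \<ominus> z] \<in> carrier (F[X])" unfolding univ_poly_carrier[symmetric] polynomial_def using True one_not_zero by simp
      moreover have "eval [\<one>, \<ominus> z] z = \<zero>" using ev1[of "\<ominus> z" z] z by (simp add: r_neg)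
      ultimately have "degree ?I \<le> 1" using minimal[of "[\<one>, \<ominus> z]"] by simp
      then show ?thesis using cnt size count_le_size[of "L.roots (\<sigma> ?I)" y] by simp
    next
      case zF: False
      obtain p q where pq: "p \<in> F" "q \<in> F" "z \<otimes> z = z \<otimes> p \<oplus> q" using all z unfolding quadratic_def by blast
      have pqD: "p \<in> carrier D" "q \<in> carrier D" using pq by auto
      have "[\<one>, \<ominus> p, \<ominus> q] \<in> carrier (F[X])" unfolding univ_poly_carrier[symmetric] polynomial_def using pq one_not_zero by simp
      moreover have "eval [\<one>, \<ominus> p, \<ominus> q] z = \<zero>"
      proof -
        have "eval [\<one>, \<ominus> p, \<ominus> q] z = (z \<otimes> p \<oplus> q) \<oplus> \<ominus> p \<otimes> z \<oplus> \<ominus> q" using ev2[of "\<ominus> p" "\<ominus> q" z] pqD z pq(3) by simp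
        also have "\<ominus> p \<otimes> z = \<ominus> (z \<otimes> p)" using l_minus[OF pqD(1) z] m_comm[OF pqD(1) z] by simp
        also have "(z \<otimes> p \<oplus> q) \<oplus> \<ominus> (z \<otimes> p) \<oplus> \<ominus> q = \<zero>" using z pqD by (simp add: a_ac r_neg r_neg1 r_neg2)
        finally show ?thesis .
      qed
      ultimately have deg2: "degree ?I \<le> 2" using minimal[of "[\<one>, \<ominus> p, \<ominus> q]"] by simp
      show ?thesis
      proof (cases "degree ?I \<le> 1")
        case True
        then show ?thesis using cnt size count_le_size[of "L.roots (\<sigma> ?I)" y] by simp
      next
        case False
        then have len: "length ?I = 3" using deg2 by simp
        then obtain a0 b0 c0 where abc: "?I = [a0, b0, c0]"
          by (auto simp: numeral_3_eq_3 length_Suc_conv)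
        then have a0: "a0 = \<one>" using Irr(3) by simp
        have bc: "b0 \<in> F" "c0 \<in> F" using setI abc by auto
        then have bcD: "b0 \<in> carrier D" "c0 \<in> carrier D" by auto
        have e0: "z \<otimes> z \<oplus> b0 \<otimes> z \<oplus> c0 = \<zero>" using Irr(4) ev2[OF bcD z] abc a0 by simp
        let ?z' = "\<ominus> b0 \<ominus> z"
        have z': "?z' \<in> carrier D" using bcD z by simp
        have e0': "?z' \<otimes> ?z' \<oplus> b0 \<otimes> ?z' \<oplus> c0 = \<zero>"
        proof -
          have "?z' \<oplus> b0 = \<ominus> z" using bcD z by (simp add: minus_eq a_ac r_neg1 r_neg2)
          moreover have "?z' \<otimes> ?z' \<oplus> b0 \<otimes> ?z' = ?z' \<otimes> (?z' \<oplus> b0)"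
            using z' bcD(1) m_comm[OF bcD(1) z'] by (simp only: r_distr)
          ultimately have "?z' \<otimes> ?z' \<oplus> b0 \<otimes> ?z' = ?z' \<otimes> \<ominus> z" by simp
          also have "\<dots> = z \<otimes> z \<oplus> b0 \<otimes> z" using bcD z by (simp add: minus_eq l_distr l_minus r_minus a_comm minus_add)
          finally show ?thesis using e0 by simp
        qed
        have root: "indexed_const w \<in># L.roots (\<sigma> ?I)" if w: "w \<in> carrier D" "w \<otimes> w \<oplus> b0 \<otimes> w \<oplus> c0 = \<zero>" for w
        proof -
          have "L.eval (\<sigma> ?I) (indexed_const w) = \<zero>\<^bsub>L\<^esub>"
            using h.eval_hom'[OF w(1) setID] ev2[OF bcD w(1)] w(2) abc a0 unfolding \<sigma>_def by simp
          then have "L.is_root (\<sigma> ?I) (indexed_const w)"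
            unfolding L.is_root_def using w(1) Ine by (simp add: \<sigma>_def)
          then show ?thesis using L.alg_mult_gt_zero_iff_is_root[OF IL, of "indexed_const w"] cnt by simp
        qed
        \<comment> \<open>Coinciding roots would give z + z = - b0 along with z z = z (- b0) - c0,
          which \<open>sep\<close> rules out.\<close>
        have ne: "z \<noteq> ?z'"
        proof
          assume e: "z = ?z'"
          have "z \<oplus> z = (\<ominus> b0 \<ominus> z) \<oplus> z" using e by simp
          also have "\<dots> = \<ominus> b0" using bcD z by (simp add: minus_eq a_assoc l_neg)
          finally have 1: "z \<oplus> z = \<ominus> b0" .
          have "z \<otimes> z = z \<otimes> (\<ominus> b0) \<oplus> \<ominus> c0"
          proof -
            have "z \<otimes> z = (z \<otimes> z \<oplus> b0 \<otimes> z \<oplus> c0) \<oplus> (\<ominus> c0 \<oplus> \<ominus> (b0 \<otimes> z))"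
              using z bcD by (simp add: a_assoc r_neg1 r_neg2 r_neg)
            also have "\<dots> = z \<otimes> (\<ominus> b0) \<oplus> \<ominus> c0"
              unfolding e0 using z bcD r_minus[OF z bcD(1)] m_comm[OF bcD(1) z] by (simp add: a_comm)
            finally show ?thesis .
          qed
          then show False using sep[OF z zF _ _ ] bc 1 by (metis F_neg)
        qed
        have ne': "(indexed_const z :: ('a list \<times> nat) multiset \<Rightarrow> 'a) \<noteq> indexed_const ?z'" using inj[OF z z'] ne by blast
        \<comment> \<open>A root other than \<open>y\<close>; as there are at most two roots with
          multiplicity, it leaves at most one place to \<open>y\<close>.\<close>
        define w :: "('a list \<times> nat) multiset \<Rightarrow> 'a" where "w = (if y = indexed_const z then indexed_const ?z' else indexed_const z)"
        have w: "w \<noteq> y" "w \<in># L.roots (\<sigma> ?I)"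
          unfolding w_def using ne' root[OF z e0] root[OF z' e0'] by (auto split: if_splits)
        have "count (L.roots (\<sigma> ?I)) y + count (L.roots (\<sigma> ?I)) w \<le> size (L.roots (\<sigma> ?I))"
        proof -
          have "replicate_mset (count (L.roots (\<sigma> ?I)) y) y + replicate_mset (count (L.roots (\<sigma> ?I)) w) w \<subseteq># L.roots (\<sigma> ?I)"
            using w(1) by (auto simp: subseteq_mset_def)
          from size_mset_mono[OF this] show ?thesis by simp
        qed
        moreover have "count (L.roots (\<sigma> ?I)) w \<noteq> 0" using w(2) by (simp only: count_eq_zero_iff not_not)
        ultimately have "count (L.roots (\<sigma> ?I)) y \<le> 1" using size deg2 by linarith
        then show ?thesis by (simp only: cnt)
      qed
    qed
  qed
  show ?thesis
    unfolding separable_field_extension_def using fld F_subfield alg mult unfolding L_def by blast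
qed

text \<open>A subfield K containing F, of largest 2-power degree over F, must be all of D: for x
  outside K the square of x lies in F, so K + K x is a subfield of twice the degree.\<close>

lemma square_field_dimension:
  assumes fld: "field D" and fin: "dimension d F (carrier D)"
    and two: "\<one> \<oplus> \<one> = \<zero>" and sq: "\<forall>x\<in>carrier D. x \<otimes> x \<in> F"
  shows "\<exists>m. d = 2 ^ m"
proof -
  interpret field D by fact
  define P where "P t \<longleftrightarrow> (\<exists>K. subfield K D \<and> F \<subseteq> K \<and> dimension (2 ^ t) F K)" for t :: nat
  have d0: "RF.vdim (carrier D) d" using fin dimension_iff_vdim by simp
  have "P 0" unfolding P_def using F_subfield dimension_one[OF F_subfield] by (intro exI[of _ F]) simp
  moreover have bd: "t \<le> d" if "P t" for t
  proof -
    obtain K where K: "subfield K D" "dimension (2 ^ t) F K" using \<open>P t\<close> unfolding P_def by blast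
    have "2 ^ t \<le> d"
      using RF.vdim_mono[OF d0, of K "2 ^ t"] K(2) dimension_iff_vdim subfieldE(3)[OF K(1)] by simp
    moreover have "t < 2 ^ t" by simp
    ultimately show ?thesis by linarith
  qed
  ultimately obtain t where t: "P t" "\<And>t'. P t' \<Longrightarrow> t' \<le> t"
    using GreatestI_nat[of P 0] Greatest_le_nat[of P, OF _ bd] by (metis bd)
  then obtain K where K: "subfield K D" "F \<subseteq> K" "dimension (2 ^ t) F K" unfolding P_def by blast
  note Ks = subringE[OF subfieldE(1)[OF K(1)]]
  have Kc [simp]: "k \<in> carrier D" if "k \<in> K" for k using Ks(1) that by auto
  have "carrier D \<subseteq> K"
  proof (rule ccontr)
    assume "\<not> carrier D \<subseteq> K"
    then obtain x where x: "x \<in> carrier D" "x \<notin> K" by auto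
    let ?K' = "line_extension K x K"
    have K'I: "k \<otimes> x \<oplus> k' \<in> ?K'" if "k \<in> K" "k' \<in> K" for k k'
      using that unfolding line_extension_mem_iff by blast
    have K'E: "\<exists>k\<in>K. \<exists>k'\<in>K. z = k \<otimes> x \<oplus> k'" if "z \<in> ?K'" for z
      using that unfolding line_extension_mem_iff by blast
    have KK': "K \<subseteq> ?K'" using K'I[OF Ks(2)] x by auto
    have sub: "?K' \<subseteq> carrier D" using K'E x by fastforce
    have mult: "z \<otimes> w \<in> ?K'" if zw: "z \<in> ?K'" "w \<in> ?K'" for z w
    proof -
      obtain a b where ab: "a \<in> K" "b \<in> K" "z = a \<otimes> x \<oplus> b" using K'E[OF zw(1)] by blast
      obtain a' b' where ab': "a' \<in> K" "b' \<in> K" "w = a' \<otimes> x \<oplus> b'" using K'E[OF zw(2)] by blast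
      have xx: "x \<otimes> x \<in> K" using sq x K(2) by auto
      have "z \<otimes> w = (a \<otimes> b' \<oplus> b \<otimes> a') \<otimes> x \<oplus> (a \<otimes> a' \<otimes> (x \<otimes> x) \<oplus> b \<otimes> b')"
        unfolding ab(3) ab'(3) using ab ab' x by (simp add: l_distr r_distr m_ac a_ac)
      then show ?thesis using K'I[of "a \<otimes> b' \<oplus> b \<otimes> a'" "a \<otimes> a' \<otimes> (x \<otimes> x) \<oplus> b \<otimes> b'"] ab ab' xx Ks(6,7) by simp
    qed
    have ring: "subring ?K' D"
    proof (rule subringI)
      show "?K' \<subseteq> carrier D" by fact
      show "\<one> \<in> ?K'" using KK' Ks(3) by auto
      fix z assume z: "z \<in> ?K'"
      then obtain a b where ab: "a \<in> K" "b \<in> K" "z = a \<otimes> x \<oplus> b" using K'E by blast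
      have "\<ominus> z = (\<ominus> a) \<otimes> x \<oplus> \<ominus> b" unfolding ab(3) using ab x by (simp add: minus_add l_minus)
      then show "\<ominus> z \<in> ?K'" using K'I[of "\<ominus> a" "\<ominus> b"] ab Ks(5) by simp
      fix w assume w: "w \<in> ?K'"
      show "z \<otimes> w \<in> ?K'" using mult z w .
      obtain a' b' where ab': "a' \<in> K" "b' \<in> K" "w = a' \<otimes> x \<oplus> b'" using K'E[OF w] by blast
      have "z \<oplus> w = (a \<oplus> a') \<otimes> x \<oplus> (b \<oplus> b')" unfolding ab(3) ab'(3) using ab ab' x by (simp add: l_distr a_ac)
      then show "z \<oplus> w \<in> ?K'" using K'I[of "a \<oplus> a'" "b \<oplus> b'"] ab ab' Ks(7) by simp
    qed
    have "subfield ?K' D"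
    proof (rule subfieldI'[OF ring])
      fix k assume k: "k \<in> ?K' - {\<zero>}"
      then have kD: "k \<in> carrier D" "k \<noteq> \<zero>" using sub by auto
      have kk: "k \<otimes> k \<in> F" "k \<otimes> k \<noteq> \<zero>" using sq kD D_m_eq_zero_iff[OF kD(1,1)] by auto
      note ik = F_inv[OF kk] inv_closed'[OF F_closed[OF kk(1)] kk(2)]
      \<comment> \<open>Squares lie in \<open>F\<close>, so the inverse of an element is a scalar
        multiple of the element.\<close>
      have "k \<otimes> (k \<otimes> inv (k \<otimes> k)) = \<one>" using ik kD by (simp add: m_assoc[symmetric])
      then have "inv k = k \<otimes> inv (k \<otimes> k)" using inv_unique_D kD ik by simp
      moreover have "inv (k \<otimes> k) \<in> ?K'" using ik(1) K(2) KK' by auto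
      ultimately show "inv k \<in> ?K'" using mult k by auto
    qed
    moreover have "dimension (Suc 1) K ?K'" using Suc_dim[OF x(1,2) dimension_one[OF K(1)]] .
    then have "dimension (2 ^ t * Suc 1) F ?K'" using telescopic_base[OF F_subfield K(1,3)] by blast
    moreover have "F \<subseteq> ?K'" using K(2) KK' by auto
    moreover have "2 ^ t * Suc 1 = (2::nat) ^ Suc t" by simp
    ultimately have "P (Suc t)" unfolding P_def by metis
    then show False using t(2)[of "Suc t"] by simp
  qed
  then have "K = carrier D" using Ks(1) by auto
  then have "RF.vdim (carrier D) (2 ^ t)" using K(3) dimension_iff_vdim by simp
  then show ?thesis using RF.vdim_unique[OF d0] by blast
qed

text \<open>The question is whether some x outside F satisfies x^2 = x p + q with p different from x
  + x, that is, with distinct conjugates. If so, the centraliser of x is F(x), and D is a quaternion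
  algebra or equals F(x). If not, the characteristic is two and all squares lie in F, which makes D
  commutative of 2-power degree.\<close>

lemma quadratic_type_of_quadratic:
  assumes fin: "dimension d F (carrier D)" and all: "\<forall>z\<in>carrier D. quadratic z"
  shows "quadratic_type D F"
proof (cases "carrier D \<subseteq> F")
  case True
  then have "F = carrier D" by auto
  then have "dimension 1 F (carrier D)" using dimension_one[OF F_subfield] by simp
  then show ?thesis unfolding quadratic_type_def by blast
next
  case nF: False
  have d: "RF.vdim (carrier D) d" using fin dimension_iff_vdim by simp
  show ?thesis
  proof (cases "\<exists>x\<in>carrier D. \<exists>p\<in>F. \<exists>q\<in>F. x \<notin> F \<and> x \<otimes> x = x \<otimes> p \<oplus> q \<and> x \<oplus> x \<noteq> p")
    case True
    then obtain x p q where x: "x \<in> carrier D" "x \<notin> F" and pq: "p \<in> F" "q \<in> F" "x \<otimes> x = x \<otimes> p \<oplus> q" "x \<oplus> x \<noteq> p" by blast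
    show ?thesis
    proof (cases "\<forall>y\<in>carrier D. y \<otimes> x = x \<otimes> y")
      case False
      then obtain y where y: "y \<in> carrier D" "y \<otimes> x \<noteq> x \<otimes> y" by blast
      note Q = noncommutative_quaternion[OF all x pq y]
      have "dimension 4 F (carrier D)" using Q(1) dimension_iff_vdim by simp
      then have "quaternion_algebra D F"
        unfolding quaternion_algebra_def using Q(2) one_not_zero skew_field_ideal by blast
      then show ?thesis unfolding quadratic_type_def using \<open>dimension 4 F (carrier D)\<close> by blast
    next
      case True
      have DL: "y \<in> quad_field x" if "y \<in> carrier D" for y
        using separable_centralizer[OF all x pq that] True that by blast
      then have DL': "carrier D = quad_field x" using quad_field_closed[OF x(1)] by blast
      have comm: "y \<otimes> z = z \<otimes> y" if yz: "y \<in> carrier D" "z \<in> carrier D" for y z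
      proof -
        obtain a b where ab: "a \<in> F" "b \<in> F" "z = a \<oplus> x \<otimes> b" using DL[OF yz(2)] by (rule quad_fieldE)
        have yx: "y \<otimes> x = x \<otimes> y" using True yz by blast
        have "y \<otimes> z = y \<otimes> a \<oplus> (y \<otimes> x) \<otimes> b" unfolding ab(3) using ab x yz by (simp add: r_distr m_assoc)
        also have "\<dots> = z \<otimes> y"
          unfolding ab(3) yx using ab x yz F_commute[OF ab(1) yz(1)] F_commute[OF ab(2) yz(1)] by (simp add: l_distr m_assoc)
        finally show ?thesis .
      qed
      have fld: "field D" using commutative_imp_field comm by blast
      have dim2: "dimension 2 F (carrier D)" using vdim_quad_field[OF x] DL' dimension_iff_vdim by simp
      \<comment> \<open>Separability passes from \<open>x\<close> to z = a + x b. If z + z is in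
        \<open>F\<close>, then, b being nonzero, the characteristic is two; so z z = q', and its
        component along x shows p = 0, against the choice of p.\<close>
      have sep: "z \<oplus> z \<noteq> p'" if z: "z \<in> carrier D" "z \<notin> F" "p' \<in> F" "q' \<in> F" "z \<otimes> z = z \<otimes> p' \<oplus> q'" for z p' q'
      proof
        assume zz: "z \<oplus> z = p'"
        obtain a b where ab: "a \<in> F" "b \<in> F" "z = a \<oplus> x \<otimes> b" using DL[OF z(1)] by (rule quad_fieldE)
        have b0: "b \<noteq> \<zero>" using ab x z(2) by auto
        have "(a \<oplus> a) \<oplus> x \<otimes> (b \<oplus> b) = z \<oplus> z" unfolding ab(3) using ab x by (simp add: r_distr a_ac)
        then have "((a \<oplus> a) \<oplus> x \<otimes> (b \<oplus> b)) \<oplus> \<ominus> p' = \<zero>" using zz z by (simp add: r_neg)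
        then have "(a \<oplus> a \<ominus> p') \<oplus> x \<otimes> (b \<oplus> b) = \<zero>" using ab x z(3) by (simp add: minus_eq a_ac)
        then have "b \<oplus> b = \<zero>" using quad_field_zero[OF x, of "a \<oplus> a \<ominus> p'" "b \<oplus> b"] ab z(3) by simp
        then have "b \<otimes> (\<one> \<oplus> \<one>) = \<zero>" using ab by (simp add: r_distr)
        then have two: "\<one> \<oplus> \<one> = \<zero>" using D_m_eq_zero_iff[of b "\<one> \<oplus> \<one>"] ab b0 by simp
        have two': "w \<oplus> w = \<zero>" if "w \<in> carrier D" for w using r_distr[of \<one> \<one> w] two that by simp
        have "p' = \<zero>" using zz two'[OF z(1)] by simp
        then have zq: "z \<otimes> z = q'" using z by simp
        have xz: "x \<otimes> z = z \<otimes> x" using comm x z by simp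
        have "z \<otimes> z = (a \<otimes> a \<oplus> (x \<otimes> x) \<otimes> (b \<otimes> b)) \<oplus> (x \<otimes> (a \<otimes> b) \<oplus> x \<otimes> (a \<otimes> b))"
        proof -
          have c1: "a \<otimes> (x \<otimes> b) = x \<otimes> (a \<otimes> b)" using ab x F_commute[OF ab(1) x(1)] by (simp add: m_assoc[symmetric])
          have c2: "(x \<otimes> b) \<otimes> a = x \<otimes> (a \<otimes> b)" using ab x F_commute[OF ab(1), of b] by (simp add: m_assoc)
          have c3: "(x \<otimes> b) \<otimes> (x \<otimes> b) = (x \<otimes> x) \<otimes> (b \<otimes> b)"
          proof -
            have "(x \<otimes> b) \<otimes> (x \<otimes> b) = x \<otimes> (b \<otimes> x) \<otimes> b" using ab x by (simp add: m_assoc)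
            then show ?thesis using F_commute[OF ab(2) x(1)] ab x by (simp add: m_assoc)
          qed
          have "z \<otimes> z = a \<otimes> a \<oplus> a \<otimes> (x \<otimes> b) \<oplus> ((x \<otimes> b) \<otimes> a \<oplus> (x \<otimes> b) \<otimes> (x \<otimes> b))"
            unfolding ab(3) using ab x by (simp add: l_distr r_distr a_ac)
          then show ?thesis unfolding c1 c2 c3 using ab x by (simp add: a_ac)
        qed
        also have "\<dots> = (a \<otimes> a \<oplus> q \<otimes> (b \<otimes> b)) \<oplus> x \<otimes> (p \<otimes> (b \<otimes> b))"
          unfolding pq(3) using two'[of "x \<otimes> (a \<otimes> b)"] ab x pq by (simp add: l_distr m_assoc a_ac)
        finally have "((a \<otimes> a \<oplus> q \<otimes> (b \<otimes> b)) \<oplus> x \<otimes> (p \<otimes> (b \<otimes> b))) \<oplus> \<ominus> q' = \<zero>" using zq z by (simp add: r_neg)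
        then have "(a \<otimes> a \<oplus> q \<otimes> (b \<otimes> b) \<ominus> q') \<oplus> x \<otimes> (p \<otimes> (b \<otimes> b)) = \<zero>"
          using ab x pq z(4) by (simp add: minus_eq a_ac)
        then have "p \<otimes> (b \<otimes> b) = \<zero>"
          using quad_field_zero[OF x, of "a \<otimes> a \<oplus> q \<otimes> (b \<otimes> b) \<ominus> q'" "p \<otimes> (b \<otimes> b)"] ab pq z(4) by simp
        then have "p = \<zero>" using D_m_eq_zero_iff ab pq b0 by simp
        then show False using pq(4) two'[OF x(1)] by simp
      qed
      have "separable_field_extension D F" by (rule quadratic_field_separable[OF fld fin all]) (rule sep)
      then show ?thesis unfolding quadratic_type_def using dim2 by blast
    qed
  next
    case insep: False
    obtain x where x: "x \<in> carrier D" "x \<notin> F" using nF by auto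
    have ins: "z \<oplus> z = p" if "z \<in> carrier D" "z \<notin> F" "p \<in> F" "q \<in> F" "z \<otimes> z = z \<otimes> p \<oplus> q" for z p q
      using insep that by blast
    \<comment> \<open>Here x + x = p lies in \<open>F\<close> although x does not, so 1 + 1 =
      0.\<close>
    have two: "\<one> \<oplus> \<one> = \<zero>"
    proof -
      obtain p q where pq: "p \<in> F" "q \<in> F" "x \<otimes> x = x \<otimes> p \<oplus> q" using all x(1) unfolding quadratic_def by blast
      have "x \<oplus> x = p" using ins[OF x pq] .
      then have "\<ominus> p \<oplus> x \<otimes> (\<one> \<oplus> \<one>) = \<zero>" using x(1) pq by (simp add: r_distr l_neg)
      then show ?thesis using quad_field_zero[OF x, of "\<ominus> p" "\<one> \<oplus> \<one>"] pq by simp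
    qed
    have two': "w \<oplus> w = \<zero>" if "w \<in> carrier D" for w using r_distr[of \<one> \<one> w] two that by simp
    have sq: "z \<otimes> z \<in> F" if z: "z \<in> carrier D" for z
    proof (cases "z \<in> F")
      case False
      obtain p q where pq: "p \<in> F" "q \<in> F" "z \<otimes> z = z \<otimes> p \<oplus> q" using all z unfolding quadratic_def by blast
      have "p = \<zero>" using ins[OF z False pq] two'[OF z] by simp
      then show ?thesis using pq z by simp
    qed simp
    have com: "y \<otimes> z \<oplus> z \<otimes> y \<in> F" if yz: "y \<in> carrier D" "z \<in> carrier D" for y z
    proof -
      have e: "(y \<oplus> z) \<otimes> (y \<oplus> z) = (y \<otimes> z \<oplus> z \<otimes> y) \<oplus> (y \<otimes> y \<oplus> z \<otimes> z)"
        using yz by (simp add: l_distr r_distr a_ac)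
      have "(y \<oplus> z) \<otimes> (y \<oplus> z) \<ominus> (y \<otimes> y \<oplus> z \<otimes> z) \<in> F" using sq[of "y \<oplus> z"] sq[OF yz(1)] sq[OF yz(2)] yz by simp
      then show ?thesis unfolding e using cancel_right[of "y \<otimes> z \<oplus> z \<otimes> y" "y \<otimes> y \<oplus> z \<otimes> z"] yz by simp
    qed
    have comm: "y \<otimes> z = z \<otimes> y" if yz: "y \<in> carrier D" "z \<in> carrier D" for y z
    proof (rule ccontr)
      assume n: "y \<otimes> z \<noteq> z \<otimes> y"
      let ?c = "y \<otimes> z \<oplus> z \<otimes> y"
      have c: "?c \<in> F" using com yz by simp
      have c0: "?c \<noteq> \<zero>"
      proof
        assume "?c = \<zero>"
        then have "y \<otimes> z = \<ominus> (z \<otimes> y)" using yz by (metis m_closed minus_equality)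
        moreover have "\<ominus> (z \<otimes> y) = z \<otimes> y" using two'[of "z \<otimes> y"] yz by (metis m_closed minus_equality)
        ultimately show False using n by simp
      qed
      \<comment> \<open>The anticommutator of y with y z is y times that of y with z. Both lie in
        \<open>F\<close> and the latter is nonzero, so y is a scalar and commutes after all.\<close>
      have "y \<otimes> (y \<otimes> z) \<oplus> (y \<otimes> z) \<otimes> y \<in> F" using com[of y "y \<otimes> z"] yz by simp
      then have yc: "y \<otimes> ?c \<in> F" using yz by (simp add: r_distr m_assoc)
      note ic = F_inv[OF c c0] inv_closed'[OF F_closed[OF c] c0]
      have "(y \<otimes> ?c) \<otimes> inv ?c \<in> F" using yc ic by simp
      moreover have "(y \<otimes> ?c) \<otimes> inv ?c = y" using m_assoc[of y ?c "inv ?c"] yz ic F_closed[OF c] by simp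
      ultimately have "y \<in> F" by simp
      then show False using n F_commute[of y z] yz by simp
    qed
    have fld: "field D" using commutative_imp_field comm by blast
    obtain m where m: "d = 2 ^ m" using square_field_dimension[OF fld fin two] sq by blast
    have "m \<noteq> 0"
    proof
      assume "m = 0"
      then have "RF.vdim (carrier D) 1" using d m by simp
      moreover have "F \<subseteq> carrier D" by auto
      ultimately have "F = carrier D" using RF.vdim_eq[of "carrier D" 1 F] vdim_F by blast
      then show False using nF by simp
    qed
    then show ?thesis
      unfolding quadratic_type_def using m fin two fld sq by (metis One_nat_def Suc_leI neq0_conv)
  qed
qed

end

section \<open>Quotients of consecutive subspaces of a flag\<close>

text \<open>One step of a complete flag: W / U is a D-line generated by the class of
  \<open>e\<close>.\<close>

locale subquotient_line = algebra_space D F V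
  for D :: "('a, 'm) ring_scheme" (structure) and F :: "'a set"
    and V :: "('a, 'b, 'k) rmodule_scheme" +
  fixes W U :: "'b set" and e :: 'b
  assumes U: "right_subspace D V U" and eV: "e \<in> carrier V" and eU: "e \<notin> U"
    and W_adjoin: "W = V.adjoin U e"
begin

abbreviation "Q \<equiv> subquotient V W U"

definition "cls w = U +>\<^bsub>V\<^esub> w"

lemmas Us = V.right_subspaceD[OF U]

lemma W: "right_subspace D V W" and UW: "U \<subseteq> W" and eW: "e \<in> W"
  using V.adjoin_subspace[OF U eV] V.adjoin_incl[OF U eV] unfolding W_adjoin by auto

lemmas Ws = V.right_subspaceD[OF W]

lemma cls_mem: "y \<in> cls w \<longleftrightarrow> (\<exists>u\<in>U. y = u \<oplus>\<^bsub>V\<^esub> w)"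
  unfolding cls_def a_r_coset_def r_coset_def by auto

lemma cls_self: "w \<in> carrier V \<Longrightarrow> w \<in> cls w"
  unfolding cls_mem using Us(2) by (intro bexI[of _ "\<zero>\<^bsub>V\<^esub>"]) auto

lemma cls_eqI:
  assumes "w \<in> carrier V" "y \<in> cls w" shows "cls y = cls w"
proof -
  obtain u where u: "u \<in> U" "y = u \<oplus>\<^bsub>V\<^esub> w" using assms(2) unfolding cls_mem by blast
  have uV: "u \<in> carrier V" using Us(7) u by simp
  show ?thesis
  proof (intro equalityI subsetI)
    fix z assume "z \<in> cls y"
    then obtain u' where u': "u' \<in> U" "z = u' \<oplus>\<^bsub>V\<^esub> y" unfolding cls_mem by blast
    then have "z = (u' \<oplus>\<^bsub>V\<^esub> u) \<oplus>\<^bsub>V\<^esub> w" using u uV Us(7)[OF u'(1)] assms(1) by (simp add: V.a_assoc)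
    then show "z \<in> cls w" unfolding cls_mem using Us(3)[OF u'(1) u(1)] by blast
  next
    fix z assume "z \<in> cls w"
    then obtain u' where u': "u' \<in> U" "z = u' \<oplus>\<^bsub>V\<^esub> w" unfolding cls_mem by blast
    then have "z = (u' \<ominus>\<^bsub>V\<^esub> u) \<oplus>\<^bsub>V\<^esub> y" using u uV Us(7)[OF u'(1)] assms(1) by (simp add: V.a_assoc V.minus_eq V.r_neg1)
    then show "z \<in> cls y" unfolding cls_mem using Us(6)[OF u'(1) u(1)] by blast
  qed
qed

lemma cls_zero: "cls \<zero>\<^bsub>V\<^esub> = U"
  using Us(7) by (auto simp: cls_mem)

lemma cls_subset:
  assumes B: "right_subspace FD V B" "U \<subseteq> B" and w: "w \<in> carrier V"
  shows "y \<in> cls w \<Longrightarrow> y \<in> B \<longleftrightarrow> w \<in> B"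
  using VF.right_subspace_add_iff(2)[OF B(1) w] B(2) unfolding cls_mem by auto

lemma Q_carrier: "carrier Q = cls ` W"
  unfolding quotient_space_def A_RCOSETS_def RCOSETS_def cls_def a_r_coset_def r_coset_def by auto

lemma Q_zero: "\<zero>\<^bsub>Q\<^esub> = cls \<zero>\<^bsub>V\<^esub>"
  unfolding cls_zero by (simp add: quotient_space_def)

lemma Q_add:
  assumes "w \<in> carrier V" "y \<in> carrier V"
  shows "cls w \<oplus>\<^bsub>Q\<^esub> cls y = cls (w \<oplus>\<^bsub>V\<^esub> y)"
proof -
  have "cls w \<oplus>\<^bsub>Q\<^esub> cls y = {a \<oplus>\<^bsub>V\<^esub> b |a b. a \<in> cls w \<and> b \<in> cls y}"
    by (auto simp: quotient_space_def set_add_def set_mult_def)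
  also have "\<dots> = cls (w \<oplus>\<^bsub>V\<^esub> y)"
  proof (intro equalityI subsetI)
    fix z assume "z \<in> {a \<oplus>\<^bsub>V\<^esub> b |a b. a \<in> cls w \<and> b \<in> cls y}"
    then obtain u u' where u: "u \<in> U" "u' \<in> U" "z = (u \<oplus>\<^bsub>V\<^esub> w) \<oplus>\<^bsub>V\<^esub> (u' \<oplus>\<^bsub>V\<^esub> y)" unfolding cls_mem by blast
    then have "z = (u \<oplus>\<^bsub>V\<^esub> u') \<oplus>\<^bsub>V\<^esub> (w \<oplus>\<^bsub>V\<^esub> y)" using Us(7) assms by (simp add: V.a_ac)
    then show "z \<in> cls (w \<oplus>\<^bsub>V\<^esub> y)" unfolding cls_mem using Us(3) u by blast
  next
    fix z assume "z \<in> cls (w \<oplus>\<^bsub>V\<^esub> y)"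
    then obtain u where u: "u \<in> U" "z = u \<oplus>\<^bsub>V\<^esub> (w \<oplus>\<^bsub>V\<^esub> y)" unfolding cls_mem by blast
    then have "z = (u \<oplus>\<^bsub>V\<^esub> w) \<oplus>\<^bsub>V\<^esub> y" using Us(7) assms by (simp add: V.a_assoc)
    moreover have "u \<oplus>\<^bsub>V\<^esub> w \<in> cls w" unfolding cls_mem using u by blast
    ultimately show "z \<in> {a \<oplus>\<^bsub>V\<^esub> b |a b. a \<in> cls w \<and> b \<in> cls y}" using cls_self[OF assms(2)] by blast
  qed
  finally show ?thesis .
qed

lemma cls_smult:
  assumes "w \<in> carrier V" "a \<in> carrier D" "y \<in> cls w"
  shows "cls (y \<bullet>\<^bsub>V\<^esub> a) = cls (w \<bullet>\<^bsub>V\<^esub> a)"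
proof (rule cls_eqI)
  show "w \<bullet>\<^bsub>V\<^esub> a \<in> carrier V" using assms by (simp add: V.rsmult_closed)
  obtain u where u: "u \<in> U" "y = u \<oplus>\<^bsub>V\<^esub> w" using assms(3) unfolding cls_mem by blast
  have "y \<bullet>\<^bsub>V\<^esub> a = u \<bullet>\<^bsub>V\<^esub> a \<oplus>\<^bsub>V\<^esub> w \<bullet>\<^bsub>V\<^esub> a" unfolding u(2) using Us(7)[OF u(1)] assms by (simp add: V.rsmult_add_vector)
  then show "y \<bullet>\<^bsub>V\<^esub> a \<in> cls (w \<bullet>\<^bsub>V\<^esub> a)" unfolding cls_mem using Us(4)[OF u(1) assms(2)] by blast
qed

lemma Q_smult:
  assumes "w \<in> carrier V" "a \<in> carrier D"
  shows "cls w \<bullet>\<^bsub>Q\<^esub> a = cls (w \<bullet>\<^bsub>V\<^esub> a)"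
proof -
  have "cls w \<bullet>\<^bsub>Q\<^esub> a = (\<Union>y\<in>cls w. cls (y \<bullet>\<^bsub>V\<^esub> a))"
    by (simp add: quotient_space_def cls_def a_r_coset_def r_coset_def)
  also have "\<dots> = (\<Union>y\<in>cls w. cls (w \<bullet>\<^bsub>V\<^esub> a))" using cls_smult[OF assms] by auto
  also have "\<dots> = cls (w \<bullet>\<^bsub>V\<^esub> a)" using cls_self[OF assms(1)] by auto
  finally show ?thesis .
qed

lemma Q_space: "right_vector_space D Q"
proof -
  have rep: "\<exists>w\<in>W. C = cls w" if C: "C \<in> carrier Q" for C using C unfolding Q_carrier by blast
  have "abelian_group Q"
  proof (rule abelian_groupI)
    fix A assume "A \<in> carrier Q"
    then obtain a where a: "a \<in> W" "A = cls a" using rep by blast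
    have aV: "a \<in> carrier V" using Ws(7) a by simp
    show "\<zero>\<^bsub>Q\<^esub> \<oplus>\<^bsub>Q\<^esub> A = A" unfolding Q_zero a(2) using aV by (simp add: Q_add)
    show "\<exists>B\<in>carrier Q. B \<oplus>\<^bsub>Q\<^esub> A = \<zero>\<^bsub>Q\<^esub>"
      using Ws(5)[OF a(1)] aV by (intro bexI[of _ "cls (\<ominus>\<^bsub>V\<^esub> a)"]) (auto simp: Q_carrier a(2) Q_zero Q_add V.l_neg)
    fix B assume "B \<in> carrier Q"
    then obtain b where b: "b \<in> W" "B = cls b" using rep by blast
    have bV: "b \<in> carrier V" using Ws(7) b by simp
    show "A \<oplus>\<^bsub>Q\<^esub> B \<in> carrier Q" unfolding Q_carrier a(2) b(2) Q_add[OF aV bV] using Ws(3) a b by blast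
    show "A \<oplus>\<^bsub>Q\<^esub> B = B \<oplus>\<^bsub>Q\<^esub> A" unfolding a(2) b(2) Q_add[OF aV bV] Q_add[OF bV aV] using aV bV by (simp add: V.a_comm)
    fix C assume "C \<in> carrier Q"
    then obtain c where c: "c \<in> W" "C = cls c" using rep by blast
    have cV: "c \<in> carrier V" using Ws(7) c by simp
    show "A \<oplus>\<^bsub>Q\<^esub> B \<oplus>\<^bsub>Q\<^esub> C = A \<oplus>\<^bsub>Q\<^esub> (B \<oplus>\<^bsub>Q\<^esub> C)"
      unfolding a(2) b(2) c(2) using aV bV cV by (simp add: Q_add V.a_assoc)
  next
    show "\<zero>\<^bsub>Q\<^esub> \<in> carrier Q" unfolding Q_zero Q_carrier using Ws(2) by blast
  qed
  then interpret Q: abelian_group Q .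
  show ?thesis
  proof unfold_locales
    fix A a assume "A \<in> carrier Q" and a: "a \<in> carrier D"
    then obtain w where w: "w \<in> W" "A = cls w" using rep by blast
    have wV: "w \<in> carrier V" using Ws(7) w by simp
    show "A \<bullet>\<^bsub>Q\<^esub> a \<in> carrier Q" unfolding Q_carrier w(2) Q_smult[OF wV a] using Ws(4)[OF w(1) a] by blast
    fix b assume b: "b \<in> carrier D"
    show "A \<bullet>\<^bsub>Q\<^esub> (a \<oplus> b) = A \<bullet>\<^bsub>Q\<^esub> a \<oplus>\<^bsub>Q\<^esub> A \<bullet>\<^bsub>Q\<^esub> b"
      unfolding w(2) using wV a b by (simp add: Q_smult Q_add V.rsmult_add_scalar V.rsmult_closed)
    show "A \<bullet>\<^bsub>Q\<^esub> (a \<otimes> b) = A \<bullet>\<^bsub>Q\<^esub> a \<bullet>\<^bsub>Q\<^esub> b"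
      unfolding w(2) using wV a b by (simp add: Q_smult V.rsmult_assoc V.rsmult_closed)
  next
    fix A B a assume "A \<in> carrier Q" "B \<in> carrier Q" and a: "a \<in> carrier D"
    then obtain w y where w: "w \<in> W" "A = cls w" "y \<in> W" "B = cls y" using rep by metis
    have wV: "w \<in> carrier V" "y \<in> carrier V" using Ws(7) w by auto
    show "(A \<oplus>\<^bsub>Q\<^esub> B) \<bullet>\<^bsub>Q\<^esub> a = A \<bullet>\<^bsub>Q\<^esub> a \<oplus>\<^bsub>Q\<^esub> B \<bullet>\<^bsub>Q\<^esub> a"
      unfolding w(2,4) using wV a by (simp add: Q_smult Q_add V.rsmult_add_vector V.rsmult_closed)
  next
    fix A assume "A \<in> carrier Q"
    then obtain w where w: "w \<in> W" "A = cls w" using rep by blast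
    then show "A \<bullet>\<^bsub>Q\<^esub> \<one> = A" using Ws(7)[OF w(1)] by (simp add: Q_smult V.rsmult_one)
  qed
qed

end

sublocale subquotient_line \<subseteq> Q: algebra_space D F "subquotient V W U"
proof -
  interpret right_vector_space D "subquotient V W U" by (rule Q_space)
  show "algebra_space D F (subquotient V W U)" by unfold_locales
qed

context subquotient_line
begin

lemma Q_adjoin: "Q.V.adjoin {\<zero>\<^bsub>Q\<^esub>} (cls e) = carrier Q"
proof (intro equalityI subsetI)
  fix C assume "C \<in> Q.V.adjoin {\<zero>\<^bsub>Q\<^esub>} (cls e)"
  then obtain a where "a \<in> carrier D" "C = \<zero>\<^bsub>Q\<^esub> \<oplus>\<^bsub>Q\<^esub> cls e \<bullet>\<^bsub>Q\<^esub> a" by (auto elim: Q.V.adjoinE)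
  moreover have "cls e \<in> carrier Q" using eW Q_carrier by blast
  ultimately show "C \<in> carrier Q" by (simp add: Q.V.rsmult_closed)
next
  fix C assume "C \<in> carrier Q"
  then obtain w where w: "w \<in> W" "C = cls w" unfolding Q_carrier by blast
  obtain u a where ua: "u \<in> U" "a \<in> carrier D" "w = u \<oplus>\<^bsub>V\<^esub> e \<bullet>\<^bsub>V\<^esub> a" using w(1) unfolding W_adjoin by (rule V.adjoinE)
  have uV: "u \<in> carrier V" using Us(7) ua by simp
  have "cls u = cls \<zero>\<^bsub>V\<^esub>" using cls_eqI[OF V.zero_closed, of u] ua(1) cls_zero by simp
  then have "C = \<zero>\<^bsub>Q\<^esub> \<oplus>\<^bsub>Q\<^esub> cls e \<bullet>\<^bsub>Q\<^esub> a"
    unfolding w(2) ua(3) Q_zero using uV ua(2) eV by (simp add: Q_add[symmetric] Q_smult V.rsmult_closed)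
  then show "C \<in> Q.V.adjoin {\<zero>\<^bsub>Q\<^esub>} (cls e)" using Q.V.adjoinI[of "\<zero>\<^bsub>Q\<^esub>" "{\<zero>\<^bsub>Q\<^esub>}" a "cls e"] ua(2) by simp
qed

lemma cls_e: "cls e \<in> carrier Q" "cls e \<noteq> \<zero>\<^bsub>Q\<^esub>"
proof -
  show "cls e \<in> carrier Q" using eW Q_carrier by blast
  show "cls e \<noteq> \<zero>\<^bsub>Q\<^esub>" using cls_self[OF eV] eU unfolding Q_zero cls_zero by auto
qed

sublocale QC: algebra_complement D F "subquotient V W U" "{\<zero>\<^bsub>subquotient V W U\<^esub>}" "cls e"
  by unfold_locales (use Q.V.right_subspace_zero cls_e Q_adjoin in auto)

lemma Q_vdim: "Q.V.vdim (carrier Q) 1"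
  using Q.V.vdim_adjoin[OF Q.V.vdim_zero cls_e(1)] cls_e(2) Q_adjoin by simp

lemma Q_End_determined:
  assumes f: "f \<in> carrier Q.E" "g \<in> carrier Q.E" and eq: "f (cls e) = g (cls e)"
  shows "f = g"
proof (rule Q.End_eqI[OF f])
  fix C assume "C \<in> carrier Q"
  then obtain a where a: "a \<in> carrier D" "C = \<zero>\<^bsub>Q\<^esub> \<oplus>\<^bsub>Q\<^esub> cls e \<bullet>\<^bsub>Q\<^esub> a"
    unfolding Q_adjoin[symmetric] by (auto elim: Q.V.adjoinE)
  then have "C = cls e \<bullet>\<^bsub>Q\<^esub> a" using cls_e by (simp add: Q.V.rsmult_closed)
  then show "f C = g C" using Q.EndD(3)[OF f(1) cls_e(1) a(1)] Q.EndD(3)[OF f(2) cls_e(1) a(1)] eq by simp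
qed

lemma Q_vdim_vals:
  assumes "Q.EF.vdim H k" shows "Q.VF.vdim (Q.vals H (cls e)) k"
proof (rule Q.ev.vdim_inj_image[OF Q.ev_linear[OF cls_e(1)] assms])
  fix f assume f: "f \<in> H" "f (cls e) = \<zero>\<^bsub>Q\<^esub>"
  have "f \<in> carrier Q.E" using Q.EF.right_subspaceD(7)[OF Q.EF.vdim_subspace[OF assms] f(1)] by simp
  then show "f = \<zero>\<^bsub>Q.ES\<^esub>" using Q_End_determined[of f "\<zero>\<^bsub>Q.E\<^esub>"] Q.End_zero_closed f(2) cls_e(1) by simp
qed

text \<open>Evaluation at the generator identifies the endomorphisms of a D-line with the line
  itself, which is \<open>d\<close>-dimensional over \<open>F\<close>.\<close>

lemma Q_End_vdim:
  assumes d: "RF.vdim (carrier D) d"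
  shows "Q.EF.vdim (carrier Q.E) d"
proof -
  have im: "Q.vals (carrier Q.E) (cls e) = carrier Q"
  proof (intro equalityI subsetI)
    fix C assume "C \<in> Q.vals (carrier Q.E) (cls e)"
    then show "C \<in> carrier Q" using Q.EndD(1) cls_e(1) by blast
  next
    fix C assume "C \<in> carrier Q"
    then show "C \<in> Q.vals (carrier Q.E) (cls e)" using QC.ex_End_eval[of C] by blast
  qed
  have "Q.VF.vdim (carrier Q) d" using Q.vdim_F_of_vdim_D[OF Q_vdim d] by simp
  then have 1: "Q.VF.vdim (Q.vals (carrier Q.E) (cls e)) d" unfolding im .
  have ker: "{f \<in> carrier Q.E. f (cls e) = \<zero>\<^bsub>Q\<^esub>} = {\<zero>\<^bsub>Q.ES\<^esub>}"
  proof (intro equalityI subsetI)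
    fix f assume "f \<in> {f \<in> carrier Q.E. f (cls e) = \<zero>\<^bsub>Q\<^esub>}"
    then have "f = \<zero>\<^bsub>Q.E\<^esub>" using Q_End_determined[of f "\<zero>\<^bsub>Q.E\<^esub>"] Q.End_zero_closed cls_e(1) by simp
    then show "f \<in> {\<zero>\<^bsub>Q.ES\<^esub>}" by simp
  next
    fix f assume "f \<in> {\<zero>\<^bsub>Q.ES\<^esub>}"
    then have "f = \<zero>\<^bsub>Q.E\<^esub>" by simp
    then show "f \<in> {f \<in> carrier Q.E. f (cls e) = \<zero>\<^bsub>Q\<^esub>}" using Q.End_zero_closed cls_e(1) by simp
  qed
  have sub: "right_subspace FD Q.ES (carrier Q.E)" using Q.EF.right_subspace_carrier by simp
  have 0: "Q.EF.vdim {f \<in> carrier Q.E. f (cls e) = \<zero>\<^bsub>Q\<^esub>} 0" unfolding ker by (rule Q.EF.vdim_zero)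
  show ?thesis using Q.ev.rank_nullity_converse[OF Q.ev_linear[OF cls_e(1)] sub 1 0] by simp
qed

text \<open>The passage from the subsets \<open>B i\<close> of \<open>flag_data\<close> to
  hyperplanes of endomorphisms of the quotient line.\<close>

definition "line_operators B = {f \<in> carrier Q.E. f (cls e) \<in> cls ` B}"

lemma cls_image_mem:
  assumes B: "right_subspace FD V B" "U \<subseteq> B" and w: "w \<in> carrier V"
  shows "cls w \<in> cls ` B \<longleftrightarrow> w \<in> B"
proof
  assume "cls w \<in> cls ` B"
  then obtain b where b: "b \<in> B" "cls w = cls b" by blast
  have "b \<in> carrier V" using VF.right_subspaceD(7)[OF B(1) b(1)] .
  then have "w \<in> cls b" using b(2) cls_self[OF w] by simp
  then show "w \<in> B" using cls_subset[OF B \<open>b \<in> carrier V\<close>] b(1) by blast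
qed auto

lemma line_operators_flag_data:
  assumes B: "right_subspace FD V B" "U \<subseteq> B" "e \<notin> B" "VF.adjoin B e = W"
  shows "Q.flag_data 1 (\<lambda>i. if i = 0 then {\<zero>\<^bsub>Q\<^esub>} else carrier Q) (\<lambda>_. cls e) (\<lambda>_. cls ` B)"
proof -
  note Bs = VF.right_subspaceD[OF B(1)]
  have BW: "B \<subseteq> W" using VF.adjoin_incl(1)[OF B(1)] B(4) eV by auto
  have sub: "right_subspace FD Q (cls ` B)"
  proof (rule Q.VF.right_subspaceI)
    show "cls ` B \<subseteq> carrier Q" unfolding Q_carrier using BW by blast
    show "\<zero>\<^bsub>Q\<^esub> \<in> cls ` B" unfolding Q_zero using Bs(2) by blast
    fix C assume "C \<in> cls ` B"
    then obtain b where b: "b \<in> B" "C = cls b" by blast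
    show "C \<oplus>\<^bsub>Q\<^esub> C' \<in> cls ` B" if C': "C' \<in> cls ` B" for C'
    proof -
      obtain c where c: "c \<in> B" "C' = cls c" using C' by blast
      then show ?thesis using b Q_add[OF Bs(7)[OF b(1)] Bs(7)[OF c(1)]] Bs(3)[OF b(1) c(1)] by simp
    qed
    show "C \<bullet>\<^bsub>Q\<^esub> a \<in> cls ` B" if a: "a \<in> carrier FD" for a
      using b Q_smult[OF Bs(7)[OF b(1)], of a] Bs(4)[OF b(1) a] a by simp
  qed
  have ad: "Q.VF.adjoin (cls ` B) (cls e) = carrier Q"
  proof
    show "Q.VF.adjoin (cls ` B) (cls e) \<subseteq> carrier Q"
      using Q.VF.right_subspaceD(1)[OF Q.VF.adjoin_subspace[OF sub cls_e(1)]] .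
    show "carrier Q \<subseteq> Q.VF.adjoin (cls ` B) (cls e)"
    proof
      fix C assume "C \<in> carrier Q"
      then obtain w where w: "w \<in> W" "C = cls w" unfolding Q_carrier by blast
      obtain b c where bc: "b \<in> B" "c \<in> F" "w = b \<oplus>\<^bsub>V\<^esub> e \<bullet>\<^bsub>V\<^esub> c"
        using w(1) unfolding B(4)[symmetric] by (rule VF.adjoinE) auto
      have "C = cls b \<oplus>\<^bsub>Q\<^esub> cls e \<bullet>\<^bsub>Q\<^esub> c"
        unfolding w(2) bc(3) using Bs(7)[OF bc(1)] bc(2) eV by (simp add: Q_add[symmetric] Q_smult V.rsmult_closed)
      then show "C \<in> Q.VF.adjoin (cls ` B) (cls e)" using Q.VF.adjoinI[of "cls b" "cls ` B" c "cls e"] bc by simp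
    qed
  qed
  show ?thesis
    unfolding Q.flag_data_def using cls_e Q_adjoin sub ad cls_image_mem[OF B(1,2) eV] B(3)
      Q.VF.right_subspaceD(2)[OF sub] by simp
qed

text \<open>The quotient line viewed as a flag of one step, so that \<open>vdim_triangular\<close>
  yields the dimension d - 1.\<close>

lemma line_operators_triangular:
  "line_operators B = Q.triangular 1 (\<lambda>i. if i = 0 then {\<zero>\<^bsub>Q\<^esub>} else carrier Q) (\<lambda>_. cls e) (\<lambda>_. cls ` B)"
proof -
  have fW: "f ` (if i = 0 then {\<zero>\<^bsub>Q\<^esub>} else carrier Q) \<subseteq> (if i = 0 then {\<zero>\<^bsub>Q\<^esub>} else carrier Q)"
    if f: "f \<in> carrier Q.E" for f and i :: nat
    using Q.EndD(1,4)[OF f] by auto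
  show ?thesis
  proof (intro equalityI subsetI)
    fix f assume "f \<in> line_operators B"
    then have f: "f \<in> carrier Q.E" "f (cls e) \<in> cls ` B" unfolding line_operators_def by blast+
    show "f \<in> Q.triangular 1 (\<lambda>i. if i = 0 then {\<zero>\<^bsub>Q\<^esub>} else carrier Q) (\<lambda>_. cls e) (\<lambda>_. cls ` B)"
      unfolding Q.triangular_def by (intro CollectI conjI allI impI f fW)
  next
    fix f assume "f \<in> Q.triangular 1 (\<lambda>i. if i = 0 then {\<zero>\<^bsub>Q\<^esub>} else carrier Q) (\<lambda>_. cls e) (\<lambda>_. cls ` B)"
    then show "f \<in> line_operators B" unfolding Q.triangular_def line_operators_def by blast
  qed
qed

lemma line_operators_hyperplane:
  assumes B: "right_subspace FD V B" "U \<subseteq> B" "e \<notin> B" "VF.adjoin B e = W" and d: "RF.vdim (carrier D) d"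
  shows "End_hyperplane D F Q (line_operators B)" "\<one>\<^bsub>Q.E\<^esub> \<notin> line_operators B"
proof -
  note fd = line_operators_flag_data[OF B]
  have "d \<noteq> 0"
  proof
    assume "d = 0"
    then have "carrier D = {\<zero>}" using RF.vdim_0 d by simp
    then show False using one_not_zero by auto
  qed
  then have d1: "d = Suc (d - 1)" by simp
  have 1: "Q.EF.vdim (line_operators B) (d - 1)"
    unfolding line_operators_triangular using vdim_triangular[OF Q.algebra_space_axioms fd d] by simp
  have 2: "Q.EF.vdim (carrier Q.E) (Suc (d - 1))" using Q_End_vdim[OF d] d1 by simp
  show "End_hyperplane D F Q (line_operators B)"
    unfolding End_hyperplane_def Q.End_subspace_iff Q.End_dimension_iff_vdim
    using 1 2 Q.EF.vdim_subspace[OF 1] by blast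
  show "\<one>\<^bsub>Q.E\<^esub> \<notin> line_operators B"
    unfolding line_operators_def using cls_image_mem[OF B(1,2) eV] B(3) cls_e(1) by simp
qed

text \<open>The witness is the union of the cosets f (cls e) over f in \<open>H\<close>, that is,
  the preimage in \<open>W\<close> of the values of \<open>H\<close> at the generator. It omits
  \<open>e\<close> because the identity is the only endomorphism fixing the generator.\<close>

lemma hyperplane_line_operators:
  assumes H: "End_hyperplane D F Q H" "\<one>\<^bsub>Q.E\<^esub> \<notin> H"
  shows "\<exists>B. right_subspace FD V B \<and> U \<subseteq> B \<and> e \<notin> B \<and> VF.adjoin B e = W \<and> H = line_operators B"
proof -
  obtain k where k: "Q.EF.vdim H k" "Q.EF.vdim (carrier Q.E) (Suc k)"
    using H(1) unfolding End_hyperplane_def Q.End_dimension_iff_vdim by blast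
  note Hs = Q.EF.right_subspaceD[OF Q.EF.vdim_subspace[OF k(1)], simplified]
  let ?B = "\<Union>f\<in>H. f (cls e)"
  let ?G = "Q.vals H (cls e)"
  have G: "Q.VF.vdim ?G k" using Q_vdim_vals[OF k(1)] .
  note Gs = Q.VF.right_subspaceD[OF Q.VF.vdim_subspace[OF G]]
  have VQ: "Q.VF.vdim (carrier Q) (Suc k)"
  proof -
    have "Q.vals (carrier Q.E) (cls e) = carrier Q"
    proof (intro equalityI subsetI)
      fix C assume "C \<in> Q.vals (carrier Q.E) (cls e)"
      then show "C \<in> carrier Q" using Q.EndD(1) cls_e(1) by blast
    next
      fix C assume "C \<in> carrier Q"
      then show "C \<in> Q.vals (carrier Q.E) (cls e)" using QC.ex_End_eval[of C] by blast
    qed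
    then show ?thesis using Q_vdim_vals[OF k(2)] by simp
  qed
  have fe: "\<exists>w\<in>W. f (cls e) = cls w" if "f \<in> carrier Q.E" for f
    using Q.EndD(1)[OF that cls_e(1)] unfolding Q_carrier by blast
  have Bmem: "w \<in> ?B \<longleftrightarrow> w \<in> W \<and> cls w \<in> ?G" for w
  proof
    assume "w \<in> ?B"
    then obtain f where f: "f \<in> H" "w \<in> f (cls e)" by blast
    obtain y where y: "y \<in> W" "f (cls e) = cls y" using fe Hs(7)[OF f(1)] by blast
    have yV: "y \<in> carrier V" using Ws(7) y by simp
    have "cls w = cls y" using cls_eqI[OF yV] f(2) y(2) by simp
    moreover have "w \<in> W" using f(2) unfolding y(2) cls_mem using UW y(1) Ws(3) by auto
    moreover have "cls y \<in> ?G" using imageI[OF f(1), of "\<lambda>f. f (cls e)"] y(2) by simp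
    ultimately show "w \<in> W \<and> cls w \<in> ?G" by simp
  next
    assume w: "w \<in> W \<and> cls w \<in> ?G"
    then obtain f where "f \<in> H" "cls w = f (cls e)" by blast
    then show "w \<in> ?B" using cls_self[of w] Ws(7) w by auto
  qed
  have eG: "cls e \<notin> ?G"
  proof
    assume "cls e \<in> ?G"
    then obtain f where f: "cls e = f (cls e)" "f \<in> H" by (rule imageE)
    have "f = \<one>\<^bsub>Q.E\<^esub>" using Q_End_determined[OF _ Q.End_one_closed] Hs(7)[OF f(2)] f(1)[symmetric] cls_e(1) by simp
    then show False using H(2) f(2) by simp
  qed
  have adG: "Q.VF.adjoin ?G (cls e) = carrier Q"
  proof (rule Q.VF.vdim_eq[OF VQ])
    show "Q.VF.vdim (Q.VF.adjoin ?G (cls e)) (Suc k)" using Q.VF.vdim_adjoin[OF G cls_e(1) eG] .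
    show "Q.VF.adjoin ?G (cls e) \<subseteq> carrier Q"
      using Q.VF.right_subspaceD(1)[OF Q.VF.adjoin_subspace[OF Q.VF.vdim_subspace[OF G] cls_e(1)]] .
  qed
  have sub: "right_subspace FD V ?B"
  proof (rule VF.right_subspaceI)
    show "?B \<subseteq> carrier V" using Bmem Ws(7) by blast
    have "cls \<zero>\<^bsub>V\<^esub> \<in> ?G" using Gs(2) Q_zero by simp
    then show "\<zero>\<^bsub>V\<^esub> \<in> ?B" unfolding Bmem using Ws(2) by blast
    fix w assume "w \<in> ?B"
    then have w: "w \<in> W" "cls w \<in> ?G" unfolding Bmem by auto
    show "w \<oplus>\<^bsub>V\<^esub> y \<in> ?B" if "y \<in> ?B" for y
    proof -
      have y: "y \<in> W" "cls y \<in> ?G" using that unfolding Bmem by auto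
      have "cls (w \<oplus>\<^bsub>V\<^esub> y) \<in> ?G" using Gs(3)[OF w(2) y(2)] Q_add[OF Ws(7)[OF w(1)] Ws(7)[OF y(1)]] by simp
      then show ?thesis unfolding Bmem using Ws(3)[OF w(1) y(1)] by blast
    qed
    show "w \<bullet>\<^bsub>V\<^esub> a \<in> ?B" if "a \<in> carrier FD" for a
    proof -
      have "cls (w \<bullet>\<^bsub>V\<^esub> a) \<in> ?G" using Gs(4)[OF w(2) that] Q_smult[OF Ws(7)[OF w(1)], of a] that by simp
      then show ?thesis unfolding Bmem using Ws(4)[OF w(1), of a] that by simp
    qed
  qed
  have UB: "U \<subseteq> ?B"
  proof
    fix u assume u: "u \<in> U"
    have "cls u = \<zero>\<^bsub>Q\<^esub>" using cls_eqI[OF V.zero_closed, of u] u cls_zero Q_zero by simp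
    then show "u \<in> ?B" unfolding Bmem using u UW Gs(2) by auto
  qed
  have eB: "e \<notin> ?B" unfolding Bmem using eG by blast
  have adB: "VF.adjoin ?B e = W"
  proof
    show "VF.adjoin ?B e \<subseteq> W"
      by (rule VF.adjoin_least[OF D_subspace_imp_F[OF W]]) (use Bmem eW in auto)
    show "W \<subseteq> VF.adjoin ?B e"
    proof
      fix w assume w: "w \<in> W"
      then have "cls w \<in> Q.VF.adjoin ?G (cls e)" unfolding adG Q_carrier by blast
      then obtain C c where Cc: "C \<in> ?G" "c \<in> F" "cls w = C \<oplus>\<^bsub>Q\<^esub> cls e \<bullet>\<^bsub>Q\<^esub> c" by (rule Q.VF.adjoinE) auto
      obtain y where y: "y \<in> W" "C = cls y" using Gs(7)[OF Cc(1)] unfolding Q_carrier by blast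
      have yV: "y \<in> carrier V" using Ws(7) y by simp
      have ec: "e \<bullet>\<^bsub>V\<^esub> c \<in> carrier V" using eV Cc(2) by (simp add: V.rsmult_closed)
      have "cls w = cls (y \<oplus>\<^bsub>V\<^esub> e \<bullet>\<^bsub>V\<^esub> c)" using Cc y yV eV ec by (simp add: Q_smult Q_add)
      then have "w \<in> cls (y \<oplus>\<^bsub>V\<^esub> e \<bullet>\<^bsub>V\<^esub> c)" using cls_self[OF Ws(7)[OF w]] by simp
      then obtain u where u: "u \<in> U" "w = u \<oplus>\<^bsub>V\<^esub> (y \<oplus>\<^bsub>V\<^esub> e \<bullet>\<^bsub>V\<^esub> c)" unfolding cls_mem by blast
      have "w = (u \<oplus>\<^bsub>V\<^esub> y) \<oplus>\<^bsub>V\<^esub> e \<bullet>\<^bsub>V\<^esub> c" using u Us(7)[OF u(1)] yV ec by (simp add: V.a_assoc)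
      moreover have "y \<in> ?B" unfolding Bmem using y Cc(1) by blast
      moreover have "u \<oplus>\<^bsub>V\<^esub> y \<in> ?B" using VF.right_subspaceD(3)[OF sub subsetD[OF UB u(1)] \<open>y \<in> ?B\<close>] .
      ultimately show "w \<in> VF.adjoin ?B e" using VF.adjoinI[of "u \<oplus>\<^bsub>V\<^esub> y" ?B c e] Cc(2) by simp
    qed
  qed
  have "H = line_operators ?B"
  proof (intro equalityI subsetI)
    fix f assume f: "f \<in> H"
    obtain w where w: "w \<in> W" "f (cls e) = cls w" using fe Hs(7)[OF f] by blast
    have "cls w \<in> ?G" using imageI[OF f, of "\<lambda>f. f (cls e)"] w(2) by simp
    then have "w \<in> ?B" unfolding Bmem using w(1) by blast
    then show "f \<in> line_operators ?B" unfolding line_operators_def using Hs(7)[OF f] w(2) by blast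
  next
    fix f assume f: "f \<in> line_operators ?B"
    then obtain w where w: "w \<in> ?B" "f (cls e) = cls w" "f \<in> carrier Q.E" unfolding line_operators_def by blast
    then obtain g where g: "g \<in> H" "cls w = g (cls e)" unfolding Bmem by blast
    have "f = g" using Q_End_determined[OF w(3) Hs(7)[OF g(1)]] w(2) g(2) by simp
    then show "f \<in> H" using g by simp
  qed
  then show ?thesis using sub UB eB adB by blast
qed

text \<open>The induced map sends the class of \<open>e\<close> to the class of \<open>u e\<close>,
  and \<open>B\<close> is a union of cosets of \<open>U\<close>, so membership can be tested on the
  representative.\<close>

lemma induced_map_line_operators:
  assumes u: "u \<in> carrier E" "u ` W \<subseteq> W" "u ` U \<subseteq> U"
    and B: "right_subspace FD V B" "U \<subseteq> B"
  shows "induced_map V W U u \<in> line_operators B \<longleftrightarrow> u e \<in> B"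
proof -
  have cu: "cls (u y) = cls (u w)" if w: "w \<in> carrier V" and y: "y \<in> cls w" for w y
  proof -
    obtain v where v: "v \<in> U" "y = v \<oplus>\<^bsub>V\<^esub> w" using y unfolding cls_mem by blast
    have "u y = u v \<oplus>\<^bsub>V\<^esub> u w" unfolding v(2) using EndD(2)[OF u(1) Us(7)[OF v(1)] w] .
    then have "u y \<in> cls (u w)" unfolding cls_mem using u(3) v(1) by blast
    then show ?thesis using cls_eqI EndD(1)[OF u(1) w] by blast
  qed
  have im: "induced_map V W U u (cls w) = cls (u w)" if "w \<in> W" for w
  proof -
    have wV: "w \<in> carrier V" using Ws(7)[OF that] .
    have "cls w \<in> carrier Q" using that Q_carrier by blast
    then have "induced_map V W U u (cls w) = (\<Union>y\<in>cls w. cls (u y))"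
      unfolding induced_map_def cls_def by simp
    also have "\<dots> = (\<Union>y\<in>cls w. cls (u w))" using cu[OF wV] by auto
    finally show ?thesis using cls_self[OF wV] by auto
  qed
  have "induced_map V W U u \<in> carrier Q.E"
  proof (rule Q.EndI)
    show "induced_map V W U u \<in> extensional (carrier Q)" unfolding induced_map_def by simp
    fix C assume "C \<in> carrier Q"
    then obtain w where w: "w \<in> W" "C = cls w" unfolding Q_carrier by blast
    have wV: "w \<in> carrier V" and uw: "u w \<in> W" "u w \<in> carrier V" using Ws(7) w u(2) by auto
    show "induced_map V W U u C \<in> carrier Q" unfolding w(2) im[OF w(1)] Q_carrier using uw by blast
    show "induced_map V W U u (C \<oplus>\<^bsub>Q\<^esub> C') = induced_map V W U u C \<oplus>\<^bsub>Q\<^esub> induced_map V W U u C'"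
      if C': "C' \<in> carrier Q" for C'
    proof -
      obtain y where y: "y \<in> W" "C' = cls y" using C' unfolding Q_carrier by blast
      have yV: "y \<in> carrier V" and uy: "u y \<in> carrier V" using Ws(7) y u(2) by auto
      show ?thesis
        unfolding w(2) y(2) Q_add[OF wV yV] im[OF w(1)] im[OF y(1)] im[OF Ws(3)[OF w(1) y(1)]] Q_add[OF uw(2) uy]
        using EndD(2)[OF u(1) wV yV] by simp
    qed
    show "induced_map V W U u (C \<bullet>\<^bsub>Q\<^esub> a) = induced_map V W U u C \<bullet>\<^bsub>Q\<^esub> a" if a: "a \<in> carrier D" for a
      unfolding w(2) Q_smult[OF wV a] im[OF w(1)] im[OF Ws(4)[OF w(1) a]] Q_smult[OF uw(2) a]
      using EndD(3)[OF u(1) wV a] by simp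
  qed
  then show ?thesis
    unfolding line_operators_def using im[OF eW] cls_image_mem[OF B, of "u e"] EndD(1)[OF u(1) eV] by simp
qed

end

lemma (in abelian_group) minus_eq_zero_iff:
  assumes "a \<in> carrier G" "b \<in> carrier G"
  shows "a \<ominus> b = \<zero> \<longleftrightarrow> a = b"
proof
  assume "a \<ominus> b = \<zero>"
  then have "\<ominus> (\<ominus> b) = a" using minus_equality[of a "\<ominus> b"] assms by (simp add: minus_eq)
  then show "a = b" using assms by simp
qed (use assms in \<open>simp add: minus_eq r_neg\<close>)

section \<open>Invertibility and optimality\<close>

context algebra_space
begin

text \<open>An injective D-linear map of a finite-dimensional space is onto by comparison of
  dimensions, and its inverse function is again linear.\<close>

lemma End_Units_iff:
  assumes n: "V.vdim (carrier V) n" and g: "g \<in> carrier E"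
  shows "g \<in> Units E \<longleftrightarrow> (\<forall>y\<in>carrier V. g y = \<zero>\<^bsub>V\<^esub> \<longrightarrow> y = \<zero>\<^bsub>V\<^esub>)"
proof
  assume "g \<in> Units E"
  then obtain h where h: "h \<in> carrier E" "h \<otimes>\<^bsub>E\<^esub> g = \<one>\<^bsub>E\<^esub>" unfolding Units_def by blast
  show "\<forall>y\<in>carrier V. g y = \<zero>\<^bsub>V\<^esub> \<longrightarrow> y = \<zero>\<^bsub>V\<^esub>"
  proof (intro ballI impI)
    fix y assume y: "y \<in> carrier V" "g y = \<zero>\<^bsub>V\<^esub>"
    have "y = (h \<otimes>\<^bsub>E\<^esub> g) y" using y(1) h(2) by simp
    then show "y = \<zero>\<^bsub>V\<^esub>" using y EndD(4)[OF h(1)] by simp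
  qed
next
  assume ker: "\<forall>y\<in>carrier V. g y = \<zero>\<^bsub>V\<^esub> \<longrightarrow> y = \<zero>\<^bsub>V\<^esub>"
  interpret VV: two_spaces D V V by unfold_locales
  have lin: "linear_map D V V g" using g End_carrier by simp
  have "V.vdim (g ` carrier V) n" using VV.vdim_inj_image[OF lin n] ker by blast
  then have surj: "g ` carrier V = carrier V" using V.vdim_eq[OF n] EndD(1)[OF g] by blast
  have inj: "y = z" if yz: "y \<in> carrier V" "z \<in> carrier V" "g y = g z" for y z
  proof -
    have "g (y \<ominus>\<^bsub>V\<^esub> z) = \<zero>\<^bsub>V\<^esub>" using EndD(6)[OF g yz(1,2)] yz EndD(1)[OF g] by (simp add: V.r_neg V.minus_eq)
    then have "y \<ominus>\<^bsub>V\<^esub> z = \<zero>\<^bsub>V\<^esub>" using ker yz by simp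
    then show ?thesis using yz(1,2) by (simp add: V.minus_eq_zero_iff)
  qed
  define h where "h = (\<lambda>y\<in>carrier V. inv_into (carrier V) g y)"
  have h: "h y \<in> carrier V" "g (h y) = y" if y: "y \<in> carrier V" for y
    unfolding h_def using inv_into_into[of y g "carrier V"] f_inv_into_f[of y g "carrier V"] surj y by auto
  have hE: "h \<in> carrier E"
  proof (rule EndI)
    show "h \<in> extensional (carrier V)" unfolding h_def by simp
    fix y assume y: "y \<in> carrier V"
    show "h y \<in> carrier V" using h y by simp
    show "h (y \<oplus>\<^bsub>V\<^esub> z) = h y \<oplus>\<^bsub>V\<^esub> h z" if z: "z \<in> carrier V" for z
      by (rule inj) (use h y z EndD(2)[OF g] in auto)
    show "h (y \<bullet>\<^bsub>V\<^esub> a) = h y \<bullet>\<^bsub>V\<^esub> a" if a: "a \<in> carrier D" for a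
      by (rule inj) (use h y a EndD(3)[OF g] V.rsmult_closed in auto)
  qed
  have "h \<otimes>\<^bsub>E\<^esub> g = \<one>\<^bsub>E\<^esub>"
    by (rule End_eqI[OF End_mult_closed[OF hE g] End_one_closed]) (use h inj EndD(1)[OF g] in simp)
  moreover have "g \<otimes>\<^bsub>E\<^esub> h = \<one>\<^bsub>E\<^esub>"
    by (rule End_eqI[OF End_mult_closed[OF g hE] End_one_closed]) (use h in simp)
  ultimately show "g \<in> Units E" unfolding Units_def using g hE by blast
qed

lemma trivial_spectrum_iff:
  assumes n: "V.vdim (carrier V) n"
  shows "trivial_spectrum D F V S \<longleftrightarrow> right_subspace FD ES S \<and> fixed_point_free S"
proof -
  interpret R: ring E by (rule End_ring)
  have "\<one>\<^bsub>E\<^esub> \<ominus>\<^bsub>E\<^esub> u \<in> Units E \<longleftrightarrow> (\<forall>y\<in>carrier V. u y = y \<longrightarrow> y = \<zero>\<^bsub>V\<^esub>)" if u: "u \<in> carrier E" for u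
  proof -
    have "(\<one>\<^bsub>E\<^esub> \<ominus>\<^bsub>E\<^esub> u) y = \<zero>\<^bsub>V\<^esub> \<longleftrightarrow> u y = y" if y: "y \<in> carrier V" for y
      using End_minus_apply(1)[OF End_one_closed u y] EndD(1)[OF u y] y by (auto simp: V.minus_eq_zero_iff)
    then show ?thesis using End_Units_iff[OF n R.minus_closed[OF End_one_closed u]] by simp
  qed
  then show ?thesis
    unfolding trivial_spectrum_def End_subspace_iff fixed_point_free_def using EF.right_subspaceD(7)[of S] by auto
qed

end

text \<open>Supplies a triangular space, which attains the bound \<open>max_dim\<close>; optimality
  can therefore be read off from the dimension.\<close>

lemma (in division_algebra) ex_flag_data:
  assumes "algebra_space D F V" "right_vector_space.vdim D V (carrier V) n" "RF.vdim (carrier D) d"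
  shows "\<exists>W e B. algebra_space.flag_data D F V n W e B"
  using assms
proof (induction n arbitrary: V)
  case (0 V)
  interpret algebra_space D F V by fact
  have "flag_data 0 (\<lambda>_. {\<zero>\<^bsub>V\<^esub>}) e B" for e B using V.vdim_0[OF 0(2)] unfolding flag_data_def by simp
  then show ?case by blast
next
  case (Suc n V)
  interpret algebra_space D F V by fact
  obtain W x where Wx: "V.vdim W n" "x \<in> carrier V" "x \<notin> W" "carrier V = V.adjoin W x"
    using Suc.prems(2) by (rule V.vdim_Suc_ex_adjoin)
  have W: "right_subspace D V W" using V.vdim_subspace[OF Wx(1)] .
  interpret C: algebra_complement D F V W x by unfold_locales (use W Wx in auto)
  have "C.R.V.vdim (carrier (V\<lparr>carrier := W\<rparr>)) n" using V.restrict_vdim_iff[OF W] Wx(1) by simp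
  then obtain Z e B where Z: "C.R.flag_data n Z e B" using Suc.IH[OF C.R.algebra_space_axioms _ Suc.prems(3)] by blast
  obtain Y where Y: "right_subspace FD V Y" "W \<subseteq> Y" "x \<notin> Y" "VF.adjoin Y x = carrier V"
    using VF.ex_hyperplane_avoiding[OF vdim_F_of_vdim_D[OF Suc.prems(2,3)] D_subspace_imp_F[OF W] Wx(2,3)] .
  show ?case using C.flag_data_extn[OF Z Y] by blast
qed

lemma (in algebra_space) optimal_trivial_spectrum_iff:
  assumes n: "V.vdim (carrier V) n" and d: "RF.vdim (carrier D) d" and card: "infinite F \<or> n * d \<le> card F"
  shows "optimal_trivial_spectrum D F V S \<longleftrightarrow> EF.vdim S (max_dim d n) \<and> fixed_point_free S"
proof -
  note ts = trivial_spectrum_iff[OF n]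
  have le: "m \<le> max_dim d n" if m: "fixed_point_free T" "EF.vdim T m" for T m
    using fixed_point_free_dim_le[OF algebra_space_axioms n d m(2,1) card] .
  obtain W e B where T: "flag_data n W e B" using ex_flag_data[OF algebra_space_axioms n d] by blast
  note T' = triangular_subspace[OF T] triangular_fixed_point_free[OF T] vdim_triangular[OF algebra_space_axioms T d]
  show ?thesis
  proof
    assume "optimal_trivial_spectrum D F V S"
    then obtain k where k: "fixed_point_free S" "EF.vdim S k"
        "\<And>T m. right_subspace FD ES T \<Longrightarrow> fixed_point_free T \<Longrightarrow> EF.vdim T m \<Longrightarrow> m \<le> k"
      unfolding optimal_trivial_spectrum_def ts End_dimension_iff_vdim by blast
    have "max_dim d n \<le> k" using k(3)[OF T'] .
    then have "k = max_dim d n" using le[OF k(1,2)] by simp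
    then show "EF.vdim S (max_dim d n) \<and> fixed_point_free S" using k by simp
  next
    assume "EF.vdim S (max_dim d n) \<and> fixed_point_free S"
    then show "optimal_trivial_spectrum D F V S"
      unfolding optimal_trivial_spectrum_def ts End_dimension_iff_vdim using le EF.vdim_subspace by blast
  qed
qed

section \<open>Joints as triangular spaces, and their invariant subspaces\<close>

context algebra_space
begin

lemma flag_data_subquotient_line:
  assumes T: "flag_data n W e B" and i: "i < n"
  shows "subquotient_line D F V (W (Suc i)) (W i) (e i)"
  by unfold_locales (use flag_data_subspace[OF T, of i] flag_dataD(3-5)[OF T i] i in auto)

lemma joint_triangular:
  assumes T: "flag_data n W e B"
    and H: "\<And>i. i < n \<Longrightarrow> H (Suc i) = subquotient_line.line_operators D V (W (Suc i)) (W i) (e i) (B i)"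
  shows "joint D V n W H = triangular n W e B"
proof -
  have eq: "induced_map V (W (Suc i)) (W i) u \<in> H (Suc i) \<longleftrightarrow> u (e i) \<in> B i"
    if u: "u \<in> carrier E" "\<And>i. i \<le> n \<Longrightarrow> u ` W i \<subseteq> W i" and i: "i < n" for u i
  proof -
    interpret L: subquotient_line D F V "W (Suc i)" "W i" "e i" by (rule flag_data_subquotient_line[OF T i])
    show ?thesis unfolding H[OF i]
      by (rule L.induced_map_line_operators[OF u(1)]) (use u(2) i flag_dataD(6,7)[OF T i] in auto)
  qed
  have "{1..n} = Suc ` {..<n}" using image_Suc_lessThan by simp
  then show ?thesis unfolding joint_def triangular_def using eq by auto
qed

text \<open>For y outside \<open>W j\<close> and v in \<open>W j\<close>, some triangular operator
  of rank at most one vanishes on \<open>W j\<close> and sends y to v. An invariant subspace that is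
  not inside \<open>W j\<close> therefore contains \<open>W j\<close>.\<close>

lemma invariant_subspaces_triangular:
  assumes T: "flag_data n W e B" and n: "V.vdim (carrier V) n"
  shows "{U. invariant_subspace D V (triangular n W e B) U} = W ` {0..n}"
proof (intro equalityI subsetI)
  fix U assume "U \<in> W ` {0..n}"
  then obtain i where i: "i \<le> n" "U = W i" by auto
  then show "U \<in> {U. invariant_subspace D V (triangular n W e B) U}"
    unfolding invariant_subspace_def triangular_def using flag_data_subspace[OF T i(1)] by auto
next
  fix U assume "U \<in> {U. invariant_subspace D V (triangular n W e B) U}"
  then have U: "right_subspace D V U" and inv: "\<And>f. f \<in> triangular n W e B \<Longrightarrow> f ` U \<subseteq> U"
    unfolding invariant_subspace_def by auto
  define i where "i = (LEAST i. U \<subseteq> W i)"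
  have top: "U \<subseteq> W n" using V.right_subspaceD(1)[OF U] flag_dataD(2)[OF T] by simp
  have i: "U \<subseteq> W i" "i \<le> n" unfolding i_def using LeastI[of "\<lambda>i. U \<subseteq> W i", OF top] Least_le[of "\<lambda>i. U \<subseteq> W i", OF top] by auto
  have "U = W i"
  proof (cases i)
    case 0
    then show ?thesis using i(1) V.right_subspaceD(2)[OF U] flag_dataD(1)[OF T] by auto
  next
    case (Suc j)
    have jn: "j < n" using Suc i(2) by simp
    have "\<not> U \<subseteq> W j" using Suc not_less_Least[of j "\<lambda>i. U \<subseteq> W i"] unfolding i_def by simp
    then obtain y where y: "y \<in> U" "y \<notin> W j" by blast
    have yV: "y \<in> carrier V" using V.right_subspaceD(7)[OF U y(1)] .
    have Wj: "right_subspace D V (W j)" using flag_data_subspace[OF T] jn by simp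
    have "W j \<subseteq> U"
    proof
      fix v assume v: "v \<in> W j"
      obtain P where P: "right_subspace D V P" "W j \<subseteq> P" "y \<notin> P" "V.adjoin P y = carrier V"
        using V.ex_hyperplane_avoiding[OF n Wj yV y(2)] .
      interpret C: algebra_complement D F V P y by unfold_locales (use P yV in auto)
      obtain h where h: "h \<in> carrier E" "\<And>z. z \<in> carrier V \<Longrightarrow> h z = v \<bullet>\<^bsub>V\<^esub> C.coord z" "h y = v"
          "\<And>w. w \<in> P \<Longrightarrow> h w = \<zero>\<^bsub>V\<^esub>"
        using C.ex_End_eval[OF V.right_subspaceD(7)[OF Wj v]] by blast
      have hj: "h z \<in> W j" if z: "z \<in> carrier V" for z
        unfolding h(2)[OF z] using V.right_subspaceD(4)[OF Wj v C.decomp(2)[OF z]] .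
      \<comment> \<open>Since \<open>h\<close> vanishes on \<open>W j\<close> and has its values
        there, it maps \<open>W l\<close> into \<open>W k\<close> whenever l \<le> k + 1. The
        condition on the flag and the one on \<open>B k\<close>, which contains \<open>W k\<close>,
        are both instances.\<close>
      have low: "h z \<in> Z" if Z: "right_subspace FD V Z" "W k \<subseteq> Z" "z \<in> W l" "k \<le> n" "l \<le> Suc k" "l \<le> n" for z k l Z
      proof (cases "k < j")
        case True
        then have "z \<in> W j" using flag_data_mono[OF T, of j l] Z jn by auto
        then have "h z = \<zero>\<^bsub>V\<^esub>" using h(4) P(2) by blast
        then show ?thesis using VF.right_subspaceD(2)[OF Z(1)] by simp
      next
        case False
        have "z \<in> carrier V" using V.right_subspaceD(7)[OF flag_data_subspace[OF T Z(6)] Z(3)] .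
        then show ?thesis using hj flag_data_mono[OF T, of k j] Z False by auto
      qed
      have "h \<in> triangular n W e B"
      proof -
        have "h ` W k \<subseteq> W k" if "k \<le> n" for k
          using low[OF D_subspace_imp_F[OF flag_data_subspace[OF T that]], of k _ k] that by auto
        moreover have "h (e k) \<in> B k" if "k < n" for k
          using low[OF flag_dataD(6,7)[OF T that], of "e k" "Suc k"] flag_data_Suc_subset[OF T that] that by auto
        ultimately show ?thesis unfolding triangular_def using h(1) by blast
      qed
      then show "v \<in> U" using inv[of h] y(1) h(3) by blast
    qed
    moreover have "W i = V.adjoin (W j) y"
      using V.adjoin_exchange[OF Wj flag_dataD(3)[OF T jn], of y] y i(1) flag_dataD(5)[OF T jn] Suc by auto
    ultimately show ?thesis using V.adjoin_least[OF U _ y(1)] i(1) by auto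
  qed
  then show "U \<in> W ` {0..n}" using i(2) by auto
qed

text \<open>Dimensions grow by at least one in each of the n strict inclusions and end at n, so they
  grow by exactly one.\<close>

lemma flag_vdim:
  assumes W: "flag D V n W" and n: "V.vdim (carrier V) n" and i: "i \<le> n"
  shows "V.vdim (W i) i"
proof -
  have "\<exists>k. V.vdim (W i) k" if "i \<le> n" for i
  proof -
    have Wi: "right_subspace D V (W i)" using W that unfolding flag_def by blast
    show ?thesis using V.vdim_sub_ex[OF n Wi V.right_subspaceD(1)[OF Wi]] by blast
  qed
  then obtain f where f: "\<And>i. i \<le> n \<Longrightarrow> V.vdim (W i) (f i)" by metis
  have less: "f i < f (Suc i)" if i: "i < n" for i
  proof -
    have sub: "W i \<subset> W (Suc i)" using W i unfolding flag_def by blast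
    have 1: "V.vdim (W (Suc i)) (f (Suc i))" "V.vdim (W i) (f i)" using f i by auto
    then have "f i \<le> f (Suc i)" "f i = f (Suc i) \<longrightarrow> W i = W (Suc i)"
      using V.vdim_mono_eq[OF 1] sub by auto
    then show ?thesis using sub by auto
  qed
  have lower: "i \<le> n \<Longrightarrow> i \<le> f i" for i
  proof (induction i)
    case (Suc i)
    then show ?case using less[of i] by simp
  qed simp
  have "f i + (n - i) \<le> f n"
    using i
  proof (induction rule: inc_induct)
    case (step k)
    then show ?case using less[of k] by simp
  qed simp
  moreover have "f n = n"
  proof (rule V.vdim_unique[OF _ n])
    have "W n = carrier V" using W unfolding flag_def by blast
    then show "V.vdim (carrier V) (f n)" using f[of n] by simp
  qed
  ultimately have "f i = i" using lower[OF i] i by simp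
  then show ?thesis using f[OF i] by simp
qed

lemma complete_flag_adjoin:
  assumes W: "complete_flag D V n W" and i: "i < n"
  shows "\<exists>e\<in>carrier V. e \<notin> W i \<and> W (Suc i) = V.adjoin (W i) e"
proof -
  have n: "V.vdim (carrier V) n" and fl: "flag D V n W"
    using W V.right_dim_imp_vdim unfolding complete_flag_def by auto
  have v: "V.vdim (W i) i" "V.vdim (W (Suc i)) (Suc i)" using flag_vdim[OF fl n] i by auto
  obtain e where e: "e \<in> W (Suc i)" "e \<notin> W i" and sub: "W i \<subseteq> W (Suc i)" using fl i unfolding flag_def by blast
  have S: "right_subspace D V (W (Suc i))" using V.vdim_subspace[OF v(2)] .
  have eV: "e \<in> carrier V" using V.right_subspaceD(7)[OF S e(1)] .
  have "V.adjoin (W i) e = W (Suc i)"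
    using V.vdim_eq[OF v(2) V.vdim_adjoin[OF v(1) eV e(2)] V.adjoin_least[OF S sub e(1)]] .
  then show ?thesis using eV e(2) by blast
qed

lemma joint_eq_triangular:
  assumes W: "complete_flag D V n W"
    and H: "\<And>i. i \<in> {1..n} \<Longrightarrow> End_hyperplane D F (subquotient V (W i) (W (i - 1))) (H i) \<and>
      \<one>\<^bsub>End_ring D (subquotient V (W i) (W (i - 1)))\<^esub> \<notin> H i"
  shows "\<exists>e B. flag_data n W e B \<and> joint D V n W H = triangular n W e B"
proof -
  obtain e where e: "\<And>i. i < n \<Longrightarrow> e i \<in> carrier V \<and> e i \<notin> W i \<and> W (Suc i) = V.adjoin (W i) (e i)"
    using complete_flag_adjoin[OF W] by metis
  have fl: "flag D V n W" using W unfolding complete_flag_def by simp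
  have "\<exists>B. right_subspace FD V B \<and> W i \<subseteq> B \<and> e i \<notin> B \<and> VF.adjoin B (e i) = W (Suc i) \<and>
      H (Suc i) = subquotient_line.line_operators D V (W (Suc i)) (W i) (e i) B" if i: "i < n" for i
  proof -
    interpret L: subquotient_line D F V "W (Suc i)" "W i" "e i"
      by unfold_locales (use e[OF i] fl i in \<open>auto simp: flag_def\<close>)
    show ?thesis using L.hyperplane_line_operators[of "H (Suc i)"] H[of "Suc i"] i by simp
  qed
  then obtain B where B: "\<And>i. i < n \<Longrightarrow> right_subspace FD V (B i) \<and> W i \<subseteq> B i \<and> e i \<notin> B i \<and>
      VF.adjoin (B i) (e i) = W (Suc i) \<and>
      H (Suc i) = subquotient_line.line_operators D V (W (Suc i)) (W i) (e i) (B i)" by metis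
  have T: "flag_data n W e B" unfolding flag_data_def using fl e B unfolding flag_def by simp
  then show ?thesis using joint_triangular[OF T] B by blast
qed

lemma triangular_eq_joint:
  assumes T: "flag_data n W e B" and d: "RF.vdim (carrier D) d"
  shows "\<exists>H. (\<forall>i \<in> {1..n}. End_hyperplane D F (subquotient V (W i) (W (i - 1))) (H i) \<and>
        \<one>\<^bsub>End_ring D (subquotient V (W i) (W (i - 1)))\<^esub> \<notin> H i) \<and>
      triangular n W e B = joint D V n W H"
proof -
  define H where "H i = subquotient_line.line_operators D V (W i) (W (i - 1)) (e (i - 1)) (B (i - 1))" for i
  have "End_hyperplane D F (subquotient V (W (Suc i)) (W i)) (H (Suc i)) \<and>
      \<one>\<^bsub>End_ring D (subquotient V (W (Suc i)) (W i))\<^esub> \<notin> H (Suc i)" if i: "i < n" for i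
  proof -
    interpret L: subquotient_line D F V "W (Suc i)" "W i" "e i" by (rule flag_data_subquotient_line[OF T i])
    show ?thesis using L.line_operators_hyperplane[OF flag_dataD(6-9)[OF T i] d] by (simp add: H_def)
  qed
  then have "\<forall>i \<in> {1..n}. End_hyperplane D F (subquotient V (W i) (W (i - 1))) (H i) \<and>
        \<one>\<^bsub>End_ring D (subquotient V (W i) (W (i - 1)))\<^esub> \<notin> H i"
    unfolding image_Suc_lessThan[symmetric] by simp
  moreover have "triangular n W e B = joint D V n W H" using joint_triangular[OF T, of H] by (simp add: H_def)
  ultimately show ?thesis by blast
qed

end

text \<open>The elements 1, z, z^2 are independent over \<open>F\<close>.\<close>

lemma (in division_algebra) vdim_ge_3_of_not_quadratic:
  assumes d: "RF.vdim (carrier D) d" and z: "z \<in> carrier D" "\<not> quadratic z"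
  shows "3 \<le> d"
proof -
  have zF: "z \<notin> F" using quadratic_F z(2) by blast
  have zz: "z \<otimes> z \<notin> quad_field z"
  proof
    assume "z \<otimes> z \<in> quad_field z"
    then obtain a b where "a \<in> F" "b \<in> F" "z \<otimes> z = a \<oplus> z \<otimes> b" by (rule quad_fieldE)
    then show False using z unfolding quadratic_def by (metis F_closed a_comm m_closed)
  qed
  have "RF.vdim (RF.adjoin (quad_field z) (z \<otimes> z)) (Suc 2)"
    by (rule RF.vdim_adjoin[OF vdim_quad_field[OF z(1) zF] _ zz]) (use z in simp)
  then have "Suc 2 \<le> d"
    using RF.vdim_mono[OF d] RF.right_subspaceD(1)[OF RF.vdim_subspace] by (metis regular_space_simps(1))
  then show ?thesis by simp
qed

theorem theorem1p16:
  fixes D :: "('a, 'm) ring_scheme" and F :: "'a set"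
    and V :: "('a, 'b, 'k) rmodule_scheme" and n d :: nat
  assumes "skew_field D"
    and "central_subfield F D"
    and "ring.dimension D d F (carrier D)"
    and "\<not> quadratic_type D F"
    and "right_vector_space D V"
    and "right_dim D V n"
    and "n \<ge> 1"
    and "infinite F \<or> card F \<ge> n * d"
  shows "(\<forall>S. optimal_trivial_spectrum D F V S \<longrightarrow>
            (\<exists>W. complete_flag D V n W \<and>
                 {U. invariant_subspace D V S U} = W ` {0..n} \<and>
                 (\<exists>H. (\<forall>i \<in> {1..n}.
                         End_hyperplane D F (subquotient V (W i) (W (i - 1))) (H i) \<and>
                         \<one>\<^bsub>End_ring D (subquotient V (W i) (W (i - 1)))\<^esub> \<notin> H i) \<and>
                      S = joint D V n W H)))
       \<and> (\<forall>W H. complete_flag D V n W \<and>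
            (\<forall>i \<in> {1..n}.
               End_hyperplane D F (subquotient V (W i) (W (i - 1))) (H i) \<and>
               \<one>\<^bsub>End_ring D (subquotient V (W i) (W (i - 1)))\<^esub> \<notin> H i)
            \<longrightarrow> optimal_trivial_spectrum D F V (joint D V n W H))"
proof -
  interpret division_algebra D F
    by (intro division_algebra.intro division_algebra_axioms.intro assms(1,2))
  interpret algebra_space D F V
    by (intro algebra_space.intro division_algebra_axioms assms(5))
  have d: "RF.vdim (carrier D) d" using assms(3) dimension_iff_vdim by simp
  have n: "V.vdim (carrier V) n" using V.right_dim_imp_vdim[OF assms(6)] .
  have card: "infinite F \<or> n * d \<le> card F" using assms(8) by simp
  note opt = optimal_trivial_spectrum_iff[OF n d card]
  obtain z where z: "z \<in> carrier D" "\<not> quadratic z" using quadratic_type_of_quadratic[OF assms(3)] assms(4) by blast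
  have "3 \<le> d" using vdim_ge_3_of_not_quadratic[OF d z] .
  \<comment> \<open>With the hypothesis on the size of \<open>F\<close> this provides a scalar other
    than 0 and 1, as the separation of quadratic polynomials requires.\<close>
  then have "3 \<le> n * d" using assms(7) by (metis mult_le_mono nat_mult_1)
  have s: "\<exists>s\<in>F. s \<noteq> \<zero>\<^bsub>D\<^esub> \<and> s \<noteq> \<one>\<^bsub>D\<^esub>"
  proof (rule ccontr)
    assume "\<not> ?thesis"
    then have sub: "F \<subseteq> {\<zero>\<^bsub>D\<^esub>, \<one>\<^bsub>D\<^esub>}" by blast
    have "card F \<le> 2" using card_mono[OF _ sub] by (auto simp: card_insert_if split: if_splits)
    then show False using card finite_subset[OF sub] \<open>3 \<le> n * d\<close> by simp
  qed
  show ?thesis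
  proof (intro conjI allI impI)
    fix S assume "optimal_trivial_spectrum D F V S"
    then have "EF.vdim S (max_dim d n)" "fixed_point_free S" unfolding opt by auto
    then obtain W e B where T: "flag_data n W e B" and S: "S = triangular n W e B"
      using fixed_point_free_structure[OF algebra_space_axioms n d _ _ card s] z by blast
    have "W i \<noteq> W (Suc i)" if "i < n" for i
      using flag_dataD(4)[OF T that] flag_data_Suc_subset[OF T that] by blast
    then have W: "complete_flag D V n W"
      unfolding complete_flag_def flag_def
      using flag_dataD(1,2)[OF T] flag_data_subspace[OF T] flag_data_Suc_subset[OF T] assms(6) by blast
    show "\<exists>W. complete_flag D V n W \<and>
                 {U. invariant_subspace D V S U} = W ` {0..n} \<and>
                 (\<exists>H. (\<forall>i \<in> {1..n}.
                         End_hyperplane D F (subquotient V (W i) (W (i - 1))) (H i) \<and>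
                         \<one>\<^bsub>End_ring D (subquotient V (W i) (W (i - 1)))\<^esub> \<notin> H i) \<and>
                      S = joint D V n W H)"
      using W invariant_subspaces_triangular[OF T n] triangular_eq_joint[OF T d] unfolding S by blast
  next
    fix W H
    assume WH: "complete_flag D V n W \<and> (\<forall>i \<in> {1..n}.
               End_hyperplane D F (subquotient V (W i) (W (i - 1))) (H i) \<and>
               \<one>\<^bsub>End_ring D (subquotient V (W i) (W (i - 1)))\<^esub> \<notin> H i)"
    obtain e B where T: "flag_data n W e B" and J: "joint D V n W H = triangular n W e B"
      using joint_eq_triangular[of n W H] WH by blast
    show "optimal_trivial_spectrum D F V (joint D V n W H)"
      unfolding opt J using vdim_triangular[OF algebra_space_axioms T d] triangular_fixed_point_free[OF T] by blast
  qed
qed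

end
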